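(* Let $p\in[d_0,\infty)$, let $D$ be a bounded domain in $\mathbb{R}^d$, and let $u\in W^2_{p,\mathrm{loc}}(D)\cap C(\bar D)$. Let $c$ be a nonnegative measurable function on $D$ and let $L\in\mathcal{L}(\delta,\|\mathfrak{b}\|)$. Then in $D$ $$u\le N\|(Lu-cu)_-\|_{L_p(D)}+\sup_{\partial D}u_+,$$ where $N$ depends only on $p,d,\delta,\|\mathfrak{b}\|$, and the diameter of $D$.
   Context: Let $d\ge2$, $\delta\in(0,1)$, and let $\mathfrak{b}\ge0$ be a Borel function on $\mathbb{R}^d$ with $\|\mathfrak{b}\|:=\|\mathfrak{b}\|_{L_d(\mathbb{R}^d)}<\infty$. $\mathbb{S}_\delta$ is the set of symmetric $d\times d$ matrices with all eigenvalues between $\delta$ and $\delta^{-1}$. $\mathcal{L}(\delta,\|\mathfrak{b}\|)$ is the set of operators $L=\tfrac12a^{ij}D_{ij}+b^iD_i$ (summation convention, $D_i=\partial/\partial x^i$, $D_{ij}=D_iD_j$), where $(a^{ij})$ is an $\mathbb{S}_\delta$-valued Borel function on $\mathbb{R}^d$ and $b=(b^i)$ is an $\mathbb{R}^d$-valued Borel function on $\mathbb{R}^d$ with $\|b\|_{L_d(\mathbb{R}^d)}\le\|\mathfrak{b}\|$. $a_\pm=\tfrac12(|a|\pm a)$. The constant $d_0$: consider all processes $x_t=\int_0^t\sigma_s\,dw_s+\int_0^tb_s\,ds$, where $(w_t,\mathcal{F}_t)$ is a $d_1$-dimensional Wiener process ($d_1>1$ an integer) on a complete probability space with complete $\sigma$-fields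 $\mathcal{F}_t$, $\sigma_t$ ($d\times d_1$-matrix-valued) and $b_t$ ($\mathbb{R}^d$-valued) are progressively measurable, $\int_0^T(|\sigma_t|^2+|b_t|)\,dt<\infty$ for all $T<\infty$ and $\omega$, and $|b_t|\le\mathfrak{b}(x_t)$, $\sigma_t\sigma_t^*\in\mathbb{S}_\delta$ for all $(\omega,t)$. Each has a Green's function $G_1\ge0$: $E\int_0^\infty e^{-t}f(x_t)\,dt=\int_{\mathbb{R}^d}fG_1\,dx$ for all nonnegative Borel $f$. $d_0\in(d/2,d)$, $d_0>d-1$, is a fixed constant depending only on $d,\delta,\|\mathfrak{b}\|$ such that, with some $N=N(d,\delta,\|\mathfrak{b}\|)$, for every such process, every ball $B$ of radius $R\le1/2$ and every $p\ge d_0$, $\|G_1\|_{L_{p/(p-1)}(B)}\le NR^{-d/p}\|G_1\|_{L_1(2B)}$, $2B$ being the concentric ball of twice the radius (such a constant exists). *)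

theory Defs
  imports "HOL-Probability.Probability"
begin

section \<open>\<open>L\<^sub>p\<close> norms\<close>

text \<open>
  The norm takes values in \<open>[0, \<infinity>]\<close>.  Integration is against \<^const>\<open>lebesgue\<close> rather than
  \<^const>\<open>lborel\<close> because weak derivatives and the coefficient \<open>c\<close> are only Lebesgue measurable.
\<close>

definition Lp_norm :: "real \<Rightarrow> (real^'d) set \<Rightarrow> (real^'d \<Rightarrow> 'b::real_normed_vector) \<Rightarrow> ennreal" where
  "Lp_norm p S f =
     (let I = \<integral>\<^sup>+x\<in>S. ennreal (norm (f x) powr p) \<partial>lebesgue
      in if I = \<infinity> then \<infinity> else ennreal (enn2real I powr (1 / p)))"

definition Lp_loc :: "real \<Rightarrow> (real^'d) set \<Rightarrow> (real^'d \<Rightarrow> real) set" where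
  "Lp_loc p D = {f. f \<in> borel_measurable (lebesgue_on D) \<and>
     (\<forall>C. compact C \<and> C \<subseteq> D \<longrightarrow> Lp_norm p C f < \<infinity>)}"

definition pos_part :: "real \<Rightarrow> real" where
  "pos_part r = (\<bar>r\<bar> + r) / 2"

definition neg_part :: "real \<Rightarrow> real" where
  "neg_part r = (\<bar>r\<bar> - r) / 2"

section \<open>Weak derivatives and \<open>W\<^sup>2\<^bsub>p,loc\<^esub>(D)\<close>\<close>

definition partial :: "'d \<Rightarrow> (real^'d \<Rightarrow> real) \<Rightarrow> real^'d \<Rightarrow> real" where
  "partial i f x = frechet_derivative f (at x) (axis i 1)"

primrec C_k :: "nat \<Rightarrow> (real^'d \<Rightarrow> real) \<Rightarrow> bool" where
  "C_k 0 f \<longleftrightarrow> continuous_on UNIV f"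
| "C_k (Suc k) f \<longleftrightarrow> (\<forall>x. f differentiable (at x)) \<and> (\<forall>i. C_k k (partial i f))"

definition test_functions :: "(real^'d) set \<Rightarrow> (real^'d \<Rightarrow> real) set" where
  "test_functions D = {\<phi>. (\<forall>k. C_k k \<phi>) \<and>
     compact (closure {x. \<phi> x \<noteq> 0}) \<and> closure {x. \<phi> x \<noteq> 0} \<subseteq> D}"

definition is_weak_partial ::
    "(real^'d) set \<Rightarrow> 'd \<Rightarrow> (real^'d \<Rightarrow> real) \<Rightarrow> (real^'d \<Rightarrow> real) \<Rightarrow> bool" where
  "is_weak_partial D i u v \<longleftrightarrow> u \<in> Lp_loc 1 D \<and> v \<in> Lp_loc 1 D \<and>
     (\<forall>\<phi>\<in>test_functions D.
        (LINT x:D|lebesgue. u x * partial i \<phi> x) = - (LINT x:D|lebesgue. v x * \<phi> x))"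

text \<open>
  A representative of the weak derivative; it is unique up to a null subset of \<open>D\<close>, and
  meaningful only if a weak derivative exists.
\<close>

definition weak_D :: "(real^'d) set \<Rightarrow> 'd \<Rightarrow> (real^'d \<Rightarrow> real) \<Rightarrow> real^'d \<Rightarrow> real" where
  "weak_D D i u = (SOME v. is_weak_partial D i u v)"

definition W2_loc :: "real \<Rightarrow> (real^'d) set \<Rightarrow> (real^'d \<Rightarrow> real) set" where
  "W2_loc p D = {u. u \<in> Lp_loc p D \<and>
     (\<forall>i. (\<exists>v. is_weak_partial D i u v) \<and> weak_D D i u \<in> Lp_loc p D) \<and>
     (\<forall>i j. (\<exists>v. is_weak_partial D i (weak_D D j u) v) \<and>
             weak_D D i (weak_D D j u) \<in> Lp_loc p D)}"

section \<open>The operators\<close>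

definition S_mat :: "real \<Rightarrow> (real^'d^'d) set" where
  "S_mat \<delta> = {A. transpose A = A \<and>
     (\<forall>l v. v \<noteq> 0 \<and> A *v v = l *\<^sub>R v \<longrightarrow> \<delta> \<le> l \<and> l \<le> 1 / \<delta>)}"

text \<open>
  An operator is given by its coefficients \<open>(a, b)\<close>.  The class depends on the function
  \<open>\<bb>\<close> only through \<open>K = \<parallel>\<bb>\<parallel>\<close>, the norm in \<open>L\<^sub>d\<close>.
\<close>

definition op_class ::
    "real \<Rightarrow> real \<Rightarrow> ((real^'d \<Rightarrow> real^'d^'d) \<times> (real^'d \<Rightarrow> real^'d)) set" where
  "op_class \<delta> K = {(a, b). a \<in> borel_measurable borel \<and> (\<forall>x. a x \<in> S_mat \<delta>) \<and>
     b \<in> borel_measurable borel \<and> Lp_norm (real CARD('d)) UNIV b \<le> ennreal K}"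

definition apply_op ::
    "(real^'d) set \<Rightarrow> (real^'d \<Rightarrow> real^'d^'d) \<times> (real^'d \<Rightarrow> real^'d) \<Rightarrow>
     (real^'d \<Rightarrow> real) \<Rightarrow> real^'d \<Rightarrow> real" where
  "apply_op D L u x =
     (1/2) * (\<Sum>i\<in>UNIV. \<Sum>j\<in>UNIV. fst L x $ i $ j * weak_D D i (weak_D D j u) x)
     + (\<Sum>i\<in>UNIV. snd L x $ i * weak_D D i u x)"

section \<open>Wiener processes and stochastic integrals\<close>

text \<open>
  Time is indexed by \<^typ>\<open>real\<close>, as \<^locale>\<open>filtration\<close> wants a topological linear order;
  only \<open>t \<ge> 0\<close> is ever used.
\<close>

definition complete_filtered_space :: "'w measure \<Rightarrow> (real \<Rightarrow> 'w measure) \<Rightarrow> bool" where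
  "complete_filtered_space M F \<longleftrightarrow> prob_space M \<and> complete_measure M \<and> filtration (space M) F \<and>
     (\<forall>t\<ge>0. sets (F t) \<subseteq> sets M \<and> null_sets M \<subseteq> sets (F t))"

definition progressive ::
    "(real \<Rightarrow> 'w measure) \<Rightarrow> (real \<Rightarrow> 'w \<Rightarrow> 'b::topological_space) \<Rightarrow> bool" where
  "progressive F X \<longleftrightarrow>
     (\<forall>T\<ge>0. (\<lambda>(t, \<omega>). X t \<omega>) \<in> borel_measurable (restrict_space borel {0..T} \<Otimes>\<^sub>M F T))"

text \<open>The components of the \<open>n\<close>-dimensional Wiener process are \<open>w 0, \<dots>, w (n - 1)\<close>.\<close>

definition wiener_process ::
    "'w measure \<Rightarrow> (real \<Rightarrow> 'w measure) \<Rightarrow> nat \<Rightarrow> (nat \<Rightarrow> real \<Rightarrow> 'w \<Rightarrow> real) \<Rightarrow> bool" where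
  "wiener_process M F n w \<longleftrightarrow>
     (\<forall>k<n. \<forall>\<omega>\<in>space M. w k 0 \<omega> = 0 \<and> continuous_on {0..} (\<lambda>t. w k t \<omega>)) \<and>
     (\<forall>k<n. \<forall>t\<ge>0. w k t \<in> borel_measurable (F t)) \<and>
     (\<forall>s t. 0 \<le> s \<and> s < t \<longrightarrow>
        (\<forall>k<n. distributed M lborel (\<lambda>\<omega>. w k t \<omega> - w k s \<omega>) (normal_density 0 (sqrt (t - s)))) \<and>
        prob_space.indep_vars M (\<lambda>_. borel) (\<lambda>k \<omega>. w k t \<omega> - w k s \<omega>) {..<n} \<and>
        prob_space.indep_set M (sets (F s))
          (sets (vimage_algebra (space M) (\<lambda>\<omega>. \<lambda>k\<in>{..<n}. w k t \<omega> - w k s \<omega>)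
                   (Pi\<^sub>M {..<n} (\<lambda>_. borel)))))"

definition tends_to_0_in_prob :: "'w measure \<Rightarrow> (nat \<Rightarrow> 'w \<Rightarrow> ennreal) \<Rightarrow> bool" where
  "tends_to_0_in_prob M Z \<longleftrightarrow>
     (\<forall>\<epsilon>>0. (\<lambda>n. measure M {\<omega>\<in>space M. ennreal \<epsilon> < Z n \<omega>}) \<longlonglongrightarrow> 0)"

text \<open>The step process \<open>\<Sum>\<^bsub>j<m\<^esub> 1\<^bsub>(\<tau> j, \<tau> (j+1)]\<^esub> \<xi> j\<close> and its integral against a real process.\<close>

definition is_step ::
    "'w measure \<Rightarrow> (real \<Rightarrow> 'w measure) \<Rightarrow> nat \<Rightarrow> (nat \<Rightarrow> real) \<Rightarrow>
     (nat \<Rightarrow> 'w \<Rightarrow> 'b::real_normed_vector) \<Rightarrow> bool" where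
  "is_step M F m \<tau> \<xi> \<longleftrightarrow> 0 \<le> \<tau> 0 \<and> (\<forall>j<m. \<tau> j \<le> \<tau> (Suc j)) \<and>
     (\<forall>j<m. \<xi> j \<in> borel_measurable (F (\<tau> j)) \<and> (\<exists>C. \<forall>\<omega>\<in>space M. norm (\<xi> j \<omega>) \<le> C))"

definition step_process ::
    "nat \<Rightarrow> (nat \<Rightarrow> real) \<Rightarrow> (nat \<Rightarrow> 'w \<Rightarrow> 'b::real_normed_vector) \<Rightarrow> real \<Rightarrow> 'w \<Rightarrow> 'b" where
  "step_process m \<tau> \<xi> t \<omega> = (\<Sum>j<m. indicat_real {\<tau> j<..\<tau> (Suc j)} t *\<^sub>R \<xi> j \<omega>)"

definition step_integral ::
    "(real \<Rightarrow> 'w \<Rightarrow> real) \<Rightarrow> nat \<Rightarrow> (nat \<Rightarrow> real) \<Rightarrow>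
     (nat \<Rightarrow> 'w \<Rightarrow> 'b::real_normed_vector) \<Rightarrow> real \<Rightarrow> 'w \<Rightarrow> 'b" where
  "step_integral v m \<tau> \<xi> t \<omega> =
     (\<Sum>j<m. (v (min (\<tau> (Suc j)) t) \<omega> - v (min (\<tau> j) t) \<omega>) *\<^sub>R \<xi> j \<omega>)"

text \<open>
  \<open>I\<close> is a continuous version of the Ito integral \<open>\<integral>\<^sub>0\<^sup>t H\<^sub>s dv\<^sub>s\<close> of a progressively measurable \<open>H\<close>
  with \<open>\<integral>\<^sub>0\<^sup>T |H\<^sub>s|\<^sup>2 ds < \<infinity>\<close>: the limit in probability of the integrals of step processes that
  approximate \<open>H\<close> in \<open>L\<^sub>2(0, T)\<close> in probability.  This determines \<open>I\<close> up to indistinguishability.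
\<close>

definition is_ito_integral ::
    "'w measure \<Rightarrow> (real \<Rightarrow> 'w measure) \<Rightarrow> (real \<Rightarrow> 'w \<Rightarrow> real) \<Rightarrow>
     (real \<Rightarrow> 'w \<Rightarrow> 'b::real_normed_vector) \<Rightarrow> (real \<Rightarrow> 'w \<Rightarrow> 'b) \<Rightarrow> bool" where
  "is_ito_integral M F v H I \<longleftrightarrow>
     (\<forall>t\<ge>0. I t \<in> borel_measurable (F t)) \<and>
     (\<forall>\<omega>\<in>space M. continuous_on {0..} (\<lambda>t. I t \<omega>)) \<and>
     (\<exists>m \<tau> \<xi>. (\<forall>n. is_step M F (m n) (\<tau> n) (\<xi> n)) \<and>
        (\<forall>T\<ge>0.
          tends_to_0_in_prob M (\<lambda>n \<omega>.
            \<integral>\<^sup>+t\<in>{0..T}. ennreal ((norm (step_process (m n) (\<tau> n) (\<xi> n) t \<omega> - H t \<omega>))\<^sup>2) \<partial>lborel) \<and>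
          tends_to_0_in_prob M (\<lambda>n \<omega>.
            ennreal (norm (step_integral v (m n) (\<tau> n) (\<xi> n) T \<omega> - I T \<omega>)))))"

section \<open>The processes and the constant \<open>d\<^sub>0\<close>\<close>

text \<open>
  \<open>\<sigma> k\<close> is the \<open>k\<close>-th column of the \<open>d \<times> d\<^sub>1\<close> matrix \<open>\<sigma>\<close>, so that \<open>\<integral> \<sigma> dw = \<Sum>\<^bsub>k<d\<^sub>1\<^esub> \<integral> \<sigma> k dw k\<close>.
\<close>

definition drift_diffusion ::
    "real \<Rightarrow> (real^'d \<Rightarrow> real) \<Rightarrow> 'w measure \<Rightarrow> (real \<Rightarrow> 'w measure) \<Rightarrow> nat \<Rightarrow>
     (nat \<Rightarrow> real \<Rightarrow> 'w \<Rightarrow> real) \<Rightarrow> (nat \<Rightarrow> real \<Rightarrow> 'w \<Rightarrow> real^'d) \<Rightarrow>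
     (real \<Rightarrow> 'w \<Rightarrow> real^'d) \<Rightarrow> (real \<Rightarrow> 'w \<Rightarrow> real^'d) \<Rightarrow> bool" where
  "drift_diffusion \<delta> \<bb> M F d1 w \<sigma> b x \<longleftrightarrow>
     complete_filtered_space M F \<and> d1 > 1 \<and> wiener_process M F d1 w \<and>
     (\<forall>k<d1. progressive F (\<sigma> k)) \<and> progressive F b \<and>
     (\<forall>T\<ge>0. \<forall>\<omega>\<in>space M.
        (\<integral>\<^sup>+t\<in>{0..T}. ennreal ((\<Sum>k<d1. (norm (\<sigma> k t \<omega>))\<^sup>2) + norm (b t \<omega>)) \<partial>lborel) < \<infinity>) \<and>
     (\<exists>I. (\<forall>k<d1. is_ito_integral M F (w k) (\<sigma> k) (I k)) \<and>
        (\<forall>t\<ge>0. \<forall>\<omega>\<in>space M. x t \<omega> = (\<Sum>k<d1. I k t \<omega>) + (LINT s:{0..t}|lborel. b s \<omega>))) \<and>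
     (\<forall>t\<ge>0. \<forall>\<omega>\<in>space M. norm (b t \<omega>) \<le> \<bb> (x t \<omega>) \<and>
        (\<chi> i j. \<Sum>k<d1. \<sigma> k t \<omega> $ i * \<sigma> k t \<omega> $ j) \<in> S_mat \<delta>)"

definition is_green_function ::
    "'w measure \<Rightarrow> (real \<Rightarrow> 'w \<Rightarrow> real^'d) \<Rightarrow> (real^'d \<Rightarrow> real) \<Rightarrow> bool" where
  "is_green_function M x G \<longleftrightarrow> G \<in> borel_measurable borel \<and> (\<forall>y. 0 \<le> G y) \<and>
     (\<forall>f::real^'d \<Rightarrow> ennreal. f \<in> borel_measurable borel \<longrightarrow>
        (\<integral>\<^sup>+\<omega>. (\<integral>\<^sup>+t\<in>{0..}. ennreal (exp (- t)) * f (x t \<omega>) \<partial>lborel) \<partial>M) =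
        (\<integral>\<^sup>+y. f y * ennreal (G y) \<partial>lborel))"

text \<open>
  HOL cannot quantify over the type of sample points inside a formula, so one type is fixed on
  which every case is realised: countable families of real paths.  Both the defining property of
  \<open>G\<close> and the estimate below depend only on the law of \<open>x\<close>, and every process of the class can be
  transported to path space, jointly with \<open>w\<close> and the running integrals of \<open>\<sigma>\<close> and \<open>b\<close>.
\<close>

type_synonym sample = "nat \<Rightarrow> real \<Rightarrow> real"

text \<open>
  \<open>N\<close> precedes the quantifier over \<open>\<bb>\<close>, since \<open>d\<^sub>0\<close> and \<open>N\<close> depend on \<open>\<bb>\<close> only through its norm \<open>K\<close>.
  The Green's function is unique almost everywhere.
\<close>

definition is_d0 :: "'d::finite itself \<Rightarrow> real \<Rightarrow> real \<Rightarrow> real \<Rightarrow> bool" where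
  "is_d0 _ \<delta> K d0 \<longleftrightarrow>
     real CARD('d) / 2 < d0 \<and> d0 < real CARD('d) \<and> real CARD('d) - 1 < d0 \<and>
     (\<exists>N::real. 0 \<le> N \<and>
       (\<forall>(\<bb> :: real^'d \<Rightarrow> real) (M :: sample measure) F d1 w \<sigma> b x.
          \<bb> \<in> borel_measurable borel \<and> (\<forall>y. 0 \<le> \<bb> y) \<and>
          Lp_norm (real CARD('d)) UNIV \<bb> = ennreal K \<and>
          drift_diffusion \<delta> \<bb> M F d1 w \<sigma> b x \<longrightarrow>
          (\<exists>G. is_green_function M x G \<and>
            (\<forall>y R p. 0 < R \<and> R \<le> 1/2 \<and> d0 \<le> p \<longrightarrow>
               Lp_norm (p / (p - 1)) (ball y R) G
                 \<le> ennreal (N * R powr (- real CARD('d) / p)) * Lp_norm 1 (ball y (2 * R)) G))))"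

end

theory Submission
 imports Defs
begin

text \<open>
For smooth coefficients the Green's function bound is applied to an Euler scheme started at a point
\<open>x\<^sub>0\<close>: \<open>\<sigma>\<close> is a measurable factor of \<open>a\<close>, frozen on each step, and the drift is switched off as soon as the
noise of the current step leaves a small ball, so that it is dominated by \<open>\<bb>\<close> of norm \<open>K\<close> evaluated at the
current point. Letting the step tend to 0 and rescaling space by \<open>\<mu>\<close> gives, for \<open>p = d\<^sub>0\<close> and a compactly
supported test function, \<open>\<phi>(x\<^sub>0)\<^sup>p \<le> N \<mu>\<^sup>d \<integral> ((\<phi> - \<mu>\<^sup>-\<^sup>2 L \<phi>)\<^sub>+)\<^sup>p\<close>. This is used for the cube of the
positive part of a mollified \<open>u\<close> minus a level above its boundary values, at its maximum; for \<open>\<mu>\<close> small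
relative to the diameter the zeroth order term is absorbed. No Sobolev embedding is needed to remove the
mollification: \<open>b\<close> is first dropped where \<open>|b| > m\<close> or \<open>|x| > m\<close> and multiplied by some \<open>\<theta> < 1\<close>, so that it is
bounded. Hoelder's inequality passes from \<open>d\<^sub>0\<close> to larger exponents.
\<close>

text \<open>The defining property of \<open>d0\<close> concerns every process of the class, so
  coefficients frozen on time steps are admissible and all Ito integrals become finite sums; a
  Wiener process on the fixed type \<open>sample\<close> is built from iid normals. Two margins
  shape the rest. A drift frozen at a grid point acts slightly away from that point, yet it must be
  dominated by a function of the current position with \<open>L_d\<close> norm exactly
  \<open>K\<close>. Hence the drifts of the smooth estimate vanish or have norm strictly below
  \<open>K\<close>, and \<theta> < 1 provides this gap. The discount exp(-t) produces a zeroth order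
  term that the final estimate does not contain. The \<open>L_d\<close> norm of the drift is
  invariant under b(y) -> b(x + y/\<mu>)/\<mu>, so one constant N serves all \<mu>; at the maximum
  of a test function supported by A the unwanted term costs, up to constants, a factor N \<mu>^d
  |A|, which is small once \<mu> times the diameter is small. The coefficient c enters only through
  its sign: the test functions live near {u >= s + \<epsilon>} with s >= 0, where c u >= 0. This set
  is compact in D, which leaves room for mollifying.\<close>

lemmas bm_contI = borel_measurable_continuous_onI

abbreviation bm :: "'a measure => ('a => 'b::topological_space) set" where
  "bm \<equiv> borel_measurable"

abbreviation cont :: "('a::topological_space => 'b::topological_space) => bool" where
  "cont \<equiv> continuous_on UNIV"

abbreviation eventually_seq :: "(nat => bool) => bool" (binder \<open>EV \<close> 10) where
  "eventually_seq P \<equiv> eventually P sequentially"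

abbreviation seq_limit :: "(nat => 'a::topological_space) => 'a => bool" (infix \<open>--->\<close> 60) where
  "X ---> L \<equiv> filterlim X (nhds L) sequentially"

abbreviation nn_lborel :: "('a::euclidean_space => ennreal) => ennreal" (binder \<open>NN \<close> 10) where
  "nn_lborel f \<equiv> nn_integral lborel f"

abbreviation nnS :: "'a::euclidean_space set => ('a => ennreal) => ennreal" where
  "nnS S f \<equiv> nn_integral lborel (%x. f x * indicator S x)"

section \<open>A Wiener process\<close>

abbreviation std_normal :: "real measure" where
 "std_normal \<equiv> density lborel std_normal_density"

lemma prob_space_std_normal: "prob_space std_normal"
 by (rule prob_space_normal_density) simp

lemma sets_std_normal [measurable_cong, simp]: "sets std_normal = sets borel"
 by simp

text \<open>Levy's midpoint construction: an increment \<open>x\<close> is split into two half-length increments with the help of an independent \<open>z\<close>; the map \<open>(x, z)\<close> to the rescaled halves is a rotation, hence preserves the Gaussian law.\<close>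

definition split_pair :: "real => real => bool => real" where
 "split_pair x z e = (x + (if e then z else - z)) / sqrt 2"

text \<open>Fubini reduces the rotation to two affine substitutions in one variable, y = -x + sqrt 2
  * u and then v = sqrt 2 * x - u. Their Jacobians \<open>sqrt 2\<close> and
  \<open>1 / sqrt 2\<close> cancel.\<close>

lemma nn_integral_rotate:
 fixes F :: "real \<times> real => ennreal"
 assumes [measurable]: "F \<in> bm borel"
 shows "(NN x. (NN y. F (split_pair x y True, split_pair x y False)))
  = (NN x. (NN y. F (x, y)))"
proof -
 have [measurable]: "F \<in> bm (lborel \<Otimes>\<^sub>M lborel)"
  by (simp add: lborel_prod)
 have [measurable]: "F \<in> bm (borel \<Otimes>\<^sub>M borel)"
  by (simp add: borel_prod)
 have s2: "sqrt 2 * sqrt 2 = 2" by simp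
 have "(NN x. (NN y. F (split_pair x y True, split_pair x y False)))
   = (NN x. \<bar>sqrt 2\<bar> * (NN u. F (u, sqrt 2 * x - u)))"
 proof (rule nn_integral_cong)
  fix x :: real
  have "(NN y. F (split_pair x y True, split_pair x y False))
   = \<bar>sqrt 2\<bar> * (NN u. F (split_pair x (-x + sqrt 2 * u) True, split_pair x (-x + sqrt 2 * u) False))"
   by (rule nn_integral_real_affine) (simp_all add: split_pair_def)
  also have "(%u. F (split_pair x (-x + sqrt 2 * u) True, split_pair x (-x + sqrt 2 * u) False)) = (%u. F (u, sqrt 2 * x - u))"
   using s2 by (auto simp: split_pair_def field_simps intro!: ext arg_cong[where f=F])
  finally show "(NN y. F (split_pair x y True, split_pair x y False)) = \<bar>sqrt 2\<bar> * (NN u. F (u, sqrt 2 * x - u))" .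
 qed
 also have "\<dots> = \<bar>sqrt 2\<bar> * (NN x. (NN u. F (u, sqrt 2 * x - u)))"
  by (rule nn_integral_cmult) measurable
 also have "(NN x. (NN u. F (u, sqrt 2 * x - u))) = (NN u. (NN x. F (u, sqrt 2 * x - u)))"
  by (rule lborel_pair.Fubini') measurable
 also have "\<dots> = (NN u. \<bar>1 / sqrt 2\<bar> * (NN v. F (u, v)))"
 proof (rule nn_integral_cong)
  fix u :: real
  have "(NN x. F (u, sqrt 2 * x - u))
   = \<bar>1 / sqrt 2\<bar> * (NN v. F (u, sqrt 2 * (u / sqrt 2 + 1 / sqrt 2 * v) - u))"
   by (rule nn_integral_real_affine) simp_all
  then show "(NN x. F (u, sqrt 2 * x - u)) = \<bar>1 / sqrt 2\<bar> * (NN v. F (u, v))"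
   by (simp add: field_simps)
 qed
 also have "\<dots> = \<bar>1 / sqrt 2\<bar> * (NN u. (NN v. F (u, v)))"
  by (rule nn_integral_cmult) measurable
 finally show ?thesis
  by (simp add: mult.assoc[symmetric] ennreal_mult'[symmetric])
qed

text \<open>The product density depends on x^2 + y^2 only, which the rotation preserves. Integrating
  over the parent x outside and the fresh noise inside is the form in which
  \<open>distr_refine\<close> meets it, one parent at a time.\<close>

lemma nn_integral_std_normal_rotate:
 assumes [measurable]: "A \<in> sets borel" "B \<in> sets borel"
 shows "(\<integral>\<^sup>+x. emeasure std_normal {y. split_pair x y True \<in> A \<and> split_pair x y False \<in> B} \<partial>std_normal)
  = emeasure std_normal A * emeasure std_normal B"
proof -
 let ?g = "%x. ennreal (std_normal_density x)"
 define F where "F = (%(u, v). indicator A u * indicator B v * (?g u * ?g v))"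
 have [measurable]: "F \<in> bm borel"
  unfolding F_def borel_prod[symmetric] by measurable
 have [measurable]: "(%y. split_pair x y e) \<in> bm borel" for x e
  by (simp add: split_pair_def)
 have gg: "?g x * ?g y = ?g (split_pair x y True) * ?g (split_pair x y False)" for x y
 proof -
  have "(split_pair x y True)\<^sup>2 + (split_pair x y False)\<^sup>2 = x\<^sup>2 + y\<^sup>2"
   by (simp add: split_pair_def power_divide power2_sum power2_diff field_simps)
  then show ?thesis
   by (simp add: ennreal_mult'[symmetric] std_normal_density_def exp_add[symmetric] add_divide_distrib[symmetric])
 qed
 have "(\<integral>\<^sup>+x. emeasure std_normal {y. split_pair x y True \<in> A \<and> split_pair x y False \<in> B} \<partial>std_normal)
  = (NN x. ?g x * (NN y. ?g y * indicator {y. split_pair x y True \<in> A \<and> split_pair x y False \<in> B} y))"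
  by (subst nn_integral_density) (simp_all add: emeasure_density split_pair_def[abs_def] cong: nn_integral_cong)
 also have "\<dots> = (NN x. (NN y. F (split_pair x y True, split_pair x y False)))"
  by (intro nn_integral_cong)
   (auto simp: nn_integral_cmult[symmetric] F_def gg[symmetric]
    intro!: nn_integral_cong split: split_indicator)
 also have "\<dots> = (NN x. (NN y. F (x, y)))"
  by (rule nn_integral_rotate) simp
 also have "\<dots> = (NN x. (?g x * indicator A x) * (NN y. ?g y * indicator B y))"
  by (intro nn_integral_cong) (auto simp: F_def nn_integral_cmult[symmetric] mult_ac intro!: nn_integral_cong)
 also have "\<dots> = emeasure std_normal A * emeasure std_normal B"
  by (subst nn_integral_multc) (simp_all add: emeasure_density)
 finally show ?thesis .
qed

section \<open>Consistent white noises on the dyadic levels\<close>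

abbreviation white_noise :: "(nat \<times> nat => real) measure" where
 "white_noise \<equiv> PiM UNIV (%_. std_normal)"

interpretation sn: prob_space std_normal by (rule prob_space_std_normal)
interpretation wn: product_prob_space "%_::'i. std_normal" "UNIV :: 'i set"
 by unfold_locales

text \<open>An index is (component, dyadic interval); interval j has the halves 2 j and 2 j + 1 on
  the next level. Increments are stored divided by their standard deviation, so all levels have the
  same law and the scale appears only in \<open>walk\<close>.\<close>

definition refine :: "(nat \<times> nat => real) => (nat \<times> nat => real) => nat \<times> nat => real" where
 "refine x z = (%(k, j). split_pair (x (k, j div 2)) (z (k, j div 2)) (even j))"

lemma measurable_refine [measurable]:
 "(%(x, z). refine x z) \<in> white_noise \<Otimes>\<^sub>M white_noise \<rightarrow>\<^sub>M white_noise"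
 unfolding refine_def split_pair_def
 by (rule measurable_PiM_single') (auto simp: split_beta)

text \<open>Children of different parents use disjoint coordinates of x and z, so a cylinder
  condition on the children factorises over the parents; for one parent it is
  \<open>nn_integral_std_normal_rotate\<close>.\<close>

lemma distr_refine: "distr (white_noise \<Otimes>\<^sub>M white_noise) white_noise (%(x, z). refine x z) = white_noise" (is "?D = _")
proof (rule wn.PiM_eq)
 show "sets ?D = sets white_noise" by simp
next
 fix J :: "(nat \<times> nat) set" and F :: "nat \<times> nat => real set"
 assume J: "finite J" and F: "\<And>j. j \<in> J ==> F j \<in> sets std_normal"
 \<comment> \<open>Padding with \<open>UNIV\<close> lets every parent constrain both of its
   children, even if only one of them lies in \<open>J\<close>.\<close>
 define G where "G j = (if j \<in> J then F j else UNIV)" for j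
 have G [measurable]: "G j \<in> sets borel" for j using F by (auto simp: G_def)
 define I where "I = (%(k, j). (k, j div 2)) ` J"
 have I: "finite I" using J by (auto simp: I_def)
 define h where "h i t = emeasure std_normal {s. split_pair t s True \<in> G (fst i, 2 * snd i) \<and> split_pair t s False \<in> G (fst i, 2 * snd i + 1)}" for i t
 have h[measurable]: "h i \<in> bm borel" for i
 proof -
  have "Measurable.pred (borel \<Otimes>\<^sub>M borel) (%p. split_pair (fst p) (snd p) True \<in> G (fst i, 2 * snd i) \<and>
    split_pair (fst p) (snd p) False \<in> G (fst i, 2 * snd i + 1))"
   unfolding split_pair_def by measurable
  then have p: "{p. split_pair (fst p) (snd p) True \<in> G (fst i, 2 * snd i) \<and>
    split_pair (fst p) (snd p) False \<in> G (fst i, 2 * snd i + 1)} \<in> sets (borel \<Otimes>\<^sub>M borel)"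
   by (simp add: pred_def space_pair_measure)
  have "(%t. emeasure std_normal {s \<in> space std_normal. (%(t,s). split_pair t s True \<in> G (fst i, 2 * snd i) \<and> split_pair t s False \<in> G (fst i, 2 * snd i + 1)) (t, s)}) \<in> bm borel"
   by (rule sn.measurable_emeasure) (use p in \<open>simp_all add: space_pair_measure case_prod_beta\<close>)
  then show ?thesis by (simp add: h_def[abs_def])
 qed
 have "emeasure ?D (prod_emb UNIV (%_. std_normal) J (\<Pi>\<^sub>E j\<in>J. F j))
  = emeasure (white_noise \<Otimes>\<^sub>M white_noise) ((%(x, z). refine x z) -` prod_emb UNIV (%_. std_normal) J (\<Pi>\<^sub>E j\<in>J. F j) \<inter> space (white_noise \<Otimes>\<^sub>M white_noise))"
  using J F by (intro emeasure_distr measurable_refine sets_PiM_I) auto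
 also have "\<dots> = emeasure (white_noise \<Otimes>\<^sub>M white_noise) {p \<in> space (white_noise \<Otimes>\<^sub>M white_noise). \<forall>i\<in>I. split_pair (fst p i) (snd p i) True \<in> G (fst i, 2 * snd i) \<and>
   split_pair (fst p i) (snd p i) False \<in> G (fst i, 2 * snd i + 1)}" (is "_ = emeasure _ ?S")
 proof (rule arg_cong[where f="emeasure _"], intro set_eqI iffI)
  fix p assume p: "p \<in> (%(x, z). refine x z) -` prod_emb UNIV (%_. std_normal) J (\<Pi>\<^sub>E j\<in>J. F j) \<inter> space (white_noise \<Otimes>\<^sub>M white_noise)"
  obtain x z where [simp]: "p = (x, z)" by (cases p)
  have r: "refine x z j \<in> G j" for j
   using p by (auto simp: prod_emb_def PiE_iff restrict_def G_def split: if_splits)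
  show "p \<in> ?S"
   using p r[of "(k, 2 * m)" for k m] r[of "(k, 2 * m + 1)" for k m] by (auto simp: refine_def)
 next
  fix p assume p: "p \<in> ?S"
  obtain x z where [simp]: "p = (x, z)" by (cases p)
  have "refine x z (k, j) \<in> F (k, j)" if "(k, j) \<in> J" for k j
  proof -
   have "(k, j div 2) \<in> I" using that by (force simp: I_def)
   with p have *: "split_pair (x (k, j div 2)) (z (k, j div 2)) True \<in> G (k, 2 * (j div 2))"
    "split_pair (x (k, j div 2)) (z (k, j div 2)) False \<in> G (k, 2 * (j div 2) + 1)" by auto
   show ?thesis
   proof (cases "even j")
    case True then show ?thesis using * that by (simp add: refine_def G_def)
   next
    case False
    then have "2 * (j div 2) + 1 = j" by simp
    then show ?thesis using * that False by (simp only: refine_def G_def) simp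
   qed
  qed
  then show "p \<in> (%(x, z). refine x z) -` prod_emb UNIV (%_. std_normal) J (\<Pi>\<^sub>E j\<in>J. F j) \<inter> space (white_noise \<Otimes>\<^sub>M white_noise)"
   using p by (auto simp: prod_emb_def PiE_iff restrict_def space_PiM extensional_def)
 qed
 also have "\<dots> = (\<integral>\<^sup>+x. emeasure white_noise (Pair x -` ?S) \<partial>white_noise)"
  using I by (intro wn.emeasure_pair_measure_alt) (simp add: split_pair_def)
 also have "\<dots> = (\<integral>\<^sup>+x. (\<Prod>i\<in>I. h i (x i)) \<partial>white_noise)"
 proof (rule nn_integral_cong)
  fix x
  have "emeasure white_noise (Pair x -` ?S) = emeasure white_noise {z \<in> space white_noise. \<forall>i\<in>I. z i \<in> {s. split_pair (x i) s True \<in> G (fst i, 2 * snd i) \<and>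
   split_pair (x i) s False \<in> G (fst i, 2 * snd i + 1)}}"
   by (rule arg_cong[where f="emeasure _"]) (auto simp: space_pair_measure space_PiM)
  also have "\<dots> = (\<Prod>i\<in>I. h i (x i))"
   unfolding h_def using I by (subst wn.emeasure_PiM_Collect) (simp_all add: split_pair_def)
  finally show "emeasure white_noise (Pair x -` ?S) = (\<Prod>i\<in>I. h i (x i))" .
 qed
 also have "\<dots> = (\<integral>\<^sup>+x. (\<Prod>i\<in>I. h i (x i)) \<partial>(PiM I (%_. std_normal)))"
  using I by (subst wn.distr_PiM_restrict_finite[symmetric, of I])
   (simp_all add: nn_integral_distr measurable_restrict_subset)
 also have "\<dots> = (\<Prod>i\<in>I. \<integral>\<^sup>+t. h i t \<partial>std_normal)"
  using I by (intro wn.product_nn_integral_prod) auto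
 also have "\<dots> = (\<Prod>i\<in>I. emeasure std_normal (G (fst i, 2 * snd i)) * emeasure std_normal (G (fst i, 2 * snd i + 1)))"
  unfolding h_def by (intro prod.cong refl nn_integral_std_normal_rotate) auto
 also have "\<dots> = (\<Prod>i\<in>I. \<Prod>e\<in>UNIV. emeasure std_normal (G (fst i, 2 * snd i + of_bool e)))"
  by (intro prod.cong refl) (simp add: UNIV_bool mult.commute)
 also have "\<dots> = (\<Prod>(i, e)\<in>I \<times> UNIV. emeasure std_normal (G (fst i, 2 * snd i + of_bool e)))"
  by (rule prod.cartesian_product)
 also have "\<dots> = (\<Prod>j\<in>(%(i, e). (fst i, 2 * snd i + of_bool e)) ` (I \<times> (UNIV::bool set)). emeasure std_normal (G j))"
 proof (subst prod.reindex)
  show "inj_on (%(i, e). (fst i, 2 * snd i + of_bool e)) (I \<times> (UNIV::bool set))"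
  proof (rule inj_onI, clarsimp)
   fix b d :: nat and e e' :: bool
   assume "2 * b + of_bool e = 2 * d + (of_bool e' :: nat)"
   then show "b = d \<and> e = e'" by (cases e; cases e'; simp; presburger)
  qed
 qed (auto intro!: prod.cong)
 also have "\<dots> = (\<Prod>j\<in>J. emeasure std_normal (F j))"
 \<comment> \<open>The children added by the padding contribute the factor 1.\<close>
 proof (rule prod.mono_neutral_cong_right)
  show "J \<subseteq> (%(i, e). (fst i, 2 * snd i + of_bool e)) ` (I \<times> (UNIV::bool set))"
  proof
   fix p assume p: "p \<in> J"
   obtain k j where [simp]: "p = (k, j)" by (cases p)
   have "((k, j div 2), odd j) \<in> I \<times> UNIV" using p by (force simp: I_def)
   moreover have "(k, j) = (%(i, e). (fst i, 2 * snd i + of_bool e)) ((k, j div 2), odd j)"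
    by (simp add: of_bool_def)
   ultimately show "p \<in> (%(i, e). (fst i, 2 * snd i + of_bool e)) ` (I \<times> (UNIV::bool set))"
    by (metis (no_types, lifting) \<open>p = (k, j)\<close> image_eqI)
  qed
 qed (use I sn.emeasure_space_1 in \<open>auto simp: G_def\<close>)
 finally show "emeasure ?D (prod_emb UNIV (%_. std_normal) J (\<Pi>\<^sub>E j\<in>J. F j)) = (\<Prod>j\<in>J. emeasure std_normal (F j))" .
qed

abbreviation base :: "(nat => real => real) measure" where
 "base \<equiv> PiM UNIV (%_. PiM UNIV (%_. std_normal))"

text \<open>The outer coordinate of a sample is the level. Only the inner coordinates
  \<open>real (prod_encode i)\<close> are read; the inner index is real because samples must have
  the type \<open>sample\<close>.\<close>

definition noise_level :: "nat => (nat => real => real) => nat \<times> nat => real" where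
 "noise_level n Z i = Z n (real (prod_encode i))"

primrec dyadic_incr :: "nat => (nat => real => real) => nat \<times> nat => real" where
 "dyadic_incr 0 Z = noise_level 0 Z"
| "dyadic_incr (Suc n) Z = refine (dyadic_incr n Z) (noise_level (Suc n) Z)"

interpretation bs: prob_space base
 by (intro prob_space_PiM prob_space_std_normal)

lemma measurable_noise_level:
 assumes "n \<in> A"
 shows "noise_level n \<in> PiM A (%_. PiM UNIV (%_. std_normal)) \<rightarrow>\<^sub>M white_noise"
proof -
 have "(%Z. Z n r) \<in> bm (PiM A (%_. PiM (UNIV::real set) (%_. std_normal)))" for r
  by (rule measurable_compose[where N="PiM UNIV (%_. std_normal)" and g="%w. w r"])
   (use assms measurable_component_singleton[of r UNIV "%_. std_normal"] in auto)
 then show ?thesis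
  unfolding noise_level_def by (intro measurable_PiM_single') auto
qed

lemma measurable_dyadic_incr':
 "{..n} \<subseteq> A ==> dyadic_incr n \<in> PiM A (%_. PiM UNIV (%_. std_normal)) \<rightarrow>\<^sub>M white_noise"
proof (induction n)
 case 0
 then have "dyadic_incr 0 = noise_level 0" by (simp add: fun_eq_iff)
 then show ?case using measurable_noise_level[of 0 A] 0 by simp
next
 case (Suc n)
 then have [measurable]: "dyadic_incr n \<in> PiM A (%_. PiM UNIV (%_. std_normal)) \<rightarrow>\<^sub>M white_noise"
  by (auto simp: atMost_Suc)
 have [measurable]: "noise_level (Suc n) \<in> PiM A (%_. PiM UNIV (%_. std_normal)) \<rightarrow>\<^sub>M white_noise"
  using Suc by (intro measurable_noise_level) auto
 have eq: "dyadic_incr (Suc n) = (%Z. (%(x, z). refine x z) (dyadic_incr n Z, noise_level (Suc n) Z))"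
  by (simp add: fun_eq_iff)
 show ?case unfolding eq
  by (rule measurable_compose[OF _ measurable_refine]) measurable
qed

lemma measurable_dyadic_incr [measurable]: "dyadic_incr n \<in> base \<rightarrow>\<^sub>M white_noise"
 by (rule measurable_dyadic_incr') simp

lemma distr_noise_level: "distr base white_noise (noise_level n) = white_noise"
proof -
 have 1: "distr base (PiM UNIV (%_. std_normal)) (%Z. Z n) = PiM UNIV (%_. std_normal)"
  by (intro distr_PiM_component prob_space_PiM prob_space_std_normal) auto
 have "inj (%i::nat\<times>nat. real (prod_encode i))"
  by (rule injI) simp
 from distr_PiM_reindex[OF prob_space_std_normal this, of UNIV]
 have 2: "distr (PiM UNIV (%_. std_normal)) white_noise (%Z n. Z (real (prod_encode n))) = white_noise"
  by (simp add: restrict_def)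
 have "distr base white_noise (noise_level n) = distr (distr base (PiM UNIV (%_. std_normal)) (%Z. Z n)) white_noise (%Z n. Z (real (prod_encode n)))"
  by (subst distr_distr) (auto simp: comp_def noise_level_def[abs_def] intro!: measurable_PiM_single')
 then show ?thesis by (simp add: 1 2)
qed

lemma indep_vars_PiM_coordinates:
 assumes "\<And>i. prob_space (M i)"
 shows "prob_space.indep_vars (PiM UNIV M) M (%i Z. Z i) UNIV"
proof -
 interpret prob_space "PiM UNIV M" by (intro prob_space_PiM assms)
 show ?thesis
  by (subst indep_vars_iff_distr_eq_PiM)
   (use assms in \<open>auto simp: restrict_def distr_PiM_component distr_id2\<close>)
qed

text \<open>\<open>dyadic_incr n\<close> reads only the levels up to n of the sample, so the two
  variables factor through disjoint sets of coordinates.\<close>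

lemma indep_dyadic_noise:
 "bs.indep_var white_noise (dyadic_incr n) white_noise (noise_level (Suc n))"
proof -
 let ?N = "%_::nat. PiM (UNIV::real set) (%_. std_normal)"
 have "bs.indep_vars ?N (%i Z. Z i) UNIV"
  by (intro indep_vars_PiM_coordinates prob_space_PiM prob_space_std_normal)
 then have "bs.indep_var (PiM {..n} ?N) (%Z. restrict (%i. Z i) {..n}) (PiM {Suc n} ?N) (%Z. restrict (%i. Z i) {Suc n})"
  by (rule bs.indep_var_restrict) auto
 then have "bs.indep_var white_noise (dyadic_incr n \<circ> (%Z. restrict (%i. Z i) {..n})) white_noise (noise_level (Suc n) \<circ> (%Z. restrict (%i. Z i) {Suc n}))"
  by (rule bs.indep_var_compose) (auto intro!: measurable_dyadic_incr' measurable_noise_level)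
 moreover have "dyadic_incr m (restrict Z {..n}) = dyadic_incr m Z" if "m <= n" for m Z
  using that by (induction m) (auto simp: noise_level_def[abs_def] fun_eq_iff refine_def)
 then have "dyadic_incr n \<circ> (%Z. restrict (%i. Z i) {..n}) = dyadic_incr n"
  by (simp add: fun_eq_iff)
 moreover have "noise_level (Suc n) \<circ> (%Z. restrict (%i. Z i) {Suc n}) = noise_level (Suc n)"
  by (simp add: fun_eq_iff noise_level_def)
 ultimately show ?thesis by simp
qed

lemma distr_dyadic_incr: "distr base white_noise (dyadic_incr n) = white_noise"
proof (induction n)
 case 0
 have "dyadic_incr 0 = noise_level 0" by (simp add: fun_eq_iff)
 then show ?case by (simp add: distr_noise_level)
next
 case (Suc n)
 have [measurable]: "noise_level (Suc n) \<in> base \<rightarrow>\<^sub>M white_noise"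
  by (rule measurable_noise_level) simp
 have eq: "dyadic_incr (Suc n) = (%(x, z). refine x z) \<circ> (%Z. (dyadic_incr n Z, noise_level (Suc n) Z))"
  by (simp add: fun_eq_iff)
 have "distr base white_noise (dyadic_incr (Suc n))
  = distr (distr base (white_noise \<Otimes>\<^sub>M white_noise) (%Z. (dyadic_incr n Z, noise_level (Suc n) Z))) white_noise (%(x, z). refine x z)"
  unfolding eq by (subst distr_distr) auto
 also have "distr base (white_noise \<Otimes>\<^sub>M white_noise) (%Z. (dyadic_incr n Z, noise_level (Suc n) Z)) = white_noise \<Otimes>\<^sub>M white_noise"
  using indep_dyadic_noise[of n] unfolding bs.indep_var_distribution_eq
  by (simp add: Suc distr_noise_level)
 finally show ?case by (simp only: distr_refine)
qed

lemma measurable_dyadic_incr_component [measurable]: "(%Z. dyadic_incr n Z i) \<in> bm base"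
 using measurable_compose[OF measurable_dyadic_incr measurable_component_singleton[of i UNIV "%_. std_normal"]]
 by simp

lemma distr_dyadic_incr_component:
 "distr base borel (%Z. dyadic_incr n Z i) = std_normal"
proof -
 have "distr base borel (%Z. dyadic_incr n Z i) = distr (distr base white_noise (dyadic_incr n)) borel (%x. x i)"
  by (subst distr_distr) (auto simp: comp_def)
 also have "\<dots> = distr white_noise std_normal (%x. x i)"
  unfolding distr_dyadic_incr by (rule distr_cong) auto
 also have "\<dots> = std_normal"
  by (intro distr_PiM_component prob_space_std_normal) auto
 finally show ?thesis .
qed

lemma indep_dyadic_incr: "bs.indep_vars (%_. borel) (%i Z. dyadic_incr n Z i) UNIV"
proof -
 have "distr base (PiM UNIV (%_. borel)) (dyadic_incr n) = distr base white_noise (dyadic_incr n)"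
  by (intro distr_cong refl sets_PiM_cong) auto
 also have "\<dots> = PiM UNIV (%i. distr base borel (%Z. dyadic_incr n Z i))"
  by (simp add: distr_dyadic_incr distr_dyadic_incr_component)
 finally show ?thesis
  by (subst bs.indep_vars_iff_distr_eq_PiM) (auto simp: restrict_def)
qed

section \<open>Uniform convergence of the dyadic walks\<close>

lemma dyadic_limit:
 fixes f :: "nat => real => real"
 assumes r: "0 < r" "r < 1"
  and step: "\<And>n t. n \<ge> n0 ==> t \<in> {0..T} ==> \<bar>f (Suc n) t - f n t\<bar> <= r ^ n"
  and osc: "\<And>n s t. n \<ge> n0 ==> s \<in> {0..T} ==> t \<in> {0..T} ==> \<bar>s - t\<bar> < 1 / 2 ^ n ==> \<bar>f n s - f n t\<bar> <= r ^ n"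
 shows "continuous_on {0..T} (%t. lim (%n. f n t))"
  and "\<And>t. t \<in> {0..T} ==> (%n. f n t) ---> lim (%n. f n t)"
proof -
 \<comment> \<open>The corrections from level n on form a geometric tail; this gives both the limit
   and its distance from level n.\<close>
 have tail: "\<bar>f (n + k) t - f n t\<bar> <= r ^ n / (1 - r)" if "n \<ge> n0" "t \<in> {0..T}" for n k t
 proof -
  have "\<bar>f (n + k) t - f n t\<bar> <= (\<Sum>i<k. r ^ (n + i))"
  proof (induction k)
   case (Suc k)
   have "\<bar>f (n + Suc k) t - f n t\<bar> <= \<bar>f (Suc (n + k)) t - f (n + k) t\<bar> + \<bar>f (n + k) t - f n t\<bar>"
    by simp
   also have "\<dots> <= r ^ (n + k) + (\<Sum>i<k. r ^ (n + i))"
    using step[of "n + k" t] that Suc by (intro add_mono) auto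
   finally show ?case by simp
  qed simp
  also have "\<dots> = r ^ n * (\<Sum>i<k. r ^ i)" by (simp add: power_add sum_distrib_left)
  also have "\<dots> <= r ^ n * (1 / (1 - r))"
   using r by (intro mult_left_mono) (auto simp: sum_gp_strict field_simps)
  finally show ?thesis by simp
 qed
 have small: "\<exists>n\<ge>n0. r ^ n / (1 - r) < e" if "e > 0" for e :: real
 proof -
  have "(%n. r ^ n / (1 - r)) ---> 0 / (1 - r)"
   using r by (intro tendsto_intros LIMSEQ_realpow_zero) auto
  then have "EV n. r ^ n / (1 - r) < e" using that by (intro order_tendstoD) auto
  from eventually_conj[OF eventually_ge_at_top[of n0] this]
  have "\<exists>n. n0 <= n \<and> r ^ n / (1 - r) < e"
   using eventually_happens'[OF sequentially_bot] by blast
  then show ?thesis by blast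
 qed
 show lim: "(%n. f n t) ---> lim (%n. f n t)" if t: "t \<in> {0..T}" for t
 proof -
  have "Cauchy (%n. f n t)"
  proof (rule metric_CauchyI)
   fix e :: real assume "e > 0"
   then obtain n where n: "n \<ge> n0" "r ^ n / (1 - r) < e / 2" using small[of "e/2"] by auto
   have "dist (f a t) (f b t) < e" if "a \<ge> n" "b \<ge> n" for a b
   proof -
    have "\<bar>f a t - f n t\<bar> < e / 2" "\<bar>f b t - f n t\<bar> < e / 2"
     using order_le_less_trans[OF tail[OF n(1) t, of "a - n"] n(2)]
      order_le_less_trans[OF tail[OF n(1) t, of "b - n"] n(2)] that by auto
    then show ?thesis by (simp add: dist_real_def abs_if split: if_splits)
   qed
   then show "\<exists>M. \<forall>m\<ge>M. \<forall>n\<ge>M. dist (f m t) (f n t) < e" by blast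
  qed
  then show ?thesis using real_Cauchy_convergent convergent_LIMSEQ_iff by blast
 qed
 have ltail: "\<bar>lim (%n. f n t) - f n t\<bar> <= r ^ n / (1 - r)" if "n \<ge> n0" "t \<in> {0..T}" for n t
 proof (rule tendsto_upperbound[where F=sequentially])
  show "(%k. \<bar>f k t - f n t\<bar>) ---> \<bar>lim (%n. f n t) - f n t\<bar>"
   using that by (intro tendsto_intros lim)
  show "EV k. \<bar>f k t - f n t\<bar> <= r ^ n / (1 - r)"
   using eventually_ge_at_top[of n]
  proof eventually_elim
   case (elim k) then show ?case using tail[OF that, of "k - n"] by simp
  qed
 qed simp
 show "continuous_on {0..T} (%t. lim (%n. f n t))"
 proof (rule continuous_onI)
  fix s e :: real assume s: "s \<in> {0..T}" and e: "e > 0"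
  then obtain n where n: "n \<ge> n0" "r ^ n / (1 - r) < e / 4" using small[of "e/4"] by auto
  \<comment> \<open>Three errors of order r^n: the tails at s and t, and the oscillation of level n
    between them.\<close>
  have "dist (lim (%n. f n t)) (lim (%n. f n s)) <= e" if t: "t \<in> {0..T}" "dist t s < 1 / 2 ^ n" for t
  proof -
   have "r ^ n <= r ^ n / (1 - r)" using r by (simp add: field_simps)
   moreover have "\<bar>f n t - f n s\<bar> <= r ^ n" using osc[OF n(1) t(1) s] t(2) by (simp add: dist_real_def)
   ultimately show ?thesis
    using ltail[OF n(1) t(1)] ltail[OF n(1) s] n(2) unfolding dist_real_def by linarith
  qed
  then show "\<exists>d>0. \<forall>t\<in>{0..T}. dist t s < d \<longrightarrow> dist (lim (%n. f n t)) (lim (%n. f n s)) <= e"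
   by (intro exI[of _ "1 / 2 ^ n"]) auto
 qed
qed

text \<open>The value at time a / 2^n of the level-n approximation: an increment over an interval of
  length 2^-n has standard deviation (1 / sqrt 2)^n.\<close>

definition walk :: "nat => nat => nat => (nat => real => real) => real" where
 "walk n k a Z = (\<Sum>j<a. (1 / sqrt 2) ^ n * dyadic_incr n Z (k, j))"

text \<open>Adding the two halves cancels the fresh noise and leaves \<open>sqrt 2\<close> times the
  parent, so refinement does not move the walk at the old grid points.\<close>

lemma walk_Suc_double: "walk (Suc n) k (2 * a) Z = walk n k a Z"
proof (induction a)
 case (Suc a)
 have "dyadic_incr (Suc n) Z (k, 2 * a) + dyadic_incr (Suc n) Z (k, 2 * a + 1) = 2 * dyadic_incr n Z (k, a) / sqrt 2"
  by (simp add: refine_def split_pair_def add_divide_distrib[symmetric])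
 also have "\<dots> = sqrt 2 * dyadic_incr n Z (k, a)"
  by (metis (no_types, opaque_lifting) mult.commute real_div_sqrt times_divide_eq_left zero_le_numeral)
 finally have *: "dyadic_incr (Suc n) Z (k, 2 * a) + dyadic_incr (Suc n) Z (k, 2 * a + 1) = sqrt 2 * dyadic_incr n Z (k, a)" .
 have "walk (Suc n) k (2 * Suc a) Z = walk (Suc n) k (2 * a) Z +
  (1 / sqrt 2) ^ Suc n * (dyadic_incr (Suc n) Z (k, 2 * a) + dyadic_incr (Suc n) Z (k, 2 * a + 1))"
  by (simp add: walk_def distrib_left del: dyadic_incr.simps)
 also have "\<dots> = walk (Suc n) k (2 * a) Z + (1 / sqrt 2) ^ n * dyadic_incr n Z (k, a)"
  unfolding * by simp
 also have "\<dots> = walk n k (Suc a) Z" unfolding Suc by (simp add: walk_def)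
 finally show ?case .
qed (simp add: walk_def)

lemma walk_Suc: "walk n k (Suc a) Z = walk n k a Z + (1 / sqrt 2) ^ n * dyadic_incr n Z (k, a)"
 by (simp add: walk_def)

definition grid :: "nat => real => nat" where
 "grid n t = nat \<lfloor>2 ^ n * t\<rfloor>"

lemma grid_Suc: "0 <= t ==> grid (Suc n) t = 2 * grid n t \<or> grid (Suc n) t = Suc (2 * grid n t)"
proof -
 assume t: "0 <= t"
 let ?x = "2 ^ n * t"
 have "0 <= \<lfloor>?x\<rfloor>" using t by simp
 moreover have "\<lfloor>2 * ?x\<rfloor> = 2 * \<lfloor>?x\<rfloor> \<or> \<lfloor>2 * ?x\<rfloor> = 2 * \<lfloor>?x\<rfloor> + 1" by linarith
 ultimately show ?thesis unfolding grid_def by (auto simp: mult.assoc nat_add_distrib nat_mult_distrib)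
qed

lemma grid_near: "0 <= s ==> s <= t ==> t - s < 1 / 2 ^ n ==> grid n t = grid n s \<or> grid n t = Suc (grid n s)"
proof -
 assume st: "0 <= s" "s <= t" "t - s < 1 / 2 ^ n"
 then have "2 ^ n * t - 2 ^ n * s < 1" by (simp add: field_simps)
 moreover have "2 ^ n * s <= 2 ^ n * t" "0 <= 2 ^ n * s" using st by auto
 ultimately show ?thesis unfolding grid_def by linarith
qed

lemma grid_mono: "s <= t ==> grid n s <= grid n t"
 unfolding grid_def by (intro nat_mono floor_mono) simp

lemma grid_le: "0 <= t ==> t <= real T ==> grid n t <= 2 ^ n * T"
proof -
 assume "0 <= t" "t <= real T"
 then have "2 ^ n * t <= 2 ^ n * real T" by simp
 then have "\<lfloor>2 ^ n * t\<rfloor> <= \<lfloor>real (2 ^ n * T)\<rfloor>" by (intro floor_mono) simp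
 then have "\<lfloor>2 ^ n * t\<rfloor> <= int (2 ^ n * T)" by (simp only: floor_of_nat)
 then show ?thesis by (simp add: grid_def nat_le_iff)
qed

lemma grid_tendsto: "0 <= t ==> (%n. grid n t / 2 ^ n) ---> t"
proof (rule tendsto_sandwich)
 assume t: "0 <= t"
 have g: "2 ^ n * t - 1 <= grid n t" "grid n t <= 2 ^ n * t" for n
  using t by (auto simp: grid_def)
 show "EV n. t - 1 / 2 ^ n <= grid n t / 2 ^ n"
 proof (intro always_eventually allI)
  fix n
  have "(t - 1 / 2 ^ n) * 2 ^ n = 2 ^ n * t - 1" by (simp add: left_diff_distrib)
  then show "t - 1 / 2 ^ n <= grid n t / 2 ^ n" using g(1)[of n] by (simp add: pos_le_divide_eq)
 qed
 show "EV n. grid n t / 2 ^ n <= t"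
  using g(2) by (auto simp: pos_divide_le_eq mult.commute intro!: always_eventually)
 have "(%n. t - (1/2) ^ n) ---> t - 0" by (intro tendsto_intros LIMSEQ_realpow_zero) auto
 then show "(%n. t - 1 / 2 ^ n) ---> t" by (simp add: power_divide)
qed auto

text \<open>The exponent 3/8 lies between 1/4 and 1/2. Above 1/4 the fourth moment makes the failure
  probabilities of the 2^n * T intervals summable, here of order 2^(-n/2); below 1/2 the increments
  of the walk, at most 2^(-n/2) * 2^(3n/8) = 2^(-n/8), decay geometrically.\<close>

definition tame :: "nat => nat => nat => (nat => real => real) => bool" where
 "tame k T n Z \<longleftrightarrow> (\<forall>j<2 ^ n * T. \<bar>dyadic_incr n Z (k, j)\<bar> <= (2 powr (3/8)) ^ n)"

definition regular :: "(nat => real => real) => bool" where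
 "regular Z \<longleftrightarrow> (\<forall>k T. EV n. tame k T n Z)"

lemma measurable_walk [measurable]: "walk n k a \<in> bm base"
 unfolding walk_def by measurable

lemma measurable_tame [measurable]: "Measurable.pred base (tame k T n)"
 unfolding tame_def by measurable

lemma measurable_regular [measurable]: "Measurable.pred base regular"
 unfolding regular_def eventually_sequentially by measurable

text \<open>Markov's inequality for the fourth power, whose mean is 3. Second moments would be too
  weak against the number of intervals of a level.\<close>

lemma std_normal_tail: "c > 0 ==> measure base {Z \<in> space base. c < \<bar>dyadic_incr n Z i\<bar>} <= 3 / c ^ 4"
proof -
 assume c: "c > 0"
 have d: "distributed base lborel (%Z. dyadic_incr n Z i) std_normal_density"
  unfolding distributed_def using distr_dyadic_incr_component[of n i]
  by (simp cong: distr_cong)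
 have I: "integrable base (%Z. dyadic_incr n Z i ^ 4)"
  using distributed_integrable[OF d, of "%x. x ^ 4"] integrable_std_normal_moment[of 4] by simp
 have E: "bs.expectation (%Z. dyadic_incr n Z i ^ 4) = 3"
 proof -
  have "bs.expectation (%Z. dyadic_incr n Z i ^ 4) = (\<integral>x. std_normal_density x * x ^ (2 * 2) \<partial>lborel)"
   using distributed_integral[OF d, of "%x. x ^ 4"] by simp
  also have "\<dots> = 3" unfolding integral_std_normal_moment_even by (simp add: fact_numeral)
  finally show ?thesis .
 qed
 have "measure base {Z \<in> space base. c < \<bar>dyadic_incr n Z i\<bar>} <= measure base {Z \<in> space base. c ^ 4 <= dyadic_incr n Z i ^ 4}"
 proof (intro bs.finite_measure_mono subsetI)
  fix Z assume "Z \<in> {Z \<in> space base. c < \<bar>dyadic_incr n Z i\<bar>}"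
  then have 1: "c <= \<bar>dyadic_incr n Z i\<bar>" and 2: "Z \<in> space base" by simp_all
  from 1 have "c ^ 4 <= \<bar>dyadic_incr n Z i\<bar> ^ 4" using c by (intro power_mono) simp_all
  then have "c ^ 4 <= dyadic_incr n Z i ^ 4" by simp
  with 2 show "Z \<in> {Z \<in> space base. c ^ 4 <= dyadic_incr n Z i ^ 4}" by blast
 qed measurable
 also have "\<dots> <= bs.expectation (%Z. dyadic_incr n Z i ^ 4) / c ^ 4"
  using c by (intro integral_Markov_inequality_measure[OF I, of "{}"] sets.empty_sets AE_I2 zero_le_even_power) simp_all
 finally show ?thesis by (simp add: E)
qed

text \<open>Borel-Cantelli with the union bound 2^n * T * 3 / 2^(3n/2).\<close>

lemma AE_regular: "AE Z in base. regular Z"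
proof -
 have "AE Z in base. EV n. tame k T n Z" for k T
 proof -
  define A where "A n = {Z \<in> space base. \<not> tame k T n Z}" for n
  have A[measurable]: "A n \<in> sets base" for n unfolding A_def by measurable
  define q :: real where "q = 2 powr (3/8)"
  have q: "q > 0" "q ^ 4 = 2 * sqrt 2"
  proof -
   have "q ^ 4 = 2 powr (3/2)" unfolding q_def by (simp add: powr_power)
   also have "\<dots> = 2 powr 1 * 2 powr (1/2)" using powr_add[of "2::real" 1 "1/2"] by simp
   finally show "q ^ 4 = 2 * sqrt 2" by (simp add: powr_half_sqrt)
  qed (simp add: q_def)
  have le: "measure base (A n) <= 3 * T * (1 / sqrt 2) ^ n" for n
  proof -
   have "A n = (\<Union>j<2^n*T. {Z \<in> space base. q ^ n < \<bar>dyadic_incr n Z (k, j)\<bar>})"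
    by (auto simp: A_def tame_def q_def)
   then have "measure base (A n) <= (\<Sum>j<2^n*T. measure base {Z \<in> space base. q ^ n < \<bar>dyadic_incr n Z (k, j)\<bar>})"
    by (simp only:) (rule bs.finite_measure_subadditive_finite, auto)
   also have "\<dots> <= (\<Sum>j<2^n*T. 3 / (q ^ n) ^ 4)"
    using q by (intro sum_mono std_normal_tail) simp
   also have "\<dots> = 3 * T * (2 / q ^ 4) ^ n"
    by (simp add: power_divide power_mult[symmetric] mult.commute)
   also have "2 / q ^ 4 = 1 / sqrt 2" unfolding q by simp
   finally show ?thesis .
  qed
  have "AE Z in base. EV n. Z \<in> space base - A n"
  proof (rule borel_cantelli_AE1)
   show "summable (%n. measure base (A n))"
    by (rule summable_comparison_test'[where g="%n. 3 * real T * (1 / sqrt 2) ^ n" and N=0])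
     (use le in \<open>auto intro!: summable_mult summable_geometric\<close>)
  qed (auto simp: less_top[symmetric])
  then show ?thesis
  proof (rule AE_mp, intro AE_I2 impI)
   fix Z assume "EV n. Z \<in> space base - A n"
   then show "EV n. tame k T n Z" by eventually_elim (auto simp: A_def)
  qed
 qed
 then show ?thesis unfolding regular_def by (simp add: AE_all_countable)
qed

text \<open>The value 0 on the exceptional null set makes every path continuous with start at 0,
  since \<open>wiener_process\<close> asks this at all points of the space.\<close>

definition brownian :: "nat => real => (nat => real => real) => real" where
 "brownian k t Z = (if regular Z then lim (%n. walk n k (grid n t) Z) else 0)"

lemma measurable_brownian [measurable]: "brownian k t \<in> bm base"
 unfolding brownian_def by measurable

lemma brownian_0 [simp]: "brownian k 0 Z = 0"
 by (simp add: brownian_def grid_def walk_def)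

lemma brownian_limit:
 assumes "regular Z"
 shows "continuous_on {0..real T} (%t. brownian k t Z)"
  and "\<And>t. t \<in> {0..real T} ==> (%n. walk n k (grid n t) Z) ---> brownian k t Z"
proof -
 \<comment> \<open>\<open>Suc T\<close> and not \<open>T\<close>: at t = T the index
   \<open>grid n t\<close> equals 2^n * T, so the interval starting there must be controlled as
   well.\<close>
 from assms have "EV n. tame k (Suc T) n Z" by (auto simp: regular_def)
 then obtain n0 where n0: "\<And>n. n \<ge> n0 ==> tame k (Suc T) n Z" by (auto simp: eventually_sequentially)
 define r :: real where "r = 2 powr (-1/8)"
 have r: "0 < r" "r < 1" by (auto simp: r_def powr_less_one)
 have r': "1 / sqrt 2 * 2 powr (3/8) = r"
 proof -
  have "1 / sqrt 2 = (2::real) powr (-1/2)" by (simp add: powr_minus_divide powr_half_sqrt)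
  then show ?thesis by (simp add: powr_add[symmetric] r_def)
 qed
 have b: "(1 / sqrt 2) ^ n * \<bar>dyadic_incr n Z (k, j)\<bar> <= r ^ n" if "n \<ge> n0" "j < 2 ^ n * Suc T" for n j
 proof -
  have "(1 / sqrt 2) ^ n * \<bar>dyadic_incr n Z (k, j)\<bar> <= (1 / sqrt 2) ^ n * (2 powr (3/8)) ^ n"
   using n0[OF that(1)] that(2) unfolding tame_def by (intro mult_left_mono) auto
  then show ?thesis by (simp only: power_mult_distrib[symmetric] r')
 qed
 have g: "grid n t < 2 ^ n * Suc T" if "t \<in> {0..real T}" for n t
  using grid_le[of t T n] that by (auto intro: le_less_trans)
 have walk1: "\<bar>walk n k (Suc a) Z - walk n k a Z\<bar> <= r ^ n" if "n \<ge> n0" "a < 2 ^ n * Suc T" for n a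
  using b[OF that] by (simp add: walk_Suc abs_mult)
 have step: "\<bar>walk (Suc n) k (grid (Suc n) t) Z - walk n k (grid n t) Z\<bar> <= r ^ n" if "n \<ge> n0" "t \<in> {0..real T}" for n t
 proof -
  have "grid (Suc n) t = 2 * grid n t \<or> grid (Suc n) t = Suc (2 * grid n t)"
   using that by (intro grid_Suc) auto
  then show ?thesis
  proof
   assume "grid (Suc n) t = 2 * grid n t"
   then show ?thesis using r by (simp add: walk_Suc_double)
  next
   assume *: "grid (Suc n) t = Suc (2 * grid n t)"
   have "\<bar>walk (Suc n) k (Suc (2 * grid n t)) Z - walk (Suc n) k (2 * grid n t) Z\<bar> <= r ^ Suc n"
    using g[OF that(2), of n] that(1) by (intro walk1) auto
   also have "r ^ Suc n <= r ^ n" using r by (intro power_decreasing) auto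
   finally show ?thesis by (simp add: * walk_Suc_double)
  qed
 qed
 have osc: "\<bar>walk n k (grid n s) Z - walk n k (grid n t) Z\<bar> <= r ^ n"
  if "n \<ge> n0" "s \<in> {0..real T}" "t \<in> {0..real T}" "\<bar>s - t\<bar> < 1 / 2 ^ n" for n s t
 proof -
  have *: "\<bar>walk n k (grid n t) Z - walk n k (grid n s) Z\<bar> <= r ^ n"
   if st: "s <= t" "s \<in> {0..real T}" "t \<in> {0..real T}" "\<bar>s - t\<bar> < 1 / 2 ^ n" for s t
  proof -
   have "grid n t = grid n s \<or> grid n t = Suc (grid n s)" using st by (intro grid_near) auto
   then show ?thesis using walk1[OF \<open>n \<ge> n0\<close> g[OF st(2)]] r by auto
  qed
  show ?thesis
  proof (cases "s <= t")
   case True then show ?thesis using *[of s t] that by (simp add: abs_minus_commute)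
  next
   case False then show ?thesis using *[of t s] that by (simp add: abs_minus_commute)
  qed
 qed
 note * = dyadic_limit[of r n0 "real T" "%n t. walk n k (grid n t) Z", OF r]
 show "continuous_on {0..real T} (%t. brownian k t Z)"
  using *(1)[OF step osc] assms by (simp add: brownian_def)
 show "(%n. walk n k (grid n t) Z) ---> brownian k t Z" if "t \<in> {0..real T}" for t
  using *(2)[OF step osc] that assms by (simp add: brownian_def)
qed

lemma continuous_brownian: "continuous_on {0..} (%t. brownian k t Z)"
proof (cases "regular Z")
 case True
 show ?thesis
  proof (rule continuous_on_eq_continuous_within[THEN iffD2], intro ballI)
   fix t :: real assume t: "t \<in> {0..}"
   obtain T :: nat where T: "t < T" using reals_Archimedean2 by blast
   have "continuous (at t within {0..real T}) (%t. brownian k t Z)"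
    using brownian_limit(1)[OF True, of T k] t T by (simp add: continuous_on_eq_continuous_within)
   moreover have "at t within {0..real T} = at t within {0..}"
    by (rule at_within_nhd[of _ "{..<real T}"]) (use T in auto)
   ultimately show "continuous (at t within {0..}) (%t. brownian k t Z)" by simp
  qed
qed (simp add: brownian_def)

lemma walk_tendsto: "regular Z ==> 0 <= t ==> (%n. walk n k (grid n t) Z) ---> brownian k t Z"
 using brownian_limit(2)[of Z t "nat \<lceil>t\<rceil>"] by auto

section \<open>Independence of the increments from the past\<close>

definition limit_cont :: "(real => real) => bool" where
 "limit_cont g \<longleftrightarrow> (\<exists>h. (\<forall>m. cont (h m) \<and> (\<forall>x. \<bar>h m x\<bar> <= 1)) \<and> (\<forall>x. (%m. h m x) ---> g x))"

lemma limit_cont_indicator: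
 assumes "closed C"
 shows "limit_cont (indicator C :: real => real)"
\<comment> \<open>\<open>infdist\<close> to the empty set is 0 by convention, so the formula used
  for the other case would give the constant 1.\<close>
proof (cases "C = {}")
 case True
 then show ?thesis unfolding limit_cont_def by (intro exI[of _ "%_ _. 0"]) auto
next
 case False
 define h where "h m x = max 0 (1 - real m * infdist x C)" for m x
 have "cont (h m)" for m unfolding h_def by (intro continuous_intros)
 moreover have "\<bar>h m x\<bar> <= 1" for m x by (auto simp: h_def infdist_nonneg)
 moreover have "(%m. h m x) ---> indicator C x" for x
 proof (cases "x \<in> C")
  case True
  then show ?thesis by (simp add: h_def)
 next
  case x: False
  then have pos: "infdist x C > 0" using assms False by (simp add: infdist_pos_not_in_closed)
  then obtain m0 where "1 < real m0 * infdist x C" using ex_less_of_nat_mult by blast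
  then have "h m x = 0" if "m \<ge> m0" for m
  proof -
   have "real m0 * infdist x C <= real m * infdist x C" using that pos by (intro mult_right_mono) auto
   with \<open>1 < real m0 * infdist x C\<close> show ?thesis by (simp add: h_def)
  qed
  then have "EV m. h m x = indicator C x" using x by (auto simp: eventually_sequentially)
  then show ?thesis by (rule tendsto_eventually)
 qed
 ultimately show ?thesis unfolding limit_cont_def by blast
qed

lemma limit_cont_measurable: "limit_cont g ==> g \<in> bm borel"
proof -
 assume "limit_cont g"
 then obtain h where h: "\<And>m. cont (h m)" "\<And>x. (%m. h m x) ---> g x"
  unfolding limit_cont_def by blast
 show ?thesis
  by (rule borel_measurable_LIMSEQ_real[where u=h]) (use h in \<open>auto intro: bm_contI\<close>)
qed

lemma abs_prod_le_1: "(\<And>i. i \<in> I ==> \<bar>f i\<bar> <= (1::real)) ==> \<bar>prod f I\<bar> <= 1"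
 by (simp add: abs_prod prod_le_1)

lemma walk_increment:
 "a <= b ==> walk n k b Z - walk n k a Z = (\<Sum>j\<in>{a..<b}. (1 / sqrt 2) ^ n * dyadic_incr n Z (k, j))"
 unfolding walk_def by (simp add: sum_diff_split lessThan_atLeast0 sum_diff_nat_ivl)

lemma distributed_dyadic_incr: "distributed base lborel (%Z. dyadic_incr n Z i) std_normal_density"
 unfolding distributed_def using distr_dyadic_incr_component[of n i]
 by (simp cong: distr_cong)

text \<open>The law is written as the image of one fixed normal law under a scaling, so that a
  change of variance becomes a continuous change of the integrand and survives n ->
  infinity.\<close>

lemma walk_increment_law:
 fixes g :: "real => real"
 assumes "a < b" and [measurable]: "g \<in> bm borel"
 shows "bs.expectation (%Z. g (walk n k b Z - walk n k a Z)) = (\<integral>x. g (sqrt ((real b - real a) / 2 ^ n) * x) \<partial>std_normal)"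
proof -
 define c where "c = (1 / sqrt 2) ^ n"
 define v where "v = sqrt ((real b - real a) / 2 ^ n)"
 have c: "c > 0" by (simp add: c_def)
 have c2: "c\<^sup>2 = 1 / 2 ^ n"
 proof -
  have "c\<^sup>2 = ((1 / sqrt 2)\<^sup>2) ^ n" unfolding c_def by (simp only: power_mult[symmetric] mult.commute)
  then show ?thesis by (simp add: power_divide)
 qed
 have v: "v > 0" using assms by (simp add: v_def)
 have "distributed base lborel (%Z. \<Sum>i\<in>Pair k ` {a..<b}. c * dyadic_incr n Z i)
  (normal_density (\<Sum>i\<in>Pair k ` {a..<b}. 0) (sqrt (\<Sum>i\<in>Pair k ` {a..<b}. c\<^sup>2)))"
 proof (rule bs.sum_indep_normal)
  have "bs.indep_vars (%_. borel) (%i Z. dyadic_incr n Z i) (Pair k ` {a..<b})"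
   by (rule bs.indep_vars_subset[OF indep_dyadic_incr]) simp
  then show "bs.indep_vars (%_. borel) (%i Z. c * dyadic_incr n Z i) (Pair k ` {a..<b})"
   by (rule bs.indep_vars_compose2) simp
  show "distributed base lborel (%Z. c * dyadic_incr n Z i) (normal_density 0 c)" for i
   using bs.normal_density_affine[OF distributed_dyadic_incr, of c 0] c by simp
 qed (use assms c in auto)
 moreover have "sqrt (\<Sum>i\<in>Pair k ` {a..<b}. c\<^sup>2) = v"
  using assms by (simp add: c2 v_def of_nat_diff card_image inj_on_def)
 moreover have "(\<Sum>i\<in>Pair k ` {a..<b}. c * dyadic_incr n Z i) = walk n k b Z - walk n k a Z" for Z
  using assms by (simp add: sum.reindex inj_on_def walk_increment c_def)
 ultimately have d: "distributed base lborel (%Z. walk n k b Z - walk n k a Z) (normal_density 0 v)"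
  by simp
 have "bs.expectation (%Z. g (walk n k b Z - walk n k a Z)) = (\<integral>x. normal_density 0 v x * g x \<partial>lborel)"
  using distributed_integral[OF d, of g] by simp
 also have "\<dots> = \<bar>v\<bar> *\<^sub>R (\<integral>x. normal_density 0 v (0 + v * x) * g (0 + v * x) \<partial>lborel)"
  using v by (intro lborel_integral_real_affine) auto
 also have "\<dots> = (\<integral>x. std_normal_density x * g (v * x) \<partial>lborel)"
 proof -
  have "v * normal_density 0 v (v * x) = std_normal_density x" for x
   using v by (simp add: normal_density_def power_mult_distrib real_sqrt_mult)
  then have "v * (normal_density 0 v (0 + v * x) * g (0 + v * x)) = std_normal_density x * g (v * x)" for x
   by (simp only: mult.assoc[symmetric] add_0)
  note eq = this
  have "\<bar>v\<bar> *\<^sub>R (\<integral>x. normal_density 0 v (0 + v * x) * g (0 + v * x) \<partial>lborel) = (\<integral>x. v * (normal_density 0 v (0 + v * x) * g (0 + v * x)) \<partial>lborel)"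
   using v by simp
  then show ?thesis unfolding eq .
 qed
 also have "\<dots> = (\<integral>x. g (v * x) \<partial>std_normal)"
  by (subst integral_density) auto
 finally show ?thesis by (simp add: v_def)
qed

text \<open>Everything is a function of the iid entries of level n: the past uses the intervals
  before \<open>a\<close>, the increment of component k uses the intervals in {a..<b} of that
  component.\<close>

lemma walk_independent_increments:
 fixes P :: "'p set" and \<kappa> \<iota> :: "'p => nat"
 assumes P: "finite P" "\<And>p. p \<in> P ==> \<iota> p <= a" and S: "finite S" and ab: "a < b"
  and G: "\<And>p. G p \<in> bm borel" "\<And>p x. \<bar>G p x\<bar> <= (1::real)"
  and g: "\<And>k. g k \<in> bm borel" "\<And>k x. \<bar>g k x\<bar> <= (1::real)"
 shows "bs.expectation (%Z. (\<Prod>p\<in>P. G p (walk n (\<kappa> p) (\<iota> p) Z)) * (\<Prod>k\<in>S. g k (walk n k b Z - walk n k a Z)))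
  = bs.expectation (%Z. \<Prod>p\<in>P. G p (walk n (\<kappa> p) (\<iota> p) Z)) *
   (\<Prod>k\<in>S. \<integral>x. g k (sqrt ((real b - real a) / 2 ^ n) * x) \<partial>std_normal)"
proof -
 note [measurable] = G(1) g(1)
 \<comment> \<open>\<open>None\<close> labels the block of the past, \<open>Some k\<close> the block
   of the increment of component k.\<close>
 define K where "K l = (case l of None => {p::nat\<times>nat. snd p < a} | Some k => {k} \<times> {a..<b})" for l
 define L where "L = insert None (Some ` S)"
 define c where "c = (1 / sqrt 2) ^ n"
 define Y where "Y l x = (case l of None => \<Prod>p\<in>P. G p (\<Sum>j<\<iota> p. c * x (\<kappa> p, j))
   | Some k => g k (\<Sum>j\<in>{a..<b}. c * x (k, j)))" for l and x :: "nat \<times> nat => real"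
 have L: "finite L" "L \<noteq> {}" using S by (auto simp: L_def)
 have "bs.indep_vars (%l. PiM (K l) (%_. borel)) (%l Z. restrict (%i. dyadic_incr n Z i) (K l)) L"
  by (rule bs.indep_vars_restrict[OF indep_dyadic_incr]) (auto simp: K_def L_def disjoint_family_on_def)
 moreover have "Y l \<in> bm (PiM (K l) (%_. borel))" if "l \<in> L" for l
 proof (cases l)
  case None
  have "(%x. G p (\<Sum>j<\<iota> p. c * x (\<kappa> p, j))) \<in> bm (PiM (K None) (%_. borel))" if "p \<in> P" for p
  proof (rule measurable_compose[OF _ G(1)], intro borel_measurable_sum borel_measurable_times measurable_const)
   fix j assume "j \<in> {..<\<iota> p}"
   then show "(%x. x (\<kappa> p, j)) \<in> bm (PiM (K None) (%_. borel))"
    using P(2)[of p] that by (intro measurable_component_singleton[where M="%_. borel"]) (auto simp: K_def)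
  qed simp
  then show ?thesis unfolding Y_def None by (simp add: borel_measurable_prod)
 next
  case (Some k)
  have "(%x. g k (\<Sum>j\<in>{a..<b}. c * x (k, j))) \<in> bm (PiM (K (Some k)) (%_. borel))"
  proof (rule measurable_compose[OF _ g(1)], intro borel_measurable_sum borel_measurable_times measurable_const)
   fix j assume "j \<in> {a..<b}"
   then show "(%x. x (k, j)) \<in> bm (PiM (K (Some k)) (%_. borel))"
    by (intro measurable_component_singleton[where M="%_. borel"]) (auto simp: K_def)
  qed simp
  then show ?thesis unfolding Y_def Some by simp
 qed
 ultimately have ind: "bs.indep_vars (%_. borel) (%l Z. Y l (restrict (%i. dyadic_incr n Z i) (K l))) L"
  by (rule bs.indep_vars_compose2)
 have YN: "Y None (restrict (%i. dyadic_incr n Z i) (K None)) = (\<Prod>p\<in>P. G p (walk n (\<kappa> p) (\<iota> p) Z))" for Z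
 proof -
  have "(\<kappa> p, j) \<in> K None" if "p \<in> P" "j < \<iota> p" for p j
   using P(2)[of p] that by (auto simp: K_def)
  then show ?thesis by (auto simp: Y_def walk_def c_def intro!: prod.cong arg_cong[where f="G _"] sum.cong)
 qed
 have YS: "Y (Some k) (restrict (%i. dyadic_incr n Z i) (K (Some k))) = g k (walk n k b Z - walk n k a Z)" for k Z
  using ab by (auto simp: Y_def walk_increment c_def K_def intro!: arg_cong[where f="g k"] sum.cong)
 have int: "integrable base (%Z. Y l (restrict (%i. dyadic_incr n Z i) (K l)))" if "l \<in> L" for l
 proof (rule bs.integrable_const_bound[where B=1])
  show "(%Z. Y l (restrict (%i. dyadic_incr n Z i) (K l))) \<in> bm base"
   using ind that by (auto simp: bs.indep_vars_def)
  show "AE Z in base. norm (Y l (restrict (%i. dyadic_incr n Z i) (K l))) <= 1"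
   by (cases l) (auto simp: YN YS g G intro!: abs_prod_le_1)
 qed
 have "bs.expectation (%Z. \<Prod>l\<in>L. Y l (restrict (%i. dyadic_incr n Z i) (K l)))
  = (\<Prod>l\<in>L. bs.expectation (%Z. Y l (restrict (%i. dyadic_incr n Z i) (K l))))"
  by (rule bs.indep_vars_lebesgue_integral[OF L(1) ind int])
 then show ?thesis
  using S ab g(1) by (simp add: L_def prod.reindex YN YS walk_increment_law)
qed

text \<open>The walks converge only pointwise on regular samples, so the functions must be
  continuous here; boundedness then gives dominated convergence.\<close>

lemma brownian_independent_cont:
 fixes P :: "(nat \<times> real) set"
 assumes P: "finite P" "\<And>k r. (k, r) \<in> P ==> 0 <= r \<and> r <= s" and S: "finite S" and st: "0 <= s" "s < t"
  and G: "\<And>p. cont (G p)" "\<And>p x. \<bar>G p x\<bar> <= (1::real)"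
  and g: "\<And>k. cont (g k)" "\<And>k x. \<bar>g k x\<bar> <= (1::real)"
 shows "bs.expectation (%Z. (\<Prod>p\<in>P. G p (brownian (fst p) (snd p) Z)) * (\<Prod>k\<in>S. g k (brownian k t Z - brownian k s Z)))
  = bs.expectation (%Z. \<Prod>p\<in>P. G p (brownian (fst p) (snd p) Z)) *
   (\<Prod>k\<in>S. \<integral>x. g k (sqrt (t - s) * x) \<partial>std_normal)"
proof -
 have [measurable]: "G p \<in> bm borel" "g k \<in> bm borel" for p k
  using G(1)[of p] g(1)[of k] by (auto intro: bm_contI)
 define A where "A n Z = (\<Prod>p\<in>P. G p (walk n (fst p) (grid n (snd p)) Z))" for n Z
 define B where "B n Z = (\<Prod>k\<in>S. g k (walk n k (grid n t) Z - walk n k (grid n s) Z))" for n Z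
 define v where "v n = sqrt ((real (grid n t) - real (grid n s)) / 2 ^ n)" for n
 have [measurable]: "A n \<in> bm base" "B n \<in> bm base" for n
  unfolding A_def B_def by measurable
 have A1: "\<bar>A n Z\<bar> <= 1" and B1: "\<bar>B n Z\<bar> <= 1" for n Z
  using G g by (auto simp: A_def B_def intro!: abs_prod_le_1)
 have lim: "(%n. A n Z) ---> (\<Prod>p\<in>P. G p (brownian (fst p) (snd p) Z))"
  "(%n. B n Z) ---> (\<Prod>k\<in>S. g k (brownian k t Z - brownian k s Z))" if "regular Z" for Z
  unfolding A_def B_def using P(2) that st
  by (auto intro!: tendsto_prod continuous_on_tendsto_compose[OF G(1)] continuous_on_tendsto_compose[OF g(1)]
   tendsto_diff walk_tendsto)
 have L1: "(%n. bs.expectation (%Z. A n Z * B n Z)) ---> bs.expectation (%Z. (\<Prod>p\<in>P. G p (brownian (fst p) (snd p) Z)) * (\<Prod>k\<in>S. g k (brownian k t Z - brownian k s Z)))"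
 proof (rule integral_dominated_convergence[where w="%_. 1"])
  show "AE Z in base. (%n. A n Z * B n Z) ---> (\<Prod>p\<in>P. G p (brownian (fst p) (snd p) Z)) * (\<Prod>k\<in>S. g k (brownian k t Z - brownian k s Z))"
   using AE_regular by eventually_elim (intro tendsto_mult lim)
  show "AE Z in base. norm (A n Z * B n Z) <= 1" for n
   using A1 B1 by (auto simp: abs_mult intro!: mult_le_one)
 qed auto
 have L2: "(%n. bs.expectation (A n)) ---> bs.expectation (%Z. \<Prod>p\<in>P. G p (brownian (fst p) (snd p) Z))"
 proof (rule integral_dominated_convergence[where w="%_. 1"])
  show "AE Z in base. (%n. A n Z) ---> (\<Prod>p\<in>P. G p (brownian (fst p) (snd p) Z))"
   using AE_regular by eventually_elim (intro lim)
 qed (use A1 in auto)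
 have "(%n. real (grid n t) / 2 ^ n - real (grid n s) / 2 ^ n) ---> t - s"
  using st by (intro tendsto_diff grid_tendsto) auto
 then have vv: "(%n. (real (grid n t) - real (grid n s)) / 2 ^ n) ---> t - s" by (simp add: diff_divide_distrib)
 then have v: "v ---> sqrt (t - s)" unfolding v_def by (intro tendsto_real_sqrt)
 have L3: "(%n. \<integral>x. g k (v n * x) \<partial>std_normal) ---> (\<integral>x. g k (sqrt (t - s) * x) \<partial>std_normal)" for k
 proof (rule integral_dominated_convergence[where w="%_. 1"])
  show "AE x in std_normal. (%n. g k (v n * x)) ---> g k (sqrt (t - s) * x)"
   by (intro AE_I2 continuous_on_tendsto_compose[OF g(1)] tendsto_mult v tendsto_const) auto
 qed (use g in auto)
 \<comment> \<open>On fine grids s and t lie in different cells, as the strict inequality of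
   \<open>walk_independent_increments\<close> requires.\<close>
 have "EV n. 0 < (real (grid n t) - real (grid n s)) / 2 ^ n"
  using vv st by (intro order_tendstoD) auto
 then have "EV n. bs.expectation (A n) * (\<Prod>k\<in>S. \<integral>x. g k (v n * x) \<partial>std_normal) = bs.expectation (%Z. A n Z * B n Z)"
 proof eventually_elim
  case (elim n)
  then have ab: "grid n s < grid n t" by (simp add: zero_less_divide_iff)
  show ?case unfolding A_def B_def v_def
   by (rule walk_independent_increments[symmetric, OF P(1) _ S ab]) (use P(2) G g in \<open>auto intro!: grid_mono\<close>)
 qed
 moreover have "(%n. bs.expectation (A n) * (\<Prod>k\<in>S. \<integral>x. g k (v n * x) \<partial>std_normal))
  ---> bs.expectation (%Z. \<Prod>p\<in>P. G p (brownian (fst p) (snd p) Z)) * (\<Prod>k\<in>S. \<integral>x. g k (sqrt (t - s) * x) \<partial>std_normal)"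
  by (intro tendsto_mult L2 tendsto_prod L3)
 ultimately have "(%n. bs.expectation (%Z. A n Z * B n Z))
  ---> bs.expectation (%Z. \<Prod>p\<in>P. G p (brownian (fst p) (snd p) Z)) * (\<Prod>k\<in>S. \<integral>x. g k (sqrt (t - s) * x) \<partial>std_normal)"
  by (rule Lim_transform_eventually[rotated])
 with L1 show ?thesis using LIMSEQ_unique by blast
qed

text \<open>A second passage to the limit, now in the functions, reaches the indicators of closed
  sets through \<open>limit_cont_indicator\<close>.\<close>

lemma brownian_independent_limit_cont:
 fixes P :: "(nat \<times> real) set"
 assumes P: "finite P" "\<And>k r. (k, r) \<in> P ==> 0 <= r \<and> r <= s" and S: "finite S" and st: "0 <= s" "s < t"
  and G: "\<And>p. limit_cont (G p)" and g: "\<And>k. limit_cont (g k)"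
 shows "bs.expectation (%Z. (\<Prod>p\<in>P. G p (brownian (fst p) (snd p) Z)) * (\<Prod>k\<in>S. g k (brownian k t Z - brownian k s Z)))
  = bs.expectation (%Z. \<Prod>p\<in>P. G p (brownian (fst p) (snd p) Z)) *
   (\<Prod>k\<in>S. \<integral>x. g k (sqrt (t - s) * x) \<partial>std_normal)"
proof -
 obtain H where H: "\<And>p m. cont (H p m)" "\<And>p m x. \<bar>H p m x\<bar> <= 1" "\<And>p x. (%m. H p m x) ---> G p x"
  using G unfolding limit_cont_def by metis
 obtain h where h: "\<And>p m. cont (h p m)" "\<And>p m x. \<bar>h p m x\<bar> <= 1" "\<And>p x. (%m. h p m x) ---> g p x"
  using g unfolding limit_cont_def by metis
 note m = bm_contI[OF H(1)] bm_contI[OF h(1)]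
  limit_cont_measurable[OF G] limit_cont_measurable[OF g]
 note [measurable] = m
 let ?A = "%m Z. \<Prod>p\<in>P. H p m (brownian (fst p) (snd p) Z)"
 let ?B = "%m Z. \<Prod>k\<in>S. h k m (brownian k t Z - brownian k s Z)"
 have 1: "(%m. bs.expectation (%Z. ?A m Z * ?B m Z)) --->
  bs.expectation (%Z. (\<Prod>p\<in>P. G p (brownian (fst p) (snd p) Z)) * (\<Prod>k\<in>S. g k (brownian k t Z - brownian k s Z)))"
 proof (rule integral_dominated_convergence[where w="%_. 1"])
  show "AE Z in base. (%m. ?A m Z * ?B m Z) ---> (\<Prod>p\<in>P. G p (brownian (fst p) (snd p) Z)) * (\<Prod>k\<in>S. g k (brownian k t Z - brownian k s Z))"
   by (intro AE_I2 tendsto_mult tendsto_prod H h)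
  show "AE Z in base. norm (?A m Z * ?B m Z) <= 1" for m
   unfolding real_norm_def abs_mult by (intro AE_I2 mult_le_one abs_prod_le_1 H h abs_ge_zero)
 qed auto
 have 2: "(%m. bs.expectation (?A m)) ---> bs.expectation (%Z. \<Prod>p\<in>P. G p (brownian (fst p) (snd p) Z))"
 proof (rule integral_dominated_convergence[where w="%_. 1"])
  show "AE Z in base. (%m. ?A m Z) ---> (\<Prod>p\<in>P. G p (brownian (fst p) (snd p) Z))"
   by (intro AE_I2 tendsto_prod H)
  show "AE Z in base. norm (?A m Z) <= 1" for m
   unfolding real_norm_def by (intro AE_I2 abs_prod_le_1 H)
 qed auto
 have 3: "(%m. \<integral>x. h k m (sqrt (t - s) * x) \<partial>std_normal) ---> (\<integral>x. g k (sqrt (t - s) * x) \<partial>std_normal)" for k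
  by (rule integral_dominated_convergence[where w="%_. 1"]) (use h in auto)
 have "bs.expectation (%Z. ?A m Z * ?B m Z) = bs.expectation (?A m) * (\<Prod>k\<in>S. \<integral>x. h k m (sqrt (t - s) * x) \<partial>std_normal)" for m
  by (rule brownian_independent_cont[OF P S st]) (use H h in auto)
 then have "(%m. bs.expectation (%Z. ?A m Z * ?B m Z)) ---> bs.expectation (%Z. \<Prod>p\<in>P. G p (brownian (fst p) (snd p) Z)) *
   (\<Prod>k\<in>S. \<integral>x. g k (sqrt (t - s) * x) \<partial>std_normal)"
  by (simp only:) (intro tendsto_mult tendsto_prod 2 3)
 with 1 show ?thesis using LIMSEQ_unique by blast
qed

lemma space_base: "space base = UNIV"
 by (simp add: space_PiM)

section \<open>The completed filtration\<close>

definition past_event :: "(nat \<times> real) set => (nat \<times> real => real set) => (nat => real => real) set" where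
 "past_event P C = {Z. \<forall>p\<in>P. brownian (fst p) (snd p) Z \<in> C p}"

text \<open>Finitely many times and closed targets: a family stable under intersection to which
  \<open>brownian_independent_events\<close> applies directly.\<close>

definition past_gen :: "real => (nat => real => real) set set" where
 "past_gen t = {past_event P C | P C. finite P \<and> (\<forall>p\<in>P. 0 <= snd p \<and> snd p <= t) \<and> (\<forall>p. closed (C p))}"

lemma past_event_sets: "finite P ==> (\<And>p. closed (C p)) ==> past_event P C \<in> sets base"
proof -
 assume P: "finite P" and C: "\<And>p. closed (C p)"
 have [measurable]: "C p \<in> sets borel" for p by (rule borel_closed[OF C])
 have "{Z\<in>space base. \<forall>p\<in>P. brownian (fst p) (snd p) Z \<in> C p} \<in> sets base"
  using P by measurable
 then show ?thesis by (simp add: past_event_def space_base)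
qed

lemma brownian_independent_events:
 assumes A: "A \<in> past_gen s" and S: "finite S" and st: "0 <= s" "s < t" and C: "\<And>k. closed (C k)"
 shows "measure base (A \<inter> {Z. \<forall>k\<in>S. brownian k t Z - brownian k s Z \<in> C k}) =
  measure base A * (\<Prod>k\<in>S. measure std_normal {x. sqrt (t - s) * x \<in> C k})"
proof -
 obtain P D where P: "finite P" "\<And>k r. (k, r) \<in> P ==> 0 <= r \<and> r <= s" and D: "\<And>p. closed (D p)" and A_eq: "A = past_event P D"
  using A unfolding past_gen_def by force
 have [measurable]: "C k \<in> sets borel" "D p \<in> sets borel" for k p by (rule borel_closed[OF C], rule borel_closed[OF D])
 have [measurable]: "A \<in> sets base" unfolding A_eq by (rule past_event_sets[OF P(1) D])
 have m: "{Z. \<forall>k\<in>S. brownian k t Z - brownian k s Z \<in> C k} \<in> sets base"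
 proof -
  have "{Z\<in>space base. \<forall>k\<in>S. brownian k t Z - brownian k s Z \<in> C k} \<in> sets base"
   using S by measurable
  then show ?thesis by (simp add: space_base)
 qed
 have ind: "(\<Prod>p\<in>P. indicator (D p) (brownian (fst p) (snd p) Z)) = (indicator A Z :: real)" for Z
  unfolding A_eq past_event_def using P(1) by (auto simp: indicator_def prod_zero_iff intro!: prod.neutral)
 have ind2: "(\<Prod>k\<in>S. indicator (C k) (brownian k t Z - brownian k s Z)) = (indicator {Z. \<forall>k\<in>S. brownian k t Z - brownian k s Z \<in> C k} Z :: real)" for Z
  using S by (auto simp: indicator_def prod_zero_iff intro!: prod.neutral)
 have ind3: "(\<integral>x. indicator (C k) (sqrt (t - s) * x) \<partial>std_normal) = measure std_normal {x. sqrt (t - s) * x \<in> C k}" for k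
 proof -
  have "{x. sqrt (t - s) * x \<in> C k} \<in> sets borel" by measurable
  moreover have "(%x. indicator (C k) (sqrt (t - s) * x) :: real) = indicator {x. sqrt (t - s) * x \<in> C k}"
   by (auto simp: indicator_def)
  ultimately show ?thesis by simp
 qed
 have "bs.expectation (%Z. indicator A Z * indicator {Z. \<forall>k\<in>S. brownian k t Z - brownian k s Z \<in> C k} Z)
  = bs.expectation (indicator A) * (\<Prod>k\<in>S. measure std_normal {x. sqrt (t - s) * x \<in> C k})"
  using brownian_independent_limit_cont[OF P S st, where G="%p. indicator (D p)" and g="%k. indicator (C k)"] C D
  by (simp add: limit_cont_indicator ind ind2 ind3)
 then show ?thesis using m by (simp add: indicator_inter_arith[symmetric])
qed

lemma past_gen_UNIV: "UNIV \<in> past_gen t"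
 unfolding past_gen_def by (intro CollectI exI[of _ "{}"]) (auto simp: past_event_def intro!: exI[of _ "%_. UNIV"])

lemma past_gen_Int: "A \<in> past_gen t ==> B \<in> past_gen t ==> A \<inter> B \<in> past_gen t"
proof -
 assume "A \<in> past_gen t" "B \<in> past_gen t"
 then obtain P C Q D where *: "finite P" "\<forall>p\<in>P. 0 <= snd p \<and> snd p <= t" "\<forall>p. closed (C p)" "A = past_event P C"
  "finite Q" "\<forall>p\<in>Q. 0 <= snd p \<and> snd p <= t" "\<forall>p. closed (D p)" "B = past_event Q D"
  unfolding past_gen_def by blast
 let ?E = "%p. (if p \<in> P then C p else UNIV) \<inter> (if p \<in> Q then D p else UNIV)"
 have "A \<inter> B = past_event (P \<union> Q) ?E" using * by (auto simp: past_event_def)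
 moreover have "\<forall>p. closed (?E p)" using * by (auto intro!: closed_Int)
 ultimately show ?thesis unfolding past_gen_def using * by (intro CollectI exI[of _ "P \<union> Q"] exI[of _ ?E]) auto
qed

lemma past_gen_mono: "s <= t ==> past_gen s \<subseteq> past_gen t"
 unfolding past_gen_def by force

abbreviation Mw :: "(nat => real => real) measure" where "Mw \<equiv> completion base"

text \<open>Null modifications are built into the generator and not added afterwards: it stays
  stable under intersection, so independence can be tested on it. The extra \<open>{}\<close> brings
  in the null sets themselves.\<close>

definition filt_gen :: "real => (nat => real => real) set set" where
 "filt_gen t = {A \<in> sets Mw. \<exists>B\<in>past_gen t \<union> {{}}. AE Z in Mw. Z \<in> A \<longleftrightarrow> Z \<in> B}"

definition Fw :: "real => (nat => real => real) measure" where
 "Fw t = sigma UNIV (filt_gen t)"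

lemma sets_Fw: "sets (Fw t) = sigma_sets UNIV (filt_gen t)" and space_Fw: "space (Fw t) = UNIV"
 by (simp_all add: Fw_def)

interpretation cw: prob_space Mw
 by (rule bs.prob_space_completion)

lemma past_gen_sets: "A \<in> past_gen t ==> A \<in> sets base"
 unfolding past_gen_def by (auto intro: past_event_sets)

lemma past_gen_in_filt_gen: "past_gen t \<subseteq> filt_gen t"
 unfolding filt_gen_def using past_gen_sets by force

lemma filt_gen_Int_stable: "Int_stable (filt_gen t)"
proof (rule Int_stableI)
 fix A A' assume "A \<in> filt_gen t" "A' \<in> filt_gen t"
 then obtain B B' where A: "A \<in> sets Mw" "A' \<in> sets Mw" and B: "B \<in> past_gen t \<union> {{}}" "B' \<in> past_gen t \<union> {{}}"
  and ae: "AE Z in Mw. Z \<in> A \<longleftrightarrow> Z \<in> B" "AE Z in Mw. Z \<in> A' \<longleftrightarrow> Z \<in> B'"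
  unfolding filt_gen_def by blast
 have "B \<inter> B' \<in> past_gen t \<union> {{}}" using B past_gen_Int by auto
 moreover have "AE Z in Mw. Z \<in> A \<inter> A' \<longleftrightarrow> Z \<in> B \<inter> B'" using ae by eventually_elim auto
 ultimately show "A \<inter> A' \<in> filt_gen t" using A unfolding filt_gen_def by blast
qed

lemma filtered_Mw: "complete_filtered_space Mw Fw"
 unfolding complete_filtered_space_def
proof (intro conjI allI impI)
 show "filtration (space Mw) Fw"
 proof
  show "space (Fw i) = space Mw" for i by (simp add: space_Fw space_base)
  show "sets (Fw i) \<subseteq> sets (Fw j)" if "i <= j" for i j
  proof -
   have "filt_gen i \<subseteq> filt_gen j" using past_gen_mono[OF that] unfolding filt_gen_def by blast
   then show ?thesis unfolding sets_Fw by (rule sigma_sets_mono')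
  qed
 qed
 show "sets (Fw t) \<subseteq> sets Mw" for t
  unfolding sets_Fw using sets.sigma_sets_subset[of "filt_gen t" Mw]
  by (simp add: space_base) (auto simp: filt_gen_def)
 show "null_sets Mw \<subseteq> sets (Fw t)" for t
 proof
  fix N assume N: "N \<in> null_sets Mw"
  have "N \<in> filt_gen t"
   unfolding filt_gen_def using AE_not_in[OF N] N by (auto intro!: bexI[of _ "{}"])
  then show "N \<in> sets (Fw t)" by (auto simp: sets_Fw)
 qed
qed (auto intro: cw.prob_space_axioms completion.complete_measure_axioms)

lemma measurable_brownian_Fw: "0 <= r ==> r <= t ==> brownian k r \<in> bm (Fw t)"
proof (rule borel_measurableI_le)
 fix y assume r: "0 <= r" "r <= t"
 have "past_event {(k, r)} (%_. {..y}) \<in> past_gen t"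
  unfolding past_gen_def using r by (intro CollectI exI[of _ "{(k, r)}"] exI[of _ "%_. {..y}"]) auto
 then have "past_event {(k, r)} (%_. {..y}) \<in> sets (Fw t)"
  unfolding sets_Fw using past_gen_in_filt_gen by blast
 then show "{x \<in> space (Fw t). brownian k r x <= y} \<in> sets (Fw t)"
  by (simp add: past_event_def space_Fw)
qed

lemma measurable_brownian_Mw [measurable]: "brownian k r \<in> bm Mw"
 by (rule measurable_completion) simp

text \<open>A change on a null set does not affect probabilities, and for the extra set
  \<open>{}\<close> both sides vanish.\<close>

lemma filt_independent_events:
 assumes A: "A \<in> filt_gen s" and S: "finite S" and st: "0 <= s" "s < t" and C: "\<And>k. closed (C k)"
 shows "measure Mw (A \<inter> {Z. \<forall>k\<in>S. brownian k t Z - brownian k s Z \<in> C k}) =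
  measure Mw A * (\<Prod>k\<in>S. measure std_normal {x. sqrt (t - s) * x \<in> C k})"
proof -
 obtain B where [measurable]: "A \<in> sets Mw" and B: "B \<in> past_gen s \<union> {{}}" and ae: "AE Z in Mw. Z \<in> A \<longleftrightarrow> Z \<in> B"
  using A unfolding filt_gen_def by blast
 have B'[measurable]: "B \<in> sets base" using B past_gen_sets by auto
 have [measurable]: "C k \<in> sets borel" for k by (rule borel_closed[OF C])
 let ?D = "{Z. \<forall>k\<in>S. brownian k t Z - brownian k s Z \<in> C k}"
 have m[measurable]: "?D \<in> sets base"
 proof -
  have "{Z\<in>space base. \<forall>k\<in>S. brownian k t Z - brownian k s Z \<in> C k} \<in> sets base"
   using S by measurable
  then show ?thesis by (simp add: space_base)
 qed
 have "measure Mw (A \<inter> ?D) = measure Mw (B \<inter> ?D)"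
  by (rule cw.finite_measure_eq_AE) (use ae in auto)
 also have "\<dots> = measure base (B \<inter> ?D)" by simp
 also have "\<dots> = measure base B * (\<Prod>k\<in>S. measure std_normal {x. sqrt (t - s) * x \<in> C k})"
  using B brownian_independent_events[OF _ S st, of B C] C by auto
 also have "measure base B = measure Mw B" by simp
 also have "\<dots> = measure Mw A"
  by (rule cw.finite_measure_eq_AE) (use ae in auto)
 finally show ?thesis .
qed

lemma UNIV_in_filt_gen: "UNIV \<in> filt_gen s"
 using past_gen_UNIV past_gen_in_filt_gen by blast

lemma increment_closed_prob:
 assumes "finite S" "0 <= s" "s < t" "\<And>k. closed (C k)"
 shows "measure Mw {Z. \<forall>k\<in>S. brownian k t Z - brownian k s Z \<in> C k} =
  (\<Prod>k\<in>S. measure std_normal {x. sqrt (t - s) * x \<in> C k})"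
 using filt_independent_events[OF UNIV_in_filt_gen assms(1-3), of C] assms(4) cw.prob_space by (simp add: space_base)

lemma distr_brownian_increment:
 assumes "0 <= s" "s < t"
 shows "distributed Mw lborel (%Z. brownian k t Z - brownian k s Z) (normal_density 0 (sqrt (t - s)))"
proof -
 let ?D = "%Z. brownian k t Z - brownian k s Z"
 let ?N = "distr std_normal borel (%x. sqrt (t - s) * x)"
 interpret N: prob_space ?N by (rule sn.prob_space_distr) simp
 interpret D: prob_space "distr Mw borel ?D" by (rule cw.prob_space_distr) simp
 have s: "sets (distr Mw borel ?D) = sigma_sets UNIV (Collect closed)" "sets ?N = sigma_sets UNIV (Collect closed)"
  by (simp_all add: borel_eq_closed)
 have e: "emeasure (distr Mw borel ?D) UNIV \<noteq> top"
  unfolding D.emeasure_eq_measure by simp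
 have eq: "distr Mw borel ?D = ?N"
 proof (rule measure_eqI_generator_eq[where E="Collect closed" and \<Omega>=UNIV and A="%_. UNIV"])
  fix X :: "real set" assume "X \<in> Collect closed"
  then have X: "closed X" and [measurable]: "X \<in> sets borel" by auto
  show "emeasure (distr Mw borel ?D) X = emeasure ?N X"
   using increment_closed_prob[of "{k}" s t "%_. X"] assms X
   unfolding D.emeasure_eq_measure N.emeasure_eq_measure
   by (simp add: measure_distr vimage_def space_base)
 qed (use s e in \<open>auto simp: Int_stable_def\<close>)
 have dX: "distributed std_normal lborel (%x. x) std_normal_density"
  by (auto simp: distributed_def distr_id2)
 have "distributed std_normal lborel (%x. 0 + sqrt (t - s) * x) (normal_density (0 + sqrt (t - s) * 0) (\<bar>sqrt (t - s)\<bar> * 1))"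
  by (rule sn.normal_density_affine[OF dX]) (use assms in auto)
 then have "distr std_normal lborel (%x. sqrt (t - s) * x) = density lborel (normal_density 0 (sqrt (t - s)))"
  using assms by (simp add: distributed_def)
 then have "distr Mw lborel ?D = density lborel (normal_density 0 (sqrt (t - s)))"
  using eq by (simp cong: distr_cong)
 then show ?thesis by (auto simp: distributed_def)
qed

lemma wiener_process_brownian:
 assumes n: "n \<ge> 1"
 shows "wiener_process Mw Fw n brownian"
 unfolding wiener_process_def
proof (intro conjI allI impI ballI)
 fix s t :: real assume "0 <= s \<and> s < t"
 then have st: "0 <= s" "s < t" by auto
 let ?D = "%k Z. brownian k t Z - brownian k s Z"
 show "distributed Mw lborel (?D k) (normal_density 0 (sqrt (t - s)))" for k
  by (rule distr_brownian_increment[OF st])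
 show "cw.indep_vars (%_. borel) ?D {..<n}"
 proof (subst cw.indep_vars_finite[where E="%_. Collect closed"])
  show "\<forall>A\<in>{..<n} \<rightarrow> Collect closed. cw.prob (\<Inter>k\<in>{..<n}. ?D k -` A k \<inter> space Mw) = (\<Prod>k\<in>{..<n}. cw.prob (?D k -` A k \<inter> space Mw))"
  proof
   fix A :: "nat => real set" assume A: "A \<in> {..<n} \<rightarrow> Collect closed"
   \<comment> \<open>Extended by \<open>UNIV\<close>, because \<open>increment_closed_prob\<close>
     wants closed sets for all indices.\<close>
   define C where "C k = (if k < n then A k else UNIV)" for k
   have C: "closed (C k)" for k using A by (auto simp: C_def)
   have "cw.prob (\<Inter>k\<in>{..<n}. ?D k -` A k \<inter> space Mw) = cw.prob {Z. \<forall>k\<in>{..<n}. ?D k Z \<in> C k}"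
    using n by (intro arg_cong[where f=cw.prob]) (auto simp: C_def space_base)
   also have "\<dots> = (\<Prod>k\<in>{..<n}. measure std_normal {x. sqrt (t - s) * x \<in> C k})"
    using st C by (intro increment_closed_prob) auto
   also have "\<dots> = (\<Prod>k\<in>{..<n}. cw.prob (?D k -` A k \<inter> space Mw))"
   proof (rule prod.cong)
    fix k assume "k \<in> {..<n}"
    then show "measure std_normal {x. sqrt (t - s) * x \<in> C k} = cw.prob (?D k -` A k \<inter> space Mw)"
     using increment_closed_prob[of "{k}" s t C] st C by (simp add: vimage_def space_base C_def)
   qed simp
   finally show "cw.prob (\<Inter>k\<in>{..<n}. ?D k -` A k \<inter> space Mw) = (\<Prod>k\<in>{..<n}. cw.prob (?D k -` A k \<inter> space Mw))" .
  qed
  have "sets (borel :: real measure) = sigma_sets UNIV (Collect closed)" by (simp add: borel_eq_closed)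
  then show "sets (borel :: real measure) = sigma_sets (space borel) (Collect closed)" by simp
 qed (use n in \<open>auto simp: Int_stable_def lessThan_empty_iff\<close>)
 show "cw.indep_set (sets (Fw s)) (sets (vimage_algebra (space Mw) (%Z. \<lambda>k\<in>{..<n}. ?D k Z) (Pi\<^sub>M {..<n} (%_. borel))))"
 proof -
  \<comment> \<open>Independence is first proved for one generator per label: the past under
    \<open>None\<close>, each component under \<open>Some k\<close>.\<close>
  define E where "E l = (case l of None => filt_gen s | Some k => {?D k -` C | C. closed C})" for l
  define L where "L = insert None (Some ` {..<n})"
  have [simp]: "finite L" "L \<noteq> {}" by (auto simp: L_def)
  have "cw.indep_sets E L"
  proof (subst cw.indep_sets_finite)
   show "E l \<subseteq> cw.events" for l
   proof (cases l)
    case (Some k)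
    have "?D k -` C \<in> sets Mw" if "closed C" for C
     using measurable_sets[of "?D k" Mw borel C] that by (simp add: space_base)
    then show ?thesis by (auto simp: E_def Some)
   qed (auto simp: E_def filt_gen_def)
   show "space Mw \<in> E l" for l
    by (cases l) (auto simp: E_def space_base UNIV_in_filt_gen intro!: exI[of _ UNIV])
   show "\<forall>A\<in>Pi L E. cw.prob (\<Inter>j\<in>L. A j) = (\<Prod>j\<in>L. cw.prob (A j))"
   proof
    fix A assume A: "A \<in> Pi L E"
    have "\<forall>k\<in>{..<n}. \<exists>C. closed C \<and> A (Some k) = ?D k -` C"
    proof
     fix k assume "k \<in> {..<n}"
     then have "A (Some k) \<in> E (Some k)" using A by (auto simp: L_def)
     then show "\<exists>C. closed C \<and> A (Some k) = ?D k -` C" by (auto simp: E_def)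
    qed
    then obtain C' where C': "\<And>k. k < n ==> closed (C' k) \<and> A (Some k) = ?D k -` C' k" by (metis lessThan_iff)
    define C where "C k = (if k < n then C' k else UNIV)" for k
    have C: "closed (C k)" for k using C' by (auto simp: C_def)
    have AN: "A None \<in> filt_gen s" using A by (auto simp: L_def E_def Pi_iff)
    have "(\<Inter>j\<in>L. A j) = A None \<inter> {Z. \<forall>k\<in>{..<n}. ?D k Z \<in> C k}"
     using C' by (auto simp: L_def C_def)
    then have "cw.prob (\<Inter>j\<in>L. A j) = cw.prob (A None) * (\<Prod>k\<in>{..<n}. measure std_normal {x. sqrt (t - s) * x \<in> C k})"
     using filt_independent_events[OF AN _ st, of "{..<n}" C] C by simp
    also have "(\<Prod>k\<in>{..<n}. measure std_normal {x. sqrt (t - s) * x \<in> C k}) = (\<Prod>k\<in>{..<n}. cw.prob (A (Some k)))"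
    proof (rule prod.cong)
     fix k assume "k \<in> {..<n}"
     then show "measure std_normal {x. sqrt (t - s) * x \<in> C k} = cw.prob (A (Some k))"
      using increment_closed_prob[of "{k}" s t C] st C C'[of k] by (simp add: vimage_def C_def)
    qed simp
    finally show "cw.prob (\<Inter>j\<in>L. A j) = (\<Prod>j\<in>L. cw.prob (A j))"
     by (simp add: L_def prod.reindex)
   qed
  qed simp_all
  \<comment> \<open>Merging all labels \<open>Some k\<close> gives independence of the past from the
    whole vector of increments.\<close>
  define J where "J b = (if b then {None :: nat option} else Some ` {..<n})" for b
  have "cw.indep_sets (%b. sigma_sets (space Mw) (\<Union>i\<in>J b. E i)) (UNIV :: bool set)"
  proof (rule cw.indep_sets_collect_sigma)
   show "cw.indep_sets E (\<Union>b\<in>UNIV. J b)"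
    using \<open>cw.indep_sets E L\<close> by (simp add: J_def L_def UNIV_bool Un_commute)
   show "Int_stable (E i)" for i
   proof (cases i)
    case (Some k)
    show ?thesis
    proof (rule Int_stableI)
     fix a b assume "a \<in> E i" "b \<in> E i"
     then obtain C C' where "closed C" "a = ?D k -` C" "closed C'" "b = ?D k -` C'" by (auto simp: E_def Some)
     then show "a \<inter> b \<in> E i" unfolding E_def Some by (auto intro!: exI[of _ "C \<inter> C'"])
    qed
   qed (simp add: E_def filt_gen_Int_stable)
  qed (auto simp: disjoint_family_on_def J_def)
  then have ind: "cw.indep_set (sigma_sets UNIV (filt_gen s)) (sigma_sets UNIV (\<Union>i\<in>Some ` {..<n}. E i))"
   unfolding cw.indep_set_def
   by (rule back_subst[where P="%x. cw.indep_sets x UNIV"]) (auto simp: fun_eq_iff J_def E_def space_base split: bool.split)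
  define \<Sigma> where "\<Sigma> = sigma UNIV (\<Union>i\<in>Some ` {..<n}. E i)"
  have S: "sets \<Sigma> = sigma_sets UNIV (\<Union>i\<in>Some ` {..<n}. E i)" "space \<Sigma> = UNIV" by (simp_all add: \<Sigma>_def)
  have "?D k \<in> bm \<Sigma>" if "k < n" for k
  proof (rule borel_measurableI_le)
   fix y
   have "?D k -` {..y} \<in> E (Some k)" by (auto simp: E_def)
   then have "?D k -` {..y} \<in> sets \<Sigma>" unfolding S using that by (intro sigma_sets.Basic) auto
   then show "{x \<in> space \<Sigma>. ?D k x <= y} \<in> sets \<Sigma>" by (simp add: vimage_def S)
  qed
  then have "(%Z. \<lambda>k\<in>{..<n}. ?D k Z) \<in> measurable \<Sigma> (Pi\<^sub>M {..<n} (%_. borel))"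
   by (intro measurable_restrict) auto
  then have "sets (vimage_algebra UNIV (%Z. \<lambda>k\<in>{..<n}. ?D k Z) (Pi\<^sub>M {..<n} (%_. borel))) \<subseteq> sets \<Sigma>"
   unfolding sets_vimage_algebra using sets.sigma_sets_subset[of _ \<Sigma>] S(2)
   by (intro sets.sigma_sets_subset[of _ \<Sigma>, unfolded S(2)]) (auto dest: measurable_sets simp: S(2))
  with ind show ?thesis
   unfolding cw.indep_set_def S sets_Fw
   by (rule_tac cw.indep_sets_mono_sets) (auto simp: space_base split: bool.splits)
 qed
qed (auto intro: continuous_brownian measurable_brownian_Fw)

theorem wiener_process_exists:
 assumes "n \<ge> 1"
 obtains M :: "sample measure" and F w where "complete_filtered_space M F" "wiener_process M F n w"
 using filtered_Mw wiener_process_brownian[OF assms] by blast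

section \<open>The Euler scheme\<close>

text \<open>The sum is at most n times its largest term. The crude constant only enters
  \<open>A2\<close> and \<open>A3\<close>.\<close>

lemma sum_power_le:
 fixes x :: "nat => real"
 assumes "\<And>k. k < n ==> 0 <= x k" and "n \<noteq> 0"
 shows "(\<Sum>k<n. x k) ^ m <= real n ^ m * (\<Sum>k<n. x k ^ m)"
proof -
 define y where "y = Max (x ` {..<n})"
 have "y \<in> x ` {..<n}" unfolding y_def using assms by (intro Max_in) auto
 then obtain k where k: "k < n" "y = x k" by auto
 have le: "x i <= y" if "i < n" for i unfolding y_def using that by (intro Max_ge) auto
 have "(\<Sum>k<n. x k) <= real n * y" using sum_bounded_above[of "{..<n}" x y] le by simp
 then have "(\<Sum>k<n. x k) ^ m <= (real n * y) ^ m" using assms by (intro power_mono sum_nonneg) auto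
 also have "\<dots> = real n ^ m * x k ^ m" by (simp add: power_mult_distrib k)
 also have "\<dots> <= real n ^ m * (\<Sum>k<n. x k ^ m)"
  using k assms by (intro mult_left_mono member_le_sum) auto
 finally show ?thesis .
qed

section \<open>Moments and independence of Wiener increments\<close>

locale wiener_setup =
 fixes M :: "'w measure" and F :: "real => 'w measure" and n :: nat and w :: "nat => real => 'w => real"
 assumes filtered: "complete_filtered_space M F" and wiener: "wiener_process M F n w"
begin

sublocale prob_space M
 using filtered by (simp add: complete_filtered_space_def)

lemma space_F: "space (F t) = space M"
 using filtered by (simp add: complete_filtered_space_def filtration_def)

lemma sets_F_mono: "s <= t ==> sets (F s) \<subseteq> sets (F t)"
 using filtered by (simp add: complete_filtered_space_def filtration_def)

lemma sets_F: "0 <= t ==> sets (F t) \<subseteq> sets M"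
 using filtered by (simp add: complete_filtered_space_def)

lemma measurable_F_mono: "f \<in> measurable (F s) N ==> s <= t ==> f \<in> measurable (F t) N"
 using sets_F_mono[of s t] by (auto simp: measurable_def space_F)

lemma measurable_F: "f \<in> measurable (F s) N ==> 0 <= s ==> f \<in> measurable M N"
 using sets_F[of s] by (auto simp: measurable_def space_F)

lemma w_continuous: "k < n ==> Z \<in> space M ==> continuous_on {0..} (%t. w k t Z)"
 using wiener by (simp add: wiener_process_def)

lemma w_measurable: "k < n ==> 0 <= s ==> s <= t ==> w k s \<in> bm (F t)"
 using wiener measurable_F_mono[of "w k s" s borel t] by (simp add: wiener_process_def)

lemma w_measurable_M: "k < n ==> 0 <= s ==> w k s \<in> bm M"
 using w_measurable measurable_F by blast

abbreviation incr :: "real => real => nat => 'w => real" where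
 "incr s t k Z \<equiv> w k t Z - w k s Z"

lemma incr_measurable: "k < n ==> 0 <= s ==> s <= t ==> incr s t k \<in> bm M"
 by (intro borel_measurable_diff w_measurable_M) auto

lemma incr_dist: "0 <= s ==> s < t ==> k < n ==> distributed M lborel (incr s t k) (normal_density 0 (sqrt (t - s)))"
 using wiener by (simp add: wiener_process_def)

lemma incr_abs_moment:
 assumes st: "0 <= s" "s < t" and k: "k < n"
 shows "integrable M (%Z. \<bar>incr s t k Z\<bar> ^ m)"
 using distributed_integrable[OF incr_dist[OF st k], of "%x. \<bar>x\<bar> ^ m"] integrable_normal_moment_abs[of "sqrt (t - s)" 0 m] st
 by simp

lemma incr_mean: 
 assumes st: "0 <= s" "s < t" and k: "k < n"
 shows "expectation (incr s t k) = 0"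
 using normal_distributed_expectation[OF _ incr_dist[OF assms]] st by simp

lemma incr_square:
 assumes st: "0 <= s" "s < t" and k: "k < n"
 shows "expectation (%Z. (incr s t k Z)\<^sup>2) = t - s"
proof -
 have "expectation (%Z. (incr s t k Z)\<^sup>2) = (\<integral>x. normal_density 0 (sqrt (t - s)) x * x\<^sup>2 \<partial>lborel)"
  using distributed_integral[OF incr_dist[OF assms], of "%x. x\<^sup>2"] by simp
 then show ?thesis using integral_normal_moment_even[of "sqrt (t - s)" 0 1] st by (simp add: fact_numeral)
qed

lemma incr_cube:
 assumes st: "0 <= s" "s < t" and k: "k < n"
 shows "expectation (%Z. \<bar>incr s t k Z\<bar> ^ 3) <= 2 * sqrt (t - s) ^ 3"
proof -
 have "expectation (%Z. \<bar>incr s t k Z\<bar> ^ 3) = (\<integral>x. normal_density 0 (sqrt (t - s)) x * \<bar>x\<bar>^3 \<partial>lborel)"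
  using distributed_integral[OF incr_dist[OF assms], of "%x. \<bar>x\<bar>^3"] by simp
 also have "\<dots> = 2 * sqrt (t - s) ^ 3 * sqrt (2 / pi)"
  using integral_normal_moment_abs_odd[of "sqrt (t - s)" 0 1] st by (simp add: numeral_3_eq_3)
 also have "\<dots> <= 2 * sqrt (t - s) ^ 3 * 1"
  using st pi_gt3 by (intro mult_left_mono) auto
 finally show ?thesis by simp
qed

lemma incr_indep_past:
 assumes st: "0 <= s" "s < t" and H: "H \<in> bm (F s)" and G: "G \<in> bm (Pi\<^sub>M {..<n} (%_. borel))"
 shows "indep_var borel H borel (%Z. G (\<lambda>k\<in>{..<n}. incr s t k Z) :: real)"
proof -
 let ?V = "vimage_algebra (space M) (%Z. \<lambda>k\<in>{..<n}. incr s t k Z) (Pi\<^sub>M {..<n} (%_. borel))"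
 have ind: "indep_set (sets (F s)) (sets ?V)"
  using wiener st by (simp add: wiener_process_def)
 have mV: "(%Z. \<lambda>k\<in>{..<n}. incr s t k Z) \<in> measurable M (Pi\<^sub>M {..<n} (%_. borel))"
  using st by (intro measurable_restrict incr_measurable) auto
 have GV: "(%Z. G (\<lambda>k\<in>{..<n}. incr s t k Z)) \<in> bm ?V"
  by (intro measurable_compose[OF _ G] measurable_vimage_algebra1) (auto simp: space_PiM)
 have spV: "space ?V = space M" by simp
 show ?thesis
  unfolding indep_var_eq
 proof (intro conjI)
  show "random_variable borel H" using H st by (intro measurable_F) auto
  show "random_variable borel (%Z. G (\<lambda>k\<in>{..<n}. incr s t k Z))" by (rule measurable_compose[OF mV G])
  have 1: "sigma_sets (space M) {H -` A \<inter> space M |A. A \<in> sets borel} \<subseteq> sets (F s)"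
   using measurable_sets[OF H] sets.sigma_sets_subset[of _ "F s"] by (auto simp: space_F intro!: sets.sigma_sets_subset[of _ "F s", unfolded space_F])
  have 2: "sigma_sets (space M) {(%Z. G (\<lambda>k\<in>{..<n}. incr s t k Z)) -` A \<inter> space M |A. A \<in> sets borel} \<subseteq> sets ?V"
   using measurable_sets[OF GV] by (intro sets.sigma_sets_subset[of _ ?V, unfolded spV]) (auto simp: spV)
  show "indep_set (sigma_sets (space M) {H -` A \<inter> space M |A. A \<in> sets borel})
  (sigma_sets (space M) {(%Z. G (\<lambda>k\<in>{..<n}. incr s t k Z)) -` A \<inter> space M |A. A \<in> sets borel})"
   using ind unfolding indep_set_def by (rule indep_sets_mono_sets) (use 1 2 in \<open>auto split: bool.splits\<close>)
 qed
qed

lemma bounded_integrable: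
 "f \<in> bm M ==> (\<And>Z. Z \<in> space M ==> \<bar>f Z\<bar> <= (C::real)) ==> integrable M f"
 by (rule integrable_const_bound[where B=C]) auto

lemma past_times_incr:
 assumes st: "0 <= s" "s < t" and k: "k < n" and H: "H \<in> bm (F s)" "\<And>Z. Z \<in> space M ==> \<bar>H Z\<bar> <= C"
 shows "integrable M (%Z. H Z * incr s t k Z)" "expectation (%Z. H Z * incr s t k Z) = 0"
proof -
 have ind: "indep_var borel H borel (%Z. (%x. x k) (\<lambda>k\<in>{..<n}. incr s t k Z))"
  using k by (intro incr_indep_past[OF st H(1)]) auto
 have iH: "integrable M H" using H st by (intro bounded_integrable measurable_F) auto
 have iI: "integrable M (%Z. (%x. x k) (\<lambda>k\<in>{..<n}. incr s t k Z))"
  using incr_abs_moment[OF st k, of 1] k st by (simp add: integrable_abs_iff incr_measurable)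
 show "integrable M (%Z. H Z * incr s t k Z)"
  using indep_var_integrable[OF ind iH iI] k by simp
 show "expectation (%Z. H Z * incr s t k Z) = 0"
  using indep_var_lebesgue_integral[OF ind iH iI] k incr_mean[OF st k] by simp
qed

lemma incr_cross:
 assumes st: "0 <= s" "s < t" and k: "k < n" "l < n" 
 shows "integrable M (%Z. incr s t k Z * incr s t l Z)"
  and "expectation (%Z. incr s t k Z * incr s t l Z) = (if k = l then t - s else 0)"
proof -
 have i: "integrable M (incr s t k)" if "k < n" for k
  using incr_abs_moment[OF st that, of 1] that st by (simp add: integrable_abs_iff incr_measurable)
 have sq: "integrable M (%Z. (incr s t k Z)\<^sup>2)" if "k < n" for k
  using incr_abs_moment[OF st that, of 2] by simp
 have "integrable M (%Z. incr s t k Z * incr s t l Z) \<and>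
   expectation (%Z. incr s t k Z * incr s t l Z) = (if k = l then t - s else 0)"
 proof (cases "k = l")
  case True
  then show ?thesis using sq[OF k(1)] incr_square[OF st k(1)] by (simp add: power2_eq_square)
 next
  case False
  have "indep_vars (%_. borel) (incr s t) {..<n}" using wiener st by (simp add: wiener_process_def)
  then have ind: "indep_vars (%_. borel) (incr s t) {k, l}"
   by (rule indep_vars_subset) (use k in auto)
  have "integrable M (%Z. \<Prod>i\<in>{k, l}. incr s t i Z)"
   by (rule indep_vars_integrable[OF _ ind]) (use i k in auto)
  moreover have "expectation (%Z. \<Prod>i\<in>{k, l}. incr s t i Z) = (\<Prod>i\<in>{k, l}. expectation (incr s t i))"
   by (rule indep_vars_lebesgue_integral[OF _ ind]) (use i k in auto)
  ultimately show ?thesis using False incr_mean[OF st k(1)] by simp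
 qed
 then show "integrable M (%Z. incr s t k Z * incr s t l Z)"
  "expectation (%Z. incr s t k Z * incr s t l Z) = (if k = l then t - s else 0)" by auto
qed

lemma past_times_incr2:
 assumes st: "0 <= s" "s < t" and k: "k < n" "l < n" and H: "H \<in> bm (F s)" "\<And>Z. Z \<in> space M ==> \<bar>H Z\<bar> <= C"
 shows "integrable M (%Z. H Z * (incr s t k Z * incr s t l Z))"
  and "expectation (%Z. H Z * (incr s t k Z * incr s t l Z)) = (if k = l then (t - s) * expectation H else 0)"
proof -
 have ind: "indep_var borel H borel (%Z. (%x. x k * x l) (\<lambda>k\<in>{..<n}. incr s t k Z))"
  using k by (intro incr_indep_past[OF st H(1)]) auto
 have iH: "integrable M H" using H st by (intro bounded_integrable measurable_F) auto
 have iI: "integrable M (%Z. (%x. x k * x l) (\<lambda>k\<in>{..<n}. incr s t k Z))"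
  using incr_cross(1)[OF st k] k by simp
 show "integrable M (%Z. H Z * (incr s t k Z * incr s t l Z))"
  using indep_var_integrable[OF ind iH iI] k by simp
 show "expectation (%Z. H Z * (incr s t k Z * incr s t l Z)) = (if k = l then (t - s) * expectation H else 0)"
  using indep_var_lebesgue_integral[OF ind iH iI] k incr_cross(2)[OF st k] by simp
qed

text \<open>The path is read at multiples of 1 / (m + 1), where time takes countably many values,
  and m grows; continuity of the path gives the limit. Clipping to [0, T] keeps every time
  observable at T.\<close>

lemma w_joint_measurable:
 assumes T: "0 <= T" and k: "k < n"
 shows "(%(t, Z). w k (max 0 (min T t)) Z) \<in> bm (borel \<Otimes>\<^sub>M F T)"
proof -
 define c where "c m t = max 0 (min T (real_of_int \<lfloor>real (Suc m) * t\<rfloor> / real (Suc m)))" for m t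
 have "(%p. w k (c m (fst p)) (snd p)) \<in> bm (borel \<Otimes>\<^sub>M F T)" for m
 proof -
  have "(%p. (%i p. w k (max 0 (min T (real_of_int i / real (Suc m)))) (snd p)) \<lfloor>real (Suc m) * fst p\<rfloor> p) \<in> bm (borel \<Otimes>\<^sub>M F T)"
  proof (rule measurable_compose_countable[where f="%i p. w k (max 0 (min T (real_of_int i / real (Suc m)))) (snd p)" and g="%p. \<lfloor>real (Suc m) * fst p\<rfloor>"])
   show "(%p. w k (max 0 (min T (real_of_int i / real (Suc m)))) (snd p)) \<in> bm (borel \<Otimes>\<^sub>M F T)" for i
    using T k by (intro measurable_compose[OF measurable_snd] w_measurable) auto
  qed measurable
  then show ?thesis by (simp add: c_def)
 qed
 moreover have "(%m. w k (c m (fst p)) (snd p)) ---> w k (max 0 (min T (fst p))) (snd p)" if "p \<in> space (borel \<Otimes>\<^sub>M F T)" for p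
 proof -
  have Z: "snd p \<in> space M" using that by (auto simp: space_pair_measure space_F)
  have "(%m. real_of_int \<lfloor>real (Suc m) * fst p\<rfloor> / real (Suc m)) ---> fst p"
  proof (rule tendsto_sandwich[where f="%m. fst p - 1 / real (Suc m)" and h="%_. fst p"])
   show "(%m. fst p - 1 / real (Suc m)) ---> fst p"
    using tendsto_diff[OF tendsto_const[of "fst p"] LIMSEQ_inverse_real_of_nat] by (simp add: inverse_eq_divide)
   show "EV m. fst p - 1 / real (Suc m) <= real_of_int \<lfloor>real (Suc m) * fst p\<rfloor> / real (Suc m)"
   proof (intro always_eventually allI)
    fix m
    have "(x - 1 / c) * c = c * x - 1" if "c > 0" for x c :: real using that by (simp add: field_simps)
    from this[of "real (Suc m)" "fst p"]
    have "(fst p - 1 / real (Suc m)) * real (Suc m) = real (Suc m) * fst p - 1" by simp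
    then show "fst p - 1 / real (Suc m) <= real_of_int \<lfloor>real (Suc m) * fst p\<rfloor> / real (Suc m)"
     by (subst pos_le_divide_eq) linarith+
   qed
   show "EV m. real_of_int \<lfloor>real (Suc m) * fst p\<rfloor> / real (Suc m) <= fst p"
    by (intro always_eventually allI, subst pos_divide_le_eq) (auto simp: mult.commute)
  qed auto
  then have "(%m. c m (fst p)) ---> max 0 (min T (fst p))"
   unfolding c_def by (intro tendsto_max tendsto_min tendsto_const)
  then show ?thesis
   by (rule continuous_on_tendsto_compose[OF w_continuous[OF k Z]]) (auto simp: c_def)
 qed
 ultimately have "(%p. w k (max 0 (min T (fst p))) (snd p)) \<in> bm (borel \<Otimes>\<^sub>M F T)"
  by (rule borel_measurable_LIMSEQ_real[rotated])
 then show ?thesis by (simp add: case_prod_beta)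
qed

end

section \<open>The Euler scheme and its interpolation\<close>

locale euler = wiener_setup M F n w
 for M :: "'w measure" and F n w +
 fixes s :: "nat => real^'d => real^'d" and b :: "real^'d => real^'d" and h r Cs Cb :: real
 assumes n_gt: "1 < n" and h_pos: "0 < h" and r_pos: "0 < r"
  and s_meas [measurable]: "\<And>k. s k \<in> bm borel" and s_bound: "\<And>k y. norm (s k y) <= Cs"
  and b_meas [measurable]: "b \<in> bm borel" and b_bound: "\<And>y. norm (b y) <= Cb"
begin

definition grid_time :: "nat => real" where "grid_time j = real j * h"

definition kick :: "nat => real^'d => real => 'w => real^'d" where
 "kick j y t Z = (\<Sum>k<n. (w k (max t (grid_time j)) Z - w k (grid_time j) Z) *\<^sub>R s k y)"

text \<open>Keeping the drift only while the kick is at most \<open>r\<close> keeps \<open>x t\<close> close to the grid value \<open>X j\<close> whenever the drift acts, as the domination \<open>norm (drift t) \<le> \<bb> (x t)\<close> requires.\<close>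

definition active :: "nat => real^'d => real => 'w => real" where
 "active j y t Z = of_bool (norm (kick j y t Z) <= r)"

definition active_time :: "nat => real^'d => real => 'w => real" where
 "active_time j y t Z = (LINT u:{grid_time j..t}|lborel. active j y u Z)"

text \<open>The start is 0; other starting points come from translating the coefficients in
  \<open>key_estimate_scaled\<close>. The drift acts for the duration \<open>active_time\<close>,
  which may be shorter than the step h.\<close>

primrec X :: "nat => 'w => real^'d" where
 "X 0 Z = 0"
| "X (Suc j) Z = X j Z + kick j (X j Z) (grid_time (Suc j)) Z
  + active_time j (X j Z) (grid_time (Suc j)) Z *\<^sub>R b (X j Z)"

definition step_of :: "real => nat" where "step_of t = nat \<lfloor>t / h\<rfloor>"

definition sig :: "nat => real => 'w => real^'d" where
 "sig k t Z = s k (X (step_of t) Z)"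

definition drift :: "real => 'w => real^'d" where
 "drift t Z = active (step_of t) (X (step_of t) Z) t Z *\<^sub>R b (X (step_of t) Z)"

text \<open>The running step is included and clipped at t, so one formula serves grid points and
  interior times.\<close>

definition ito :: "nat => real => 'w => real^'d" where
 "ito k t Z = (\<Sum>j\<le>step_of t. (w k (min (grid_time (Suc j)) t) Z - w k (min (grid_time j) t) Z) *\<^sub>R s k (X j Z))"

definition x :: "real => 'w => real^'d" where
 "x t Z = (\<Sum>k<n. ito k t Z) + (LINT u:{0..t}|lborel. drift u Z)"

lemma grid_time_simps [simp]: "grid_time 0 = 0" "grid_time (Suc j) = grid_time j + h" "0 <= grid_time j"
 using h_pos by (auto simp: grid_time_def algebra_simps)

lemma grid_time_less: "grid_time i < grid_time j \<longleftrightarrow> i < j" "grid_time i <= grid_time j \<longleftrightarrow> i <= j"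
 using h_pos by (auto simp: grid_time_def)

lemma step_of_eq: "grid_time j <= t ==> t < grid_time (Suc j) ==> step_of t = j"
proof -
 assume t: "grid_time j <= t" "t < grid_time (Suc j)"
 then have "real j <= t / h" "t / h < real j + 1" using h_pos by (auto simp: grid_time_def field_simps)
 then show ?thesis unfolding step_of_def by linarith
qed

lemma step_of_bounds: "0 <= t ==> grid_time (step_of t) <= t" "0 <= t ==> t < grid_time (Suc (step_of t))"
proof -
 assume t: "0 <= t"
 have "real (step_of t) <= t / h" "t / h < real (step_of t) + 1"
  using t h_pos unfolding step_of_def by (auto simp: nat_less_iff)
 then show "grid_time (step_of t) <= t" "t < grid_time (Suc (step_of t))"
  using h_pos by (auto simp: grid_time_def field_simps)
qed

lemma step_of_mono: "u <= t ==> step_of u <= step_of t"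
 unfolding step_of_def using h_pos by (intro nat_mono floor_mono divide_right_mono) auto

lemma kick_continuous: "Z \<in> space M ==> cont (%t. kick j y t Z)"
 unfolding kick_def
 by (intro continuous_intros continuous_on_compose2[OF w_continuous]) (auto simp: le_max_iff_disj)

lemma active_measurable: "Z \<in> space M ==> (%t. active j y t Z) \<in> bm borel"
proof -
 assume Z: "Z \<in> space M"
 have [measurable]: "(%t. kick j y t Z) \<in> bm borel"
  by (rule bm_contI[OF kick_continuous[OF Z]])
 show ?thesis unfolding active_def by measurable
qed

lemma active_bounds: "0 <= active j y t Z" "active j y t Z <= 1"
 by (auto simp: active_def)

lemma active_integrable: "Z \<in> space M ==> set_integrable lborel {a..t} (%u. active j y u Z)"
proof -
 assume Z: "Z \<in> space M"
 note [measurable] = active_measurable[OF Z]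
 show ?thesis unfolding set_integrable_def
  by (rule integrableI_bounded_set_indicator[where B=1])
   (auto simp: active_bounds abs_le_iff emeasure_lborel_Icc_eq intro!: AE_I2 order_trans[OF _ active_bounds(1)])
qed

lemma active_time_bounds:
 assumes "Z \<in> space M" "grid_time j <= t"
 shows "0 <= active_time j y t Z" "active_time j y t Z <= t - grid_time j"
proof -
 show "0 <= active_time j y t Z" unfolding active_time_def set_lebesgue_integral_def
  by (intro integral_nonneg_AE AE_I2) (simp add: active_bounds)
 have "active_time j y t Z <= (LINT u:{grid_time j..t}|lborel. 1)" unfolding active_time_def
  using borel_integrable_atLeastAtMost'[of "grid_time j" t "%_. 1 :: real"]
  by (intro set_integral_mono active_integrable assms) (auto simp: active_bounds)
 then show "active_time j y t Z <= t - grid_time j"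
  using assms(2) by (simp add: set_lebesgue_integral_def)
qed

lemma kick_joint_measurable:
 assumes T: "grid_time j <= T" and Y: "Y \<in> bm (F T)"
 shows "(%(t, Z). kick j (Y Z) (min T t) Z) \<in> bm (borel \<Otimes>\<^sub>M F T)"
proof -
 have T0: "0 <= T" using T grid_time_simps(3)[of j] by linarith
 note [measurable] = Y
 have 1: "(%p. w k (max (min T (fst p)) (grid_time j)) (snd p)) \<in> bm (borel \<Otimes>\<^sub>M F T)" if "k < n" for k
 proof -
  have "(%p. (%(t, Z). w k (max 0 (min T t)) Z) (max (fst p) (grid_time j), snd p)) \<in> bm (borel \<Otimes>\<^sub>M F T)"
   by (rule measurable_compose[OF _ w_joint_measurable[OF T0 that]]) measurable
  moreover have "max 0 (min T (max t (grid_time j))) = max (min T t) (grid_time j)" for t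
   using T grid_time_simps(3)[of j] by (auto simp: max_def min_def simp del: grid_time_simps)
  ultimately show ?thesis by (simp add: case_prod_beta)
 qed
 have 2: "(%p. w k (grid_time j) (snd p)) \<in> bm (borel \<Otimes>\<^sub>M F T)" if "k < n" for k
  using that T by (intro measurable_compose[OF measurable_snd] w_measurable) auto
 show ?thesis unfolding kick_def case_prod_beta
  using 1 2 by (intro borel_measurable_sum borel_measurable_scaleR borel_measurable_diff) (auto intro!: measurable_compose[OF _ s_meas])
qed

lemma active_joint_measurable:
 assumes T: "grid_time j <= T" and Y: "Y \<in> bm (F T)"
 shows "(%(t, Z). active j (Y Z) (min T t) Z) \<in> bm (borel \<Otimes>\<^sub>M F T)"
proof -
 have [measurable]: "(%p. kick j (Y (snd p)) (min T (fst p)) (snd p)) \<in> bm (borel \<Otimes>\<^sub>M F T)"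
  using kick_joint_measurable[OF assms] by (simp add: case_prod_beta)
 show ?thesis unfolding active_def case_prod_beta by measurable
qed

lemma active_time_measurable:
 assumes T: "grid_time j <= T" and Y: "Y \<in> bm (F T)"
 shows "(%Z. active_time j (Y Z) T Z) \<in> bm (F T)"
proof -
 have "(%p. active j (Y (snd p)) (min T (fst p)) (snd p)) \<in> bm (borel \<Otimes>\<^sub>M F T)"
  using active_joint_measurable[OF assms] by (simp add: case_prod_beta)
 from measurable_compose[OF measurable_pair_swap' this]
 have 1[measurable]: "(%p. active j (Y (fst p)) (min T (snd p)) (fst p)) \<in> bm (F T \<Otimes>\<^sub>M borel)"
  by (simp add: case_prod_beta)
 have "(%Z. \<integral>u. indicator {grid_time j..T} u *\<^sub>R active j (Y Z) (min T u) Z \<partial>lborel) \<in> bm (F T)"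
 proof (rule sigma_finite_measure.borel_measurable_lebesgue_integral)
  have "(%p. indicator {grid_time j..T} (snd p) *\<^sub>R active j (Y (fst p)) (min T (snd p)) (fst p)) \<in> bm (F T \<Otimes>\<^sub>M borel)"
   by measurable
  then show "(%(Z, u). indicator {grid_time j..T} u *\<^sub>R active j (Y Z) (min T u) Z) \<in> bm (F T \<Otimes>\<^sub>M lborel)"
   by (simp add: case_prod_beta cong: measurable_cong_sets)
 qed (rule lborel.sigma_finite_measure_axioms)
 also have "(%Z. \<integral>u. indicator {grid_time j..T} u *\<^sub>R active j (Y Z) (min T u) Z \<partial>lborel) = (%Z. active_time j (Y Z) T Z)"
  unfolding active_time_def set_lebesgue_integral_def
  by (intro ext Bochner_Integration.integral_cong) (auto simp: indicator_def min_def)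
 finally show ?thesis .
qed

lemma kick_measurable:
 assumes T: "grid_time j <= T" and Y: "Y \<in> bm (F T)"
 shows "(%Z. kick j (Y Z) T Z) \<in> bm (F T)"
proof -
 have "(%Z. (%(t, Z). kick j (Y Z) (min T t) Z) (T, Z)) \<in> bm (F T)"
  by (rule measurable_compose[OF _ kick_joint_measurable[OF assms]]) measurable
 then show ?thesis by simp
qed

lemma X_measurable: "X j \<in> bm (F (grid_time j))"
proof (induction j)
 case (Suc j)
 have X: "X j \<in> bm (F (grid_time (Suc j)))"
  using h_pos by (intro measurable_F_mono[OF Suc]) simp
 have T: "grid_time j <= grid_time (Suc j)" using h_pos by simp
 show ?case
  using kick_measurable[OF T X] active_time_measurable[OF T X] measurable_compose[OF X b_meas] X
  by (simp del: grid_time_simps)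
qed simp

lemma X_measurable': "grid_time j <= t ==> X j \<in> bm (F t)"
 using X_measurable measurable_F_mono by blast

text \<open>Steps after t have both end points clipped to t and vanish. A summation range
  independent of t yields continuity and matches \<open>step_integral\<close>.\<close>

lemma ito_extend:
 assumes "0 <= t" "step_of t <= N"
 shows "ito k t Z = (\<Sum>j\<le>N. (w k (min (grid_time (Suc j)) t) Z - w k (min (grid_time j) t) Z) *\<^sub>R s k (X j Z))"
 unfolding ito_def
proof (rule sum.mono_neutral_left)
 show "\<forall>j\<in>{..N} - {..step_of t}. (w k (min (grid_time (Suc j)) t) Z - w k (min (grid_time j) t) Z) *\<^sub>R s k (X j Z) = 0"
 proof
  fix j assume "j \<in> {..N} - {..step_of t}"
  then have "grid_time (Suc (step_of t)) <= grid_time j" by (simp only: grid_time_less) auto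
  then have "t <= grid_time j" using step_of_bounds(2)[OF assms(1)] by linarith
  then show "(w k (min (grid_time (Suc j)) t) Z - w k (min (grid_time j) t) Z) *\<^sub>R s k (X j Z) = 0"
   using h_pos by (simp add: min_def)
 qed
qed (use assms in auto)

lemma ito_on_step:
 assumes t: "grid_time j <= t" "t <= grid_time (Suc j)"
 shows "ito k t Z = (\<Sum>i<j. (w k (grid_time (Suc i)) Z - w k (grid_time i) Z) *\<^sub>R s k (X i Z))
  + (w k t Z - w k (grid_time j) Z) *\<^sub>R s k (X j Z)"
proof -
 have t0: "0 <= t" using t(1) grid_time_simps(3)[of j] by linarith
 \<comment> \<open>\<open>Suc j\<close> and not j: at the right end point of the step the index
   \<open>step_of t\<close> has already advanced.\<close>
 have "step_of t <= Suc j"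
 proof (rule ccontr)
  assume "\<not> step_of t <= Suc j"
  then have "grid_time (Suc j) < grid_time (step_of t)" by (simp only: grid_time_less)
  then show False using step_of_bounds(1)[OF t0] t by linarith
 qed
 then have "ito k t Z = (\<Sum>i\<le>Suc j. (w k (min (grid_time (Suc i)) t) Z - w k (min (grid_time i) t) Z) *\<^sub>R s k (X i Z))"
  by (rule ito_extend[OF t0])
 also have "\<dots> = (\<Sum>i<j. (w k (min (grid_time (Suc i)) t) Z - w k (min (grid_time i) t) Z) *\<^sub>R s k (X i Z))
  + (w k (min (grid_time (Suc j)) t) Z - w k (min (grid_time j) t) Z) *\<^sub>R s k (X j Z)
  + (w k (min (grid_time (Suc (Suc j))) t) Z - w k (min (grid_time (Suc j)) t) Z) *\<^sub>R s k (X (Suc j) Z)"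
  by (simp only: lessThan_Suc_atMost[symmetric] sum.lessThan_Suc)
 also have "\<dots> = (\<Sum>i<j. (w k (min (grid_time (Suc i)) t) Z - w k (min (grid_time i) t) Z) *\<^sub>R s k (X i Z))
  + (w k t Z - w k (grid_time j) Z) *\<^sub>R s k (X j Z)"
 proof -
  have "min (grid_time (Suc (Suc j))) t = t" "min (grid_time (Suc j)) t = t" "min (grid_time j) t = grid_time j"
   using t h_pos by auto
  then show ?thesis by (simp only:) simp
 qed
 also have "(\<Sum>i<j. (w k (min (grid_time (Suc i)) t) Z - w k (min (grid_time i) t) Z) *\<^sub>R s k (X i Z)) =
  (\<Sum>i<j. (w k (grid_time (Suc i)) Z - w k (grid_time i) Z) *\<^sub>R s k (X i Z))"
 proof (rule sum.cong)
  fix i assume "i \<in> {..<j}"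
  then have "grid_time (Suc i) <= grid_time j" by (simp only: grid_time_less) auto
  then have "min (grid_time (Suc i)) t = grid_time (Suc i)" "min (grid_time i) t = grid_time i" using t h_pos by auto
  then show "(w k (min (grid_time (Suc i)) t) Z - w k (min (grid_time i) t) Z) *\<^sub>R s k (X i Z) = (w k (grid_time (Suc i)) Z - w k (grid_time i) Z) *\<^sub>R s k (X i Z)"
   by simp
 qed simp
 finally show ?thesis by simp
qed

lemma drift_on_step:
 assumes Z: "Z \<in> space M" and t: "grid_time j <= t" "t <= grid_time (Suc j)"
 shows "set_integrable lborel {grid_time j..t} (%u. drift u Z)"
  and "(LINT u:{grid_time j..t}|lborel. drift u Z) = active_time j (X j Z) t Z *\<^sub>R b (X j Z)"
proof -
 let ?g = "%u. active j (X j Z) u Z *\<^sub>R b (X j Z)"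
 have ig: "set_integrable lborel {grid_time j..t} ?g"
  using active_integrable[OF Z] by (intro set_integrable_scaleR_left) auto
 \<comment> \<open>At the right end point \<open>drift\<close> already follows the next step; a
   single point is a null set of times.\<close>
 have eq: "drift u Z = ?g u" if "u \<in> {grid_time j..t}" "u \<noteq> grid_time (Suc j)" for u
  using step_of_eq[of j u] that t by (simp add: drift_def)
 have meas_drift: "(%u. indicator {grid_time j..t} u *\<^sub>R drift u Z) \<in> bm lborel"
 proof -
  have "(%u. indicator {grid_time j..t} u *\<^sub>R drift u Z) = (%u. if u = grid_time (Suc j) then indicator {grid_time j..t} u *\<^sub>R drift (grid_time (Suc j)) Z else indicator {grid_time j..t} u *\<^sub>R ?g u)"
   using eq by (auto simp: indicator_def fun_eq_iff)
  also have "\<dots> \<in> bm lborel" using active_measurable[OF Z] by measurable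
  finally show ?thesis .
 qed
 have ae: "AE u in lborel. indicator {grid_time j..t} u *\<^sub>R drift u Z = indicator {grid_time j..t} u *\<^sub>R ?g u"
  using AE_lborel_singleton[of "grid_time (Suc j)"] by eventually_elim (use eq in \<open>auto simp: indicator_def\<close>)
 show "set_integrable lborel {grid_time j..t} (%u. drift u Z)"
  unfolding set_integrable_def
  by (subst integrable_cong_AE[OF meas_drift _ ae]) (use ig in \<open>auto simp: set_integrable_def\<close>)
 have "(LINT u:{grid_time j..t}|lborel. drift u Z) = (LINT u:{grid_time j..t}|lborel. ?g u)"
  unfolding set_lebesgue_integral_def
  by (rule integral_cong_AE[OF meas_drift _ ae]) (use ig in \<open>auto simp: set_integrable_def\<close>)
 also have "\<dots> = active_time j (X j Z) t Z *\<^sub>R b (X j Z)"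
  unfolding active_time_def set_lebesgue_integral_def
  using active_integrable[OF Z, of "grid_time j" t j "X j Z"]
  by (subst integral_scaleR_left[symmetric]) (auto simp: set_integrable_def)
 finally show "(LINT u:{grid_time j..t}|lborel. drift u Z) = active_time j (X j Z) t Z *\<^sub>R b (X j Z)" .
qed

lemma drift_integral_grid:
 assumes Z: "Z \<in> space M"
 shows "set_integrable lborel {0..grid_time j} (%u. drift u Z) \<and>
  (LINT u:{0..grid_time j}|lborel. drift u Z) = (\<Sum>i<j. active_time i (X i Z) (grid_time (Suc i)) Z *\<^sub>R b (X i Z))"
proof (induction j)
 case 0
 have "set_integrable lborel {0..0::real} (%u. drift u Z)"
  using drift_on_step(1)[OF Z, of 0 0] h_pos by simp
 then show ?case by (simp add: set_lebesgue_integral_def flip: has_bochner_integral_iff)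
  (rule integral_eq_zero_AE, use AE_lborel_singleton[of "0::real"] in eventually_elim, simp)
next
 case (Suc j)
 have step: "grid_time j <= grid_time (Suc j)" using h_pos by simp
 note d = drift_on_step[OF Z step order_refl]
 have un: "{0..grid_time (Suc j)} = {0..grid_time j} \<union> {grid_time j..grid_time (Suc j)}"
  using h_pos grid_time_simps(3)[of j] by (auto simp del: grid_time_simps(3))
 have i: "set_integrable lborel {0..grid_time (Suc j)} (%u. drift u Z)"
  unfolding un using Suc d(1) by (intro set_integrable_Un) auto
 have "(LINT u:{0..grid_time (Suc j)}|lborel. drift u Z) = (LINT u:{0..grid_time j}|lborel. drift u Z) + (LINT u:{grid_time j..grid_time (Suc j)}|lborel. drift u Z)"
  unfolding un
 proof (rule set_integral_Un_AE)
  show "AE u in lborel. \<not> (u \<in> {0..grid_time j} \<and> u \<in> {grid_time j..grid_time (Suc j)})"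
   using AE_lborel_singleton[of "grid_time j"] by eventually_elim auto
 qed (use Suc d(1) in auto)
 then show ?case using Suc d(2) i by simp
qed

text \<open>Links the process defined by stochastic integrals with the recursion, at both ends of a
  step and in between; all path estimates use this form.\<close>

lemma x_step:
 assumes Z: "Z \<in> space M" and t: "grid_time j <= t" "t <= grid_time (Suc j)"
 shows "x t Z = X j Z + kick j (X j Z) t Z + active_time j (X j Z) t Z *\<^sub>R b (X j Z)"
proof -
 have X: "X j Z = (\<Sum>i<j. kick i (X i Z) (grid_time (Suc i)) Z) + (\<Sum>i<j. active_time i (X i Z) (grid_time (Suc i)) Z *\<^sub>R b (X i Z))"
  by (induction j) simp_all
 have un: "{0..t} = {0..grid_time j} \<union> {grid_time j..t}"
  using t grid_time_simps(3)[of j] by (auto simp del: grid_time_simps(3))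
 note d = drift_on_step[OF Z t] and g = drift_integral_grid[OF Z, of j]
 have "(LINT u:{0..t}|lborel. drift u Z) = (LINT u:{0..grid_time j}|lborel. drift u Z) + (LINT u:{grid_time j..t}|lborel. drift u Z)"
  unfolding un
 proof (rule set_integral_Un_AE)
  show "AE u in lborel. \<not> (u \<in> {0..grid_time j} \<and> u \<in> {grid_time j..t})"
   using AE_lborel_singleton[of "grid_time j"] by eventually_elim auto
 qed (use g d(1) in auto)
 moreover have "(\<Sum>k<n. ito k t Z) = (\<Sum>i<j. kick i (X i Z) (grid_time (Suc i)) Z) + kick j (X j Z) t Z"
 proof -
  have "(\<Sum>k<n. ito k t Z) = (\<Sum>k<n. \<Sum>i<j. (w k (grid_time (Suc i)) Z - w k (grid_time i) Z) *\<^sub>R s k (X i Z)) + (\<Sum>k<n. (w k t Z - w k (grid_time j) Z) *\<^sub>R s k (X j Z))"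
   by (simp only: ito_on_step[OF t] sum.distrib)
  also have "(\<Sum>k<n. \<Sum>i<j. (w k (grid_time (Suc i)) Z - w k (grid_time i) Z) *\<^sub>R s k (X i Z)) = (\<Sum>i<j. kick i (X i Z) (grid_time (Suc i)) Z)"
   using h_pos by (subst sum.swap) (simp add: kick_def max_def)
  also have "(\<Sum>k<n. (w k t Z - w k (grid_time j) Z) *\<^sub>R s k (X j Z)) = kick j (X j Z) t Z"
   using t by (simp add: kick_def max_def)
  finally show ?thesis .
 qed
 ultimately show ?thesis unfolding x_def using g d(2) by (subst X) (simp del: grid_time_simps)
qed

end

section \<open>Progressive measurability and the Ito integrals\<close>

context euler
begin

lemma step_of_measurable [measurable]: "step_of \<in> measurable borel (count_space UNIV)"
 unfolding step_of_def by measurable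

lemma measurable_pair_restrict:
 "f \<in> bm (borel \<Otimes>\<^sub>M F T) ==> f \<in> bm (restrict_space (borel :: real measure) A \<Otimes>\<^sub>M F T)"
proof -
 assume f: "f \<in> bm (borel \<Otimes>\<^sub>M F T)"
 have "(%p. (fst p, snd p)) \<in> restrict_space (borel :: real measure) A \<Otimes>\<^sub>M F T \<rightarrow>\<^sub>M borel \<Otimes>\<^sub>M F T"
  by (intro measurable_Pair measurable_compose[OF measurable_fst] measurable_snd measurable_restrict_space1) simp
 from measurable_compose[OF this f] show ?thesis by simp
qed

text \<open>Up to time T only the indices up to \<open>step_of T\<close> occur, and they start no
  later than T. Capping the index by \<open>step_of T\<close> makes its range finite and changes
  nothing on {0..T}.\<close>

lemma progressive_by_steps:
 assumes "\<And>j T. grid_time j <= T ==> (%p. f j (fst p) (snd p)) \<in> bm (restrict_space borel {0..T} \<Otimes>\<^sub>M F T)"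
 shows "progressive F (%t. f (step_of t) t)"
 unfolding progressive_def
proof (intro allI impI)
 fix T :: real assume T: "0 <= T"
 let ?R = "restrict_space borel {0..T} \<Otimes>\<^sub>M F T"
 let ?g = "%p :: real \<times> 'w. min (step_of (fst p)) (step_of T)"
 have "(%p. (%j p. f j (fst p) (snd p)) (?g p) p) \<in> bm ?R"
 proof (rule measurable_compose_countable'[where I="{..step_of T}"])
  fix j assume "j \<in> {..step_of T}"
  then have "grid_time j <= grid_time (step_of T)" by (simp only: grid_time_less atMost_iff)
  then show "(%p. f j (fst p) (snd p)) \<in> bm ?R"
   using step_of_bounds(1)[OF T] by (intro assms) linarith
 next
  have "(%p. step_of (fst p)) \<in> ?R \<rightarrow>\<^sub>M count_space UNIV"
   by (intro measurable_compose[OF measurable_fst] measurable_restrict_space1) measurable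
  then have "?g \<in> ?R \<rightarrow>\<^sub>M count_space UNIV" by measurable
  then show "?g \<in> ?R \<rightarrow>\<^sub>M count_space {..step_of T}"
   by (auto simp: measurable_def)
 qed simp
 also have "?this \<longleftrightarrow> (%(t, Z). f (step_of t) t Z) \<in> bm ?R"
 proof (rule measurable_cong)
  fix p assume "p \<in> space ?R"
  then have "fst p <= T" by (auto simp: space_pair_measure space_restrict_space)
  then have "?g p = step_of (fst p)" using step_of_mono by simp
  then show "f (?g p) (fst p) (snd p) = (case p of (t, Z) => f (step_of t) t Z)" by (simp add: case_prod_beta)
 qed
 finally show "(%(t, Z). f (step_of t) t Z) \<in> bm ?R" .
qed

lemma progressive_sig: "progressive F (sig k)"
proof -
 have "progressive F (%t. (%j t Z. s k (X j Z)) (step_of t) t)"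
 proof (rule progressive_by_steps)
  fix j T assume "grid_time j <= T"
  then have [measurable]: "X j \<in> bm (F T)" by (rule X_measurable')
  show "(%p. s k (X j (snd p))) \<in> bm (restrict_space borel {0..T} \<Otimes>\<^sub>M F T)" by measurable
 qed
 then show ?thesis by (simp add: sig_def[abs_def])
qed

lemma progressive_drift: "progressive F drift"
proof -
 have "progressive F (%t. (%j t Z. active j (X j Z) t Z *\<^sub>R b (X j Z)) (step_of t) t)"
 proof (rule progressive_by_steps)
  fix j T assume T: "grid_time j <= T"
  then have X[measurable]: "X j \<in> bm (F T)" by (rule X_measurable')
  have "(%p. active j (X j (snd p)) (min T (fst p)) (snd p)) \<in> bm (restrict_space borel {0..T} \<Otimes>\<^sub>M F T)"
   using active_joint_measurable[OF T X] by (intro measurable_pair_restrict) (simp add: case_prod_beta)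
  then have "(%p. active j (X j (snd p)) (min T (fst p)) (snd p) *\<^sub>R b (X j (snd p))) \<in> bm (restrict_space borel {0..T} \<Otimes>\<^sub>M F T)"
   by measurable
  then show "(%p. active j (X j (snd p)) (fst p) (snd p) *\<^sub>R b (X j (snd p))) \<in> bm (restrict_space borel {0..T} \<Otimes>\<^sub>M F T)"
   by (rule measurable_cong[THEN iffD1, rotated]) (auto simp: space_pair_measure space_restrict_space min_def)
 qed
 then show ?thesis by (simp add: drift_def[abs_def])
qed

lemma drift_bound: "norm (drift t Z) <= Cb"
 using b_bound[of "X (step_of t) Z"] order_trans[OF norm_ge_zero b_bound] by (simp add: drift_def active_def)

lemma integrable_coefficients:
 "0 <= T ==> (nnS {0..T} (%t. ennreal ((\<Sum>k<n. (norm (sig k t Z))\<^sup>2) + norm (drift t Z)))) < \<infinity>"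
proof -
 assume T: "0 <= T"
 have "(nnS {0..T} (%t. ennreal ((\<Sum>k<n. (norm (sig k t Z))\<^sup>2) + norm (drift t Z))))
  <= (NN t. ennreal (real n * Cs\<^sup>2 + Cb) * indicator {0..T} t)"
 proof (intro nn_integral_mono mult_right_mono ennreal_leI add_mono drift_bound)
  fix t
  have "(\<Sum>k<n. (norm (sig k t Z))\<^sup>2) <= (\<Sum>k<n. Cs\<^sup>2)"
   unfolding sig_def by (intro sum_mono power_mono s_bound) auto
  then show "(\<Sum>k<n. (norm (sig k t Z))\<^sup>2) <= real n * Cs\<^sup>2" by simp
 qed simp
 also have "\<dots> = ennreal (real n * Cs\<^sup>2 + Cb) * ennreal T"
  using T by (simp add: nn_integral_cmult_indicator)
 also have "\<dots> < \<infinity>" by (simp add: ennreal_mult_less_top)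
 finally show ?thesis .
qed

lemma ito_measurable: "k < n ==> 0 <= t ==> ito k t \<in> bm (F t)"
 unfolding ito_def
proof (intro borel_measurable_sum borel_measurable_scaleR borel_measurable_diff)
 fix j assume k: "k < n" and t: "0 <= t" and "j \<in> {..step_of t}"
 then have "grid_time j <= grid_time (step_of t)" by (simp only: grid_time_less atMost_iff)
 then have jt: "grid_time j <= t" using step_of_bounds(1)[OF t] by linarith
 show "(%Z. s k (X j Z)) \<in> bm (F t)"
  by (rule measurable_compose[OF X_measurable'[OF jt] s_meas])
 show "w k (min (grid_time (Suc j)) t) \<in> bm (F t)" "w k (min (grid_time j) t) \<in> bm (F t)"
  using k t h_pos by (auto intro!: w_measurable add_nonneg_nonneg)
qed

lemma ito_continuous:
 assumes "k < n" "Z \<in> space M"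
 shows "continuous_on {0..} (%t. ito k t Z)"
proof (rule continuous_on_eq_continuous_within[THEN iffD2], intro ballI)
 fix t :: real assume t: "t \<in> {0..}"
 let ?N = "step_of (t + 1)"
 have "continuous_on {0..t + 1} (%t. \<Sum>j\<le>?N. (w k (min (grid_time (Suc j)) t) Z - w k (min (grid_time j) t) Z) *\<^sub>R s k (X j Z))"
  using h_pos by (intro continuous_intros continuous_on_compose2[OF w_continuous[OF assms]]) (auto intro!: add_nonneg_nonneg)
 then have "continuous_on {0..t + 1} (%t. ito k t Z)"
 proof (rule continuous_on_eq)
  fix u assume u: "u \<in> {0..t + 1}"
  then have "step_of u <= ?N" by (intro step_of_mono) simp
  with u show "(\<Sum>j\<le>?N. (w k (min (grid_time (Suc j)) u) Z - w k (min (grid_time j) u) Z) *\<^sub>R s k (X j Z)) = ito k u Z"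
   by (intro ito_extend[symmetric]) simp_all
 qed
 then have "continuous (at t within {0..t + 1}) (%t. ito k t Z)"
  using t by (simp add: continuous_on_eq_continuous_within)
 moreover have "at t within {0..t + 1} = at t within {0..}"
  by (rule at_within_nhd[of _ "{..<t + 1}"]) auto
 ultimately show "continuous (at t within {0..}) (%t. ito k t Z)" by simp
qed

text \<open>Step processes use intervals open on the left, \<open>step_of\<close> uses intervals
  open on the right; the two conventions differ only at grid points.\<close>

lemma step_process_eq:
 assumes "0 <= t" "step_of t < N" "t \<noteq> grid_time (step_of t)"
 shows "step_process N grid_time (%j Z. s k (X j Z)) t Z = sig k t Z"
proof -
 let ?J = "step_of t"
 have "t \<in> {grid_time j<..grid_time (Suc j)} \<longleftrightarrow> j = ?J" for j
 proof
  assume j: "t \<in> {grid_time j<..grid_time (Suc j)}"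
  show "j = ?J"
  proof (cases "t = grid_time (Suc j)")
   case True
   then have "grid_time (Suc j) <= t" "t < grid_time (Suc (Suc j))" using h_pos by auto
   then have "?J = Suc j" by (rule step_of_eq)
   then show ?thesis using assms(3) True by simp
  next
   case False
   then show ?thesis using j by (intro step_of_eq[symmetric]) auto
  qed
 next
  assume "j = ?J"
  then show "t \<in> {grid_time j<..grid_time (Suc j)}"
   using step_of_bounds[OF assms(1)] assms(3) by auto
 qed
 then have "step_process N grid_time (%j Z. s k (X j Z)) t Z = (\<Sum>j<N. if j = ?J then s k (X j Z) else 0)"
  unfolding step_process_def by (intro sum.cong refl) (auto simp: indicator_def)
 then show ?thesis using assms(2) by (simp add: sig_def)
qed

text \<open>\<open>sig\<close> is itself a step process up to a null set of times: the approximation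
  by its first N steps is exact up to time T as soon as N exceeds \<open>step_of T\<close>, so both
  limits in probability are eventually constant.\<close>

lemma is_ito_integral_ito:
 assumes k: "k < n"
 shows "is_ito_integral M F (w k) (sig k) (ito k)"
 unfolding is_ito_integral_def
proof (intro conjI allI impI ballI)
 let ?\<xi> = "%j Z. s k (X j Z)"
 show "\<exists>m \<tau> \<xi>. (\<forall>N. is_step M F (m N) (\<tau> N) (\<xi> N)) \<and>
  (\<forall>T\<ge>0. tends_to_0_in_prob M (%N Z. (nnS {0..T} (%t. ennreal ((norm (step_process (m N) (\<tau> N) (\<xi> N) t Z - sig k t Z))\<^sup>2)))) \<and>
   tends_to_0_in_prob M (%N Z. ennreal (norm (step_integral (w k) (m N) (\<tau> N) (\<xi> N) T Z - ito k T Z))))"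
 proof (intro exI conjI allI impI)
  show "is_step M F N grid_time ?\<xi>" for N
   unfolding is_step_def using s_bound h_pos measurable_compose[OF X_measurable s_meas] by auto
  fix T :: real assume T: "0 <= T"
  have ev: "EV N. step_of T < N" by (rule eventually_gt_at_top)
  have z1: "(nnS {0..T} (%t. ennreal ((norm (step_process N grid_time ?\<xi> t Z - sig k t Z))\<^sup>2))) = 0"
   if N: "step_of T < N" for N Z
  proof -
   have "AE t in lborel. t \<notin> range grid_time"
    by (rule AE_not_in) (rule countable_imp_null_set_lborel, auto)
   then have "AE t in lborel. ennreal ((norm (step_process N grid_time ?\<xi> t Z - sig k t Z))\<^sup>2) * indicator {0..T} t = 0"
   proof eventually_elim
    case (elim t)
    show ?case
    proof (cases "t \<in> {0..T}")
     case True
     then have "step_of t < N" using step_of_mono[of t T] N by auto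
     then show ?thesis using step_process_eq[of t N k Z] True elim by auto
    qed simp
   qed
   then have "(nnS {0..T} (%t. ennreal ((norm (step_process N grid_time ?\<xi> t Z - sig k t Z))\<^sup>2))) = (\<integral>\<^sup>+t. 0 \<partial>(lborel :: real measure))"
    by (rule nn_integral_cong_AE)
   then show ?thesis by simp
  qed
  have z2: "step_integral (w k) N grid_time ?\<xi> T Z = ito k T Z" if N: "step_of T < N" for N Z
  proof -
   obtain N' where N': "N = Suc N'" "step_of T <= N'" using N by (cases N) auto
   show ?thesis unfolding ito_extend[OF T N'(2)] step_integral_def N'(1) lessThan_Suc_atMost ..
  qed
  show "tends_to_0_in_prob M (%N Z. (nnS {0..T} (%t. ennreal ((norm (step_process N grid_time ?\<xi> t Z - sig k t Z))\<^sup>2))))"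
   unfolding tends_to_0_in_prob_def
  proof (intro allI impI)
   fix e :: real
   show "(%N. prob {Z \<in> space M. ennreal e < (nnS {0..T} (%t. ennreal ((norm (step_process N grid_time ?\<xi> t Z - sig k t Z))\<^sup>2)))}) ---> 0"
    by (rule tendsto_eventually) (use ev in eventually_elim, simp add: z1)
  qed
  show "tends_to_0_in_prob M (%N Z. ennreal (norm (step_integral (w k) N grid_time ?\<xi> T Z - ito k T Z)))"
   unfolding tends_to_0_in_prob_def
  proof (intro allI impI)
   fix e :: real
   show "(%N. prob {Z \<in> space M. ennreal e < ennreal (norm (step_integral (w k) N grid_time ?\<xi> T Z - ito k T Z))}) ---> 0"
    by (rule tendsto_eventually) (use ev in eventually_elim, simp add: z2)
  qed
 qed
qed (use k in \<open>auto intro: ito_measurable ito_continuous\<close>)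

text \<open>While the drift acts, the kick is at most r and the drift has moved the point by at most
  Cb * h <= r, so the current point lies within 2 * r of the point at which b is frozen. Otherwise
  the drift is 0.\<close>

lemma drift_diffusion_euler:
 assumes small: "Cb * h <= r"
  and bb: "\<And>y z. norm (z - y) <= 2 * r ==> norm (b y) <= \<bb> z" "\<And>z. 0 <= \<bb> z"
  and cov: "\<And>y. (\<chi> i j. \<Sum>k<n. s k y $ i * s k y $ j) \<in> S_mat \<delta>"
 shows "drift_diffusion \<delta> \<bb> M F n w sig drift x"
 unfolding drift_diffusion_def
proof (intro conjI allI impI ballI)
 show "\<exists>I. (\<forall>k<n. is_ito_integral M F (w k) (sig k) (I k)) \<and> (\<forall>t\<ge>0. \<forall>Z\<in>space M. x t Z = (\<Sum>k<n. I k t Z) + (LINT s:{0..t}|lborel. drift s Z))"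
  by (intro exI[of _ ito]) (auto simp: x_def is_ito_integral_ito)
 fix t :: real and Z assume t: "0 <= t" and Z: "Z \<in> space M"
 show "(\<chi> i j. \<Sum>k<n. sig k t Z $ i * sig k t Z $ j) \<in> S_mat \<delta>"
  unfolding sig_def by (rule cov)
 let ?j = "step_of t"
 show "norm (drift t Z) <= \<bb> (x t Z)"
 proof (cases "norm (kick ?j (X ?j Z) t Z) <= r")
  case False
  then show ?thesis using bb(2) by (simp add: drift_def active_def)
 next
  case True
  have b: "grid_time ?j <= t" "t <= grid_time (Suc ?j)" using step_of_bounds[OF t] by auto
  have at: "0 <= active_time ?j (X ?j Z) t Z" "active_time ?j (X ?j Z) t Z <= h"
   using active_time_bounds[OF Z b(1), of "X ?j Z"] step_of_bounds(2)[OF t] grid_time_simps(2)[of ?j] by linarith+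
  have "norm (x t Z - X ?j Z) <= norm (kick ?j (X ?j Z) t Z) + norm (active_time ?j (X ?j Z) t Z *\<^sub>R b (X ?j Z))"
   unfolding x_step[OF Z b] add.assoc add_diff_cancel_left' by (rule norm_triangle_ineq)
  also have "norm (active_time ?j (X ?j Z) t Z *\<^sub>R b (X ?j Z)) <= h * Cb"
   using at b_bound by (auto intro!: mult_mono)
  finally have "norm (x t Z - X ?j Z) <= 2 * r" using True small by (simp add: mult.commute)
  from bb(1)[OF this] show ?thesis using True by (simp add: drift_def active_def)
 qed
qed (use filtered wiener n_gt in \<open>simp_all add: progressive_sig progressive_drift integrable_coefficients[simplified]\<close>)

end

section \<open>One step: moments and second order expansion\<close>

context euler
begin

text \<open>In \<open>A2\<close> and \<open>A3\<close> one factor n comes from the sum over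
  components and the other powers of n from \<open>sum_power_le\<close>; the 2 in \<open>A3\<close>
  comes from \<open>incr_cube\<close>.\<close>

definition "A2 = Cs\<^sup>2 * real n ^ 3"
definition "A3 = 2 * Cs ^ 3 * real n ^ 4"

lemma Cs_nonneg: "0 <= Cs" and Cb_nonneg: "0 <= Cb"
 using order_trans[OF norm_ge_zero s_bound] order_trans[OF norm_ge_zero b_bound] by auto

lemma A_nonneg: "0 <= A2" "0 <= A3"
 using Cs_nonneg by (auto simp: A2_def A3_def)

lemma X_measurable_M [measurable]: "X j \<in> bm M"
 using measurable_F[OF X_measurable] by simp

lemma kick_eq: "grid_time j <= t ==> kick j y t Z = (\<Sum>k<n. incr (grid_time j) t k Z *\<^sub>R s k y)"
 by (simp add: kick_def max_def)

lemma kick_measurable_M: "grid_time j <= t ==> (%Z. kick j (X j Z) t Z) \<in> bm M"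
 using kick_measurable[OF _ X_measurable'] order_trans[OF grid_time_simps(3)[of j]] by (intro measurable_F[of _ t]) auto

lemma norm_kick_power:
 assumes "grid_time j <= t"
 shows "norm (kick j y t Z) ^ m <= Cs ^ m * real n ^ m * (\<Sum>k<n. \<bar>incr (grid_time j) t k Z\<bar> ^ m)"
proof -
 have "norm (kick j y t Z) <= (\<Sum>k<n. \<bar>incr (grid_time j) t k Z\<bar> * Cs)"
  unfolding kick_eq[OF assms] by (intro norm_sum[THEN order_trans] sum_mono) (auto intro!: mult_left_mono s_bound)
 then have "norm (kick j y t Z) <= Cs * (\<Sum>k<n. \<bar>incr (grid_time j) t k Z\<bar>)"
  by (simp add: sum_distrib_left mult.commute)
 then have "norm (kick j y t Z) ^ m <= (Cs * (\<Sum>k<n. \<bar>incr (grid_time j) t k Z\<bar>)) ^ m"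
  by (rule power_mono) simp
 also have "\<dots> = Cs ^ m * (\<Sum>k<n. \<bar>incr (grid_time j) t k Z\<bar>) ^ m" by (rule power_mult_distrib)
 also have "\<dots> <= Cs ^ m * (real n ^ m * (\<Sum>k<n. \<bar>incr (grid_time j) t k Z\<bar> ^ m))"
  using n_gt Cs_nonneg by (intro mult_left_mono sum_power_le) auto
 finally show ?thesis by (simp add: mult.assoc)
qed

lemma norm_kick_moment:
 assumes "grid_time j <= t"
 shows "integrable M (%Z. norm (kick j (X j Z) t Z) ^ m)"
proof (cases "t = grid_time j")
 case True
 then show ?thesis by (simp add: kick_def)
next
 case False
 have i: "integrable M (%Z. Cs ^ m * real n ^ m * (\<Sum>k<n. \<bar>incr (grid_time j) t k Z\<bar> ^ m))"
  using False assms by (intro integrable_mult_right Bochner_Integration.integrable_sum incr_abs_moment) auto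
 have [measurable]: "(%Z. kick j (X j Z) t Z) \<in> bm M" by (rule kick_measurable_M[OF assms])
 show ?thesis
  by (rule Bochner_Integration.integrable_bound[OF i])
   (use norm_kick_power[OF assms] in \<open>auto intro!: AE_I2 order_trans[OF norm_kick_power[OF assms]]\<close>)
qed

lemma kick_second_moment:
 assumes "grid_time j <= t"
 shows "expectation (%Z. (norm (kick j (X j Z) t Z))\<^sup>2) <= A2 * (t - grid_time j)"
proof (cases "t = grid_time j")
 case True
 then show ?thesis by (simp add: kick_def)
next
 case False
 then have st: "0 <= grid_time j" "grid_time j < t" using assms by auto
 have i: "integrable M (%Z. \<bar>incr (grid_time j) t k Z\<bar> ^ 2)" if "k < n" for k
  using st that by (intro incr_abs_moment) auto
 have "expectation (%Z. (norm (kick j (X j Z) t Z))\<^sup>2) <= expectation (%Z. Cs\<^sup>2 * real n ^ 2 * (\<Sum>k<n. \<bar>incr (grid_time j) t k Z\<bar> ^ 2))"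
  using i by (intro integral_mono norm_kick_moment assms norm_kick_power integrable_mult_right Bochner_Integration.integrable_sum) auto
 also have "\<dots> = Cs\<^sup>2 * real n ^ 2 * (\<Sum>k<n. expectation (%Z. \<bar>incr (grid_time j) t k Z\<bar> ^ 2))"
  using i by (subst integral_mult_right_zero, subst Bochner_Integration.integral_sum) auto
 also have "(\<Sum>k<n. expectation (%Z. \<bar>incr (grid_time j) t k Z\<bar> ^ 2)) = (\<Sum>k<n. t - grid_time j)"
  using incr_square[OF st] by (intro sum.cong) auto
 finally show ?thesis by (simp add: A2_def power2_eq_square power3_eq_cube mult_ac)
qed

lemma kick_third_moment:
 assumes "grid_time j < t"
 shows "expectation (%Z. norm (kick j (X j Z) t Z) ^ 3) <= A3 * sqrt (t - grid_time j) ^ 3"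
proof -
 have st: "0 <= grid_time j" "grid_time j < t" using assms by auto
 have i: "integrable M (%Z. \<bar>incr (grid_time j) t k Z\<bar> ^ 3)" if "k < n" for k
  using st that by (intro incr_abs_moment) auto
 have "expectation (%Z. norm (kick j (X j Z) t Z) ^ 3) <= expectation (%Z. Cs^3 * real n ^ 3 * (\<Sum>k<n. \<bar>incr (grid_time j) t k Z\<bar> ^ 3))"
  using i assms by (intro integral_mono norm_kick_moment norm_kick_power integrable_mult_right Bochner_Integration.integrable_sum) auto
 also have "\<dots> = Cs^3 * real n ^ 3 * (\<Sum>k<n. expectation (%Z. \<bar>incr (grid_time j) t k Z\<bar> ^ 3))"
  using i by (subst integral_mult_right_zero, subst Bochner_Integration.integral_sum) auto
 also have "\<dots> <= Cs^3 * real n ^ 3 * (\<Sum>k<n. 2 * sqrt (t - grid_time j) ^ 3)"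
  using incr_cube[OF st] Cs_nonneg by (intro mult_left_mono sum_mono) auto
 finally show ?thesis by (simp add: A3_def power_numeral_reduce mult_ac)
qed

text \<open>Its mean is of order h^2, one order better than the length of the step. It pays both for
  the drift time lost by deactivation and for freezing \<psi> during the step.\<close>

definition kick_energy :: "nat => 'w => real" where
 "kick_energy j Z = (LINT u:{grid_time j..<grid_time (Suc j)}|lborel. (norm (kick j (X j Z) u Z))\<^sup>2)"

lemma kick_path_measurable [measurable]: "Z \<in> space M ==> (%t. kick j y t Z) \<in> bm borel"
 by (rule bm_contI[OF kick_continuous])

lemma kick_energy_integrable:
 assumes Z: "Z \<in> space M"
 shows "set_integrable lborel {grid_time j..<grid_time (Suc j)} (%u. (norm (kick j (X j Z) u Z))\<^sup>2)"
proof (rule set_integrable_subset)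
 show "set_integrable lborel {grid_time j..grid_time (Suc j)} (%u. (norm (kick j (X j Z) u Z))\<^sup>2)"
  by (intro borel_integrable_atLeastAtMost' continuous_intros continuous_on_subset[OF kick_continuous[OF Z]]) auto
qed auto

lemma id_measurable_F: "0 <= t ==> (%Z. Z) \<in> M \<rightarrow>\<^sub>M F t"
 using measurable_F[of "%Z. Z" t "F t"] by simp

lemma kick_energy_expectation: "integrable M (kick_energy j)" "expectation (kick_energy j) <= A2 * h\<^sup>2"
proof -
 let ?I = "{grid_time j..<grid_time (Suc j)}"
 let ?T = "grid_time (Suc j)"
 \<comment> \<open>The clipping \<open>min ?T u\<close> changes nothing on the step and makes the
   integrand jointly measurable by \<open>kick_joint_measurable\<close>.\<close>
 let ?f = "%u Z. ennreal ((norm (kick j (X j Z) (min ?T u) Z))\<^sup>2 * indicator ?I u)"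
 have T: "grid_time j <= ?T" using h_pos by simp
 have T0: "0 <= ?T" by (rule grid_time_simps(3))
 have "(%p. (fst p, snd p)) \<in> borel \<Otimes>\<^sub>M M \<rightarrow>\<^sub>M borel \<Otimes>\<^sub>M F ?T"
  by (intro measurable_Pair measurable_fst measurable_compose[OF measurable_snd id_measurable_F[OF T0]])
 from measurable_compose[OF this kick_joint_measurable[OF T X_measurable'[OF T]]]
 have [measurable]: "(%p. kick j (X j (snd p)) (min ?T (fst p)) (snd p)) \<in> bm (borel \<Otimes>\<^sub>M M)" by simp
 have "(%p. ?f (fst p) (snd p)) \<in> bm (borel \<Otimes>\<^sub>M M)" by measurable
 then have m: "case_prod ?f \<in> bm (lborel \<Otimes>\<^sub>M M)"
  by (simp add: case_prod_beta cong: measurable_cong_sets)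
 interpret P: pair_sigma_finite "lborel :: real measure" M ..
 have "(\<integral>\<^sup>+Z. (NN u. ?f u Z) \<partial>M) = (NN u. (\<integral>\<^sup>+Z. ?f u Z \<partial>M))"
  by (rule P.Fubini'[OF m])
 also have "\<dots> <= (NN u. ennreal (A2 * h) * indicator ?I u)"
 proof (rule nn_integral_mono)
  fix u :: real
  show "(\<integral>\<^sup>+Z. ?f u Z \<partial>M) <= ennreal (A2 * h) * indicator ?I u"
  proof (cases "u \<in> ?I")
   case True
   then have u: "grid_time j <= u" "min ?T u = u" "u - grid_time j <= h" by auto
   have "(\<integral>\<^sup>+Z. ?f u Z \<partial>M) = ennreal (expectation (%Z. (norm (kick j (X j Z) u Z))\<^sup>2))"
    unfolding u(2) using True norm_kick_moment[OF u(1), of 2] by (simp add: nn_integral_eq_integral)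
   also have "\<dots> <= ennreal (A2 * h)"
    using kick_second_moment[OF u(1)] mult_left_mono[OF u(3) A_nonneg(1)] by (intro ennreal_leI) linarith
   finally show ?thesis using True by simp
  qed simp
 qed
 also have "\<dots> = ennreal (A2 * h) * ennreal h"
  using h_pos by (subst nn_integral_cmult_indicator) auto
 finally have le: "(\<integral>\<^sup>+Z. (NN u. ?f u Z) \<partial>M) <= ennreal (A2 * h\<^sup>2)"
  using h_pos A_nonneg(1) by (simp add: ennreal_mult[symmetric] power2_eq_square mult.assoc)
 have eq: "(NN u. ?f u Z) = ennreal (kick_energy j Z)" if "Z \<in> space M" for Z
 proof -
  have "(NN u. ?f u Z) = (NN u. ennreal (indicator ?I u *\<^sub>R (norm (kick j (X j Z) u Z))\<^sup>2))"
   by (intro nn_integral_cong) (auto simp: indicator_def)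
  also have "\<dots> = ennreal (kick_energy j Z)" unfolding kick_energy_def set_lebesgue_integral_def
   using kick_energy_integrable[OF that, of j] unfolding set_integrable_def by (intro nn_integral_eq_integral) auto
  finally show ?thesis .
 qed
 have nn: "0 <= kick_energy j Z" for Z
  unfolding kick_energy_def set_lebesgue_integral_def by (intro integral_nonneg_AE AE_I2) simp
 have "(%Z. (NN u. ?f u Z)) \<in> bm M"
 proof (rule lborel.borel_measurable_nn_integral)
  show "(%(Z, u). ?f u Z) \<in> bm (M \<Otimes>\<^sub>M lborel)"
   using measurable_compose[OF measurable_pair_swap' m] by (simp add: case_prod_beta)
 qed
 then have "(%Z. enn2real (NN u. ?f u Z)) \<in> bm M" by measurable
 also have "?this \<longleftrightarrow> kick_energy j \<in> bm M"
  by (rule measurable_cong) (simp add: eq nn del: grid_time_simps)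
 finally have [measurable]: "kick_energy j \<in> bm M" .
 have le': "(\<integral>\<^sup>+Z. ennreal (kick_energy j Z) \<partial>M) <= ennreal (A2 * h\<^sup>2)"
  using le eq by (simp del: grid_time_simps cong: nn_integral_cong)
 show int: "integrable M (kick_energy j)"
  by (rule integrableI_nonneg) (use nn le' in \<open>auto simp: less_top[symmetric] top_unique\<close>)
 show "expectation (kick_energy j) <= A2 * h\<^sup>2"
  using le' nn A_nonneg(1) by (simp add: nn_integral_eq_integral[OF int])
qed

text \<open>Chebyshev's inequality in the time variable: the inactive times are those at which the
  kick exceeds r.\<close>

lemma active_deficit:
 assumes Z: "Z \<in> space M"
 shows "h - active_time j (X j Z) (grid_time (Suc j)) Z <= kick_energy j Z / r\<^sup>2"
proof -
 let ?I = "{grid_time j..<grid_time (Suc j)}"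
 have ai: "set_integrable lborel ?I (%u. active j (X j Z) u Z)"
  by (rule set_integrable_subset[OF active_integrable[OF Z, of "grid_time j" "grid_time (Suc j)"]]) auto
 have c: "set_integrable lborel ?I (%u. 1 :: real)"
  by (rule set_integrable_subset[OF borel_integrable_atLeastAtMost'[of "grid_time j" "grid_time (Suc j)" "%_. 1 :: real"]]) auto
 have "active_time j (X j Z) (grid_time (Suc j)) Z = (LINT u:?I|lborel. active j (X j Z) u Z)"
  unfolding active_time_def set_lebesgue_integral_def
 proof (rule integral_cong_AE)
  show "AE u in lborel. indicator {grid_time j..grid_time (Suc j)} u *\<^sub>R active j (X j Z) u Z = indicator ?I u *\<^sub>R active j (X j Z) u Z"
   using AE_lborel_singleton[of "grid_time (Suc j)"] by eventually_elim (auto simp: indicator_def)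
 qed (use active_measurable[OF Z] in auto)
 moreover have "h = (LINT u:?I|lborel. 1)"
  using h_pos by (simp add: set_lebesgue_integral_def)
 ultimately have "h - active_time j (X j Z) (grid_time (Suc j)) Z = (LINT u:?I|lborel. 1 - active j (X j Z) u Z)"
  using set_integral_diff(2)[OF c ai] by simp
 also have "\<dots> <= (LINT u:?I|lborel. (norm (kick j (X j Z) u Z))\<^sup>2 / r\<^sup>2)"
 proof (rule set_integral_mono)
  show "set_integrable lborel ?I (%u. 1 - active j (X j Z) u Z)" by (rule set_integral_diff(1)[OF c ai])
  show "set_integrable lborel ?I (%u. (norm (kick j (X j Z) u Z))\<^sup>2 / r\<^sup>2)"
   using kick_energy_integrable[OF Z] by simp
  fix u
  show "1 - active j (X j Z) u Z <= (norm (kick j (X j Z) u Z))\<^sup>2 / r\<^sup>2"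
  proof (cases "norm (kick j (X j Z) u Z) <= r")
   case False
   then have "r\<^sup>2 <= (norm (kick j (X j Z) u Z))\<^sup>2" using r_pos by (intro power_mono) auto
   then show ?thesis using r_pos False by (simp add: active_def)
  qed (simp add: active_def)
 qed
 also have "\<dots> = kick_energy j Z / r\<^sup>2" unfolding kick_energy_def by simp
 finally show ?thesis .
qed

text \<open>The kick is continuous in t, and \<open>active_time\<close> is increasing in t, hence
  Borel.\<close>

lemma x_path_measurable:
 assumes Z: "Z \<in> space M"
 shows "(%t. X j Z + kick j (X j Z) t Z + active_time j (X j Z) t Z *\<^sub>R b (X j Z)) \<in> bm borel"
proof -
 have "mono (%t. active_time j (X j Z) t Z)"
 proof (rule monoI)
  fix t u :: real assume "t <= u"
  then show "active_time j (X j Z) t Z <= active_time j (X j Z) u Z"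
   unfolding active_time_def set_lebesgue_integral_def
   using active_integrable[OF Z, of "grid_time j" _ j "X j Z"] active_bounds[of j "X j Z"]
   by (intro integral_mono) (auto simp: set_integrable_def indicator_def)
 qed
 then have [measurable]: "(%t. active_time j (X j Z) t Z) \<in> bm borel"
  by (rule borel_measurable_mono)
 show ?thesis using kick_path_measurable[OF Z] by measurable
qed

end

text \<open>The remainders are a small constant times |v|^2 plus a large one times |v|^3, and for
  \<psi> a small constant plus a large one times the square of the distance. In mean over a step the
  large constants meet higher powers of h, so only e and e' have to be small beforehand.\<close>

locale euler_test = euler M F n w s b h r Cs Cb
 for M :: "'w measure" and F n w and s :: "nat => real^'d => real^'d" and b h r Cs Cb +
 fixes \<phi> \<psi> :: "real^'d => real" and g :: "real^'d => real^'d" and Hm :: "real^'d => real^'d^'d"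
  and e C Cg CH C\<phi> C\<psi> e' C' :: real
 assumes phi_meas [measurable]: "\<phi> \<in> bm borel" and phi_bounds: "\<And>y. 0 <= \<phi> y" "\<And>y. \<phi> y <= C\<phi>"
  and g_meas [measurable]: "g \<in> bm borel" and g_bound: "\<And>y. norm (g y) <= Cg"
  and Hm_meas [measurable]: "Hm \<in> bm borel" and Hm_bound: "\<And>y u v. \<bar>u \<bullet> (Hm y *v v)\<bar> <= CH * norm u * norm v"
  and taylor: "\<And>y v. \<bar>\<phi> (y + v) - \<phi> y - g y \<bullet> v - (v \<bullet> (Hm y *v v)) / 2\<bar> <= e * (norm v)\<^sup>2 + C * norm v ^ 3"
  and lip: "\<And>y v. \<bar>\<phi> (y + v) - \<phi> y\<bar> <= Cg * norm v"
  and psi_meas [measurable]: "\<psi> \<in> bm borel" and psi_bound: "\<And>y. \<bar>\<psi> y\<bar> <= C\<psi>"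
  and psi_def: "\<And>y. \<psi> y = \<phi> y - ((\<Sum>k<n. s k y \<bullet> (Hm y *v s k y)) / 2 + g y \<bullet> b y)"
  and psi_mod: "\<And>y z. \<psi> y <= max 0 (\<psi> z) + e' + C' * (norm (z - y))\<^sup>2"
  and nonneg: "0 <= e" "0 <= C" "0 <= CH" "0 <= e'" "0 <= C'" and h_small: "h <= 1 / 2"
begin

lemma matrix_vector_mult_measurable:
 fixes A :: "'z => real^'d^'d" and v :: "'z => real^'d"
 assumes "A \<in> bm N" "v \<in> bm N"
 shows "(%z. A z *v v z) \<in> bm N"
proof -
 have "cont (%p :: (real^'d^'d) \<times> (real^'d). fst p *v snd p)"
  unfolding matrix_vector_mult_def by (intro continuous_intros continuous_on_vec_lambda)
 then have "(%p :: (real^'d^'d) \<times> (real^'d). fst p *v snd p) \<in> bm (borel \<Otimes>\<^sub>M borel)"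
  by (simp add: borel_prod bm_contI)
 from measurable_compose[OF measurable_Pair[OF assms] this] show ?thesis by simp
qed

lemma Cg_nonneg: "0 <= Cg"
 using order_trans[OF norm_ge_zero g_bound] .

definition gen :: "real^'d => real" where
 "gen y = (\<Sum>k<n. s k y \<bullet> (Hm y *v s k y)) / 2 + g y \<bullet> b y"

text \<open>A bound for the mean error of one step divided by h; it tends to 2 * e * A2 as h ->
  0.\<close>

definition E1 :: real where
 "E1 = Cg * Cb * A2 * h / r\<^sup>2 + CH * Cb * sqrt h * (1 + A2) / 2 + CH * Cb\<^sup>2 * h / 2
  + 2 * e * (A2 + Cb\<^sup>2 * h) + 4 * C * (A3 * sqrt h + Cb ^ 3 * h\<^sup>2)"

lemma gen_measurable [measurable]: "gen \<in> bm borel"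
 unfolding gen_def
 by (intro borel_measurable_add borel_measurable_divide borel_measurable_sum borel_measurable_inner matrix_vector_mult_measurable) measurable

lemma gen_bound: "\<bar>gen y\<bar> <= C\<phi> + C\<psi>"
 using psi_bound[of y] phi_bounds[of y] psi_def[of y] unfolding gen_def by linarith

text \<open>Second order Taylor expansion at the grid value, the displacement being kick plus drift.
  The drift time lost by deactivation is charged to \<open>kick_energy\<close> through
  \<open>active_deficit\<close>; the drift in the quadratic term is of higher order.\<close>

lemma step_pointwise:
 fixes j :: nat
 assumes Z: "Z \<in> space M"
 defines "\<xi> \<equiv> kick j (X j Z) (grid_time (Suc j)) Z"
 shows "\<phi> (X (Suc j) Z) \<ge> \<phi> (X j Z) + g (X j Z) \<bullet> \<xi> + (\<xi> \<bullet> (Hm (X j Z) *v \<xi>)) / 2 + h * (g (X j Z) \<bullet> b (X j Z))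
  - (Cg * Cb * (kick_energy j Z / r\<^sup>2) + CH * Cb * (h * sqrt h + sqrt h * (norm \<xi>)\<^sup>2) / 2 + CH * Cb\<^sup>2 * h\<^sup>2 / 2
    + e * (2 * (norm \<xi>)\<^sup>2 + 2 * Cb\<^sup>2 * h\<^sup>2) + C * (4 * norm \<xi> ^ 3 + 4 * Cb ^ 3 * h ^ 3))"
proof -
 define y where "y = X j Z"
 define \<theta> where "\<theta> = active_time j y (grid_time (Suc j)) Z"
 define \<beta> where "\<beta> = \<theta> *\<^sub>R b y"
 define v where "v = \<xi> + \<beta>"
 have T: "grid_time j <= grid_time (Suc j)" using h_pos by simp
 have th: "0 <= \<theta>" "\<theta> <= h" using active_time_bounds[OF Z T, of y] by (auto simp: \<theta>_def)
 have def: "h - \<theta> <= kick_energy j Z / r\<^sup>2" using active_deficit[OF Z, of j] by (simp add: \<theta>_def y_def del: grid_time_simps)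
 have nb: "norm \<beta> <= Cb * h"
 proof -
  have "\<theta> * norm (b y) <= h * Cb" using th b_bound[of y] h_pos by (intro mult_mono) auto
  then show ?thesis using th by (simp add: \<beta>_def mult.commute)
 qed
 have Xs: "X (Suc j) Z = y + v" by (simp add: y_def v_def \<beta>_def \<theta>_def \<xi>_def)
 have q: "0 < sqrt h" "sqrt h * sqrt h = h" using h_pos by auto
 have gb: "g y \<bullet> \<beta> \<ge> h * (g y \<bullet> b y) - Cg * Cb * (kick_energy j Z / r\<^sup>2)"
 proof -
  have "\<bar>g y \<bullet> b y\<bar> <= Cg * Cb"
   using Cauchy_Schwarz_ineq2[of "g y" "b y"] mult_mono[OF g_bound[of y] b_bound[of y] Cg_nonneg norm_ge_zero] by linarith
  then have "(h - \<theta>) * (g y \<bullet> b y) <= (h - \<theta>) * (Cg * Cb)" using th by (intro mult_left_mono) auto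
  also have "\<dots> <= (kick_energy j Z / r\<^sup>2) * (Cg * Cb)"
   using def Cg_nonneg Cb_nonneg by (intro mult_right_mono) auto
  finally have "(h - \<theta>) * (g y \<bullet> b y) <= Cg * Cb * (kick_energy j Z / r\<^sup>2)" by (simp only: mult.commute)
  moreover have "g y \<bullet> \<beta> = h * (g y \<bullet> b y) - (h - \<theta>) * (g y \<bullet> b y)" by (simp add: \<beta>_def algebra_simps)
  ultimately show ?thesis by linarith
 qed
 have quad: "v \<bullet> (Hm y *v v) \<ge> \<xi> \<bullet> (Hm y *v \<xi>) - CH * Cb * (h * sqrt h + sqrt h * (norm \<xi>)\<^sup>2) - CH * Cb\<^sup>2 * h\<^sup>2"
 proof -
  have "v \<bullet> (Hm y *v v) = \<xi> \<bullet> (Hm y *v \<xi>) + \<xi> \<bullet> (Hm y *v \<beta>) + \<beta> \<bullet> (Hm y *v \<xi>) + \<beta> \<bullet> (Hm y *v \<beta>)"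
   by (simp add: v_def matrix_vector_right_distrib inner_add_left inner_add_right)
  moreover have "\<xi> \<bullet> (Hm y *v \<beta>) \<ge> - (CH * norm \<xi> * norm \<beta>)" "\<beta> \<bullet> (Hm y *v \<xi>) \<ge> - (CH * norm \<xi> * norm \<beta>)"
    "\<beta> \<bullet> (Hm y *v \<beta>) \<ge> - (CH * norm \<beta> * norm \<beta>)"
   using Hm_bound[of \<xi> y \<beta>] Hm_bound[of \<beta> y \<xi>] Hm_bound[of \<beta> y \<beta>] by (auto simp: mult_ac)
  \<comment> \<open>The weight \<open>sqrt h\<close> balances the product h * |\<xi>|: both
    resulting terms have mean of order h^(3/2).\<close>
  moreover have "CH * norm \<xi> * norm \<beta> <= CH * Cb * (h * sqrt h + sqrt h * (norm \<xi>)\<^sup>2) / 2"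
  proof -
   have "2 * (sqrt h * norm \<xi>) <= h + (norm \<xi>)\<^sup>2"
    using sum_squares_bound[of "sqrt h" "norm \<xi>"] h_pos by (simp add: mult.assoc)
   then have "sqrt h * (2 * (sqrt h * norm \<xi>)) <= sqrt h * (h + (norm \<xi>)\<^sup>2)" using q by (intro mult_left_mono) auto
   then have *: "h * norm \<xi> <= (h * sqrt h + sqrt h * (norm \<xi>)\<^sup>2) / 2"
   proof -
    have "sqrt h * (2 * (sqrt h * norm \<xi>)) = 2 * ((sqrt h * sqrt h) * norm \<xi>)" by (simp only: mult_ac)
    also have "\<dots> = 2 * (h * norm \<xi>)" by (simp only: q(2))
    finally have "2 * (h * norm \<xi>) <= sqrt h * (h + (norm \<xi>)\<^sup>2)"
     using \<open>sqrt h * (2 * (sqrt h * norm \<xi>)) <= sqrt h * (h + (norm \<xi>)\<^sup>2)\<close> by linarith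
    then show ?thesis by (simp add: algebra_simps)
   qed
   have "CH * norm \<xi> * norm \<beta> <= CH * norm \<xi> * (Cb * h)"
    using nb nonneg by (intro mult_left_mono) auto
   also have "\<dots> = CH * Cb * (h * norm \<xi>)" by (simp only: mult_ac)
   also have "\<dots> <= CH * Cb * ((h * sqrt h + sqrt h * (norm \<xi>)\<^sup>2) / 2)"
    using * nonneg Cb_nonneg by (intro mult_left_mono) auto
   finally show ?thesis by simp
  qed
  moreover have "CH * norm \<beta> * norm \<beta> <= CH * Cb\<^sup>2 * h\<^sup>2"
  proof -
   have "norm \<beta> * norm \<beta> <= (Cb * h) * (Cb * h)" using nb Cb_nonneg h_pos by (intro mult_mono) auto
   then show ?thesis using nonneg(3) mult_left_mono[of "norm \<beta> * norm \<beta>" "(Cb * h) * (Cb * h)" CH] by (simp add: power2_eq_square mult_ac)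
  qed
  ultimately show ?thesis by argo
 qed
 have nv: "norm v <= norm \<xi> + Cb * h" using nb norm_triangle_ineq[of \<xi> \<beta>] by (simp add: v_def)
 have v2: "(norm v)\<^sup>2 <= 2 * (norm \<xi>)\<^sup>2 + 2 * Cb\<^sup>2 * h\<^sup>2"
 proof -
  have "(norm v)\<^sup>2 <= (norm \<xi> + Cb * h)\<^sup>2" using nv by (intro power_mono) auto
  also have "\<dots> <= 2 * (norm \<xi>)\<^sup>2 + 2 * (Cb * h)\<^sup>2"
   using zero_le_power2[of "norm \<xi> - Cb * h"] unfolding power2_sum power2_diff by linarith
  finally show ?thesis by (simp add: power_mult_distrib)
 qed
 have v3: "norm v ^ 3 <= 4 * norm \<xi> ^ 3 + 4 * Cb ^ 3 * h ^ 3"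
 proof -
  have cube: "(a + c) ^ 3 <= 4 * a ^ 3 + 4 * c ^ 3" if "0 <= a" "0 <= c" for a c :: real
  proof -
   have "4 * a ^ 3 + 4 * c ^ 3 - (a + c) ^ 3 = 3 * (a + c) * (a - c)\<^sup>2"
    by (simp add: power2_eq_square power3_eq_cube algebra_simps)
   moreover have "0 <= 3 * (a + c) * (a - c)\<^sup>2" using that by simp
   ultimately show ?thesis by linarith
  qed
  have "norm v ^ 3 <= (norm \<xi> + Cb * h) ^ 3" using nv by (intro power_mono) auto
  also have "\<dots> <= 4 * norm \<xi> ^ 3 + 4 * (Cb * h) ^ 3" using Cb_nonneg h_pos by (intro cube) auto
  finally show ?thesis by (simp add: power_mult_distrib)
 qed
 have "\<phi> (y + v) \<ge> \<phi> y + g y \<bullet> v + (v \<bullet> (Hm y *v v)) / 2 - (e * (norm v)\<^sup>2 + C * norm v ^ 3)"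
  using taylor[of y v] by linarith
 moreover have "e * (norm v)\<^sup>2 <= e * (2 * (norm \<xi>)\<^sup>2 + 2 * Cb\<^sup>2 * h\<^sup>2)" using v2 nonneg by (intro mult_left_mono) auto
 moreover have "C * norm v ^ 3 <= C * (4 * norm \<xi> ^ 3 + 4 * Cb ^ 3 * h ^ 3)" using v3 nonneg by (intro mult_left_mono) auto
 moreover have "g y \<bullet> v = g y \<bullet> \<xi> + g y \<bullet> \<beta>" by (simp add: v_def inner_add_right)
 ultimately show ?thesis using gb quad unfolding Xs y_def[symmetric] by argo
qed

lemma expectation_martingale_part:
 "integrable M (%Z. g (X j Z) \<bullet> kick j (X j Z) (grid_time (Suc j)) Z)"
 "expectation (%Z. g (X j Z) \<bullet> kick j (X j Z) (grid_time (Suc j)) Z) = 0"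
proof -
 let ?t = "grid_time j" and ?t' = "grid_time (Suc j)"
 have st: "0 <= ?t" "?t < ?t'" using h_pos by auto
 have X[measurable]: "X j \<in> bm (F ?t)" by (rule X_measurable)
 have eq: "g (X j Z) \<bullet> kick j (X j Z) ?t' Z = (\<Sum>k<n. (g (X j Z) \<bullet> s k (X j Z)) * incr ?t ?t' k Z)" for Z
  using st by (subst kick_eq) (auto simp: inner_sum_right mult.commute)
 have H: "(%Z. g (X j Z) \<bullet> s k (X j Z)) \<in> bm (F ?t)" for k by measurable
 have Hb: "\<bar>g (X j Z) \<bullet> s k (X j Z)\<bar> <= Cg * Cs" for k Z
  using Cauchy_Schwarz_ineq2[of "g (X j Z)" "s k (X j Z)"] mult_mono[OF g_bound s_bound Cg_nonneg norm_ge_zero] by (rule order_trans)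
 note p = past_times_incr[OF st _ H Hb]
 show "integrable M (%Z. g (X j Z) \<bullet> kick j (X j Z) ?t' Z)"
  unfolding eq by (intro Bochner_Integration.integrable_sum p) auto
 show "expectation (%Z. g (X j Z) \<bullet> kick j (X j Z) ?t' Z) = 0"
  unfolding eq using p by (subst Bochner_Integration.integral_sum) auto
qed

text \<open>The increments are independent of the grid value and uncorrelated with variance h, so
  only the diagonal survives, and it is h times twice the second order part of
  \<open>gen\<close>.\<close>

lemma expectation_quadratic_part:
 "integrable M (%Z. kick j (X j Z) (grid_time (Suc j)) Z \<bullet> (Hm (X j Z) *v kick j (X j Z) (grid_time (Suc j)) Z))"
 "expectation (%Z. kick j (X j Z) (grid_time (Suc j)) Z \<bullet> (Hm (X j Z) *v kick j (X j Z) (grid_time (Suc j)) Z))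
  = h * expectation (%Z. \<Sum>k<n. s k (X j Z) \<bullet> (Hm (X j Z) *v s k (X j Z)))"
proof -
 let ?t = "grid_time j" and ?t' = "grid_time (Suc j)"
 have st: "0 <= ?t" "?t < ?t'" using h_pos by auto
 have X[measurable]: "X j \<in> bm (F ?t)" by (rule X_measurable)
 let ?H = "%k l Z. s k (X j Z) \<bullet> (Hm (X j Z) *v s l (X j Z))"
 have eq: "kick j (X j Z) ?t' Z \<bullet> (Hm (X j Z) *v kick j (X j Z) ?t' Z) = (\<Sum>k<n. \<Sum>l<n. ?H k l Z * (incr ?t ?t' k Z * incr ?t ?t' l Z))" for Z
  unfolding kick_eq[OF less_imp_le[OF st(2)]] matrix_vector_mul_linear[THEN linear_sum] inner_sum_left inner_sum_right
  by (simp add: matrix_vector_mult_scaleR inner_sum_right sum_distrib_left mult_ac del: grid_time_simps)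
   (subst sum.swap, simp add: mult_ac)
 have H: "?H k l \<in> bm (F ?t)" for k l
  by (intro borel_measurable_inner matrix_vector_mult_measurable) measurable
 have Hb: "\<bar>?H k l Z\<bar> <= CH * Cs * Cs" for k l Z
 proof -
  have "\<bar>?H k l Z\<bar> <= CH * norm (s k (X j Z)) * norm (s l (X j Z))" by (rule Hm_bound)
  also have "\<dots> <= CH * Cs * Cs" using nonneg Cs_nonneg by (intro mult_mono s_bound) auto
  finally show ?thesis .
 qed
 have iH: "integrable M (?H k l)" for k l
  using measurable_F[OF H] Hb by (intro bounded_integrable[where C="CH * Cs * Cs"]) auto
 note p = past_times_incr2[OF st _ _ H Hb]
 show "integrable M (%Z. kick j (X j Z) ?t' Z \<bullet> (Hm (X j Z) *v kick j (X j Z) ?t' Z))"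
  unfolding eq by (intro Bochner_Integration.integrable_sum p) auto
 have "expectation (%Z. \<Sum>k<n. \<Sum>l<n. ?H k l Z * (incr ?t ?t' k Z * incr ?t ?t' l Z))
  = (\<Sum>k<n. \<Sum>l<n. expectation (%Z. ?H k l Z * (incr ?t ?t' k Z * incr ?t ?t' l Z)))"
 proof -
  have "expectation (%Z. \<Sum>k<n. \<Sum>l<n. ?H k l Z * (incr ?t ?t' k Z * incr ?t ?t' l Z))
   = (\<Sum>k<n. expectation (%Z. \<Sum>l<n. ?H k l Z * (incr ?t ?t' k Z * incr ?t ?t' l Z)))"
   by (intro Bochner_Integration.integral_sum Bochner_Integration.integrable_sum p) auto
  also have "\<dots> = (\<Sum>k<n. \<Sum>l<n. expectation (%Z. ?H k l Z * (incr ?t ?t' k Z * incr ?t ?t' l Z)))"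
   by (intro sum.cong refl Bochner_Integration.integral_sum p) auto
  finally show ?thesis .
 qed
 also have "\<dots> = (\<Sum>k<n. \<Sum>l<n. if k = l then h * expectation (?H k l) else 0)"
  using p(2) by (intro sum.cong refl) simp
 also have "\<dots> = (\<Sum>k<n. h * expectation (?H k k))" by simp
 also have "\<dots> = h * expectation (%Z. \<Sum>k<n. ?H k k Z)"
  using iH by (simp add: Bochner_Integration.integral_sum sum_distrib_left)
 finally show "expectation (%Z. kick j (X j Z) ?t' Z \<bullet> (Hm (X j Z) *v kick j (X j Z) ?t' Z))
  = h * expectation (%Z. \<Sum>k<n. ?H k k Z)" unfolding eq .
qed

end

section \<open>Discounted sums and the occupation time\<close>

context euler_test
begin

text \<open>The added term bounds the change of the mean of \<phi> over a step; it appears because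
  the discount multiplies the later value of \<phi>.\<close>

definition E2 :: real where
 "E2 = E1 + Cg * ((1 + A2) * sqrt h / 2 + Cb * h)"

abbreviation last_kick :: "nat => 'w => real^'d" where
 "last_kick j Z \<equiv> kick j (X j Z) (grid_time (Suc j)) Z"

lemma last_kick_moments:
 "integrable M (%Z. norm (last_kick j Z) ^ m)"
 "expectation (%Z. (norm (last_kick j Z))\<^sup>2) <= A2 * h"
 "expectation (%Z. norm (last_kick j Z) ^ 3) <= A3 * sqrt h ^ 3"
proof -
 have T: "grid_time j < grid_time (Suc j)" using h_pos by simp
 show "integrable M (%Z. norm (last_kick j Z) ^ m)" using T by (intro norm_kick_moment) auto
 show "expectation (%Z. (norm (last_kick j Z))\<^sup>2) <= A2 * h"
  using kick_second_moment[OF less_imp_le[OF T]] by simp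
 show "expectation (%Z. norm (last_kick j Z) ^ 3) <= A3 * sqrt h ^ 3"
  using kick_third_moment[OF T] by simp
qed

lemma bounded_X_integrable: "f \<in> bm borel ==> (\<And>y. \<bar>f y\<bar> <= (B::real)) ==> integrable M (%Z. f (X j Z))"
 by (rule bounded_integrable[where C=B]) auto

lemma phi_integrable: "integrable M (%Z. \<phi> (X j Z))"
 using phi_bounds by (intro bounded_X_integrable[where B=C\<phi>]) (auto simp: abs_le_iff intro: order_trans)

lemma psi_integrable: "integrable M (%Z. \<psi> (X j Z))"
 using psi_bound by (intro bounded_X_integrable[where B=C\<psi>]) auto

lemma gen_integrable: "integrable M (%Z. gen (X j Z))"
 using gen_bound by (intro bounded_X_integrable) auto

lemma phi_step:
 "expectation (%Z. \<phi> (X (Suc j) Z)) \<ge> expectation (%Z. \<phi> (X j Z)) + h * expectation (%Z. gen (X j Z)) - h * E1"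
proof -
 let ?m = "%Z. g (X j Z) \<bullet> last_kick j Z"
 let ?qd = "%Z. last_kick j Z \<bullet> (Hm (X j Z) *v last_kick j Z)"
 let ?N2 = "%Z. (norm (last_kick j Z))\<^sup>2" and ?N3 = "%Z. norm (last_kick j Z) ^ 3"
 let ?gb = "%Z. g (X j Z) \<bullet> b (X j Z)"
 let ?tr = "%Z. \<Sum>k<n. s k (X j Z) \<bullet> (Hm (X j Z) *v s k (X j Z))"
 let ?err = "%Z. Cg * Cb * (kick_energy j Z / r\<^sup>2) + CH * Cb * (h * sqrt h + sqrt h * ?N2 Z) / 2 + CH * Cb\<^sup>2 * h\<^sup>2 / 2
    + e * (2 * ?N2 Z + 2 * Cb\<^sup>2 * h\<^sup>2) + C * (4 * ?N3 Z + 4 * Cb ^ 3 * h ^ 3)"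
 have igb: "integrable M ?gb"
 proof (rule bounded_X_integrable[where B="Cg * Cb"])
  show "\<bar>g y \<bullet> b y\<bar> <= Cg * Cb" for y
   using Cauchy_Schwarz_ineq2[of "g y" "b y"] mult_mono[OF g_bound[of y] b_bound[of y] Cg_nonneg norm_ge_zero] by linarith
 qed measurable
 have itr: "integrable M ?tr"
 proof -
  have "integrable M (%Z. 2 * (gen (X j Z) - ?gb Z))" by (intro integrable_mult_right Bochner_Integration.integrable_diff gen_integrable igb)
  then show ?thesis by (simp add: gen_def)
 qed
 note i = phi_integrable[of j] expectation_martingale_part(1)[of j] expectation_quadratic_part(1)[of j] igb kick_energy_expectation(1)[of j]
  last_kick_moments(1)[of j 2] last_kick_moments(1)[of j 3]
 have ierr: "integrable M ?err"
  by (intro Bochner_Integration.integrable_add integrable_mult_right integrable_divide i) simp_all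
 have "expectation (%Z. \<phi> (X j Z) + ?m Z + ?qd Z / 2 + h * ?gb Z - ?err Z) <= expectation (%Z. \<phi> (X (Suc j) Z))"
 proof (rule integral_mono)
  show "integrable M (%Z. \<phi> (X j Z) + ?m Z + ?qd Z / 2 + h * ?gb Z - ?err Z)"
   by (intro Bochner_Integration.integrable_diff Bochner_Integration.integrable_add integrable_mult_right integrable_divide i ierr)
  show "integrable M (%Z. \<phi> (X (Suc j) Z))" by (rule phi_integrable)
  show "\<phi> (X j Z) + ?m Z + ?qd Z / 2 + h * ?gb Z - ?err Z <= \<phi> (X (Suc j) Z)" if "Z \<in> space M" for Z
   by (rule step_pointwise[OF that])
 qed
 also have "expectation (%Z. \<phi> (X j Z) + ?m Z + ?qd Z / 2 + h * ?gb Z - ?err Z)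
  = expectation (%Z. \<phi> (X j Z)) + expectation ?m + expectation ?qd / 2 + h * expectation ?gb - expectation ?err"
 proof -
  have 1: "integrable M (%Z. \<phi> (X j Z) + ?m Z)" "integrable M (%Z. ?qd Z / 2)" "integrable M (%Z. h * ?gb Z)"
   by (intro Bochner_Integration.integrable_add integrable_mult_right integrable_divide i)+
  note 2 = Bochner_Integration.integrable_add[OF 1(1,2)]
  note 3 = Bochner_Integration.integrable_add[OF 2 1(3)]
  show ?thesis
   unfolding Bochner_Integration.integral_diff[OF 3 ierr] Bochner_Integration.integral_add[OF 2 1(3)]
    Bochner_Integration.integral_add[OF 1(1,2)] Bochner_Integration.integral_add[OF i(1,2)]
    integral_divide_zero integral_mult_right_zero ..
 qed
 finally have main: "expectation (%Z. \<phi> (X j Z)) + h * (expectation ?tr / 2 + expectation ?gb) - expectation ?err <= expectation (%Z. \<phi> (X (Suc j) Z))"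
  unfolding expectation_martingale_part(2) expectation_quadratic_part(2) by (simp add: algebra_simps)
 have geq: "expectation (%Z. gen (X j Z)) = expectation ?tr / 2 + expectation ?gb"
  unfolding gen_def using itr igb by simp
 have eerr: "expectation ?err = Cg * Cb * (expectation (kick_energy j) / r\<^sup>2) + CH * Cb * (h * sqrt h + sqrt h * expectation ?N2) / 2 + CH * Cb\<^sup>2 * h\<^sup>2 / 2
    + e * (2 * expectation ?N2 + 2 * Cb\<^sup>2 * h\<^sup>2) + C * (4 * expectation ?N3 + 4 * Cb ^ 3 * h ^ 3)"
  using i prob_space by (simp del: grid_time_simps)
 have q: "0 < sqrt h" "sqrt h ^ 3 = sqrt h * h" using h_pos by (auto simp: power3_eq_cube)
 have "expectation ?err <= Cg * Cb * (A2 * h\<^sup>2 / r\<^sup>2) + CH * Cb * (h * sqrt h + sqrt h * (A2 * h)) / 2 + CH * Cb\<^sup>2 * h\<^sup>2 / 2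
    + e * (2 * (A2 * h) + 2 * Cb\<^sup>2 * h\<^sup>2) + C * (4 * (A3 * (sqrt h * h)) + 4 * Cb ^ 3 * h ^ 3)"
  unfolding eerr
  using kick_energy_expectation(2)[of j] last_kick_moments(2)[of j] last_kick_moments(3)[of j] nonneg Cg_nonneg Cb_nonneg h_pos q
  by (intro add_mono mult_left_mono divide_right_mono order_refl) (auto simp del: grid_time_simps)
 also have "\<dots> = h * E1"
  unfolding E1_def by (simp add: algebra_simps power2_eq_square power3_eq_cube add_divide_distrib)
 finally show ?thesis using main unfolding geq by linarith
qed

text \<open>The Lipschitz bound involves the first absolute moment of the kick; |\<xi>| <= sqrt h /
  2 + |\<xi>|^2 / (2 * sqrt h) reduces it to the second.\<close>

lemma phi_change:
 "expectation (%Z. \<phi> (X (Suc j) Z)) <= expectation (%Z. \<phi> (X j Z)) + Cg * ((1 + A2) * sqrt h / 2 + Cb * h)"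
proof -
 let ?N2 = "%Z. (norm (last_kick j Z))\<^sup>2"
 have q: "0 < sqrt h" "sqrt h * sqrt h = h" using h_pos by auto
 have "\<phi> (X (Suc j) Z) <= \<phi> (X j Z) + Cg * (sqrt h / 2 + ?N2 Z / (2 * sqrt h) + Cb * h)" if Z: "Z \<in> space M" for Z
 proof -
  have T: "grid_time j <= grid_time (Suc j)" using h_pos by simp
  let ?\<theta> = "active_time j (X j Z) (grid_time (Suc j)) Z"
  let ?v = "last_kick j Z + ?\<theta> *\<^sub>R b (X j Z)"
  have th: "0 <= ?\<theta>" "?\<theta> <= h" using active_time_bounds[OF Z T, of "X j Z"] by auto
  have "?\<theta> * norm (b (X j Z)) <= h * Cb" using th b_bound h_pos by (intro mult_mono) auto
  then have "norm ?v <= norm (last_kick j Z) + Cb * h"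
   using norm_triangle_ineq[of "last_kick j Z" "?\<theta> *\<^sub>R b (X j Z)"] th(1) by (simp add: mult.commute del: grid_time_simps)
  also have "norm (last_kick j Z) <= sqrt h / 2 + ?N2 Z / (2 * sqrt h)"
  proof -
   have "2 * (sqrt h * norm (last_kick j Z)) <= sqrt h * sqrt h + ?N2 Z"
    using sum_squares_bound[of "sqrt h" "norm (last_kick j Z)"] by (simp add: mult.assoc power2_eq_square del: grid_time_simps)
   then have "norm (last_kick j Z) <= (sqrt h * sqrt h + ?N2 Z) / (2 * sqrt h)"
    using q(1) by (subst pos_le_divide_eq) (simp_all only: mult_ac mult_pos_pos zero_less_numeral)
   also have "\<dots> = sqrt h / 2 + ?N2 Z / (2 * sqrt h)"
    using q(1) by (simp only: add_divide_distrib) (simp del: real_sqrt_mult_self grid_time_simps)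
   finally show ?thesis .
  qed
  finally have "norm ?v <= sqrt h / 2 + ?N2 Z / (2 * sqrt h) + Cb * h" by simp
  then have "Cg * norm ?v <= Cg * (sqrt h / 2 + ?N2 Z / (2 * sqrt h) + Cb * h)" using Cg_nonneg by (rule mult_left_mono)
  moreover have "\<phi> (X (Suc j) Z) <= \<phi> (X j Z) + Cg * norm ?v"
   using lip[of "X j Z" ?v] by (simp add: add.assoc del: grid_time_simps)
  ultimately show ?thesis by linarith
 qed
 then have "expectation (%Z. \<phi> (X (Suc j) Z)) <= expectation (%Z. \<phi> (X j Z) + Cg * (sqrt h / 2 + ?N2 Z / (2 * sqrt h) + Cb * h))"
  by (intro integral_mono phi_integrable Bochner_Integration.integrable_add integrable_mult_right integrable_divide
    integrable_const last_kick_moments(1)) blast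
 also have "\<dots> = expectation (%Z. \<phi> (X j Z)) + Cg * (sqrt h / 2 + expectation ?N2 / (2 * sqrt h) + Cb * h)"
  using last_kick_moments(1)[of j 2] phi_integrable prob_space by (simp del: grid_time_simps)
 also have "\<dots> <= expectation (%Z. \<phi> (X j Z)) + Cg * (sqrt h / 2 + A2 * h / (2 * sqrt h) + Cb * h)"
  using last_kick_moments(2)[of j] Cg_nonneg q by (intro add_mono mult_left_mono divide_right_mono order_refl) auto
 also have "A2 * h / (2 * sqrt h) = A2 * sqrt h / 2"
 proof -
  have "A2 * h / (2 * sqrt h) = A2 * (sqrt h * sqrt h) / (2 * sqrt h)" by (simp only: q(2))
  then show ?thesis using q(1) by (simp del: real_sqrt_mult_self)
 qed
 finally show ?thesis by (simp add: algebra_simps add_divide_distrib)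
qed

text \<open>With the means a, b of \<phi> before and after the step, \<open>phi_step\<close> reads a
  <= (1 - h) * b + h * (b - a) + h * (E \<psi> + E1). The middle term is bounded by
  \<open>phi_change\<close>, and (1 - h) * b <= exp (- h) * b because b >= 0.\<close>

lemma discounted_step:
 "expectation (%Z. \<phi> (X j Z)) <= h * (expectation (%Z. \<psi> (X j Z)) + E2) + exp (- h) * expectation (%Z. \<phi> (X (Suc j) Z))"
proof -
 let ?a = "expectation (%Z. \<phi> (X j Z))" and ?b = "expectation (%Z. \<phi> (X (Suc j) Z))"
 have "0 <= ?b" by (intro integral_nonneg_AE AE_I2 phi_bounds)
 then have "(1 - h) * ?b <= exp (- h) * ?b" using exp_ge_add_one_self[of "- h"] by (intro mult_right_mono) auto
 moreover have "h * ?b <= h * (?a + Cg * ((1 + A2) * sqrt h / 2 + Cb * h))" using phi_change[of j] h_pos by (intro mult_left_mono) auto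
 moreover have "expectation (%Z. \<psi> (X j Z)) = ?a - expectation (%Z. gen (X j Z))"
  unfolding psi_def gen_def[symmetric] using phi_integrable gen_integrable by simp
 then have "h * expectation (%Z. \<psi> (X j Z)) = h * ?a - h * expectation (%Z. gen (X j Z))"
  by (simp only: right_diff_distrib)
 ultimately show ?thesis using phi_step[of j] unfolding E2_def distrib_left left_diff_distrib mult_1 by linarith
qed

text \<open>A discrete Feynman-Kac formula: iterate \<open>discounted_step\<close> and bound the
  last value by C\<phi>.\<close>

lemma phi_0_le:
 "\<phi> 0 <= (\<Sum>j<N. exp (- (real j * h)) * (h * (expectation (%Z. \<psi> (X j Z)) + E2))) + exp (- (real N * h)) * C\<phi>"
proof -
 have "\<phi> 0 <= (\<Sum>j<N. exp (- (real j * h)) * (h * (expectation (%Z. \<psi> (X j Z)) + E2))) + exp (- (real N * h)) * expectation (%Z. \<phi> (X N Z))"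
 proof (induction N)
  case 0
  show ?case using prob_space by simp
 next
  case (Suc N)
  have "exp (- (real N * h)) * expectation (%Z. \<phi> (X N Z)) <= exp (- (real N * h)) * (h * (expectation (%Z. \<psi> (X N Z)) + E2) + exp (- h) * expectation (%Z. \<phi> (X (Suc N) Z)))"
   by (intro mult_left_mono discounted_step) simp
  also have "\<dots> = exp (- (real N * h)) * (h * (expectation (%Z. \<psi> (X N Z)) + E2)) + exp (- (real (Suc N) * h)) * expectation (%Z. \<phi> (X (Suc N) Z))"
  proof -
   have "exp (- (real N * h)) * exp (- h) = exp (- (real (Suc N) * h))"
    unfolding exp_add[symmetric] by (simp add: algebra_simps)
   then have "exp (- (real N * h)) * (exp (- h) * a) = exp (- (real (Suc N) * h)) * a" for a
    by (simp only: mult.assoc[symmetric])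
   then show ?thesis by (simp only: distrib_left[of "exp (- (real N * h))" "h * c" "d" for c d])
  qed
  finally show ?case using Suc by (simp del: X.simps)
 qed
 moreover have "expectation (%Z. \<phi> (X N Z)) <= C\<phi>"
  using integral_mono[OF phi_integrable[of N] integrable_const[of C\<phi>]] phi_bounds prob_space by simp
 then have "exp (- (real N * h)) * expectation (%Z. \<phi> (X N Z)) <= exp (- (real N * h)) * C\<phi>" by (intro mult_left_mono) auto
 ultimately show ?thesis by linarith
qed

text \<open>By the defining property of a Green's function, the mean of this quantity is the
  integral of the positive part of \<psi> against that function.\<close>

definition occupation :: "'w => ennreal" where
 "occupation Z = (nnS {0..} (%t. ennreal (exp (- t)) * ennreal (max 0 (\<psi> (x t Z)))))"

definition step_loss :: "nat => 'w => real" where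
 "step_loss j Z = e' * h + C' * (2 * kick_energy j Z + 2 * Cb\<^sup>2 * h ^ 3)"

text \<open>\<psi> at the grid value is compared with \<psi> along the step by
  \<open>psi_mod\<close>, at the price \<open>step_loss\<close>. The factor 2 pays for replacing exp
  (- j * h) by exp (- t), which is possible since h <= 1/2.\<close>

lemma occupation_step:
 assumes Z: "Z \<in> space M"
 shows "ennreal (exp (- (real j * h)) * (h * \<psi> (X j Z) - step_loss j Z))
  <= 2 * (NN t. ennreal (exp (- t)) * ennreal (max 0 (\<psi> (x t Z))) * indicator {grid_time j..<grid_time (Suc j)} t)"
proof -
 let ?I = "{grid_time j..<grid_time (Suc j)}"
 define z where "z t = X j Z + kick j (X j Z) t Z + active_time j (X j Z) t Z *\<^sub>R b (X j Z)" for t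
 have [measurable]: "z \<in> bm borel" unfolding z_def by (rule x_path_measurable[OF Z])
 have xz: "x t Z = z t" if "t \<in> ?I" for t unfolding z_def using that by (intro x_step[OF Z]) auto
 have C\<psi>: "0 <= C\<psi>" using order_trans[OF abs_ge_zero psi_bound] .
 have ibnd: "set_integrable lborel ?I f" if [measurable]: "f \<in> bm borel" and "\<And>t. t \<in> ?I ==> \<bar>f t\<bar> <= B" for f :: "real => real" and B :: real
  unfolding set_integrable_def
  by (rule integrableI_bounded_set_indicator[where B=B]) (use that h_pos in \<open>auto simp: emeasure_lborel_Ico\<close>)
 have i1: "set_integrable lborel ?I (%t. max 0 (\<psi> (z t)))"
  by (rule ibnd[of _ C\<psi>]) (use C\<psi> psi_bound in \<open>auto simp: abs_le_iff\<close>)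
 have i2: "set_integrable lborel ?I (%t. exp (- t) * max 0 (\<psi> (z t)))"
 proof (rule ibnd[of _ C\<psi>])
  fix t assume "t \<in> ?I"
  then have "0 <= t" using grid_time_simps(3)[of j] by (auto simp del: grid_time_simps)
  then have "exp (- t) * max 0 (\<psi> (z t)) <= 1 * C\<psi>" using C\<psi> psi_bound[of "z t"] by (intro mult_mono) auto
  then show "\<bar>exp (- t) * max 0 (\<psi> (z t))\<bar> <= C\<psi>" by (simp add: abs_mult)
 qed measurable
 have i3: "set_integrable lborel ?I (%t. e' + C' * (2 * (norm (kick j (X j Z) t Z))\<^sup>2 + 2 * Cb\<^sup>2 * h\<^sup>2))"
  using kick_energy_integrable[OF Z, of j] ibnd[of "%_. e'" "\<bar>e'\<bar>"] ibnd[of "%_. 2 * Cb\<^sup>2 * h\<^sup>2" "\<bar>2 * Cb\<^sup>2 * h\<^sup>2\<bar>"]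
  by (intro set_integral_add(1) set_integrable_mult_right) auto
 have c: "set_integrable lborel ?I (%t. \<psi> (X j Z))" by (rule ibnd[of _ C\<psi>]) (use psi_bound in auto)
 have len: "measure lborel ?I = h" using h_pos by simp
 have "h * \<psi> (X j Z) = (LINT t:?I|lborel. \<psi> (X j Z))"
  using h_pos by (simp add: set_lebesgue_integral_def)
 also have "\<dots> <= (LINT t:?I|lborel. max 0 (\<psi> (z t)) + (e' + C' * (2 * (norm (kick j (X j Z) t Z))\<^sup>2 + 2 * Cb\<^sup>2 * h\<^sup>2)))"
 proof (rule set_integral_mono[OF c set_integral_add(1)[OF i1 i3]])
  fix t assume t: "t \<in> ?I"
  have at: "0 <= active_time j (X j Z) t Z" "active_time j (X j Z) t Z <= h"
   using active_time_bounds[OF Z, of j t "X j Z"] t by auto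
  have "active_time j (X j Z) t Z * norm (b (X j Z)) <= h * Cb" using at b_bound h_pos by (intro mult_mono) auto
  then have "norm (z t - X j Z) <= norm (kick j (X j Z) t Z) + Cb * h"
   using norm_triangle_ineq[of "kick j (X j Z) t Z" "active_time j (X j Z) t Z *\<^sub>R b (X j Z)"] at
   by (simp add: z_def mult.commute add.assoc)
  then have "(norm (z t - X j Z))\<^sup>2 <= (norm (kick j (X j Z) t Z) + Cb * h)\<^sup>2" by (intro power_mono) auto
  also have "\<dots> <= 2 * (norm (kick j (X j Z) t Z))\<^sup>2 + 2 * (Cb * h)\<^sup>2"
   using zero_le_power2[of "norm (kick j (X j Z) t Z) - Cb * h"] unfolding power2_sum power2_diff by linarith
  finally have "C' * (norm (z t - X j Z))\<^sup>2 <= C' * (2 * (norm (kick j (X j Z) t Z))\<^sup>2 + 2 * Cb\<^sup>2 * h\<^sup>2)"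
   using nonneg by (intro mult_left_mono) (auto simp: power_mult_distrib)
  then show "\<psi> (X j Z) <= max 0 (\<psi> (z t)) + (e' + C' * (2 * (norm (kick j (X j Z) t Z))\<^sup>2 + 2 * Cb\<^sup>2 * h\<^sup>2))"
   using psi_mod[of "X j Z" "z t"] by linarith
 qed
 also have "\<dots> = (LINT t:?I|lborel. max 0 (\<psi> (z t))) + (LINT t:?I|lborel. e' + C' * (2 * (norm (kick j (X j Z) t Z))\<^sup>2 + 2 * Cb\<^sup>2 * h\<^sup>2))"
  by (rule set_integral_add(2)[OF i1 i3])
 also have "(LINT t:?I|lborel. e' + C' * (2 * (norm (kick j (X j Z) t Z))\<^sup>2 + 2 * Cb\<^sup>2 * h\<^sup>2)) = step_loss j Z"
 proof -
  have 1: "set_integrable lborel ?I (%_. e')" by (rule ibnd[of _ "\<bar>e'\<bar>"]) auto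
  have 2: "set_integrable lborel ?I (%_. 2 * Cb\<^sup>2 * h\<^sup>2)" by (rule ibnd[of _ "\<bar>2 * Cb\<^sup>2 * h\<^sup>2\<bar>"]) auto
  have 3: "set_integrable lborel ?I (%t. 2 * (norm (kick j (X j Z) t Z))\<^sup>2)" using kick_energy_integrable[OF Z, of j] by (rule set_integrable_mult_right)
  have "(LINT t:?I|lborel. e' + C' * (2 * (norm (kick j (X j Z) t Z))\<^sup>2 + 2 * Cb\<^sup>2 * h\<^sup>2))
   = (LINT t:?I|lborel. e') + C' * ((LINT t:?I|lborel. 2 * (norm (kick j (X j Z) t Z))\<^sup>2) + (LINT t:?I|lborel. 2 * Cb\<^sup>2 * h\<^sup>2))"
   using 1 2 3 set_integral_add(1)[OF 3 2] by (simp add: set_integral_add(2) set_integral_mult_right set_integrable_mult_right del: grid_time_simps)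
  also have "\<dots> = e' * h + C' * (2 * kick_energy j Z + 2 * Cb\<^sup>2 * h ^ 3)"
   unfolding kick_energy_def using h_pos by (simp add: set_lebesgue_integral_def power2_eq_square power3_eq_cube)
  finally show ?thesis by (simp add: step_loss_def)
 qed
 finally have "h * \<psi> (X j Z) - step_loss j Z <= (LINT t:?I|lborel. max 0 (\<psi> (z t)))" by simp
 then have "exp (- (real j * h)) * (h * \<psi> (X j Z) - step_loss j Z) <= exp (- (real j * h)) * (LINT t:?I|lborel. max 0 (\<psi> (z t)))"
  by (intro mult_left_mono) auto
 also have "\<dots> = (LINT t:?I|lborel. exp (- (real j * h)) * max 0 (\<psi> (z t)))" by simp
 also have "\<dots> <= (LINT t:?I|lborel. 2 * (exp (- t) * max 0 (\<psi> (z t))))"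
 proof (rule set_integral_mono)
  show "set_integrable lborel ?I (%t. exp (- (real j * h)) * max 0 (\<psi> (z t)))" "set_integrable lborel ?I (%t. 2 * (exp (- t) * max 0 (\<psi> (z t))))"
   using i1 i2 by (auto intro: set_integrable_mult_right)
  fix t assume t: "t \<in> ?I"
  then have "t - real j * h <= 1 / 2" using h_small by (auto simp: grid_time_def algebra_simps)
  have "1 / 2 <= exp (real j * h - t)" using exp_ge_add_one_self[of "real j * h - t"] \<open>t - real j * h <= 1 / 2\<close> by linarith
  then have "1 / 2 * exp (- (real j * h)) <= exp (real j * h - t) * exp (- (real j * h))" by (rule mult_right_mono) simp
  also have "\<dots> = exp (- t)" by (simp add: exp_add[symmetric])
  finally have "exp (- (real j * h)) <= 2 * exp (- t)" by simp
  then have "exp (- (real j * h)) * max 0 (\<psi> (z t)) <= 2 * exp (- t) * max 0 (\<psi> (z t))" by (intro mult_right_mono) auto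
  then show "exp (- (real j * h)) * max 0 (\<psi> (z t)) <= 2 * (exp (- t) * max 0 (\<psi> (z t)))" by simp
 qed
 finally have "ennreal (exp (- (real j * h)) * (h * \<psi> (X j Z) - step_loss j Z)) <= ennreal (LINT t:?I|lborel. 2 * (exp (- t) * max 0 (\<psi> (z t))))"
  by (rule ennreal_leI)
 also have "\<dots> = (NN t. ennreal (indicator ?I t *\<^sub>R (2 * (exp (- t) * max 0 (\<psi> (z t))))))"
  unfolding set_lebesgue_integral_def using i2
  by (intro nn_integral_eq_integral[symmetric]) (auto simp: set_integrable_def mult.left_commute[of _ 2])
 also have "\<dots> = (NN t. 2 * (ennreal (exp (- t)) * ennreal (max 0 (\<psi> (x t Z))) * indicator ?I t))"
  by (intro nn_integral_cong) (auto simp: indicator_def xz ennreal_mult ennreal_mult' simp del: grid_time_simps)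
 also have "\<dots> = (NN t. 2 * (ennreal (exp (- t)) * ennreal (max 0 (\<psi> (z t))) * indicator ?I t))"
  by (intro nn_integral_cong) (auto simp: indicator_def xz simp del: grid_time_simps)
 also have "\<dots> = 2 * (NN t. ennreal (exp (- t)) * ennreal (max 0 (\<psi> (z t))) * indicator ?I t)"
  by (rule nn_integral_cmult) measurable
 also have "(NN t. ennreal (exp (- t)) * ennreal (max 0 (\<psi> (z t))) * indicator ?I t) = (NN t. ennreal (exp (- t)) * ennreal (max 0 (\<psi> (x t Z))) * indicator ?I t)"
  by (intro nn_integral_cong) (auto simp: indicator_def xz simp del: grid_time_simps)
 finally show ?thesis .
qed

end

text \<open>Only an inequality, since \<open>ennreal\<close> sends negative summands to 0; the
  summands in \<open>occupation_lower\<close> may be negative.\<close>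

lemma ennreal_sum_le: "ennreal (\<Sum>i\<in>I. f i) <= (\<Sum>i\<in>I. ennreal (f i))"
proof (cases "finite I")
 case True
 then show ?thesis
 proof (induction I)
  case (insert i I)
  have "ennreal (f i + sum f I) <= ennreal (max 0 (f i) + max 0 (sum f I))" by (intro ennreal_leI add_mono) auto
  also have "\<dots> = ennreal (f i) + ennreal (sum f I)" by (simp add: ennreal_plus max_def ennreal_neg)
  also have "\<dots> <= ennreal (f i) + (\<Sum>i\<in>I. ennreal (f i))" using insert by (intro add_mono) auto
  finally show ?case using insert by simp
 qed simp
qed simp

context euler_test
begin

lemma occupation_lower:
 assumes Z: "Z \<in> space M"
 shows "ennreal (\<Sum>j<N. exp (- (real j * h)) * (h * \<psi> (X j Z) - step_loss j Z)) <= 2 * occupation Z"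
proof -
 let ?I = "%j. {grid_time j..<grid_time (Suc j)}"
 let ?f = "%t. ennreal (exp (- t)) * ennreal (max 0 (\<psi> (x t Z)))"
 have meas: "(%t. ?f t * indicator (?I j) t) \<in> bm borel" for j
 proof -
  define z where "z t = X j Z + kick j (X j Z) t Z + active_time j (X j Z) t Z *\<^sub>R b (X j Z)" for t
  have [measurable]: "z \<in> bm borel" unfolding z_def by (rule x_path_measurable[OF Z])
  have xz: "x t Z = z t" if "t \<in> ?I j" for t unfolding z_def using that by (intro x_step[OF Z]) auto
  have "(%t. ?f t * indicator (?I j) t) = (%t. ennreal (exp (- t)) * ennreal (max 0 (\<psi> (z t))) * indicator (?I j) t)"
   by (auto simp: fun_eq_iff indicator_def xz simp del: grid_time_simps)
  then show ?thesis by simp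
 qed
 have "ennreal (\<Sum>j<N. exp (- (real j * h)) * (h * \<psi> (X j Z) - step_loss j Z)) <= (\<Sum>j<N. 2 * (NN t. ?f t * indicator (?I j) t))"
  by (rule order_trans[OF ennreal_sum_le sum_mono[OF occupation_step[OF Z]]])
 also have "\<dots> = 2 * (NN t. (\<Sum>j<N. ?f t * indicator (?I j) t))"
  using meas by (subst nn_integral_sum) (auto simp: sum_distrib_left)
 also have "\<dots> <= 2 * (NN t. ?f t * indicator {0..} t)"
 proof (intro mult_left_mono nn_integral_mono)
  fix t :: real
  have "(\<Sum>j<N. ?f t * indicator (?I j) t) = ?f t * (\<Sum>j<N. indicator (?I j) t)" by (simp add: sum_distrib_left)
  also have "(\<Sum>j<N. indicator (?I j) t) <= (indicator {0..} t :: ennreal)"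
  proof (cases "0 <= t")
   case True
   have "(\<Sum>j<N. indicator (?I j) t) <= (\<Sum>j<N. if j = step_of t then 1 else 0 :: ennreal)"
    by (intro sum_mono) (auto simp: indicator_def step_of_eq)
   also have "\<dots> <= 1" by simp
   finally show ?thesis using True by simp
  next
   case False
   then have "t \<notin> ?I j" for j using grid_time_simps(3)[of j] by (auto simp del: grid_time_simps)
   then show ?thesis by (simp del: grid_time_simps)
  qed
  finally show "(\<Sum>j<N. ?f t * indicator (?I j) t) <= ?f t * indicator {0..} t" by (simp add: mult_left_mono)
 qed simp
 finally show ?thesis unfolding occupation_def .
qed

text \<open>A left Riemann sum of exp (- t); the geometric series and 1 - exp (- h) >= h / 2 give
  the bound.\<close>

lemma discount_sum: "(\<Sum>j<N. exp (- (real j * h)) * h) <= 2"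
proof -
 have q: "exp (- h) < 1" using h_pos by simp
 have "exp (- h) <= 1 / (1 + h)" using exp_ge_add_one_self[of h] h_pos by (simp add: exp_minus inverse_eq_divide frac_le)
 also have "\<dots> <= 1 - h / 2"
 proof -
  have "h * h <= h * 1" using h_small h_pos by (intro mult_left_mono) auto
  then have "1 <= (1 - h / 2) * (1 + h)" by (simp add: algebra_simps)
  then show ?thesis using h_pos by (simp add: pos_divide_le_eq)
 qed
 finally have h2: "h / 2 <= 1 - exp (- h)" by simp
 have "(\<Sum>j<N. exp (- (real j * h)) * h) = h * (\<Sum>j<N. exp (- h) ^ j)"
  by (simp add: sum_distrib_left exp_of_nat_mult[symmetric] mult.commute)
 also have "\<dots> = h * ((1 - exp (- h) ^ N) / (1 - exp (- h)))" using q by (subst sum_gp_strict) auto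
 also have "\<dots> <= h * (1 / (h / 2))"
  using h2 h_pos q by (intro mult_left_mono frac_le) auto
 finally show ?thesis using h_pos by simp
qed

text \<open>The means in \<open>phi_0_le\<close> are compared with the mean occupation time; the
  remainder exp (- N * h) * C\<phi> disappears as N grows.\<close>

theorem value_bound:
 assumes V: "(\<integral>\<^sup>+Z. occupation Z \<partial>M) <= ennreal V" "0 <= V"
 shows "\<phi> 0 <= 2 * V + 2 * (\<bar>E2\<bar> + (e' + C' * (2 * A2 * h + 2 * Cb\<^sup>2 * h\<^sup>2)))"
proof -
 let ?L = "e' + C' * (2 * A2 * h + 2 * Cb\<^sup>2 * h\<^sup>2)"
 have L0: "0 <= ?L" using nonneg A_nonneg h_pos by auto
 have bound: "\<phi> 0 <= 2 * V + 2 * (\<bar>E2\<bar> + ?L) + exp (- (real N * h)) * C\<phi>" for N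
 proof -
  define f where "f Z = (\<Sum>j<N. exp (- (real j * h)) * (h * \<psi> (X j Z) - step_loss j Z))" for Z
  have il: "integrable M (step_loss j)" for j
   unfolding step_loss_def[abs_def]
   by (intro Bochner_Integration.integrable_add integrable_mult_right integrable_const kick_energy_expectation(1))
  have el: "expectation (step_loss j) <= h * ?L" for j
  proof -
   have "expectation (step_loss j) = e' * h + C' * (2 * expectation (kick_energy j) + 2 * Cb\<^sup>2 * h ^ 3)"
    unfolding step_loss_def[abs_def] using kick_energy_expectation(1)[of j] prob_space by simp
   also have "\<dots> <= e' * h + C' * (2 * (A2 * h\<^sup>2) + 2 * Cb\<^sup>2 * h ^ 3)"
    using kick_energy_expectation(2)[of j] nonneg by (intro add_mono mult_left_mono order_refl) auto
   also have "\<dots> = h * ?L" by (simp add: algebra_simps power2_eq_square power3_eq_cube)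
   finally show ?thesis .
  qed
  have i: "integrable M (%Z. exp (- (real j * h)) * (h * \<psi> (X j Z) - step_loss j Z))" for j
   by (intro integrable_mult_right Bochner_Integration.integrable_diff psi_integrable il)
  have fi: "integrable M f" unfolding f_def[abs_def] by (intro Bochner_Integration.integrable_sum i)
  have Ef: "expectation f = (\<Sum>j<N. exp (- (real j * h)) * (h * expectation (%Z. \<psi> (X j Z)) - expectation (step_loss j)))"
   unfolding f_def[abs_def] using i psi_integrable il by (subst Bochner_Integration.integral_sum) auto
  \<comment> \<open>The factor 2 is moved to the left, where it can be handled as a real number;
    taking it out of the integral of \<open>occupation\<close> would call for measurability of
    \<open>occupation\<close>.\<close>
  have half: "ennreal (f Z / 2) <= occupation Z" if "Z \<in> space M" for Z
  proof -
   have "2 * ennreal (f Z / 2) = ennreal (2 * (f Z / 2))" by (subst ennreal_mult') simp_all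
   also have "\<dots> <= 2 * occupation Z" using occupation_lower[OF that, of N] by (simp add: f_def)
   finally show ?thesis by (subst (asm) ennreal_mult_le_mult_iff) auto
  qed
  have "expectation (%Z. f Z / 2) <= V"
  proof -
   have "(\<integral>\<^sup>+Z. ennreal (max 0 (f Z / 2)) \<partial>M) <= (\<integral>\<^sup>+Z. occupation Z \<partial>M)"
    using half by (intro nn_integral_mono) (auto simp: max_def ennreal_neg)
   also have "\<dots> <= ennreal V" by (rule V)
   also have "(\<integral>\<^sup>+Z. ennreal (max 0 (f Z / 2)) \<partial>M) = ennreal (expectation (%Z. max 0 (f Z / 2)))"
    using fi by (intro nn_integral_eq_integral) auto
   finally have "expectation (%Z. max 0 (f Z / 2)) <= V" using V(2) by (simp add: ennreal_le_iff)
   moreover have "expectation (%Z. f Z / 2) <= expectation (%Z. max 0 (f Z / 2))"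
    using fi by (intro integral_mono) auto
   ultimately show ?thesis by linarith
  qed
  then have fe: "expectation f <= 2 * V" by simp
  have "\<phi> 0 <= (\<Sum>j<N. exp (- (real j * h)) * (h * (expectation (%Z. \<psi> (X j Z)) + E2))) + exp (- (real N * h)) * C\<phi>"
   by (rule phi_0_le)
  also have "(\<Sum>j<N. exp (- (real j * h)) * (h * (expectation (%Z. \<psi> (X j Z)) + E2)))
   <= (\<Sum>j<N. exp (- (real j * h)) * (h * expectation (%Z. \<psi> (X j Z)) - expectation (step_loss j)) + exp (- (real j * h)) * h * (\<bar>E2\<bar> + ?L))"
  proof (rule sum_mono)
   fix j
   have "h * E2 <= h * \<bar>E2\<bar>" using h_pos by (intro mult_left_mono) auto
   then have "h * (expectation (%Z. \<psi> (X j Z)) + E2) <= (h * expectation (%Z. \<psi> (X j Z)) - expectation (step_loss j)) + h * (\<bar>E2\<bar> + ?L)"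
    using el[of j] unfolding distrib_left by linarith
   then have "exp (- (real j * h)) * (h * (expectation (%Z. \<psi> (X j Z)) + E2)) <= exp (- (real j * h)) * ((h * expectation (%Z. \<psi> (X j Z)) - expectation (step_loss j)) + h * (\<bar>E2\<bar> + ?L))"
    by (rule mult_left_mono) simp
   then show "exp (- (real j * h)) * (h * (expectation (%Z. \<psi> (X j Z)) + E2)) <= exp (- (real j * h)) * (h * expectation (%Z. \<psi> (X j Z)) - expectation (step_loss j)) + exp (- (real j * h)) * h * (\<bar>E2\<bar> + ?L)"
    unfolding distrib_left[of "exp (- (real j * h))" "h * expectation (%Z. \<psi> (X j Z)) - expectation (step_loss j)"] by (simp only: mult.assoc)
  qed
  also have "\<dots> = expectation f + (\<Sum>j<N. exp (- (real j * h)) * h) * (\<bar>E2\<bar> + ?L)"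
   unfolding Ef sum.distrib sum_distrib_right ..
  also have "\<dots> <= 2 * V + 2 * (\<bar>E2\<bar> + ?L)"
   using fe L0 by (intro add_mono mult_right_mono discount_sum) auto
  finally show ?thesis by simp
 qed
 have "(%N. exp (- (real N * h)) * C\<phi>) ---> 0 * C\<phi>"
 proof (intro tendsto_mult tendsto_const)
  have "(%N. exp (- h) ^ N) ---> 0" using h_pos by (intro LIMSEQ_realpow_zero) auto
  then show "(%N. exp (- (real N * h))) ---> 0" by (simp add: exp_of_nat_mult[symmetric] mult.commute)
 qed
 then have "(%N. 2 * V + 2 * (\<bar>E2\<bar> + ?L) + exp (- (real N * h)) * C\<phi>) ---> 2 * V + 2 * (\<bar>E2\<bar> + ?L) + 0 * C\<phi>"
  by (intro tendsto_add tendsto_const)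
 then have "\<phi> 0 <= 2 * V + 2 * (\<bar>E2\<bar> + ?L) + 0 * C\<phi>"
  by (rule LIMSEQ_le_const) (use bound in auto)
 then show ?thesis by simp
qed

end

section \<open>Matrices and diffusion factors\<close>

text \<open>Young's inequality for f and g divided by their norm bounds, then integration. The
  division is why vanishing bounds are separated.\<close>

lemma Holder2:
 fixes f g :: "'a => real"
 assumes pq: "1 < p" "1 < q" "1 / p + 1 / q = 1"
  and [measurable]: "f \<in> bm M" "g \<in> bm M" and nn: "\<And>y. 0 <= f y" "\<And>y. 0 <= g y"
  and A: "0 <= A" "(\<integral>\<^sup>+y. ennreal (f y powr p) \<partial>M) <= ennreal A"
  and B: "0 <= B" "(\<integral>\<^sup>+y. ennreal (g y powr q) \<partial>M) <= ennreal B"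
 shows "(\<integral>\<^sup>+y. ennreal (f y * g y) \<partial>M) <= ennreal (A powr (1 / p) * B powr (1 / q))"
proof (cases "A = 0 \<or> B = 0")
 case True
 have z: "AE y in M. h y = 0" if "(\<integral>\<^sup>+y. ennreal (h y powr r) \<partial>M) <= ennreal 0" "h \<in> bm M" for h r
  using that by (simp add: nn_integral_0_iff_AE ennreal_eq_0_iff)
 have "AE y in M. f y = 0 \<or> g y = 0"
  using True A(2) B(2) z[of f p] z[of g q] assms(4,5) by (auto elim: eventually_mono)
 then have "AE y in M. ennreal (f y * g y) = 0" by eventually_elim auto
 then have "(\<integral>\<^sup>+y. ennreal (f y * g y) \<partial>M) = (\<integral>\<^sup>+y. 0 \<partial>M)" by (rule nn_integral_cong_AE)
 then show ?thesis by simp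
next
 case False
 then have AB: "0 < A" "0 < B" using A B by auto
 define P where "P = A powr (1 / p) * B powr (1 / q)"
 have P: "0 < P" using AB by (simp add: P_def)
 have "(\<integral>\<^sup>+y. ennreal (f y * g y) \<partial>M) <= (\<integral>\<^sup>+y. ennreal (P / (p * A)) * ennreal (f y powr p) + ennreal (P / (q * B)) * ennreal (g y powr q) \<partial>M)"
 proof (rule nn_integral_mono)
  fix y
  have "f y / A powr (1 / p) * (g y / B powr (1 / q)) <= (f y / A powr (1 / p)) powr p / p + (g y / B powr (1 / q)) powr q / q"
   using pq nn by (intro Youngs_inequality) (auto intro: divide_nonneg_nonneg)
  also have "\<dots> = f y powr p / (p * A) + g y powr q / (q * B)"
   using pq nn AB by (simp add: powr_divide powr_powr mult.commute)
  finally have "P * (f y / A powr (1 / p) * (g y / B powr (1 / q))) <= P * (f y powr p / (p * A) + g y powr q / (q * B))"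
   using P by (intro mult_left_mono) auto
  then have "f y * g y <= P / (p * A) * f y powr p + P / (q * B) * g y powr q"
   using AB by (simp add: P_def distrib_left)
  then have "ennreal (f y * g y) <= ennreal (P / (p * A) * f y powr p + P / (q * B) * g y powr q)" by (rule ennreal_leI)
  also have "\<dots> = ennreal (P / (p * A)) * ennreal (f y powr p) + ennreal (P / (q * B)) * ennreal (g y powr q)"
   using P pq AB by (simp add: ennreal_mult'[symmetric])
  finally show "ennreal (f y * g y) <= ennreal (P / (p * A)) * ennreal (f y powr p) + ennreal (P / (q * B)) * ennreal (g y powr q)" .
 qed
 also have "\<dots> = ennreal (P / (p * A)) * (\<integral>\<^sup>+y. ennreal (f y powr p) \<partial>M) + ennreal (P / (q * B)) * (\<integral>\<^sup>+y. ennreal (g y powr q) \<partial>M)"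
  by (simp add: nn_integral_add nn_integral_cmult)
 also have "\<dots> <= ennreal (P / (p * A)) * ennreal A + ennreal (P / (q * B)) * ennreal B"
  by (intro add_mono mult_left_mono A B) auto
 also have "\<dots> = ennreal (P / p + P / q)" using P pq AB by (simp add: ennreal_mult'[symmetric])
 also have "P / p + P / q = P * (1 / p + 1 / q)" by (simp add: distrib_left)
 finally show ?thesis unfolding pq(3) P_def by simp
qed

lemma Lp_norm_le_iff:
 fixes f :: "real^'d => 'b::real_normed_vector"
 assumes p: "0 < p" and c: "0 <= c"
 shows "Lp_norm p S f <= ennreal c \<longleftrightarrow> (\<integral>\<^sup>+y\<in>S. ennreal (norm (f y) powr p) \<partial>lebesgue) <= ennreal (c powr p)"
proof -
 define I where "I = (\<integral>\<^sup>+y\<in>S. ennreal (norm (f y) powr p) \<partial>lebesgue)"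
 show ?thesis
 proof (cases "I = \<infinity>")
  case True
  then show ?thesis unfolding Lp_norm_def I_def[symmetric] by (simp add: top_unique)
 next
  case False
  then obtain i where i: "I = ennreal i" "0 <= i" by (cases I) auto
  have "i powr (1 / p) <= c \<longleftrightarrow> i <= c powr p"
  proof
   assume "i powr (1 / p) <= c"
   then have "(i powr (1 / p)) powr p <= c powr p" using p by (intro powr_mono2) auto
   then show "i <= c powr p" using p i by (simp add: powr_powr)
  next
   assume "i <= c powr p"
   then have "i powr (1 / p) <= (c powr p) powr (1 / p)" using p i by (intro powr_mono2) auto
   then show "i powr (1 / p) <= c" using p c by (simp add: powr_powr)
  qed
  then show ?thesis unfolding Lp_norm_def I_def[symmetric] using i c by simp
 qed
qed

lemma nn_integral_lebesgue_eq:
 fixes f :: "real^'d => ennreal"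
 assumes "f \<in> bm borel"
 shows "(\<integral>\<^sup>+y. f y \<partial>lebesgue) = (NN y. f y)"
 using assms by (intro nn_integral_completion)

lemma norm_matrix_vector_le:
 fixes A :: "real^'n^'m" and v :: "real^'n"
 shows "norm (A *v v) <= norm A * norm v"
proof -
 have "norm (A *v v) <= L2_set (%i. norm (A $ i) * norm v) UNIV"
  unfolding norm_vec_def[of "A *v v"] by (rule L2_set_mono) (auto simp: matrix_vector_mul_component Cauchy_Schwarz_ineq2)
 also have "\<dots> = norm A * norm v"
  unfolding norm_vec_def[of A] by (rule L2_set_left_distrib[symmetric]) simp
 finally show ?thesis .
qed

lemma quadratic_form_eq: "(u::real^'d) \<bullet> (A *v v) = (\<Sum>i\<in>UNIV. \<Sum>j\<in>UNIV. A $ i $ j * u $ i * v $ j)"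
 by (simp add: inner_vec_def matrix_vector_mult_def sum_distrib_left mult_ac)

lemma symmetric_form: "transpose A = A ==> (u::real^'d) \<bullet> (A *v v) = v \<bullet> (A *v u)"
proof -
 assume "transpose A = A"
 then have "transpose A $ i $ j = A $ i $ j" for i j by simp
 then have A: "A $ j $ i = A $ i $ j" for i j by (simp add: transpose_def)
 have "u \<bullet> (A *v v) = (\<Sum>j\<in>UNIV. \<Sum>i\<in>UNIV. A $ i $ j * u $ i * v $ j)"
  unfolding quadratic_form_eq by (rule sum.swap)
 also have "\<dots> = v \<bullet> (A *v u)"
  unfolding quadratic_form_eq by (intro sum.cong refl) (simp add: A mult_ac)
 finally show ?thesis .
qed

text \<open>v minimises u . A u - m |u|^2. Moving from v in the direction z = A v - m v changes this
  by 2 t |z|^2 to first order, which for small negative t contradicts minimality unless z =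
  0.\<close>

lemma extremal_eigenvector:
 fixes A :: "real^'d^'d" and v :: "real^'d"
 assumes sym: "transpose A = A" and v: "v \<bullet> (A *v v) = m * (v \<bullet> v)" and min: "\<And>u. m * (u \<bullet> u) <= u \<bullet> (A *v u)"
 shows "A *v v = m *\<^sub>R v"
proof -
 define z where "z = A *v v - m *\<^sub>R v"
 have *: "0 <= 2 * t * (z \<bullet> z) + t\<^sup>2 * (z \<bullet> (A *v z) - m * (z \<bullet> z))" for t
 proof -
  have "m * ((v + t *\<^sub>R z) \<bullet> (v + t *\<^sub>R z)) <= (v + t *\<^sub>R z) \<bullet> (A *v (v + t *\<^sub>R z))" by (rule min)
  also have "\<dots> = v \<bullet> (A *v v) + 2 * t * (z \<bullet> (A *v v)) + t\<^sup>2 * (z \<bullet> (A *v z))"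
   using symmetric_form[OF sym, of v z]
   by (simp add: matrix_vector_right_distrib matrix_vector_mult_scaleR inner_add_left inner_add_right power2_eq_square algebra_simps)
  also have "m * ((v + t *\<^sub>R z) \<bullet> (v + t *\<^sub>R z)) = m * (v \<bullet> v) + 2 * t * (z \<bullet> (m *\<^sub>R v)) + t\<^sup>2 * (m * (z \<bullet> z))"
   by (simp add: inner_add_left inner_add_right power2_eq_square inner_commute[of v z] algebra_simps)
  finally have "0 <= 2 * t * (z \<bullet> (A *v v)) - 2 * t * (z \<bullet> (m *\<^sub>R v)) + (t\<^sup>2 * (z \<bullet> (A *v z)) - t\<^sup>2 * (m * (z \<bullet> z)))"
   using v by linarith
  also have "\<dots> = 2 * t * (z \<bullet> z) + t\<^sup>2 * (z \<bullet> (A *v z) - m * (z \<bullet> z))"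
   by (simp add: z_def inner_diff_right right_diff_distrib)
  finally show ?thesis .
 qed
 let ?a = "z \<bullet> z" and ?c = "z \<bullet> (A *v z) - m * (z \<bullet> z)"
 have "?a = 0"
 proof (rule ccontr)
  assume "?a \<noteq> 0"
  then have a: "?a > 0" by simp
  \<comment> \<open>Small enough that the second order part is at most half of the first order
    part.\<close>
  define t where "t = - ?a / (1 + \<bar>?c\<bar>)"
  have t: "t < 0" using a by (simp add: t_def divide_neg_pos)
  have "0 <= t * (2 * ?a + t * ?c)" using *[of t] by (simp add: power2_eq_square algebra_simps)
  then have "2 * ?a + t * ?c <= 0" using t by (simp add: zero_le_mult_iff)
  moreover have "\<bar>t * ?c\<bar> <= ?a"
  proof -
   have "\<bar>t * ?c\<bar> = ?a * (\<bar>?c\<bar> / (1 + \<bar>?c\<bar>))" using a by (simp add: t_def abs_mult)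
   also have "\<dots> <= ?a * 1" using a by (intro mult_left_mono) auto
   finally show ?thesis by simp
  qed
  ultimately show False using a by linarith
 qed
 then show ?thesis by (simp add: z_def)
qed

lemma symmetric_form_lower:
 fixes A :: "real^'d^'d"
 assumes sym: "transpose A = A" and ev: "\<And>l v. v \<noteq> 0 ==> A *v v = l *\<^sub>R v ==> m <= l"
 shows "m * (u \<bullet> u) <= u \<bullet> (A *v u)"
proof -
 let ?S = "sphere (0::real^'d) 1"
 have "axis undefined 1 \<in> ?S" by simp
 then have ne: "?S \<noteq> {}" by blast
 have "continuous_on ?S (%v. v \<bullet> (A *v v))" by (intro continuous_intros)
 then obtain v where v: "v \<in> ?S" "\<And>u. u \<in> ?S ==> v \<bullet> (A *v v) <= u \<bullet> (A *v u)"
  using continuous_attains_inf[OF compact_sphere ne] by blast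
 define l where "l = v \<bullet> (A *v v)"
 have vv: "v \<bullet> v = 1" using v(1) by (simp add: norm_eq_sqrt_inner)
 have low: "l * (u \<bullet> u) <= u \<bullet> (A *v u)" for u
 proof (cases "u = 0")
  case False
  then have "(1 / norm u) *\<^sub>R u \<in> ?S" by simp
  from v(2)[OF this] have "l <= (u \<bullet> (A *v u)) / (norm u)\<^sup>2"
   by (simp add: l_def matrix_vector_mult_scaleR power2_eq_square)
  then show ?thesis using False by (simp add: pos_le_divide_eq dot_square_norm)
 qed simp
 have "A *v v = l *\<^sub>R v" by (rule extremal_eigenvector[OF sym _ low]) (simp add: l_def vv)
 then have "m <= l" using v(1) by (intro ev) auto
 then have "m * (u \<bullet> u) <= l * (u \<bullet> u)" by (intro mult_right_mono) auto
 with low[of u] show ?thesis by linarith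
qed

lemma uminus_matrix_vector: "(- A) *v v = - (A *v (v :: real^'n))"
 by (simp add: matrix_vector_mult_def vec_eq_iff sum_negf)

text \<open>The minimum of the form on the unit sphere is an eigenvalue; the upper bound is the
  lower bound for - A. In this form the class is visibly an intersection of closed convex conditions
  on A, which the eigenvalue condition does not show.\<close>

lemma S_mat_iff:
 fixes A :: "real^'d^'d"
 shows "A \<in> S_mat \<delta> \<longleftrightarrow> transpose A = A \<and> (\<forall>u. \<delta> * (u \<bullet> u) <= u \<bullet> (A *v u) \<and> u \<bullet> (A *v u) <= 1 / \<delta> * (u \<bullet> u))"
proof
 assume A: "A \<in> S_mat \<delta>"
 then have sym: "transpose A = A" and ev: "\<And>l v. v \<noteq> 0 ==> A *v v = l *\<^sub>R v ==> \<delta> <= l \<and> l <= 1 / \<delta>"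
  by (auto simp: S_mat_def)
 have "(- (1 / \<delta>)) * (u \<bullet> u) <= u \<bullet> ((- A) *v u)" for u
 proof (rule symmetric_form_lower)
  show "transpose (- A) = - A" using sym by (simp add: transpose_def vec_eq_iff)
  fix l v assume "v \<noteq> 0" "(- A) *v v = l *\<^sub>R v"
  then have "- (A *v v) = l *\<^sub>R v" by (simp only: uminus_matrix_vector)
  then have "- (- (A *v v)) = - (l *\<^sub>R v)" by (simp only:)
  then have "A *v v = (- l) *\<^sub>R v" by (simp only: minus_minus scaleR_minus_left)
  then have "- l <= 1 / \<delta>" using ev \<open>v \<noteq> 0\<close> by blast
  then show "- (1 / \<delta>) <= l" by simp
 qed
 then have "u \<bullet> (A *v u) <= 1 / \<delta> * (u \<bullet> u)" for u
  using \<open>\<And>u. (- (1 / \<delta>)) * (u \<bullet> u) <= u \<bullet> ((- A) *v u)\<close>[of u] by (simp add: uminus_matrix_vector)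
 moreover have "\<delta> * (u \<bullet> u) <= u \<bullet> (A *v u)" for u using symmetric_form_lower[OF sym, of \<delta>] ev by blast
 ultimately show "transpose A = A \<and> (\<forall>u. \<delta> * (u \<bullet> u) <= u \<bullet> (A *v u) \<and> u \<bullet> (A *v u) <= 1 / \<delta> * (u \<bullet> u))"
  using sym by blast
next
 assume A: "transpose A = A \<and> (\<forall>u. \<delta> * (u \<bullet> u) <= u \<bullet> (A *v u) \<and> u \<bullet> (A *v u) <= 1 / \<delta> * (u \<bullet> u))"
 have "\<delta> <= l \<and> l <= 1 / \<delta>" if "v \<noteq> 0" "A *v v = l *\<^sub>R v" for l v
 proof -
  have "\<delta> * (v \<bullet> v) <= l * (v \<bullet> v) \<and> l * (v \<bullet> v) <= 1 / \<delta> * (v \<bullet> v)"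
  proof -
   have "v \<bullet> (A *v v) = l * (v \<bullet> v)" using that(2) by simp
   moreover from A have "\<delta> * (v \<bullet> v) <= v \<bullet> (A *v v)" "v \<bullet> (A *v v) <= 1 / \<delta> * (v \<bullet> v)" by blast+
   ultimately show ?thesis by (simp only: conj_absorb)
  qed
  moreover have "0 < v \<bullet> v" using that by simp
  ultimately show ?thesis by (simp only: mult_le_cancel_right_pos)
 qed
 then show "A \<in> S_mat \<delta>" using A by (auto simp: S_mat_def)
qed

text \<open>Together with \<open>closed_S_mat\<close> this makes the closest-point projection onto
  the class continuous, as \<open>diffusion_approx\<close> uses.\<close>

lemma convex_S_mat: "convex (S_mat \<delta>)"
proof (rule convexI)
 fix A B :: "real^'d^'d" and s t :: real
 assume AB: "A \<in> S_mat \<delta>" "B \<in> S_mat \<delta>" and st: "0 <= s" "0 <= t" "s + t = 1"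
 have sym: "transpose (s *\<^sub>R A + t *\<^sub>R B) = s *\<^sub>R A + t *\<^sub>R B"
  using AB by (auto simp: S_mat_iff transpose_def vec_eq_iff)
 have eq: "u \<bullet> ((s *\<^sub>R A + t *\<^sub>R B) *v u) = s * (u \<bullet> (A *v u)) + t * (u \<bullet> (B *v u))" for u
  by (simp add: matrix_vector_mult_add_rdistrib scaleR_matrix_vector_assoc[symmetric] inner_add_right)
 have "c * (u \<bullet> u) = s * (c * (u \<bullet> u)) + t * (c * (u \<bullet> u))" for c and u :: "real^'d"
  using st(3) by (simp add: distrib_right[symmetric])
 note c = this
 have "\<delta> * (u \<bullet> u) <= s * (u \<bullet> (A *v u)) + t * (u \<bullet> (B *v u)) \<and>
   s * (u \<bullet> (A *v u)) + t * (u \<bullet> (B *v u)) <= 1 / \<delta> * (u \<bullet> u)" for u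
 proof -
  have "\<delta> * (u \<bullet> u) <= u \<bullet> (A *v u)" "u \<bullet> (A *v u) <= 1 / \<delta> * (u \<bullet> u)"
   "\<delta> * (u \<bullet> u) <= u \<bullet> (B *v u)" "u \<bullet> (B *v u) <= 1 / \<delta> * (u \<bullet> u)"
   using AB unfolding S_mat_iff by blast+
  then have "s * (\<delta> * (u \<bullet> u)) <= s * (u \<bullet> (A *v u))" "s * (u \<bullet> (A *v u)) <= s * (1 / \<delta> * (u \<bullet> u))"
   "t * (\<delta> * (u \<bullet> u)) <= t * (u \<bullet> (B *v u))" "t * (u \<bullet> (B *v u)) <= t * (1 / \<delta> * (u \<bullet> u))"
   using st by (auto intro!: mult_left_mono simp del: times_divide_eq_left)
  then show ?thesis using c[of \<delta> u] c[of "1 / \<delta>" u] by linarith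
 qed
 with sym show "s *\<^sub>R A + t *\<^sub>R B \<in> S_mat \<delta>" unfolding S_mat_iff eq by blast
qed

lemma closed_S_mat: "closed (S_mat \<delta> :: (real^'d^'d) set)"
proof -
 have "S_mat \<delta> = {A :: real^'d^'d. transpose A = A} \<inter> (\<Inter>u. {A. \<delta> * (u \<bullet> u) <= u \<bullet> (A *v u)} \<inter> {A. u \<bullet> (A *v u) <= 1 / \<delta> * (u \<bullet> u)})"
  unfolding set_eq_iff S_mat_iff by auto
 moreover have "cont (%A :: real^'d^'d. u \<bullet> (A *v u))" for u
  unfolding quadratic_form_eq by (intro continuous_intros)
 moreover have "cont (%A :: real^'d^'d. transpose A)"
  unfolding transpose_def by (intro continuous_intros continuous_on_vec_lambda)
 ultimately show ?thesis
  by (simp only:) (intro closed_Int closed_INT ballI closed_Collect_le closed_Collect_eq continuous_on_const continuous_on_id)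
qed

lemma S_mat_diag_le: "A \<in> S_mat \<delta> ==> A $ i $ i <= 1 / \<delta>"
proof -
 assume "A \<in> S_mat \<delta>"
 then have "axis i 1 \<bullet> (A *v axis i 1) <= 1 / \<delta> * (axis i 1 \<bullet> axis i (1::real))" unfolding S_mat_iff by blast
 then show ?thesis by (simp add: inner_axis' matrix_vector_mult_basis column_def inner_axis_axis)
qed

section \<open>A measurable factor of a positive semidefinite matrix\<close>

definition psd :: "real^'d^'d => bool" where
 "psd A \<longleftrightarrow> transpose A = A \<and> (\<forall>u. 0 <= u \<bullet> (A *v u))"

lemma psd_cauchy:
 assumes "psd A" shows "(u \<bullet> (A *v v))\<^sup>2 <= (u \<bullet> (A *v u)) * (v \<bullet> (A *v v))"
proof -
 let ?a = "v \<bullet> (A *v v)" and ?b = "u \<bullet> (A *v v)" and ?c = "u \<bullet> (A *v u)"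
 have sym: "v \<bullet> (A *v u) = ?b" using assms symmetric_form by (auto simp: psd_def)
 have q: "0 <= ?c + 2 * t * ?b + t\<^sup>2 * ?a" for t
 proof -
  have "0 <= (u + t *\<^sub>R v) \<bullet> (A *v (u + t *\<^sub>R v))" using assms by (simp add: psd_def)
  then show ?thesis using sym
   by (simp add: matrix_vector_right_distrib matrix_vector_mult_scaleR inner_add_left inner_add_right power2_eq_square algebra_simps)
 qed
 have a: "0 <= ?a" using assms by (simp add: psd_def)
 show ?thesis
 proof (cases "?a = 0")
  case True
  have "?b = 0"
  proof (rule ccontr)
   assume b: "?b \<noteq> 0"
   have "0 <= ?c + 2 * (- (?c + 1) / (2 * ?b)) * ?b" using q[of "- (?c + 1) / (2 * ?b)"] True by simp
   then show False using b by (simp add: field_simps)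
  qed
  then show ?thesis using True by simp
 next
  case False
  then have a: "0 < ?a" using a by simp
  have "0 <= ?c + 2 * (- ?b / ?a) * ?b + (- ?b / ?a)\<^sup>2 * ?a" by (rule q)
  also have "\<dots> = ?c - ?b\<^sup>2 / ?a" using a by (simp add: power2_eq_square field_simps)
  finally show ?thesis using a by (simp add: pos_divide_le_eq)
 qed
qed

definition outer :: "real^'d => real^'d^'d" where "outer l = (\<chi> i j. l $ i * l $ j)"

lemma outer_form: "u \<bullet> (outer l *v v) = (u \<bullet> l) * (l \<bullet> v)"
 unfolding quadratic_form_eq by (simp add: outer_def inner_vec_def sum_product mult_ac)

text \<open>Cholesky elimination of one index at a time: subtracting the outer square of column m of
  the remainder B, divided by the root of its diagonal entry, clears row m, and what is left stays
  positive semidefinite by \<open>psd_cauchy\<close>. The explicit formula gives measurability in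
  A.\<close>

lemma measurable_cholesky_partial:
 fixes S :: "'d::finite set"
 assumes "finite S"
 shows "\<exists>l :: 'd => real^'d^'d => real^'d. (\<forall>k. l k \<in> bm borel) \<and>
  (\<forall>A. psd A \<longrightarrow> psd (A - (\<Sum>k\<in>S. outer (l k A))) \<and> (\<forall>i\<in>S. \<forall>j. (A - (\<Sum>k\<in>S. outer (l k A))) $ i $ j = 0))"
 using assms
proof (induction S)
 case empty
 show ?case by (intro exI[of _ "%_ _. 0"]) auto
next
 case (insert m S)
 then obtain l :: "'d => real^'d^'d => real^'d" where l: "\<And>k. l k \<in> bm borel"
  "\<And>A. psd A ==> psd (A - (\<Sum>k\<in>S. outer (l k A)))" "\<And>A i j. psd A ==> i \<in> S ==> (A - (\<Sum>k\<in>S. outer (l k A))) $ i $ j = 0"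
  by blast
 define B where "B A = A - (\<Sum>k\<in>S. outer (l k A))" for A
 \<comment> \<open>If the diagonal entry is 0, division by 0 yields the zero vector. This is the
   right choice, because the whole column then vanishes (\<open>row0\<close>).\<close>
 define v where "v A = (1 / sqrt (B A $ m $ m)) *\<^sub>R column m (B A)" for A
 have co: "cont (outer :: real^'d => real^'d^'d)"
  unfolding outer_def by (intro continuous_intros continuous_on_vec_lambda)
 have Bm: "B \<in> bm borel"
  unfolding B_def using l(1)
  by (intro borel_measurable_diff borel_measurable_sum measurable_compose[OF l(1) bm_contI[OF co]]) auto
 have comp: "(%A. B A $ i $ j) \<in> bm borel" for i j
  by (rule measurable_compose[OF Bm bm_contI]) (intro continuous_intros)
 have cc: "cont (column m :: real^'d^'d => real^'d)"
  unfolding column_def by (intro continuous_intros continuous_on_vec_lambda)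
 have vm: "v \<in> bm borel"
  unfolding v_def using comp
  by (intro borel_measurable_scaleR borel_measurable_divide borel_measurable_const measurable_compose[OF comp borel_measurable_sqrt]
    measurable_compose[OF Bm bm_contI[OF cc]])
 define l' where "l' k = (if k = m then v else l k)" for k
 have l'_S: "(\<Sum>k\<in>S. outer (l' k A)) = (\<Sum>k\<in>S. outer (l k A))" for A
 proof (rule sum.cong)
  fix k assume "k \<in> S"
  then have "k \<noteq> m" using insert(2) by auto
  then show "outer (l' k A) = outer (l k A)" by (simp add: l'_def)
 qed simp
 have l'_m: "l' m = v" by (simp add: l'_def)
 have eq: "A - (\<Sum>k\<in>insert m S. outer (l' k A)) = B A - outer (v A)" for A
  using insert(1,2) by (simp add: l'_S l'_m B_def)
 have main: "psd (B A - outer (v A)) \<and> (\<forall>i\<in>insert m S. \<forall>j. (B A - outer (v A)) $ i $ j = 0)" if A: "psd A" for A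
 proof -
  have pB: "psd (B A)" using l(2)[OF A] by (simp add: B_def)
  have symB: "B A $ i $ j = B A $ j $ i" for i j
  proof -
   have "transpose (B A) $ i $ j = B A $ i $ j" using pB by (simp add: psd_def)
   then show ?thesis by (simp add: transpose_def)
  qed
  have form: "axis i 1 \<bullet> (B A *v axis j 1) = B A $ i $ j" for i j
   by (simp add: inner_axis' matrix_vector_mult_basis column_def)
  have d: "0 <= B A $ m $ m" using pB unfolding form[symmetric] psd_def by blast
  have row0: "B A $ i $ m = 0" if "B A $ m $ m = 0" for i
   using psd_cauchy[OF pB, of "axis i 1" "axis m 1"] that by (simp add: form)
  have vform: "u \<bullet> v A = (u \<bullet> (B A *v axis m 1)) / sqrt (B A $ m $ m)" for u
   by (simp add: v_def matrix_vector_mult_basis)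
  have uvv: "(u \<bullet> v A) * (v A \<bullet> w) = (if B A $ m $ m = 0 then 0 else (u \<bullet> (B A *v axis m 1)) * (w \<bullet> (B A *v axis m 1)) / (B A $ m $ m))" for u w
   using d by (simp add: inner_commute[of "v A" w] vform)
  have p: "psd (B A - outer (v A))"
   unfolding psd_def
  proof (intro conjI allI)
   show "transpose (B A - outer (v A)) = B A - outer (v A)"
    using symB by (simp add: transpose_def vec_eq_iff outer_def mult.commute)
   fix u
   have "u \<bullet> ((B A - outer (v A)) *v u) = u \<bullet> (B A *v u) - (u \<bullet> v A) * (v A \<bullet> u)"
    by (simp add: matrix_vector_mult_diff_rdistrib inner_diff_right outer_form)
   also have "\<dots> \<ge> 0"
   proof (cases "B A $ m $ m = 0")
    case True
    then show ?thesis using pB by (simp add: uvv psd_def)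
   next
    case False
    then have pos: "0 < B A $ m $ m" using d by simp
    have "(u \<bullet> (B A *v axis m 1))\<^sup>2 <= (u \<bullet> (B A *v u)) * (B A $ m $ m)"
     using psd_cauchy[OF pB, of u "axis m 1"] by (simp add: form)
    then show ?thesis using pos unfolding uvv by (simp add: power2_eq_square pos_divide_le_eq)
   qed
   finally show "0 <= u \<bullet> ((B A - outer (v A)) *v u)" .
  qed
  have entry: "(B A - outer (v A)) $ i $ j = B A $ i $ j - (if B A $ m $ m = 0 then 0 else B A $ i $ m * (B A $ j $ m) / (B A $ m $ m))" for i j
  proof -
   have "outer (v A) $ i $ j = (axis i 1 \<bullet> v A) * (v A \<bullet> axis j 1)" by (simp add: outer_def inner_axis inner_axis')
   then show ?thesis unfolding uvv form by simp
  qed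
  have "(B A - outer (v A)) $ i $ j = 0" if "i \<in> insert m S" for i j
  proof (cases "i = m")
   case True
   then show ?thesis unfolding entry using row0[of j] symB[of m j] by auto
  next
   case False
   then have "B A $ i $ j = 0" "B A $ i $ m = 0" using that l(3)[OF A, of i] by (auto simp: B_def)
   then show ?thesis unfolding entry by simp
  qed
  with p show ?thesis by blast
 qed
 show ?case
  by (rule exI[of _ l']) (unfold eq, use main l(1) vm in \<open>auto simp: l'_def\<close>)
qed

lemma measurable_cholesky:
 "\<exists>l :: 'd::finite => real^'d^'d => real^'d. (\<forall>k. l k \<in> bm borel) \<and>
  (\<forall>A. psd A \<longrightarrow> A = (\<Sum>k\<in>UNIV. outer (l k A)))"
proof -
 obtain l :: "'d => real^'d^'d => real^'d" where l: "\<And>k. l k \<in> bm borel"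
  "\<And>A i j. psd A ==> (A - (\<Sum>k\<in>UNIV. outer (l k A))) $ i $ j = 0"
 proof -
  from measurable_cholesky_partial[OF finite_class.finite_UNIV]
  obtain l :: "'d => real^'d^'d => real^'d" where "\<forall>k. l k \<in> bm borel"
   "\<forall>A. psd A \<longrightarrow> psd (A - (\<Sum>k\<in>UNIV. outer (l k A))) \<and> (\<forall>i\<in>UNIV. \<forall>j. (A - (\<Sum>k\<in>UNIV. outer (l k A))) $ i $ j = 0)"
   by blast
  note l = this
  show thesis by (rule that[of l]) (use l in blast)+
 qed
 have "A = (\<Sum>k\<in>UNIV. outer (l k A))" if "psd A" for A
 proof -
  have "A - (\<Sum>k\<in>UNIV. outer (l k A)) = 0" unfolding vec_eq_iff using l(2)[OF that] by simp
  then show ?thesis by simp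
 qed
 with l(1) show ?thesis by blast
qed

lemma S_mat_psd: "0 < \<delta> ==> A \<in> S_mat \<delta> ==> psd A"
proof -
 assume \<delta>: "0 < \<delta>" and A: "A \<in> S_mat \<delta>"
 have "0 <= \<delta> * (u \<bullet> u)" for u :: "real^'d" using \<delta> by simp
 then show "psd A" using A unfolding S_mat_iff psd_def by (blast intro: order_trans)
qed

lemma factor_norm_bound:
 fixes l :: "'d::finite => real^'d"
 assumes "A \<in> S_mat \<delta>" "A = (\<Sum>k\<in>UNIV. outer (l k))"
 shows "norm (l k) <= sqrt (real CARD('d) / \<delta>)"
proof -
 have "(l k $ i)\<^sup>2 <= 1 / \<delta>" for i
 proof -
  have "(l k $ i)\<^sup>2 <= (\<Sum>k\<in>UNIV. (l k $ i)\<^sup>2)" by (rule member_le_sum) auto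
  also have "\<dots> = A $ i $ i" by (subst assms(2)) (simp add: outer_def power2_eq_square)
  also have "\<dots> <= 1 / \<delta>" by (rule S_mat_diag_le[OF assms(1)])
  finally show ?thesis .
 qed
 then have "(\<Sum>i\<in>UNIV. (l k $ i)\<^sup>2) <= (\<Sum>i\<in>(UNIV::'d set). 1 / \<delta>)" by (rule sum_mono)
 then show ?thesis unfolding norm_vec_def L2_set_def by simp
qed

lemma trace_factor:
 assumes "A = (\<Sum>k\<in>K. outer (l k))" "finite K"
 shows "(\<Sum>k\<in>K. l k \<bullet> (H *v l k)) = (\<Sum>i\<in>UNIV. \<Sum>j\<in>UNIV. A $ i $ j * H $ i $ j)"
proof -
 have "(\<Sum>k\<in>K. l k \<bullet> (H *v l k)) = (\<Sum>i\<in>UNIV. \<Sum>j\<in>UNIV. \<Sum>k\<in>K. l k $ i * l k $ j * H $ i $ j)"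
  unfolding quadratic_form_eq
  by (subst sum.swap, intro sum.cong refl, subst sum.swap, intro sum.cong refl) (simp add: mult_ac)
 then show ?thesis unfolding assms(1) by (simp add: outer_def sum_distrib_right)
qed

section \<open>The estimate for smooth coefficients\<close>

lemma compact_support_bounded:
 fixes f :: "real^'d => 'b::real_normed_vector"
 assumes "cont f" "\<And>y. R <= norm y ==> f y = 0"
 obtains B where "0 <= B" "\<And>y. norm (f y) <= B"
proof -
 have "compact (f ` cball 0 R)"
  by (intro compact_continuous_image continuous_on_subset[OF assms(1)]) auto
 then obtain B where B: "\<And>y. y \<in> cball 0 R ==> norm (f y) <= B"
  by (meson bounded_iff compact_imp_bounded imageI)
 have "norm (f y) <= max B 0" for y
  using B[of y] assms(2)[of y] by (cases "norm y <= R") auto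
 then show thesis by (intro that[of "max B 0"]) auto
qed

lemma compact_support_uniform:
 fixes f :: "real^'d => 'b::real_normed_vector"
 assumes f: "cont f" "\<And>y. R <= norm y ==> f y = 0" and e: "0 < e"
 obtains \<delta> where "0 < \<delta>" "\<And>y z. norm (z - y) < \<delta> ==> norm (f z - f y) < e"
proof -
 have "uniformly_continuous_on (cball 0 (R + 1)) f"
  by (intro compact_uniformly_continuous continuous_on_subset[OF f(1)]) auto
 then obtain \<delta> where \<delta>: "0 < \<delta>" "\<And>y z. y \<in> cball 0 (R + 1) ==> z \<in> cball 0 (R + 1) ==> dist z y < \<delta> ==> dist (f z) (f y) < e"
  using e unfolding uniformly_continuous_on_def by blast
 have "norm (f z - f y) < e" if "norm (z - y) < min \<delta> 1" for y z
 proof (cases "norm y <= R + 1 \<and> norm z <= R + 1")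
  case True
  then show ?thesis using \<delta>(2)[of y z] that by (simp add: dist_norm)
 next
  case False
  have "norm y <= norm z + norm (z - y)" "norm z <= norm y + norm (z - y)"
   using norm_triangle_ineq4[of z "z - y"] norm_triangle_ineq[of y "z - y"] by (auto simp: norm_minus_commute)
  then have "f y = 0" "f z = 0" using False that by (auto intro!: f(2))
  then show ?thesis using e by simp
 qed
 then show thesis using \<delta>(1) by (intro that[of "min \<delta> 1"]) auto
qed

text \<open>Beyond the distance \<delta> of uniform continuity, the trivial bound 2 * B is absorbed
  by the quadratic term with C = 2 * B / \<delta>^2. This is the form wanted by
  \<open>psi_mod\<close>.\<close>

lemma compact_support_modulus:
 fixes f :: "real^'d => real"
 assumes f: "cont f" "\<And>y. R <= norm y ==> f y = 0" and e: "0 < e"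
 obtains C where "0 <= C" "\<And>y z. \<bar>f y - f z\<bar> <= e + C * (norm (z - y))\<^sup>2"
proof -
 obtain B where B: "0 <= B" "\<And>y. norm (f y) <= B" using compact_support_bounded[OF f] by blast
 obtain \<delta> where \<delta>: "0 < \<delta>" "\<And>y z. norm (z - y) < \<delta> ==> norm (f z - f y) < e" using compact_support_uniform[OF f e] by blast
 define C where "C = 2 * B / \<delta>\<^sup>2"
 have "\<bar>f y - f z\<bar> <= e + C * (norm (z - y))\<^sup>2" for y z
 proof (cases "norm (z - y) < \<delta>")
  case True
  have "0 <= C * (norm (z - y))\<^sup>2" using B(1) by (simp add: C_def)
  then show ?thesis using \<delta>(2)[OF True] by (simp add: abs_minus_commute)
 next
  case False
  then have "\<delta>\<^sup>2 <= (norm (z - y))\<^sup>2" using \<delta> by (intro power_mono) auto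
  then have "C * \<delta>\<^sup>2 <= C * (norm (z - y))\<^sup>2" using B(1) by (intro mult_left_mono) (auto simp: C_def)
  moreover have "C * \<delta>\<^sup>2 = 2 * B" using \<delta>(1) by (simp add: C_def)
  moreover have "\<bar>f y - f z\<bar> <= 2 * B" using B(2)[of y] B(2)[of z] by simp
  ultimately show ?thesis using e by linarith
 qed
 then show thesis using B(1) by (intro that[of C]) (auto simp: C_def)
qed

definition test_pair :: "real => (real^'d => real) => (real^'d => real^'d) => (real^'d => real^'d^'d) => bool" where
 "test_pair R \<phi> g H \<longleftrightarrow> (\<forall>y. 0 <= \<phi> y) \<and> (\<forall>y. (\<phi> has_derivative (%v. g y \<bullet> v)) (at y)) \<and>
  (\<forall>y. (g has_derivative (%v. H y *v v)) (at y)) \<and> cont H \<and>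
  (\<forall>y. R <= norm y \<longrightarrow> \<phi> y = 0 \<and> g y = 0 \<and> H y = 0)"

lemma test_pair_continuous:
 assumes "test_pair R \<phi> g H"
 shows "cont \<phi>" "cont g" "cont H"
 using assms unfolding test_pair_def
 by (auto simp: continuous_on_eq_continuous_at intro: has_derivative_continuous)

lemma test_pair_line:
 assumes T: "test_pair R \<phi> g H"
 shows "((%t. \<phi> (y + t *\<^sub>R v)) has_real_derivative g (y + t *\<^sub>R v) \<bullet> v) (at t)"
  and "((%t. g (y + t *\<^sub>R v) \<bullet> v) has_real_derivative v \<bullet> (H (y + t *\<^sub>R v) *v v)) (at t)"
proof -
 have l: "((%t. y + t *\<^sub>R v) has_derivative (%h. h *\<^sub>R v)) (at t)" by (auto intro!: derivative_eq_intros)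
 have "((%t. \<phi> (y + t *\<^sub>R v)) has_derivative (%h. g (y + t *\<^sub>R v) \<bullet> (h *\<^sub>R v))) (at t)"
  using T by (intro has_derivative_compose[OF l]) (simp add: test_pair_def)
 then show "((%t. \<phi> (y + t *\<^sub>R v)) has_real_derivative g (y + t *\<^sub>R v) \<bullet> v) (at t)"
  by (simp add: has_field_derivative_def mult_commute_abs)
 have "((%t. g (y + t *\<^sub>R v)) has_derivative (%h. H (y + t *\<^sub>R v) *v (h *\<^sub>R v))) (at t)"
  using T by (intro has_derivative_compose[OF l]) (simp add: test_pair_def)
 then have "((%t. g (y + t *\<^sub>R v) \<bullet> v) has_derivative (%h. (H (y + t *\<^sub>R v) *v (h *\<^sub>R v)) \<bullet> v)) (at t)"
  by (rule has_derivative_inner_left)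
 then show "((%t. g (y + t *\<^sub>R v) \<bullet> v) has_real_derivative v \<bullet> (H (y + t *\<^sub>R v) *v v)) (at t)"
  by (simp add: has_field_derivative_def matrix_vector_mult_scaleR mult_commute_abs inner_commute)
qed

lemma test_pair_lipschitz:
 assumes T: "test_pair R \<phi> g H" and B: "\<And>y. norm (g y) <= B"
 shows "\<bar>\<phi> (y + v) - \<phi> y\<bar> <= B * norm v"
proof -
 obtain t where t: "\<phi> (y + 1 *\<^sub>R v) - \<phi> (y + 0 *\<^sub>R v) = (1 - 0) * (g (y + t *\<^sub>R v) \<bullet> v)"
  using MVT2[of 0 1 "%t. \<phi> (y + t *\<^sub>R v)" "%t. g (y + t *\<^sub>R v) \<bullet> v"] test_pair_line(1)[OF T] by auto
 have "\<bar>g (y + t *\<^sub>R v) \<bullet> v\<bar> <= norm (g (y + t *\<^sub>R v)) * norm v" by (rule Cauchy_Schwarz_ineq2)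
 also have "\<dots> <= B * norm v" by (intro mult_right_mono B) auto
 finally show ?thesis using t by simp
qed

text \<open>For short v, uniform continuity of the second derivatives gives e * |v|^2; for |v| >=
  \<delta>, |v|^2 <= |v|^3 / \<delta> moves the error into the cubic term.\<close>

lemma test_pair_taylor:
 assumes T: "test_pair R \<phi> g H" and e: "0 < e"
 obtains C where "0 <= C" "\<And>y v. \<bar>\<phi> (y + v) - \<phi> y - g y \<bullet> v - (v \<bullet> (H y *v v)) / 2\<bar> <= e * (norm v)\<^sup>2 + C * norm v ^ 3"
proof -
 have H: "cont H" "\<And>y. R <= norm y ==> H y = 0" using T by (auto simp: test_pair_def)
 obtain B where B: "0 <= B" "\<And>y. norm (H y) <= B" using compact_support_bounded[OF H] by blast
 obtain \<delta> where \<delta>: "0 < \<delta>" "\<And>y z. norm (z - y) < \<delta> ==> norm (H z - H y) < e" using compact_support_uniform[OF H e] by blast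
 define C where "C = B / \<delta>"
 have "\<bar>\<phi> (y + v) - \<phi> y - g y \<bullet> v - (v \<bullet> (H y *v v)) / 2\<bar> <= e * (norm v)\<^sup>2 + C * norm v ^ 3" for y v
 proof -
  define D where "D m = (if m = 0 then (%t. \<phi> (y + t *\<^sub>R v)) else if m = 1 then (%t. g (y + t *\<^sub>R v) \<bullet> v) else (%t. v \<bullet> (H (y + t *\<^sub>R v) *v v)))" for m :: nat
  have "\<exists>t>0. t < 1 \<and> \<phi> (y + 1 *\<^sub>R v) = (\<Sum>m<2. D m 0 / fact m * 1 ^ m) + D 2 t / fact 2 * 1 ^ 2"
  proof (rule Maclaurin)
   show "\<forall>m t. m < 2 \<and> 0 <= t \<and> t <= 1 \<longrightarrow> DERIV (D m) t :> D (Suc m) t"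
    using test_pair_line[OF T] by (auto simp: D_def less_2_cases_iff)
  qed (auto simp: D_def)
  then obtain t where t: "0 < t" "t < 1" and eq: "\<phi> (y + v) = \<phi> y + g y \<bullet> v + (v \<bullet> (H (y + t *\<^sub>R v) *v v)) / 2"
   by (auto simp: D_def numeral_2_eq_2)
  let ?E = "H (y + t *\<^sub>R v) - H y"
  have "\<bar>\<phi> (y + v) - \<phi> y - g y \<bullet> v - (v \<bullet> (H y *v v)) / 2\<bar> = \<bar>v \<bullet> (?E *v v)\<bar> / 2"
  proof -
   have "\<phi> (y + v) - \<phi> y - g y \<bullet> v - (v \<bullet> (H y *v v)) / 2 = (v \<bullet> (?E *v v)) / 2"
    unfolding eq by (simp add: matrix_vector_mult_diff_rdistrib inner_diff_right field_simps)
   from arg_cong[OF this, of abs] show ?thesis by (simp only: abs_divide abs_numeral)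
  qed
  also have "\<bar>v \<bullet> (?E *v v)\<bar> <= norm v * (norm ?E * norm v)"
   by (rule order_trans[OF Cauchy_Schwarz_ineq2 mult_left_mono[OF norm_matrix_vector_le]]) simp
  also have "norm v * (norm ?E * norm v) / 2 <= e * (norm v)\<^sup>2 + C * norm v ^ 3"
  proof (cases "norm v < \<delta>")
   case True
   have "norm (t *\<^sub>R v) <= norm v" using t by (simp add: mult_left_le_one_le)
   then have "norm ?E < e" using True by (intro \<delta>(2)) auto
   then have "norm ?E * (norm v)\<^sup>2 <= e * (norm v)\<^sup>2" by (intro mult_right_mono) auto
   moreover have "0 <= norm ?E * (norm v)\<^sup>2" "0 <= C * norm v ^ 3" using B(1) \<delta>(1) by (auto simp: C_def)
   moreover have "norm v * (norm ?E * norm v) = norm ?E * (norm v)\<^sup>2" by (simp add: power2_eq_square)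
   ultimately show ?thesis by linarith
  next
   case False
   have "norm ?E <= B + B" by (rule norm_triangle_le_diff) (intro add_mono B(2))
   then have "norm ?E * (norm v)\<^sup>2 <= (2 * B) * (norm v)\<^sup>2" by (intro mult_right_mono) auto
   moreover have "B * (norm v)\<^sup>2 <= C * norm v ^ 3"
   proof -
    have "C * \<delta> * (norm v)\<^sup>2 <= C * norm v * (norm v)\<^sup>2"
     using False B(1) \<delta>(1) by (intro mult_right_mono mult_left_mono) (auto simp: C_def)
    moreover have "C * \<delta> = B" using \<delta>(1) by (simp add: C_def)
    ultimately show ?thesis by (simp add: power2_eq_square power3_eq_cube mult.assoc)
   qed
   moreover have "0 <= e * (norm v)\<^sup>2" using e by simp
   moreover have "norm v * (norm ?E * norm v) = norm ?E * (norm v)\<^sup>2" by (simp add: power2_eq_square)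
   ultimately show ?thesis by linarith
  qed
  finally show ?thesis by simp
 qed
 then show thesis using B(1) \<delta>(1) by (intro that[of C]) (auto simp: C_def)
qed

text \<open>The strict inequality leaves room to raise |b| by a small constant \<kappa> on a
  slightly larger ball. By uniform continuity the raised function at z dominates |b| at all points
  within 2 * r of z.\<close>

lemma dominating_drift:
 fixes b :: "real^'d => real^'d"
 assumes b: "cont b" "\<And>y. R <= norm y ==> b y = 0" and K: "0 <= K"
  and norm_b: "(NN y. ennreal (norm (b y) ^ CARD('d))) < ennreal (K ^ CARD('d)) \<or> (\<forall>y. b y = 0)"
 obtains r \<bb> where "0 < r" "\<bb> \<in> bm borel" "\<And>y. 0 <= \<bb> y"
  "Lp_norm (real CARD('d)) UNIV \<bb> = ennreal K" "\<And>y z. norm (z - y) <= 2 * r ==> norm (b y) <= \<bb> z"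
proof -
 let ?d = "CARD('d)"
 let ?B = "ball 0 (R + 1) :: (real^'d) set"
 have [measurable]: "?B \<in> sets borel" by simp
 have [measurable]: "b \<in> bm borel" by (rule bm_contI[OF b(1)])
 define u where "u \<kappa> y = norm (b y) + \<kappa> * indicator ?B y" for \<kappa> y
 have [measurable]: "u \<kappa> \<in> bm borel" for \<kappa> unfolding u_def by measurable
 have "\<exists>\<kappa> r. 0 <= \<kappa> \<and> 0 < r \<and> (NN y. ennreal (u \<kappa> y ^ ?d)) <= ennreal (K ^ ?d) \<and>
  (\<forall>y z. norm (z - y) <= 2 * r \<longrightarrow> norm (b y) <= u \<kappa> z)"
 proof (cases "\<forall>y. b y = 0")
  case True
  have "u 0 y ^ ?d = 0" for y using True by (simp add: u_def zero_power)
  then have "(NN y. ennreal (u 0 y ^ ?d)) <= ennreal (K ^ ?d)" by (simp only: ennreal_0 nn_integral_const mult_zero_left zero_le)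
  moreover have "norm (b y) <= u 0 z" for y z using True by (simp add: u_def)
  ultimately show ?thesis by (intro exI[of _ 0] exI[of _ 1]) auto
 next
  case False
  then have lt: "(NN y. ennreal (norm (b y) ^ ?d)) < ennreal (K ^ ?d)" using norm_b by blast
  obtain B where B: "0 <= B" "\<And>y. norm (b y) <= B" using compact_support_bounded[OF b] by blast
  have "(%n. (NN y. ennreal (u (1 / real (Suc n)) y ^ ?d))) ---> (NN y. ennreal (norm (b y) ^ ?d))"
  proof (rule nn_integral_dominated_convergence[where w="%y. ennreal ((B + 1) ^ ?d) * indicator ?B y"])
   show "(NN y. ennreal ((B + 1) ^ ?d) * indicator ?B y) < \<infinity>"
    using emeasure_lborel_ball_finite[of "0 :: real^'d" "R + 1"] by (subst nn_integral_cmult_indicator) (simp_all add: ennreal_mult_less_top)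
   show "AE y in lborel. ennreal (u (1 / real (Suc n)) y ^ ?d) <= ennreal ((B + 1) ^ ?d) * indicator ?B y" for n
   proof (rule AE_I2)
    fix y
    show "ennreal (u (1 / real (Suc n)) y ^ ?d) <= ennreal ((B + 1) ^ ?d) * indicator ?B y"
    proof (cases "y \<in> ?B")
     case True
     have "u (1 / real (Suc n)) y <= B + 1" unfolding u_def using B(2)[of y] True by (simp add: add_mono)
     then show ?thesis using True by (auto intro!: ennreal_leI power_mono simp: u_def)
    next
     case False
     then have "b y = 0" by (intro b(2)) auto
     then show ?thesis using False by (simp add: u_def)
    qed
   qed
   have "(%n. u (1 / real (Suc n)) y) ---> norm (b y) + 0 * indicator ?B y" for y
    unfolding u_def by (intro tendsto_intros LIMSEQ_Suc lim_1_over_n)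
   then show "AE y in lborel. (%n. ennreal (u (1 / real (Suc n)) y ^ ?d)) ---> ennreal (norm (b y) ^ ?d)"
    by (intro AE_I2 tendsto_ennrealI tendsto_power) simp
  qed measurable
  then have "EV n. (NN y. ennreal (u (1 / real (Suc n)) y ^ ?d)) < ennreal (K ^ ?d)"
   using lt by (rule order_tendstoD)
  then obtain n where n: "(NN y. ennreal (u (1 / real (Suc n)) y ^ ?d)) < ennreal (K ^ ?d)"
   using eventually_happens'[OF sequentially_bot] by blast
  let ?\<kappa> = "1 / real (Suc n)"
  have "0 < ?\<kappa>" by simp
  obtain \<delta> where \<delta>: "0 < \<delta>" "\<And>y z. norm (z - y) < \<delta> ==> norm (b z - b y) < ?\<kappa>"
   using compact_support_uniform[OF b \<open>0 < ?\<kappa>\<close>] by blast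
  define r where "r = min \<delta> 1 / 4"
  have r: "0 < r" "2 * r < \<delta>" "2 * r < 1" using \<delta>(1) by (auto simp: r_def)
  have "norm (b y) <= u ?\<kappa> z" if yz: "norm (z - y) <= 2 * r" for y z
  proof (cases "b y = 0")
   case False
   then have "norm y < R" using b(2)[of y] by force
   moreover have "norm z <= norm y + norm (z - y)" using norm_triangle_ineq[of y "z - y"] by simp
   ultimately have "z \<in> ?B" using yz r by simp
   moreover have "norm (b z - b y) < ?\<kappa>" using yz r by (intro \<delta>(2)) simp
   then have "norm (b y) <= norm (b z) + ?\<kappa>" using norm_triangle_ineq2[of "b y" "b z"] by (simp add: norm_minus_commute)
   ultimately show ?thesis by (simp add: u_def)
  qed (simp add: u_def)
  then show ?thesis using n r(1) by (intro exI[of _ ?\<kappa>] exI[of _ r]) (auto intro: less_imp_le)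
 qed
 then obtain \<kappa> r where \<kappa>: "0 <= \<kappa>" and r: "0 < r" and le: "(NN y. ennreal (u \<kappa> y ^ ?d)) <= ennreal (K ^ ?d)"
  and dom: "\<And>y z. norm (z - y) <= 2 * r ==> norm (b y) <= u \<kappa> z" by blast
 have u0: "0 <= u \<kappa> y" for y using \<kappa> by (simp add: u_def)
 obtain i where i: "(NN y. ennreal (u \<kappa> y ^ ?d)) = ennreal i" "0 <= i"
  using le by (cases "(NN y. ennreal (u \<kappa> y ^ ?d))") (auto simp: top_unique)
 have iK: "i <= K ^ ?d" using le i K by (simp add: ennreal_le_iff)
 let ?Q = "cball 0 1 :: (real^'d) set"
 define vol where "vol = measure lborel ?Q"
 have vol: "0 < vol" unfolding vol_def by (rule content_cball_pos) simp
 have evol: "emeasure lborel ?Q = ennreal vol"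
  unfolding vol_def by (intro emeasure_eq_ennreal_measure) (use emeasure_bounded_finite[of "cball (0::real^'d) 1"] in auto)
 \<comment> \<open>Tops up the d-th power on the unit ball, because \<open>is_d0\<close> speaks of
   functions whose norm equals K exactly.\<close>
 define c where "c = (K ^ ?d - i) / vol"
 have c: "0 <= c" using iK vol by (simp add: c_def)
 define \<bb> where "\<bb> y = (u \<kappa> y ^ ?d + c * indicator ?Q y) powr (1 / ?d)" for y
 have d: "0 < ?d" by simp
 have pw: "norm (\<bb> y) powr ?d = u \<kappa> y ^ ?d + c * indicator ?Q y" for y
  using u0[of y] c d by (simp add: \<bb>_def powr_powr)
 have [measurable]: "?Q \<in> sets borel" by simp
 have [measurable]: "\<bb> \<in> bm borel" unfolding \<bb>_def by measurable
 have "(\<integral>\<^sup>+y\<in>UNIV. ennreal (norm (\<bb> y) powr ?d) \<partial>lebesgue) = (NN y. ennreal (u \<kappa> y ^ ?d) + ennreal c * indicator ?Q y)"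
 proof -
  have "(\<integral>\<^sup>+y\<in>UNIV. ennreal (norm (\<bb> y) powr ?d) \<partial>lebesgue) = (NN y. ennreal (norm (\<bb> y) powr ?d))"
   by (simp add: nn_integral_lebesgue_eq)
  also have "\<dots> = (NN y. ennreal (u \<kappa> y ^ ?d) + ennreal c * indicator ?Q y)"
   unfolding pw using u0 c by (intro nn_integral_cong) (auto simp: indicator_def)
  finally show ?thesis .
 qed
 also have "\<dots> = ennreal i + ennreal c * ennreal vol"
  by (subst nn_integral_add) (auto simp: i nn_integral_cmult_indicator evol)
 also have "\<dots> = ennreal (K ^ ?d)"
 proof -
  have "ennreal i + ennreal c * ennreal vol = ennreal i + ennreal (c * vol)" using c by (simp add: ennreal_mult')
  also have "\<dots> = ennreal (i + c * vol)" using c vol i by (intro ennreal_plus[symmetric]) auto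
  also have "i + c * vol = K ^ ?d" using vol by (simp add: c_def)
  finally show ?thesis .
 qed
 finally have "Lp_norm (real ?d) UNIV \<bb> = ennreal ((K ^ ?d) powr (1 / ?d))"
  using K by (simp add: Lp_norm_def)
 also have "(K ^ ?d) powr (1 / ?d) = K"
  using K d by (cases "K = 0") (auto simp: powr_realpow[symmetric] powr_powr)
 finally have n: "Lp_norm (real ?d) UNIV \<bb> = ennreal K" .
 have "norm (b y) <= \<bb> z" if "norm (z - y) <= 2 * r" for y z
 proof -
  have "(u \<kappa> z ^ ?d) powr (1 / ?d) <= \<bb> z" unfolding \<bb>_def using u0 c by (intro powr_mono2) auto
  moreover have "(u \<kappa> z ^ ?d) powr (1 / ?d) = u \<kappa> z"
   using u0[of z] d by (cases "u \<kappa> z = 0") (auto simp: powr_realpow[symmetric] powr_powr)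
  ultimately show ?thesis using dom[OF that] by linarith
 qed
 with n r show thesis by (intro that[of r \<bb>]) (auto simp: \<bb>_def)
qed

section \<open>The estimate at unit scale\<close>

definition gen_op :: "(real^'d => real^'d^'d) => (real^'d => real^'d) => (real^'d => real^'d) => (real^'d => real^'d^'d) => real^'d => real" where
 "gen_op a b g H y = (\<Sum>i\<in>UNIV. \<Sum>j\<in>UNIV. a y $ i $ j * H y $ i $ j) / 2 + g y \<bullet> b y"

definition smooth_drift :: "real => (real^'d => real^'d) => bool" where
 "smooth_drift K b \<longleftrightarrow> cont b \<and> (\<exists>R. \<forall>y. R <= norm y \<longrightarrow> b y = 0) \<and>
  ((NN y. ennreal (norm (b y) ^ CARD('d))) < ennreal (K ^ CARD('d)) \<or> (\<forall>y. b y = 0))"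

lemma gen_op_continuous:
 assumes "cont a" "cont b" "cont g" "cont H"
 shows "cont (gen_op a b g H)"
 unfolding gen_op_def by (intro continuous_intros assms) auto

text \<open>Testing with the constant 1 gives total mass 1, because exp (- t) integrates to
  1.\<close>

lemma green_mass:
 assumes "prob_space M" "is_green_function M x G"
 shows "Lp_norm 1 S G <= 1"
proof -
 interpret prob_space M by fact
 have e: "(nnS {0..} (%t. ennreal (exp (- t)) * 1)) = 1"
 proof -
  show ?thesis using nn_intergal_power_times_exp_Ici[of 0] by simp
 qed
 have G: "G \<in> bm borel" "\<And>y. 0 <= G y" using assms(2) by (auto simp: is_green_function_def)
 have "(\<integral>\<^sup>+Z. (nnS {0..} (%t. ennreal (exp (- t)) * (%_. 1) (x t Z))) \<partial>M) = (NN y. 1 * ennreal (G y))"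
  using assms(2) unfolding is_green_function_def by (elim conjE allE[of _ "%_. 1"]) auto
 then have 1: "(NN y. ennreal (G y)) = 1" using e by (simp add: emeasure_space_1)
 have "(\<integral>\<^sup>+y\<in>S. ennreal (norm (G y) powr 1) \<partial>lebesgue) <= (\<integral>\<^sup>+y. ennreal (G y) \<partial>lebesgue)"
  using G(2) by (intro nn_integral_mono) (auto simp: indicator_def)
 also have "\<dots> = 1" using 1 G(1) by (simp add: nn_integral_lebesgue_eq)
 finally show ?thesis using Lp_norm_le_iff[of 1 1 S G] by simp
qed

text \<open>The mean occupation time is the integral of the positive part of \<psi> against G. As
  \<psi> vanishes outside the ball of radius 1/2, the largest radius allowed in
  \<open>is_d0\<close>, Hoelder's inequality bounds it by the L_p norm of that part;
  \<open>value_bound\<close> then transfers the bound to \<phi> 0.\<close>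

theorem key_estimate:
 assumes d: "2 <= CARD('d::finite)" and \<delta>: "0 < \<delta>" "\<delta> < 1" and K: "0 <= K" and d0: "is_d0 TYPE('d) \<delta> K p"
 shows "\<exists>N\<ge>0. \<forall>\<phi> g H (a :: real^'d => real^'d^'d) b. test_pair (1 / 2) \<phi> g H \<and> cont a \<and> (\<forall>y. a y \<in> S_mat \<delta>) \<and> smooth_drift K b \<longrightarrow>
  ennreal (\<phi> 0 powr p) <= ennreal N * (NN y. ennreal (max 0 (\<phi> y - gen_op a b g H y) powr p))"
proof -
 let ?n = "CARD('d)"
 let ?P = "%N (\<bb> :: real^'d => real) (M :: sample measure) F d1 w \<sigma> b x.
   \<bb> \<in> bm borel \<and> (\<forall>y. 0 <= \<bb> y) \<and>
     Lp_norm (real CARD('d)) UNIV \<bb> = ennreal K \<and>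
     drift_diffusion \<delta> \<bb> M F d1 w \<sigma> b x \<longrightarrow>
     (\<exists>G. is_green_function M x G \<and>
      (\<forall>y R q. 0 < R \<and> R <= 1/2 \<and> p <= q \<longrightarrow>
       Lp_norm (q / (q - 1)) (ball y R) G
        <= ennreal (N * R powr (- real CARD('d) / q)) * Lp_norm 1 (ball y (2 * R)) G))"
 from d0 have "\<exists>N::real. 0 <= N \<and> (\<forall>\<bb> M F d1 w \<sigma> b x. ?P N \<bb> M F d1 w \<sigma> b x)"
  unfolding is_d0_def by (elim conjE)
 then obtain N0 where N0: "0 <= N0" and all: "\<forall>\<bb> M F d1 w \<sigma> b x. ?P N0 \<bb> M F d1 w \<sigma> b x"
  by (elim exE conjE)
 have green: "?P N0 \<bb> M F d1 w \<sigma> b x" for \<bb> M F d1 w \<sigma> b x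
  using all[THEN spec, THEN spec, THEN spec, THEN spec, THEN spec, THEN spec, THEN spec, THEN spec, of \<bb> M F d1 w \<sigma> b x] .
 have p: "1 < p" using d0 d unfolding is_d0_def by auto
 define q where "q = p / (p - 1)"
 have q: "1 < q" "1 / p + 1 / q = 1" using p by (auto simp: q_def field_simps)
 define c where "c = N0 * (1 / 2) powr (- real ?n / p)"
 have c: "0 <= c" using N0 by (simp add: c_def)
 obtain l :: "'d => real^'d^'d => real^'d" where l: "\<And>k. l k \<in> bm borel" "\<And>A. psd A ==> A = (\<Sum>k\<in>UNIV. outer (l k A))"
  using measurable_cholesky[where 'd='d] by blast
 \<comment> \<open>Numbers the d columns of the factor, so that d Wiener components drive the
   process; d >= 2 gives the required d1 > 1.\<close>
 obtain en where en: "bij_betw en {..<?n} (UNIV :: 'd set)"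
  using ex_bij_betw_nat_finite[of "UNIV :: 'd set"] by (auto simp: lessThan_atLeast0)
 obtain M :: "sample measure" and F w where W: "complete_filtered_space M F" "wiener_process M F ?n w"
  using wiener_process_exists[of ?n] d by auto
 show ?thesis
 proof (intro exI[of _ "(2 * c) powr p"] conjI allI impI)
  fix \<phi> :: "real^'d => real" and g b :: "real^'d => real^'d" and a H :: "real^'d => real^'d^'d"
  assume asm: "test_pair (1 / 2) \<phi> g H \<and> cont a \<and> (\<forall>y. a y \<in> S_mat \<delta>) \<and> smooth_drift K b"
  then have T: "test_pair (1 / 2) \<phi> g H" and a: "cont a" "\<And>y. a y \<in> S_mat \<delta>"
   and bc: "cont b" and bn: "(NN y. ennreal (norm (b y) ^ ?n)) < ennreal (K ^ ?n) \<or> (\<forall>y. b y = 0)"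
   by (auto simp: smooth_drift_def)
  obtain Rb where bs: "\<And>y. Rb <= norm y ==> b y = 0" using asm unfolding smooth_drift_def by blast
  have supp: "\<phi> y = 0" "g y = 0" "H y = 0" if "1 / 2 <= norm y" for y using T that by (auto simp: test_pair_def)
  note cont = test_pair_continuous[OF T]
  define \<psi> where "\<psi> y = \<phi> y - gen_op a b g H y" for y
  have \<psi>c: "cont \<psi>" unfolding \<psi>_def[abs_def] by (intro continuous_intros cont gen_op_continuous a bc)
  have \<psi>s: "\<psi> y = 0" if "1 / 2 <= norm y" for y using supp[OF that] by (simp add: \<psi>_def gen_op_def)
  have [measurable]: "a \<in> bm borel" "b \<in> bm borel" "\<psi> \<in> bm borel" "\<phi> \<in> bm borel"
    "g \<in> bm borel" "H \<in> bm borel"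
   by (rule bm_contI, fact)+
  obtain r \<bb> where bb: "0 < r" "\<bb> \<in> bm borel" "\<And>y. 0 <= \<bb> y"
   "Lp_norm (real ?n) UNIV \<bb> = ennreal K" "\<And>y z. norm (z - y) <= 2 * r ==> norm (b y) <= \<bb> z"
  proof (rule dominating_drift[OF bc bs K bn])
   fix r :: real and \<bb> :: "real^'d => real"
   assume *: "0 < r" "\<bb> \<in> bm borel" "\<And>y. 0 <= \<bb> y" "Lp_norm (real ?n) UNIV \<bb> = ennreal K"
    "\<And>y z. norm (z - y) <= 2 * r ==> norm (b y) <= \<bb> z"
   show thesis by (rule that[of r \<bb>]) (fact *)+
  qed
  obtain Cb where Cb: "0 <= Cb" "\<And>y. norm (b y) <= Cb" using compact_support_bounded[OF bc bs] by blast
  obtain C\<phi> where C\<phi>: "0 <= C\<phi>" "\<And>y. norm (\<phi> y) <= C\<phi>" using compact_support_bounded[OF cont(1) supp(1)] by blast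
  obtain Cg where Cg: "0 <= Cg" "\<And>y. norm (g y) <= Cg" using compact_support_bounded[OF cont(2) supp(2)] by blast
  obtain CH where CH: "0 <= CH" "\<And>y. norm (H y) <= CH" using compact_support_bounded[OF cont(3) supp(3)] by blast
  obtain C\<psi> where C\<psi>: "0 <= C\<psi>" "\<And>y. norm (\<psi> y) <= C\<psi>" using compact_support_bounded[OF \<psi>c \<psi>s] by blast
  define s where "s k y = l (en k) (a y)" for k y
  define Cs where "Cs = sqrt (real ?n / \<delta>)"
  have afac: "a y = (\<Sum>k\<in>UNIV. outer (l k (a y)))" for y by (rule l(2)[OF S_mat_psd[OF \<delta>(1) a(2)]])
  have s: "s k \<in> bm borel" "norm (s k y) <= Cs" for k y
   unfolding s_def Cs_def by (auto intro!: measurable_compose[OF _ l(1)] factor_norm_bound[OF a(2) afac])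
  have sum_s: "(\<Sum>k<?n. f (l (en k) A)) = (\<Sum>k\<in>UNIV. f (l k A))" for f :: "real^'d => real" and A
   by (rule sum.reindex_bij_betw[OF en])
  have cov: "(\<chi> i j. \<Sum>k<?n. s k y $ i * s k y $ j) = a y" for y
  proof -
   have "(\<Sum>k<?n. s k y $ i * s k y $ j) = (\<Sum>k\<in>UNIV. outer (l k (a y))) $ i $ j" for i j
    unfolding s_def using sum_s[of "%v. v $ i * v $ j" "a y"] by (simp add: outer_def)
   then show ?thesis unfolding afac[of y, symmetric] by (simp add: vec_eq_iff)
  qed
  define A2 where "A2 = Cs\<^sup>2 * real ?n ^ 3"
  define A3 where "A3 = 2 * Cs ^ 3 * real ?n ^ 4"
  have A2: "0 <= A2" by (simp add: A2_def)
  have \<psi>int: "(NN y. ennreal (max 0 (\<psi> y) powr p)) < \<infinity>"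
  proof -
   have "(NN y. ennreal (max 0 (\<psi> y) powr p)) <= (NN y. ennreal (C\<psi> powr p) * indicator (ball 0 (1/2) :: (real^'d) set) y)"
   proof (rule nn_integral_mono)
    fix y :: "real^'d"
    have "max 0 (\<psi> y) <= C\<psi>" using C\<psi>(1) C\<psi>(2)[of y] by auto
    then have "max 0 (\<psi> y) powr p <= C\<psi> powr p" using p by (intro powr_mono2) auto
    then show "ennreal (max 0 (\<psi> y) powr p) <= ennreal (C\<psi> powr p) * indicator (ball 0 (1/2)) y"
     using \<psi>s[of y] by (cases "y \<in> ball 0 (1/2)") (auto intro!: ennreal_leI)
   qed
   also have "\<dots> < \<infinity>"
    using emeasure_lborel_ball_finite[of "0 :: real^'d" "1/2"] by (subst nn_integral_cmult_indicator) (simp_all add: ennreal_mult_less_top)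
   finally show ?thesis .
  qed
  then obtain I where I: "(NN y. ennreal (max 0 (\<psi> y) powr p)) = ennreal I" "0 <= I"
   by (cases "(NN y. ennreal (max 0 (\<psi> y) powr p))") auto
  define V where "V = I powr (1 / p) * c"
  have V: "0 <= V" using c by (simp add: V_def)
  have "\<phi> 0 <= 2 * V"
  proof (rule field_le_epsilon)
   fix \<eta> :: real assume \<eta>: "0 < \<eta>"
   \<comment> \<open>For h -> 0 the total error \<open>Tot\<close> tends to 2 * (2 * e * A2 + e').
     The choices of e and e' bring this to at most \<eta> / 2; the 1 added to A2 keeps the quotient
     defined.\<close>
   define e where "e = \<eta> / (16 * (A2 + 1))"
   define e' where "e' = \<eta> / 8"
   have e: "0 < e" "0 < e'" using \<eta> A2 by (auto simp: e_def e'_def)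
   obtain C where C: "0 <= C" "\<And>y v. \<bar>\<phi> (y + v) - \<phi> y - g y \<bullet> v - (v \<bullet> (H y *v v)) / 2\<bar> <= e * (norm v)\<^sup>2 + C * norm v ^ 3"
    using test_pair_taylor[OF T e(1)] by blast
   obtain C' where C': "0 <= C'" "\<And>y z. \<bar>\<psi> y - \<psi> z\<bar> <= e' + C' * (norm (z - y))\<^sup>2"
    using compact_support_modulus[OF \<psi>c \<psi>s e(2)] by blast
   define E1 where "E1 h = Cg * Cb * A2 * h / r\<^sup>2 + CH * Cb * sqrt h * (1 + A2) / 2 + CH * Cb\<^sup>2 * h / 2
    + 2 * e * (A2 + Cb\<^sup>2 * h) + 4 * C * (A3 * sqrt h + Cb ^ 3 * h\<^sup>2)" for h
   define E2 where "E2 h = E1 h + Cg * ((1 + A2) * sqrt h / 2 + Cb * h)" for h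
   define Tot where "Tot h = 2 * (\<bar>E2 h\<bar> + (e' + C' * (2 * A2 * h + 2 * Cb\<^sup>2 * h\<^sup>2)))" for h
   have "isCont Tot 0" unfolding Tot_def E2_def E1_def by (intro continuous_intros) (use bb(1) in auto)
   then have "(Tot \<longlongrightarrow> Tot 0) (at_right 0)" by (simp add: isCont_def filterlim_at_split)
   moreover have "Tot 0 < \<eta>"
   proof -
    have "2 * e * A2 <= \<eta> / 8"
    proof -
     have "2 * (\<eta> / (16 * c)) * A2 = \<eta> / 8 * (A2 / c)" if "0 < c" for c using that by (simp add: field_simps)
     from this[of "A2 + 1"] A2 have "2 * e * A2 = \<eta> / 8 * (A2 / (A2 + 1))" by (simp only: e_def)
     also have "\<dots> <= \<eta> / 8 * 1" using \<eta> A2 by (intro mult_left_mono) auto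
     finally show ?thesis by simp
    qed
    moreover have "0 <= 2 * e * A2" using e A2 by simp
    ultimately show ?thesis using \<eta> by (simp add: Tot_def E2_def E1_def e'_def)
   qed
   ultimately have "\<forall>\<^sub>F h in at_right 0. Tot h < \<eta>" by (rule order_tendstoD)
   moreover have "\<forall>\<^sub>F h in at_right (0::real). h < min (1/2) (r / (Cb + 1))"
    using bb(1) Cb(1) by (intro eventually_at_right_less[THEN eventually_mono] order_tendstoD(2)[OF tendsto_ident_at]) auto
   moreover have "\<forall>\<^sub>F h in at_right (0::real). 0 < h" by (rule eventually_at_right_less)
   ultimately have "\<forall>\<^sub>F h in at_right (0::real). Tot h < \<eta> \<and> h < min (1/2) (r / (Cb + 1)) \<and> 0 < h" by eventually_elim auto
   then obtain h where h: "Tot h < \<eta>" "h < 1 / 2" "h < r / (Cb + 1)" "0 < h"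
    using eventually_happens'[OF trivial_limit_at_right_real] by auto
   have hr: "Cb * h <= r"
   proof -
    have "h * (Cb + 1) < r" using h(3) Cb(1) by (simp add: pos_less_divide_eq)
    then show ?thesis using h(4) by (simp add: algebra_simps)
   qed
   interpret E: euler M F ?n w s b h r Cs Cb
    by unfold_locales (use W d h bb s Cb in auto)
   interpret E: euler_test M F ?n w s b h r Cs Cb \<phi> \<psi> g H e C Cg CH C\<phi> C\<psi> e' C'
   proof unfold_locales
    show "0 <= \<phi> y" for y using T by (simp add: test_pair_def)
    show "\<phi> y <= C\<phi>" for y using C\<phi>(2)[of y] by simp
    show "\<bar>u \<bullet> (H y *v v)\<bar> <= CH * norm u * norm v" for y u v
    proof -
     have "\<bar>u \<bullet> (H y *v v)\<bar> <= norm u * (norm (H y) * norm v)"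
      by (rule order_trans[OF Cauchy_Schwarz_ineq2 mult_left_mono[OF norm_matrix_vector_le]]) simp
     also have "\<dots> <= norm u * (CH * norm v)" by (intro mult_left_mono mult_right_mono CH) auto
     finally show ?thesis by (simp add: mult_ac)
    qed
    show "\<bar>\<phi> (y + v) - \<phi> y\<bar> <= Cg * norm v" for y v by (rule test_pair_lipschitz[OF T Cg(2)])
    show "\<psi> y = \<phi> y - ((\<Sum>k<?n. s k y \<bullet> (H y *v s k y)) / 2 + g y \<bullet> b y)" for y
     unfolding \<psi>_def gen_op_def s_def sum_s[of "%v. v \<bullet> (H y *v v)"] using trace_factor[OF afac[of y], of "H y"] by simp
    show "\<psi> y <= max 0 (\<psi> z) + e' + C' * (norm (z - y))\<^sup>2" for y z using C'(2)[of y z] by linarith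
   qed (use C C' CH Cg C\<psi> e h in auto)
   have dd: "drift_diffusion \<delta> \<bb> M F ?n w E.sig E.drift E.x"
    by (rule E.drift_diffusion_euler[OF hr]) (use bb cov a(2) in auto)
   obtain G where G: "is_green_function M E.x G" and est: "\<And>y R q. 0 < R ==> R <= 1/2 ==> p <= q ==>
       Lp_norm (q / (q - 1)) (ball y R) G <= ennreal (N0 * R powr (- real CARD('d) / q)) * Lp_norm 1 (ball y (2 * R)) G"
    using green[of \<bb> M F ?n w E.sig E.drift E.x] bb(2,3,4) dd by blast
   have Gm[measurable]: "G \<in> bm borel" and G0: "\<And>y. 0 <= G y" using G by (auto simp: is_green_function_def)
   have "Lp_norm q (ball 0 (1/2)) G <= ennreal c * Lp_norm 1 (ball 0 (2 * (1/2))) G"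
    unfolding q_def c_def by (rule est) auto
   also have "\<dots> <= ennreal c * 1" by (intro mult_left_mono green_mass[OF E.prob_space_axioms G]) simp
   finally have "Lp_norm q (ball 0 (1/2)) G <= ennreal c" by simp
   then have Gq: "(\<integral>\<^sup>+y\<in>ball 0 (1/2). ennreal (norm (G y) powr q) \<partial>lebesgue) <= ennreal (c powr q)"
    using q c by (simp add: Lp_norm_le_iff)
   \<comment> \<open>\<psi> vanishes outside this ball, so the cut leaves the integral unchanged,
     and the estimate controls G only there.\<close>
   define G1 where "G1 y = G y * indicator (ball 0 (1/2)) y" for y
   have [measurable]: "ball 0 (1/2) \<in> sets (borel :: (real^'d) measure)" by simp
   have [measurable]: "G1 \<in> bm borel" unfolding G1_def by measurable
   have "(NN y. ennreal (G1 y powr q)) = (\<integral>\<^sup>+y\<in>ball 0 (1/2). ennreal (norm (G y) powr q) \<partial>lebesgue)"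
    using G0 by (subst nn_integral_lebesgue_eq) (auto simp: G1_def indicator_def intro!: nn_integral_cong)
   with Gq have G1q: "(NN y. ennreal (G1 y powr q)) <= ennreal (c powr q)" by simp
   have "(\<integral>\<^sup>+Z. E.occupation Z \<partial>M) = (NN y. ennreal (max 0 (\<psi> y)) * ennreal (G y))"
   proof -
    have m: "(%y. ennreal (max 0 (\<psi> y))) \<in> bm borel" by measurable
    have gf: "\<And>f :: real^'d => ennreal. f \<in> bm borel ==>
     (\<integral>\<^sup>+Z. (nnS {0..} (%t. ennreal (exp (- t)) * f (E.x t Z))) \<partial>M) = (NN y. f y * ennreal (G y))"
     using G unfolding is_green_function_def by blast
    show ?thesis unfolding E.occupation_def by (rule gf[OF m])
   qed
   also have "\<dots> = (NN y. ennreal (max 0 (\<psi> y) * G1 y))"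
   proof (rule nn_integral_cong)
    fix y
    show "ennreal (max 0 (\<psi> y)) * ennreal (G y) = ennreal (max 0 (\<psi> y) * G1 y)"
    proof (cases "y \<in> ball 0 (1/2)")
     case True
     have "ennreal (max 0 (\<psi> y)) * ennreal (G y) = ennreal (max 0 (\<psi> y) * G y)"
      by (rule ennreal_mult'[symmetric]) simp
     with True show ?thesis by (simp only: G1_def indicator_simps mult_1_right)
    next
     case False
     then show ?thesis using \<psi>s[of y] by simp
    qed
   qed
   also have "\<dots> <= ennreal (I powr (1 / p) * (c powr q) powr (1 / q))"
    by (rule Holder2[OF p q]) (use I G1q G0 in \<open>auto simp: G1_def\<close>)
   also have "I powr (1 / p) * (c powr q) powr (1 / q) = V" using q c by (simp add: V_def powr_powr)
   finally have "\<phi> 0 <= 2 * V + 2 * (\<bar>E.E2\<bar> + (e' + C' * (2 * E.A2 * h + 2 * Cb\<^sup>2 * h\<^sup>2)))"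
    using V by (rule E.value_bound)
   also have "2 * (\<bar>E.E2\<bar> + (e' + C' * (2 * E.A2 * h + 2 * Cb\<^sup>2 * h\<^sup>2))) = Tot h"
    unfolding Tot_def E2_def E1_def E.E2_def E.E1_def E.A2_def E.A3_def A2_def A3_def ..
   finally show "\<phi> 0 <= 2 * V + \<eta>" using h(1) by simp
  qed
  moreover have "0 <= \<phi> 0" using T by (simp add: test_pair_def)
  ultimately have "\<phi> 0 powr p <= (2 * V) powr p" using p by (intro powr_mono2) auto
  also have "\<dots> = (2 * c) powr p * I"
   using p c I by (simp add: V_def powr_mult powr_powr mult_ac)
  finally have "ennreal (\<phi> 0 powr p) <= ennreal ((2 * c) powr p * I)" by (rule ennreal_leI)
  then show "ennreal (\<phi> 0 powr p) <= ennreal ((2 * c) powr p) * (NN y. ennreal (max 0 (\<phi> y - gen_op a b g H y) powr p))"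
   using I by (simp add: ennreal_mult' \<psi>_def)
 qed simp
qed

section \<open>Translation and rescaling\<close>

lemma ennreal_power_cancel:
 assumes "0 < (c :: real)"
 shows "ennreal (c ^ n) * ennreal ((1 / c) ^ n) = 1"
proof -
 have "ennreal (c ^ n) * ennreal ((1 / c) ^ n) = ennreal (c ^ n * (1 / c) ^ n)"
  using assms by (intro ennreal_mult'[symmetric]) simp
 also have "c ^ n * (1 / c) ^ n = (c * (1 / c)) ^ n" by (simp only: power_mult_distrib)
 also have "\<dots> = 1" using assms by simp
 finally show ?thesis by simp
qed

lemma nn_integral_scale:
 fixes f :: "real^'d => ennreal"
 assumes [measurable]: "f \<in> bm borel" and c: "0 < c"
 shows "(NN z. f (t + (1 / c) *\<^sub>R z)) = ennreal (c ^ CARD('d)) * (NN y. f y)"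
proof -
 have "(NN y. f y) = (\<integral>\<^sup>+y. f y \<partial>(density (distr lborel borel (%x. t + (1 / c) *\<^sub>R x)) (%_. \<bar>1 / c\<bar> ^ DIM(real^'d))))"
  using c by (subst lborel_affine[of "1 / c" t]) auto
 also have "\<dots> = ennreal ((1 / c) ^ CARD('d)) * (NN z. f (t + (1 / c) *\<^sub>R z))"
  using c by (simp add: nn_integral_density nn_integral_distr nn_integral_cmult)
 finally have "ennreal (c ^ CARD('d)) * (NN y. f y) = ennreal (c ^ CARD('d)) * ennreal ((1 / c) ^ CARD('d)) * (NN z. f (t + (1 / c) *\<^sub>R z))"
  by (simp add: mult.assoc)
 also have "ennreal (c ^ CARD('d)) * ennreal ((1 / c) ^ CARD('d)) = 1"
  using c by (rule ennreal_power_cancel)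
 finally show ?thesis by simp
qed

definition test_fun :: "(real^'d => real) => (real^'d => real^'d) => (real^'d => real^'d^'d) => bool" where
 "test_fun \<phi> g H \<longleftrightarrow> (\<forall>y. 0 <= \<phi> y) \<and> (\<forall>y. (\<phi> has_derivative (%v. g y \<bullet> v)) (at y)) \<and>
  (\<forall>y. (g has_derivative (%v. H y *v v)) (at y)) \<and> cont H"

lemma test_pair_rescale:
 assumes T: "test_fun \<phi> g H" and supp: "\<And>y. 1 / (2 * \<mu>) <= norm (y - x0) ==> \<phi> y = 0 \<and> g y = 0 \<and> H y = 0" and l: "0 < \<mu>"
 shows "test_pair (1 / 2) (%z. \<phi> (x0 + (1 / \<mu>) *\<^sub>R z)) (%z. (1 / \<mu>) *\<^sub>R g (x0 + (1 / \<mu>) *\<^sub>R z)) (%z. (1 / \<mu>\<^sup>2) *\<^sub>R H (x0 + (1 / \<mu>) *\<^sub>R z))"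
 unfolding test_pair_def
proof (intro conjI allI impI)
 fix z
 let ?y = "x0 + (1 / \<mu>) *\<^sub>R z"
 have d: "((%z. x0 + (1 / \<mu>) *\<^sub>R z) has_derivative (%v. (1 / \<mu>) *\<^sub>R v)) (at z)"
  using has_derivative_add[OF has_derivative_const[of x0] has_derivative_scaleR_right[OF has_derivative_ident[of "at z"], of "1 / \<mu>"]] by simp
 show "0 <= \<phi> ?y" using T by (simp add: test_fun_def)
 have "((%z. \<phi> (x0 + (1 / \<mu>) *\<^sub>R z)) has_derivative (%v. g ?y \<bullet> ((1 / \<mu>) *\<^sub>R v))) (at z)"
  using T by (intro has_derivative_compose[OF d]) (simp add: test_fun_def)
 then show "((%z. \<phi> (x0 + (1 / \<mu>) *\<^sub>R z)) has_derivative (%v. ((1 / \<mu>) *\<^sub>R g ?y) \<bullet> v)) (at z)" by simp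
 have "((%z. g (x0 + (1 / \<mu>) *\<^sub>R z)) has_derivative (%v. H ?y *v ((1 / \<mu>) *\<^sub>R v))) (at z)"
  using T by (intro has_derivative_compose[OF d]) (simp add: test_fun_def)
 then have "((%z. (1 / \<mu>) *\<^sub>R g (x0 + (1 / \<mu>) *\<^sub>R z)) has_derivative (%v. (1 / \<mu>) *\<^sub>R (H ?y *v ((1 / \<mu>) *\<^sub>R v)))) (at z)"
  by (rule has_derivative_scaleR_right)
 then show "((%z. (1 / \<mu>) *\<^sub>R g (x0 + (1 / \<mu>) *\<^sub>R z)) has_derivative (%v. ((1 / \<mu>\<^sup>2) *\<^sub>R H ?y) *v v)) (at z)"
  by (simp only: matrix_vector_mult_scaleR scaleR_matrix_vector_assoc scaleR_scaleR power2_eq_square times_divide_times_eq mult_1)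
 show "cont (%z. (1 / \<mu>\<^sup>2) *\<^sub>R H (x0 + (1 / \<mu>) *\<^sub>R z))"
 proof (rule continuous_on_scaleR[OF continuous_on_const])
  have H: "cont H" using T by (simp add: test_fun_def)
  show "cont (%z. H (x0 + (1 / \<mu>) *\<^sub>R z))"
   by (rule continuous_on_compose2[OF H]) (intro continuous_intros, simp)
 qed
 assume z: "1 / 2 <= norm z"
 have "norm (?y - x0) = norm z / \<mu>" using l by simp
 moreover have "(1 / 2) / \<mu> <= norm z / \<mu>" using z l by (intro divide_right_mono) auto
 ultimately have "1 / (2 * \<mu>) <= norm (?y - x0)" by (simp only: divide_divide_eq_left)
 then show "\<phi> ?y = 0" "(1 / \<mu>) *\<^sub>R g ?y = 0" "(1 / \<mu>\<^sup>2) *\<^sub>R H ?y = 0" using supp[of ?y] by simp_all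
qed

text \<open>The factor \<mu>^-d from the d-th power of the drift cancels the Jacobian \<mu>^d: the
  \<open>L_d\<close> norm is scale invariant, so K stays the same.\<close>

lemma smooth_drift_rescale:
 fixes b :: "real^'d => real^'d"
 assumes b: "smooth_drift K b" and l: "0 < \<mu>"
 shows "smooth_drift K (%z. (1 / \<mu>) *\<^sub>R b (x0 + (1 / \<mu>) *\<^sub>R z))"
 unfolding smooth_drift_def
proof (intro conjI)
 have bc: "cont b" using b by (simp add: smooth_drift_def)
 have [measurable]: "b \<in> bm borel" by (rule bm_contI[OF bc])
 show "cont (%z. (1 / \<mu>) *\<^sub>R b (x0 + (1 / \<mu>) *\<^sub>R z))"
  by (intro continuous_intros continuous_on_compose2[OF bc]) auto
 obtain R where R: "\<And>y. R <= norm y ==> b y = 0" using b unfolding smooth_drift_def by blast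
 have "(1 / \<mu>) *\<^sub>R b (x0 + (1 / \<mu>) *\<^sub>R z) = 0" if "\<mu> * (R + norm x0) <= norm z" for z
 proof -
  have "R + norm x0 <= norm ((1 / \<mu>) *\<^sub>R z)" using that l by (simp add: field_simps)
  then have "R <= norm (x0 + (1 / \<mu>) *\<^sub>R z)" using norm_triangle_ineq4[of "x0 + (1 / \<mu>) *\<^sub>R z" x0] by simp
  then show ?thesis using R by simp
 qed
 then show "\<exists>R. \<forall>z. R <= norm z \<longrightarrow> (1 / \<mu>) *\<^sub>R b (x0 + (1 / \<mu>) *\<^sub>R z) = 0" by blast
 have "(NN z. ennreal (norm ((1 / \<mu>) *\<^sub>R b (x0 + (1 / \<mu>) *\<^sub>R z)) ^ CARD('d)))
  = (NN z. ennreal ((1 / \<mu>) ^ CARD('d)) * ennreal (norm (b (x0 + (1 / \<mu>) *\<^sub>R z)) ^ CARD('d)))"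
 proof (rule nn_integral_cong)
  fix z
  have "norm ((1 / \<mu>) *\<^sub>R b (x0 + (1 / \<mu>) *\<^sub>R z)) = (1 / \<mu>) * norm (b (x0 + (1 / \<mu>) *\<^sub>R z))" using l by simp
  then have "norm ((1 / \<mu>) *\<^sub>R b (x0 + (1 / \<mu>) *\<^sub>R z)) ^ CARD('d) = (1 / \<mu>) ^ CARD('d) * norm (b (x0 + (1 / \<mu>) *\<^sub>R z)) ^ CARD('d)"
   by (simp only: power_mult_distrib)
  then show "ennreal (norm ((1 / \<mu>) *\<^sub>R b (x0 + (1 / \<mu>) *\<^sub>R z)) ^ CARD('d)) = ennreal ((1 / \<mu>) ^ CARD('d)) * ennreal (norm (b (x0 + (1 / \<mu>) *\<^sub>R z)) ^ CARD('d))"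
   using l by (simp only:) (intro ennreal_mult', simp)
 qed
 also have "\<dots> = ennreal ((1 / \<mu>) ^ CARD('d)) * (NN z. ennreal (norm (b (x0 + (1 / \<mu>) *\<^sub>R z)) ^ CARD('d)))"
  by (rule nn_integral_cmult) measurable
 also have "(NN z. ennreal (norm (b (x0 + (1 / \<mu>) *\<^sub>R z)) ^ CARD('d))) = ennreal (\<mu> ^ CARD('d)) * (NN y. ennreal (norm (b y) ^ CARD('d)))"
  by (rule nn_integral_scale) (use l in auto)
 also have "ennreal ((1 / \<mu>) ^ CARD('d)) * (ennreal (\<mu> ^ CARD('d)) * (NN y. ennreal (norm (b y) ^ CARD('d)))) = (NN y. ennreal (norm (b y) ^ CARD('d)))"
  using ennreal_power_cancel[OF l, of "CARD('d)"] by (simp only: mult.assoc[symmetric] mult.commute[of "ennreal ((1 / \<mu>) ^ CARD('d))"] mult_1)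
 finally show "(NN z. ennreal (norm ((1 / \<mu>) *\<^sub>R b (x0 + (1 / \<mu>) *\<^sub>R z)) ^ CARD('d))) < ennreal (K ^ CARD('d)) \<or> (\<forall>z. (1 / \<mu>) *\<^sub>R b (x0 + (1 / \<mu>) *\<^sub>R z) = 0)"
  using b by (auto simp: smooth_drift_def)
qed

text \<open>One N serves all \<mu>, because the rescaled data stay in the same classes. Only the
  volume contributes \<mu>^d, and for small \<mu> the operator outweighs the zeroth order
  term.\<close>

theorem key_estimate_scaled:
 assumes d: "2 <= CARD('d::finite)" and \<delta>: "0 < \<delta>" "\<delta> < 1" and K: "0 <= K" and d0: "is_d0 TYPE('d) \<delta> K p"
 shows "\<exists>N\<ge>0. \<forall>\<phi> g H (a :: real^'d => real^'d^'d) b x0 \<mu>. 0 < \<mu> \<and> test_fun \<phi> g H \<and>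
   (\<forall>y. 1 / (2 * \<mu>) <= norm (y - x0) \<longrightarrow> \<phi> y = 0 \<and> g y = 0 \<and> H y = 0) \<and>
   cont a \<and> (\<forall>y. a y \<in> S_mat \<delta>) \<and> smooth_drift K b \<longrightarrow>
  ennreal (\<phi> x0 powr p) <= ennreal (N * \<mu> ^ CARD('d)) * (NN y. ennreal (max 0 (\<phi> y - gen_op a b g H y / \<mu>\<^sup>2) powr p))"
proof -
 obtain N where N: "0 <= N" and key: "\<And>\<phi> g H (a :: real^'d => real^'d^'d) b. test_pair (1 / 2) \<phi> g H ==> cont a ==>
   (\<forall>y. a y \<in> S_mat \<delta>) ==> smooth_drift K b ==>
  ennreal (\<phi> 0 powr p) <= ennreal N * (NN y. ennreal (max 0 (\<phi> y - gen_op a b g H y) powr p))"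
  using key_estimate[OF assms] by blast
 show ?thesis
 proof (intro exI[of _ N] conjI allI impI N)
  fix \<phi> :: "real^'d => real" and g b :: "real^'d => real^'d" and a H :: "real^'d => real^'d^'d" and x0 :: "real^'d" and \<mu> :: real
  assume "0 < \<mu> \<and> test_fun \<phi> g H \<and> (\<forall>y. 1 / (2 * \<mu>) <= norm (y - x0) \<longrightarrow> \<phi> y = 0 \<and> g y = 0 \<and> H y = 0) \<and>
   cont a \<and> (\<forall>y. a y \<in> S_mat \<delta>) \<and> smooth_drift K b"
  then have l: "0 < \<mu>" and T: "test_fun \<phi> g H" and supp: "\<And>y. 1 / (2 * \<mu>) <= norm (y - x0) ==> \<phi> y = 0 \<and> g y = 0 \<and> H y = 0"
   and a: "cont a" "\<And>y. a y \<in> S_mat \<delta>" and b: "smooth_drift K b" by blast+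
  let ?T = "%z. x0 + (1 / \<mu>) *\<^sub>R z"
  have ca: "cont (%z. a (?T z))" by (intro continuous_on_compose2[OF a(1)] continuous_intros) auto
  have g: "gen_op (%z. a (?T z)) (%z. (1 / \<mu>) *\<^sub>R b (?T z)) (%z. (1 / \<mu>) *\<^sub>R g (?T z)) (%z. (1 / \<mu>\<^sup>2) *\<^sub>R H (?T z)) z
   = gen_op a b g H (?T z) / \<mu>\<^sup>2" for z
   by (simp add: gen_op_def sum_divide_distrib[symmetric] add_divide_distrib power2_eq_square)
  have bc: "cont b" using b by (simp add: smooth_drift_def)
  have c: "cont \<phi>" "cont g" "cont H"
   using T unfolding test_fun_def by (auto simp: continuous_on_eq_continuous_at intro: has_derivative_continuous)
  have m: "(%y. \<phi> y - gen_op a b g H y / \<mu>\<^sup>2) \<in> bm borel"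
   using l by (intro bm_contI continuous_intros c gen_op_continuous a bc) auto
  have "ennreal (\<phi> (?T 0) powr p) <= ennreal N * (NN z. ennreal (max 0 (\<phi> (?T z) - gen_op a b g H (?T z) / \<mu>\<^sup>2) powr p))"
  proof -
   have T': "test_pair (1 / 2) (%z. \<phi> (?T z)) (%z. (1 / \<mu>) *\<^sub>R g (?T z)) (%z. (1 / \<mu>\<^sup>2) *\<^sub>R H (?T z))"
    by (rule test_pair_rescale[OF T _ l]) (rule supp)
   have "\<forall>z. a (?T z) \<in> S_mat \<delta>" using a(2) by blast
   from key[OF T' ca this smooth_drift_rescale[OF b l, of x0]] show ?thesis unfolding g .
  qed
  also have "(NN z. ennreal (max 0 (\<phi> (?T z) - gen_op a b g H (?T z) / \<mu>\<^sup>2) powr p))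
   = ennreal (\<mu> ^ CARD('d)) * (NN y. ennreal (max 0 (\<phi> y - gen_op a b g H y / \<mu>\<^sup>2) powr p))"
   by (rule nn_integral_scale[OF measurable_compose[OF m] l]) measurable
  finally show "ennreal (\<phi> x0 powr p) <= ennreal (N * \<mu> ^ CARD('d)) * (NN y. ennreal (max 0 (\<phi> y - gen_op a b g H y / \<mu>\<^sup>2) powr p))"
   using N by (simp add: ennreal_mult' mult.assoc)
 qed
qed

section \<open>Mollification\<close>

text \<open>The power in the denominator closes the family under differentiation up to linear
  combinations, see \<open>flat_exp_deriv\<close>.\<close>

definition flat_exp :: "nat => real => real" where
 "flat_exp m t = (if t <= 0 then 0 else exp (- 1 / t) / t ^ m)"

lemma flat_exp_nonneg: "0 <= flat_exp m t"
 by (simp add: flat_exp_def)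

text \<open>The expression is the difference quotient at 0; the exponential beats every
  power.\<close>

lemma flat_exp_tendsto_0: "((%t. flat_exp m t / t) \<longlongrightarrow> 0) (at 0)"
proof -
 have "((%t :: real. exp (- 1 / t) / t ^ Suc m) \<longlongrightarrow> 0) (at_right 0)"
 proof -
  have "((%t :: real. (inverse t) ^ Suc m / exp (inverse t)) \<longlongrightarrow> 0) (at_right 0)"
   by (rule filterlim_compose[OF tendsto_power_div_exp_0 filterlim_inverse_at_top_right])
  moreover have "(inverse t) ^ Suc m / exp (inverse t) = exp (- 1 / t) / t ^ Suc m" for t :: real
   by (simp add: exp_minus field_simps del: power_Suc)
  ultimately show ?thesis by (simp only:)
 qed
 moreover have "\<forall>\<^sub>F t in at_right 0. exp (- 1 / t) / t ^ Suc m = flat_exp m t / t"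
  using eventually_at_right_less[of "0 :: real"] by eventually_elim (simp add: flat_exp_def field_simps)
 ultimately have "((%t. flat_exp m t / t) \<longlongrightarrow> 0) (at_right 0)"
  by (simp add: filterlim_cong)
 moreover have "((%t. flat_exp m t / t) \<longlongrightarrow> 0) (at_left 0)"
 proof -
  have "\<forall>\<^sub>F t in at_left 0. 0 = flat_exp m t / t"
   using eventually_at_left_real[of "-1" "0 :: real"] by (rule eventually_mono) (auto simp: flat_exp_def)
  then show ?thesis by (rule Lim_transform_eventually[OF tendsto_const])
 qed
 ultimately show ?thesis by (rule filterlim_split_at[rotated])
qed

lemma DERIV_transfer_ev:
 "\<forall>\<^sub>F s in nhds t. f s = g s ==> (f has_field_derivative D) (at t) ==> (g has_field_derivative D) (at t)"
 using DERIV_cong_ev[OF refl _ refl, of f g t D] by blast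

lemma flat_exp_deriv:
 "(flat_exp m has_real_derivative (flat_exp (m + 2) t - real m * flat_exp (m + 1) t)) (at t)"
proof -
 consider "t < 0" | "t = 0" | "0 < t" by linarith
 then show ?thesis
 proof cases
  case 1
  have "((%t. 0 :: real) has_real_derivative 0) (at t)" by simp
  moreover have "\<forall>\<^sub>F s in nhds t. 0 = flat_exp m s"
   using eventually_nhds_in_open[of "{..<0}" t] 1 by (auto elim!: eventually_mono simp: flat_exp_def)
  ultimately have "(flat_exp m has_real_derivative 0) (at t)" by (rule DERIV_transfer_ev[rotated])
  then show ?thesis using 1 by (simp add: flat_exp_def)
 next
  case 2
  have "((%h. (flat_exp m h - flat_exp m 0) / (h - 0)) \<longlongrightarrow> 0) (at 0)"
   using flat_exp_tendsto_0[of m] by (simp add: flat_exp_def)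
  then have "(flat_exp m has_real_derivative 0) (at 0)" by (simp add: has_field_derivative_iff)
  then show ?thesis using 2 by (simp add: flat_exp_def)
 next
  case 3
  have "((%t. exp (- 1 / t) * inverse (t ^ m)) has_real_derivative (exp (- 1 / t) * (1 / t\<^sup>2)) * inverse (t ^ m)
    + exp (- 1 / t) * (- (real m * t ^ (m - 1)) * inverse ((t ^ m)\<^sup>2))) (at t)"
   using 3 by (auto intro!: derivative_eq_intros simp: power2_eq_square)
  also have "(exp (- 1 / t) * (1 / t\<^sup>2)) * inverse (t ^ m) = flat_exp (m + 2) t"
   using 3 by (simp add: flat_exp_def power_add power2_eq_square field_simps)
  also have "exp (- 1 / t) * (- (real m * t ^ (m - 1)) * inverse ((t ^ m)\<^sup>2)) = - real m * flat_exp (m + 1) t"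
   using 3 by (cases m) (simp_all add: flat_exp_def field_simps power2_eq_square)
  finally have "((%t. exp (- 1 / t) * inverse (t ^ m)) has_real_derivative (flat_exp (m + 2) t - real m * flat_exp (m + 1) t)) (at t)"
   by simp
  moreover have "\<forall>\<^sub>F s in nhds t. exp (- 1 / s) * inverse (s ^ m) = flat_exp m s"
   using eventually_nhds_in_open[of "{0<..}" t] 3 by (auto elim!: eventually_mono simp: flat_exp_def divide_inverse)
  ultimately show ?thesis by (rule DERIV_transfer_ev[rotated])
 qed
qed

text \<open>The functions generated from one radial profile by linear combinations and
  multiplication with coordinates. The family is closed under partial derivatives, so
  \<open>C_k\<close> for every k follows by induction, and all members vanish outside the same
  ball.\<close>

inductive bump :: "real^'d => real => (real^'d => real) => bool" for c e where
 base: "bump c e (%x. flat_exp m (e\<^sup>2 - (x - c) \<bullet> (x - c)))"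
| add: "bump c e f ==> bump c e g ==> bump c e (%x. f x + g x)"
| scale: "bump c e f ==> bump c e (%x. s * f x)"
| coord: "bump c e f ==> bump c e (%x. x $ i * f x)"

lemma bump_diff: "bump c e f ==> bump c e g ==> bump c e (%x. f x - g x)"
 using bump.add[OF _ bump.scale[of c e g "-1"]] by fastforce

lemma bump_support: "bump c e f ==> 0 < e ==> e <= norm (x - c) ==> f x = 0"
proof (induction rule: bump.induct)
 case (base m)
 then have "e\<^sup>2 <= (norm (x - c))\<^sup>2" by (intro power_mono) auto
 then show ?case by (simp add: flat_exp_def dot_square_norm)
qed auto

lemma bump_derivative:
 "bump c e f ==> \<exists>D. (\<forall>x. (f has_derivative (%h. \<Sum>i\<in>UNIV. h $ i * D i x)) (at x)) \<and> (\<forall>i. bump c e (D i))"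
proof (induction rule: bump.induct)
 case (base m)
 define D where "D = (%i x. (- 2) * ((x $ i) * (flat_exp (m + 2) (e\<^sup>2 - (x - c) \<bullet> (x - c)) - real m * flat_exp (m + 1) (e\<^sup>2 - (x - c) \<bullet> (x - c)))
  - c $ i * (flat_exp (m + 2) (e\<^sup>2 - (x - c) \<bullet> (x - c)) - real m * flat_exp (m + 1) (e\<^sup>2 - (x - c) \<bullet> (x - c)))))"
 have "bump c e (D i)" for i unfolding D_def
  by (intro bump.scale bump_diff bump.coord bump.base)
 moreover have "((%x. flat_exp m (e\<^sup>2 - (x - c) \<bullet> (x - c))) has_derivative (%h. \<Sum>i\<in>UNIV. h $ i * D i x)) (at x)" for x
 proof -
  let ?F = "flat_exp (m + 2) (e\<^sup>2 - (x - c) \<bullet> (x - c)) - real m * flat_exp (m + 1) (e\<^sup>2 - (x - c) \<bullet> (x - c))"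
  have "((%x. e\<^sup>2 - (x - c) \<bullet> (x - c)) has_derivative (%h. - 2 * ((x - c) \<bullet> h))) (at x)"
   by (auto intro!: derivative_eq_intros simp: inner_commute)
  from has_derivative_compose[OF this flat_exp_deriv[of m, unfolded has_field_derivative_def]]
  have "((%x. flat_exp m (e\<^sup>2 - (x - c) \<bullet> (x - c))) has_derivative (%h. ?F * (- 2 * ((x - c) \<bullet> h)))) (at x)" .
  moreover have "?F * (- 2 * ((x - c) \<bullet> h)) = (\<Sum>i\<in>UNIV. h $ i * D i x)" for h
  proof -
   have "D i x = - 2 * ?F * ((x - c) $ i)" for i unfolding D_def by (simp add: algebra_simps)
   then have "(\<Sum>i\<in>UNIV. h $ i * D i x) = (\<Sum>i\<in>UNIV. - 2 * ?F * ((x - c) $ i * h $ i))"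
    by (intro sum.cong) (simp_all add: mult_ac)
   also have "\<dots> = - 2 * ?F * (\<Sum>i\<in>UNIV. (x - c) $ i * h $ i)" by (rule sum_distrib_left[symmetric])
   also have "(\<Sum>i\<in>UNIV. (x - c) $ i * h $ i) = (x - c) \<bullet> h" unfolding inner_vec_def inner_real_def ..
   also have "- 2 * ?F * ((x - c) \<bullet> h) = ?F * (- 2 * ((x - c) \<bullet> h))" by (simp only: mult_ac)
   finally show ?thesis by simp
  qed
  ultimately show ?thesis by simp
 qed
 ultimately show ?case by blast
next
 case (add f g)
 then obtain D E where D: "\<And>x. (f has_derivative (%h. \<Sum>i\<in>UNIV. h $ i * D i x)) (at x)" "\<And>i. bump c e (D i)"
  and E: "\<And>x. (g has_derivative (%h. \<Sum>i\<in>UNIV. h $ i * E i x)) (at x)" "\<And>i. bump c e (E i)" by blast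
 have "((%x. f x + g x) has_derivative (%h. \<Sum>i\<in>UNIV. h $ i * (D i x + E i x))) (at x)" for x
  using has_derivative_add[OF D(1) E(1)] by (simp add: sum.distrib distrib_left)
 moreover have "bump c e (%x. D i x + E i x)" for i by (intro bump.add D E)
 ultimately show ?case by (intro exI[of _ "%i x. D i x + E i x"]) blast
next
 case (scale f s)
 then obtain D where D: "\<And>x. (f has_derivative (%h. \<Sum>i\<in>UNIV. h $ i * D i x)) (at x)" "\<And>i. bump c e (D i)" by blast
 have "((%x. s * f x) has_derivative (%h. \<Sum>i\<in>UNIV. h $ i * (s * D i x))) (at x)" for x
  using has_derivative_mult_right[OF D(1), of s] by (simp add: sum_distrib_left mult_ac)
 moreover have "bump c e (%x. s * D i x)" for i by (intro bump.scale D)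
 ultimately show ?case by (intro exI[of _ "%i x. s * D i x"]) blast
next
 case (coord f j)
 then obtain D where D: "\<And>x. (f has_derivative (%h. \<Sum>i\<in>UNIV. h $ i * D i x)) (at x)" "\<And>i. bump c e (D i)" by blast
 have "((%x. x $ j * f x) has_derivative (%h. \<Sum>i\<in>UNIV. h $ i * ((if i = j then 1 else 0) * f x + x $ j * D i x))) (at x)" for x
 proof -
  have "((%x. x $ j) has_derivative (%h. h $ j)) (at x)"
   by (rule bounded_linear_imp_has_derivative) (rule bounded_linear_vec_nth)
  from has_derivative_mult[OF this D(1)]
  have "((%x. x $ j * f x) has_derivative (%h. x $ j * (\<Sum>i\<in>UNIV. h $ i * D i x) + h $ j * f x)) (at x)" .
  moreover have "x $ j * (\<Sum>i\<in>UNIV. h $ i * D i x) + h $ j * f x = (\<Sum>i\<in>UNIV. h $ i * ((if i = j then 1 else 0) * f x + x $ j * D i x))" for h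
  proof -
   have "(\<Sum>i\<in>UNIV. h $ i * ((if i = j then 1 else 0) * f x + x $ j * D i x))
     = (\<Sum>i\<in>UNIV. (if i = j then h $ i * f x else 0)) + (\<Sum>i\<in>UNIV. x $ j * (h $ i * D i x))"
    unfolding sum.distrib[symmetric] by (intro sum.cong) (auto simp: algebra_simps)
   then show ?thesis by (simp add: sum_distrib_left)
  qed
  ultimately show ?thesis by simp
 qed
 moreover have "bump c e (%x. (if i = j then 1 else 0) * f x + x $ j * D i x)" for i
  by (intro bump.add bump.scale bump.coord D coord)
 ultimately show ?case by (intro exI[of _ "%i x. (if i = j then 1 else 0) * f x + x $ j * D i x"]) blast
qed

lemma partial_eq:
 assumes "(f has_derivative (%h. \<Sum>j\<in>UNIV. h $ j * D j)) (at x)"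
 shows "partial i f x = D i"
proof -
 have "frechet_derivative f (at x) = (%h. \<Sum>j\<in>UNIV. h $ j * D j)"
  using frechet_derivative_at[OF assms] by simp
 then show ?thesis by (simp add: partial_def axis_def if_distrib[of "%a. a * _"] cong: if_cong)
qed

lemma bump_partial:
 assumes "bump c e f"
 shows "(f has_derivative (%h. \<Sum>i\<in>UNIV. h $ i * partial i f x)) (at x)" and "bump c e (partial i f)"
proof -
 obtain D where D: "\<And>x. (f has_derivative (%h. \<Sum>i\<in>UNIV. h $ i * D i x)) (at x)" "\<And>i. bump c e (D i)"
  using bump_derivative[OF assms] by blast
 have p: "partial i f = D i" for i by (rule ext, rule partial_eq[OF D(1)])
 show "(f has_derivative (%h. \<Sum>i\<in>UNIV. h $ i * partial i f x)) (at x)" "bump c e (partial i f)"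
  unfolding p by (rule D)+
qed

lemma bump_continuous: "bump c e f ==> cont f"
 using has_derivative_continuous[OF bump_partial(1)] by (auto simp: continuous_on_eq_continuous_at)

lemma bump_C_k: "bump c e f ==> C_k k f"
proof (induction k arbitrary: f)
 case 0
 then show ?case by (simp add: bump_continuous)
next
 case (Suc k)
 have "f differentiable at x" for x using bump_partial(1)[OF Suc.prems] by (rule differentiableI)
 then show ?case using Suc.IH bump_partial(2)[OF Suc.prems] by simp
qed

lemma bump_test_function:
 assumes f: "bump c e f" and e: "0 < e" "cball c e \<subseteq> D"
 shows "f \<in> test_functions D"
proof -
 have s: "closure {x. f x \<noteq> 0} \<subseteq> cball c e"
 proof (rule closure_minimal)
  show "{x. f x \<noteq> 0} \<subseteq> cball c e" using bump_support[OF f e(1)] by (force simp: dist_norm norm_minus_commute)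
 qed simp
 then have "compact (closure {x. f x \<noteq> 0})"
  using bounded_subset[OF bounded_cball s] by (simp add: compact_eq_bounded_closed)
 then show ?thesis using s e bump_C_k[OF f] by (auto simp: test_functions_def)
qed

text \<open>A convolution kernel, seen as a function of the integration variable, thereby becomes a
  test function centred at x.\<close>

lemma bump_reflect: "bump 0 e f ==> bump x e (%y. f (x - y))"
proof (induction rule: bump.induct)
 case (base m)
 have "(x - y - 0) \<bullet> (x - y - 0) = (y - x) \<bullet> (y - x)" for y
  by (simp add: dot_square_norm norm_minus_commute)
 then show ?case using bump.base[of x e m] by simp
next
 case (coord f i)
 have "bump x e (%y. x $ i * f (x - y) - y $ i * f (x - y))" by (intro bump_diff bump.scale bump.coord coord)
 then show ?case by (simp add: left_diff_distrib)
qed (auto intro: bump.intros)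

lemma partial_reflect:
 assumes f: "bump 0 e f"
 shows "partial i (%y. f (x - y)) y = - partial i f (x - y)"
proof -
 have "((%y. x - y) has_derivative (%h. - h)) (at y)" by (auto intro!: derivative_eq_intros)
 from has_derivative_compose[OF this bump_partial(1)[OF f]]
 have "((%y. f (x - y)) has_derivative (%h. \<Sum>i\<in>UNIV. h $ i * (- partial i f (x - y)))) (at y)" by simp
 then show ?thesis by (rule partial_eq)
qed

section \<open>Approximation by continuous functions\<close>

lemma powr_sum_le:
 fixes a b q :: real
 assumes "0 <= a" "0 <= b" "0 < q"
 shows "(a + b) powr q <= 2 powr q * (a powr q + b powr q)"
proof -
 have "(a + b) powr q <= (2 * max a b) powr q" using assms by (intro powr_mono2) auto
 also have "\<dots> = 2 powr q * max a b powr q" by (rule powr_mult)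
 also have "\<dots> <= 2 powr q * (a powr q + b powr q)" by (intro mult_left_mono) (auto simp: max_def)
 finally show ?thesis .
qed

lemma powr_sum_le_ennreal:
 fixes a b c :: real
 assumes "0 <= a" "0 <= b" "0 <= c" "c <= a + b" "0 < q"
 shows "ennreal (c powr q) <= ennreal (2 powr q) * (ennreal (a powr q) + ennreal (b powr q))"
proof -
 have "c powr q <= (a + b) powr q" using assms by (intro powr_mono2) auto
 also have "\<dots> <= 2 powr q * (a powr q + b powr q)" using assms by (intro powr_sum_le) auto
 finally show ?thesis by (simp add: ennreal_mult'[symmetric] ennreal_plus[symmetric] del: ennreal_plus)
qed

lemma AE_continuous_approx:
 fixes f :: "'a::euclidean_space => 'b::euclidean_space"
 assumes "f \<in> bm borel"
 obtains g where "\<And>n. cont (g n)" "AE x in lborel. (%n. g n x) ---> f x"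
proof -
 have "f \<in> bm lebesgue" using assms by (simp add: measurable_completion)
 then have "f measurable_on UNIV" by (rule lebesgue_measurable_imp_measurable_on) simp
 then obtain N g where N: "negligible N" and g: "\<And>n :: nat. cont (g n)" and t: "\<And>x. x \<notin> N ==> (%n. g n x) ---> f x"
  unfolding measurable_on_def by auto
 have "AE x in lebesgue. x \<notin> N" using N by (intro AE_not_in) (simp add: negligible_iff_null_sets)
 then have "AE x in lborel. x \<notin> N" by (simp only: AE_completion_iff)
 then have "AE x in lborel. (%n. g n x) ---> f x" by eventually_elim (rule t)
 then show thesis using that g by blast
qed

text \<open>The radial projection onto the ball of radius M, written with \<open>max\<close> so that
  continuity is immediate.\<close>

definition clip :: "real => 'b::real_normed_vector => 'b" where
 "clip M v = (M / max M (norm v)) *\<^sub>R v"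

lemma clip:
 fixes v :: "'a::real_normed_vector"
 assumes "0 < M"
 shows "cont (clip M :: 'a => 'a)" "norm (clip M v) <= M" "norm v <= M ==> clip M v = v"
proof -
 have p: "0 < max M (norm v)" for v :: 'a using assms by simp
 show "cont (clip M :: 'a => 'a)" unfolding clip_def[abs_def]
  by (intro continuous_intros ballI) (use p in \<open>auto simp: less_imp_neq[symmetric]\<close>)
 show "norm (clip M v) <= M"
  using p[of v] assms by (simp add: clip_def pos_divide_le_eq)
 show "norm v <= M ==> clip M v = v" using assms by (simp add: clip_def max_absorb1)
qed

definition cutoff :: "real => 'a::real_normed_vector => real" where
 "cutoff M y = max 0 (min 1 (M + 1 - norm y))"

lemma cutoff:
 "cont (cutoff M)" "0 <= cutoff M y" "cutoff M y <= 1" "norm y <= M ==> cutoff M y = 1"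
 "M + 1 <= norm y ==> cutoff M y = 0"
 unfolding cutoff_def[abs_def] by (auto intro!: continuous_intros)

text \<open>Clipping and cutting off the continuous approximations leaves their limit unchanged,
  because the limit obeys the same bound and support condition; dominated convergence then applies
  to them.\<close>

lemma bounded_approx:
 fixes f :: "'a::euclidean_space => 'b::euclidean_space"
 assumes f: "f \<in> bm borel" and c: "0 < c" "\<And>x. norm (f x) <= c" "\<And>x. c < norm x ==> f x = 0"
 obtains T where "\<And>n. cont (T n)" "\<And>n x. norm (T n x) <= c" "\<And>n x. c + 1 <= norm x ==> T n x = 0"
  "AE x in lborel. (%n. T n x) ---> f x"
proof -
 obtain g where g: "\<And>n. cont (g n)" "AE x in lborel. (%n. g n x) ---> f x"
  using AE_continuous_approx[OF f] by blast
 note clc = clip(1)[OF c(1), where 'a='b]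
 show thesis
 proof (rule that[of "%n x. cutoff c x *\<^sub>R clip c (g n x)"])
  show "cont (%x. cutoff c x *\<^sub>R clip c (g n x))" for n
   by (intro continuous_on_scaleR cutoff continuous_on_compose2[OF clc g(1)]) auto
  show "norm (cutoff c x *\<^sub>R clip c (g n x)) <= c" for n x
  proof -
   have "norm (cutoff c x *\<^sub>R clip c (g n x)) <= 1 * c" unfolding norm_scaleR
    using cutoff(2,3)[of c x] clip(2)[OF c(1), of "g n x"] by (intro mult_mono) auto
   then show ?thesis by simp
  qed
  show "cutoff c x *\<^sub>R clip c (g n x) = 0" if "c + 1 <= norm x" for n x using cutoff(5)[OF that] by simp
  show "AE x in lborel. (%n. cutoff c x *\<^sub>R clip c (g n x)) ---> f x"
   using g(2)
  proof eventually_elim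
   case (elim x)
   have "(%n. cutoff c x *\<^sub>R clip c (g n x)) ---> cutoff c x *\<^sub>R clip c (f x)"
    by (rule tendsto_scaleR[OF tendsto_const continuous_on_tendsto_compose[OF clc elim]]) simp_all
   moreover have "cutoff c x *\<^sub>R clip c (f x) = f x"
    using clip(3)[OF c(1,2), of x] cutoff(4)[of x c] c(3)[of x] by (cases "norm x <= c") simp_all
   ultimately show ?case by simp
  qed
 qed
qed

lemma bounded_approx_Lp:
 fixes T :: "nat => 'a::euclidean_space => 'b::euclidean_space"
 assumes f: "\<And>n. T n \<in> bm borel" "f \<in> bm borel" and q: "0 < q"
  and T: "\<And>n x. norm (T n x) <= c" "\<And>n x. R <= norm x ==> T n x = 0" "AE x in lborel. (%n. T n x) ---> f x"
 shows "(%n. (NN x. ennreal (norm (T n x) powr q))) ---> (NN x. ennreal (norm (f x) powr q))"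
proof -
 define w where "w = (%x :: 'a. ennreal (c powr q) * indicator (cball 0 R) x)"
 have "(NN x. w x) = ennreal (c powr q) * emeasure lborel (cball 0 R :: 'a set)"
  unfolding w_def by (rule nn_integral_cmult_indicator) simp
 also have "\<dots> < \<infinity>" using emeasure_lborel_cball_finite[of "0 :: 'a" R] by (simp add: ennreal_mult_less_top)
 finally have w: "(NN x. w x) < \<infinity>" .
 show ?thesis
 proof (rule nn_integral_dominated_convergence[OF _ _ _ _ w])
  show "w \<in> bm lborel" unfolding w_def by (intro borel_measurable_times_ennreal borel_measurable_const borel_measurable_indicator) simp
  show "AE x in lborel. ennreal (norm (T n x) powr q) <= w x" for n
  proof (rule AE_I2)
   fix x
   have "norm (T n x) powr q <= c powr q" using q by (intro powr_mono2 T) auto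
   then show "ennreal (norm (T n x) powr q) <= w x"
    using T(2)[of x n] q unfolding w_def by (cases "norm x <= R") (simp_all add: ennreal_leI)
  qed
  show "AE x in lborel. (%n. ennreal (norm (T n x) powr q)) ---> ennreal (norm (f x) powr q)"
   using T(3)
  proof eventually_elim
   case (elim x)
   then show ?case using q by (intro tendsto_ennrealI tendsto_powr' tendsto_norm) auto
  qed
 qed (use f in simp_all)
qed

theorem Lp_approx:
 fixes f :: "'a::euclidean_space => 'b::euclidean_space"
 assumes f[measurable]: "f \<in> bm borel" and q: "0 < q"
  and fin: "(NN y. ennreal (norm (f y) powr q)) < \<infinity>" and \<eta>: "0 < \<eta>"
 obtains g R where "cont g" "\<And>y. R <= norm y ==> g y = 0"
  "(NN y. ennreal (norm (g y - f y) powr q)) <= ennreal \<eta>"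
proof -
 define F where "F = (%n y. if norm (f y) <= real (Suc n) \<and> norm y <= real (Suc n) then f y else 0)"
 \<comment> \<open>The two errors, from truncation and from continuous approximation, are added at
   the price 2^q of \<open>powr_sum_le\<close>.\<close>
 define \<eta>' where "\<eta>' = \<eta> / (2 * 2 powr q)"
 have \<eta>': "0 < \<eta>'" using \<eta> by (simp add: \<eta>'_def)
 have Fm[measurable]: "F n \<in> bm borel" for n unfolding F_def by measurable
 have "(%n. (NN y. ennreal (norm (F n y - f y) powr q))) ---> (NN (y :: 'a). 0)"
 proof (rule nn_integral_dominated_convergence[where w="%y. ennreal (norm (f y) powr q)"])
  show "AE x in lborel. ennreal (norm (F j x - f x) powr q) <= ennreal (norm (f x) powr q)" for j
   using q by (intro AE_I2 ennreal_leI powr_mono2) (auto simp: F_def)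
  show "AE x in lborel. (%i. ennreal (norm (F i x - f x) powr q)) ---> 0"
  proof (rule AE_I2)
   fix x
   obtain n where n: "max (norm x) (norm (f x)) <= real n" using real_arch_simple by blast
   have "F m x = f x" if "n <= m" for m using n that by (auto simp: F_def)
   then show "(%i. ennreal (norm (F i x - f x) powr q)) ---> 0"
    using q by (intro tendsto_eventually) (auto simp: eventually_sequentially intro!: exI[of _ n])
  qed
 qed (use fin in auto)
 then have "EV n. (NN y. ennreal (norm (F n y - f y) powr q)) < ennreal \<eta>'"
  using \<eta>' by (intro order_tendstoD) auto
 then obtain n where n: "(NN y. ennreal (norm (F n y - f y) powr q)) < ennreal \<eta>'"
  using eventually_happens' sequentially_bot by blast
 define c where "c = real (Suc n)"
 have Fc: "norm (F n x) <= c" "c < norm x ==> F n x = 0" for x by (auto simp: F_def c_def)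
 obtain T where T: "\<And>k. cont (T k)" "\<And>k x. norm (T k x) <= c" "\<And>k x. c + 1 <= norm x ==> T k x = 0"
  "AE x in lborel. (%k. T k x) ---> F n x"
  using bounded_approx[OF Fm _ Fc] by (auto simp: c_def)
 have [measurable]: "T k \<in> bm borel" for k by (rule bm_contI[OF T(1)])
 have "(%k. (NN y. ennreal (norm (T k y - F n y) powr q))) ---> (\<integral>\<^sup>+y. ennreal (norm (0 :: 'b) powr q) \<partial>(lborel :: 'a measure))"
 proof (rule bounded_approx_Lp[OF _ _ q, where c="c + c" and R="c + 1"])
  show "norm (T k x - F n x) <= c + c" for k x by (rule order_trans[OF norm_triangle_ineq4 add_mono[OF T(2) Fc(1)]])
  show "T k x - F n x = 0" if "c + 1 <= norm x" for k x using T(3)[OF that] Fc(2)[of x] that by simp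
  show "AE x in lborel. (%k. T k x - F n x) ---> 0" using T(4) by eventually_elim (rule LIM_zero)
 qed simp_all
 then have "EV k. (NN y. ennreal (norm (T k y - F n y) powr q)) < ennreal \<eta>'"
  using \<eta>' q by (intro order_tendstoD) auto
 then obtain k where k: "(NN y. ennreal (norm (T k y - F n y) powr q)) < ennreal \<eta>'"
  using eventually_happens' sequentially_bot by blast
 show thesis
 proof (rule that[OF T(1) T(3)])
  have "(NN y. ennreal (norm (T k y - f y) powr q))
   <= (NN y. ennreal (2 powr q) * (ennreal (norm (T k y - F n y) powr q) + ennreal (norm (F n y - f y) powr q)))"
  proof (intro nn_integral_mono powr_sum_le_ennreal q)
   show "norm (T k y - f y) <= norm (T k y - F n y) + norm (F n y - f y)" for y
    using norm_triangle_ineq[of "T k y - F n y" "F n y - f y"] by simp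
  qed auto
  also have "\<dots> = ennreal (2 powr q) * ((NN y. ennreal (norm (T k y - F n y) powr q)) + (NN y. ennreal (norm (F n y - f y) powr q)))"
   by (simp add: nn_integral_cmult nn_integral_add)
  also have "\<dots> <= ennreal (2 powr q) * (ennreal \<eta>' + ennreal \<eta>')"
   using k n by (intro mult_left_mono add_mono) auto
  also have "\<dots> = ennreal (2 powr q * (\<eta>' + \<eta>'))"
   using \<eta>' by (simp add: ennreal_mult'[symmetric] ennreal_plus[symmetric] del: ennreal_plus)
  also have "2 powr q * (\<eta>' + \<eta>') = \<eta>" by (simp add: \<eta>'_def)
  finally show "(NN y. ennreal (norm (T k y - f y) powr q)) <= ennreal \<eta>" .
 qed
qed

section \<open>Convolution with smooth kernels\<close>

definition conv :: "(real^'d => real) => (real^'d => real) => real^'d => real" where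
 "conv k f x = (\<integral>y. f y * k (x - y) \<partial>lborel)"

lemma bump_bounded:
 assumes "bump c e k" "0 < e"
 obtains B where "0 <= B" "\<And>y. \<bar>k y\<bar> <= B"
proof -
 have "k y = 0" if "norm c + e <= norm y" for y
  using that norm_triangle_ineq2[of y c] by (intro bump_support[OF assms]) linarith
 from compact_support_bounded[OF bump_continuous[OF assms(1)] this]
 show thesis using that by auto
qed

lemma integrable_conv:
 assumes k: "bump 0 e k" "0 < e" and f: "integrable lborel f"
 shows "integrable lborel (%y. f y * k (x - y))"
proof -
 obtain B where B: "0 <= B" "\<And>y. \<bar>k y\<bar> <= B" using bump_bounded[OF k] by blast
 have [measurable]: "k \<in> bm borel" by (rule bm_contI[OF bump_continuous[OF k(1)]])
 have [measurable]: "f \<in> bm borel" using borel_measurable_integrable[OF f] by simp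
 have "integrable lborel (%y. f y * B)" using f by simp
 then show ?thesis
 proof (rule Bochner_Integration.integrable_bound)
  show "AE y in lborel. norm (f y * k (x - y)) <= norm (f y * B)"
  proof (rule AE_I2)
   fix y
   have "\<bar>f y\<bar> * \<bar>k (x - y)\<bar> <= \<bar>f y\<bar> * B" by (intro mult_left_mono B) simp
   then show "norm (f y * k (x - y)) <= norm (f y * B)" using B by (simp add: abs_mult)
  qed
 qed measurable
qed

text \<open>The gradient is uniformly continuous, so the Taylor remainder is small uniformly in z;
  this permits differentiation under the integral for a merely integrable f.\<close>

lemma bump_uniform_derivative:
 assumes k: "bump 0 e k" "0 < e" and \<eta>: "0 < \<eta>"
 obtains \<delta> where "0 < \<delta>" "\<And>z h. norm h < \<delta> ==> \<bar>k (z + h) - k z - (\<Sum>i\<in>UNIV. h $ i * partial i k z)\<bar> <= \<eta> * norm h"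
proof -
 define G where "G = (%z. \<chi> i. partial i k z)"
 have Gc: "cont G" unfolding G_def
  by (intro continuous_intros bump_continuous[OF bump_partial(2)[OF k(1)]])
 have G0: "G y = 0" if "e <= norm y" for y
  using bump_support[OF bump_partial(2)[OF k(1)] k(2), of y] that by (simp add: G_def vec_eq_iff)
 have Gi: "(\<Sum>i\<in>UNIV. h $ i * partial i k z) = G z \<bullet> h" for h z by (simp add: G_def inner_vec_def mult.commute)
 have kd: "(k has_derivative (%h. G z \<bullet> h)) (at z)" for z using bump_partial(1)[OF k(1), of z] by (simp only: Gi)
 obtain \<delta> where \<delta>: "0 < \<delta>" "\<And>y z. norm (z - y) < \<delta> ==> norm (G z - G y) < \<eta>"
  using compact_support_uniform[OF Gc G0 \<eta>] by blast
 show thesis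
 proof (rule that[OF \<delta>(1)])
  fix z h :: "real^'a" assume h: "norm h < \<delta>"
  have "((%t. k (z + t *\<^sub>R h)) has_real_derivative G (z + t *\<^sub>R h) \<bullet> h) (at t)" for t
  proof -
   have "((%t. z + t *\<^sub>R h) has_derivative (%s. s *\<^sub>R h)) (at t)" by (auto intro!: derivative_eq_intros)
   from has_derivative_compose[OF this kd]
   show ?thesis by (simp add: has_field_derivative_def mult.commute[of _ "G (z + t *\<^sub>R h) \<bullet> h"])
  qed
  then obtain t where t: "0 < t" "t < 1" "k (z + 1 *\<^sub>R h) - k (z + 0 *\<^sub>R h) = (1 - 0) * (G (z + t *\<^sub>R h) \<bullet> h)"
   using MVT2[of 0 1 "%t. k (z + t *\<^sub>R h)" "%t. G (z + t *\<^sub>R h) \<bullet> h"] by auto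
  then have "k (z + h) - k z - (\<Sum>i\<in>UNIV. h $ i * partial i k z) = (G (z + t *\<^sub>R h) - G z) \<bullet> h"
   unfolding Gi by (simp add: inner_diff_left)
  also have "\<bar>\<dots>\<bar> <= norm (G (z + t *\<^sub>R h) - G z) * norm h" by (rule Cauchy_Schwarz_ineq2)
  also have "\<dots> <= \<eta> * norm h"
  proof (intro mult_right_mono less_imp_le[OF \<delta>(2)])
   have "t * norm h <= 1 * norm h" using t by (intro mult_right_mono) auto
   then show "norm (z + t *\<^sub>R h - z) < \<delta>" using h t by simp
  qed simp
  finally show "\<bar>k (z + h) - k z - (\<Sum>i\<in>UNIV. h $ i * partial i k z)\<bar> <= \<eta> * norm h" .
 qed
qed

lemma conv_has_derivative:
 assumes k: "bump 0 e k" "0 < e" and f: "integrable lborel f"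
 shows "(conv k f has_derivative (%h. \<Sum>i\<in>UNIV. h $ i * conv (partial i k) f x)) (at x)"
 unfolding has_derivative_at_alt
proof (intro conjI allI impI)
 show "bounded_linear (%h. \<Sum>i\<in>UNIV. h $ i * conv (partial i k) f x)"
  by (intro bounded_linear_sum bounded_linear_mult_const bounded_linear_vec_nth)
 fix \<epsilon> :: real assume \<epsilon>: "0 < \<epsilon>"
 define I where "I = (\<integral>y. \<bar>f y\<bar> \<partial>lborel)"
 have I0: "0 <= I" by (simp add: I_def)
 \<comment> \<open>The added 1 covers the case of f vanishing almost everywhere.\<close>
 define \<eta> where "\<eta> = \<epsilon> / (I + 1)"
 have \<eta>: "0 < \<eta>" using \<epsilon> I0 by (simp add: \<eta>_def)
 obtain \<delta> where \<delta>: "0 < \<delta>" "\<And>z h. norm h < \<delta> ==> \<bar>k (z + h) - k z - (\<Sum>i\<in>UNIV. h $ i * partial i k z)\<bar> <= \<eta> * norm h"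
  using bump_uniform_derivative[OF k \<eta>] by blast
 have ii: "integrable lborel (%y. f y * partial i k (x - y))" for i x
  by (rule integrable_conv[OF bump_partial(2)[OF k(1)] k(2) f])
 have main: "norm (conv k f y - conv k f x - (\<Sum>i\<in>UNIV. (y - x) $ i * conv (partial i k) f x)) <= \<epsilon> * norm (y - x)" if y: "norm (y - x) < \<delta>" for y
 proof -
  let ?h = "y - x"
  have "conv k f y - conv k f x - (\<Sum>i\<in>UNIV. ?h $ i * conv (partial i k) f x)
   = (\<integral>z. f z * k (y - z) - f z * k (x - z) - (\<Sum>i\<in>UNIV. ?h $ i * (f z * partial i k (x - z))) \<partial>lborel)"
   unfolding conv_def using ii integrable_conv[OF k f] by simp
  also have "norm \<dots> <= (\<integral>z. (\<eta> * norm ?h) * \<bar>f z\<bar> \<partial>lborel)"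
  proof (rule Bochner_Integration.integral_norm_bound_integral)
   show "integrable lborel (%z. f z * k (y - z) - f z * k (x - z) - (\<Sum>i\<in>UNIV. ?h $ i * (f z * partial i k (x - z))))"
    using ii integrable_conv[OF k f] by simp
   show "integrable lborel (%z. (\<eta> * norm ?h) * \<bar>f z\<bar>)" using f by simp
   fix z
   have "f z * k (y - z) - f z * k (x - z) - (\<Sum>i\<in>UNIV. ?h $ i * (f z * partial i k (x - z)))
    = f z * (k ((x - z) + ?h) - k (x - z) - (\<Sum>i\<in>UNIV. ?h $ i * partial i k (x - z)))"
    by (simp add: right_diff_distrib sum_distrib_left mult.left_commute)
   also have "norm \<dots> = \<bar>f z\<bar> * \<bar>k ((x - z) + ?h) - k (x - z) - (\<Sum>i\<in>UNIV. ?h $ i * partial i k (x - z))\<bar>"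
    by (simp only: real_norm_def abs_mult)
   also have "\<dots> <= \<bar>f z\<bar> * (\<eta> * norm ?h)" by (intro mult_left_mono \<delta>(2) y) simp
   finally show "norm (f z * k (y - z) - f z * k (x - z) - (\<Sum>i\<in>UNIV. ?h $ i * (f z * partial i k (x - z)))) <= (\<eta> * norm ?h) * \<bar>f z\<bar>"
    by (simp only: mult.commute)
  qed
  also have "\<dots> = \<eta> * I * norm ?h" by (simp add: I_def)
  also have "\<dots> <= \<epsilon> * norm ?h"
  proof (intro mult_right_mono)
   have "\<eta> * I <= \<eta> * (I + 1)" using \<eta> by (intro mult_left_mono) auto
   also have "\<dots> = \<epsilon>" using I0 by (simp add: \<eta>_def)
   finally show "\<eta> * I <= \<epsilon>" .
  qed simp
  finally show ?thesis .
 qed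
 show "\<exists>d>0. \<forall>y. norm (y - x) < d \<longrightarrow> norm (conv k f y - conv k f x - (\<Sum>i\<in>UNIV. (y - x) $ i * conv (partial i k) f x)) <= \<epsilon> * norm (y - x)"
  using \<delta>(1) main by blast
qed

lemma conv_continuous:
 assumes "bump 0 e k" "0 < e" "integrable lborel f"
 shows "cont (conv k f)"
 using has_derivative_continuous[OF conv_has_derivative[OF assms]] by (auto simp: continuous_on_eq_continuous_at)

text \<open>The subtraction of 0 keeps the literal form of \<open>bump.base\<close> with centre
  0.\<close>

definition mollifier :: "real => real^'d => real" where
 "mollifier e x = flat_exp 0 (e\<^sup>2 - (x - 0) \<bullet> (x - 0)) / (\<integral>y. flat_exp 0 (e\<^sup>2 - (y - 0) \<bullet> (y - 0 :: real^'d)) \<partial>lborel)"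

lemma bump_integrable:
 assumes k: "bump c e k" "0 < e"
 shows "integrable lborel k"
proof -
 obtain B where B: "0 <= B" "\<And>y. \<bar>k y\<bar> <= B" using bump_bounded[OF k] by blast
 have "integrable lborel (%y. indicator (cball c e) y * B)"
  using emeasure_lborel_cball_finite[of c e] by (intro integrable_mult_left integrable_real_indicator) (auto simp: emeasure_lborel_cball_finite)
 then show ?thesis
 proof (rule Bochner_Integration.integrable_bound)
  show "k \<in> bm lborel" using bm_contI[OF bump_continuous[OF k(1)]] by simp
  show "AE y in lborel. norm (k y) <= norm (indicator (cball c e) y * B)"
  proof (rule AE_I2)
   fix y
   show "norm (k y) <= norm (indicator (cball c e) y * B)"
    using B bump_support[OF k, of y] by (cases "y \<in> cball c e") (auto simp: dist_norm norm_minus_commute)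
  qed
 qed
qed

lemma mollifier:
 assumes e: "0 < e"
 shows "bump 0 e (mollifier e :: real^'d => real)" "0 <= mollifier e (x :: real^'d)"
  "(NN (x :: real^'d). ennreal (mollifier e x)) = 1"
proof -
 let ?k = "%x :: real^'d. flat_exp 0 (e\<^sup>2 - (x - 0) \<bullet> (x - 0))"
 have b: "bump 0 e ?k" by (rule bump.base)
 have int: "integrable lborel ?k" by (rule bump_integrable[OF b e])
 define Z where "Z = integral\<^sup>L lborel ?k"
 have m: "mollifier e x = (1 / Z) * ?k x" for x :: "real^'d" by (simp add: mollifier_def Z_def)
 have "0 <= Z" unfolding Z_def by (simp add: flat_exp_nonneg)
 moreover have "Z \<noteq> 0"
 proof
  assume "Z = 0"
  then have "AE x in lborel. ?k x = 0"
   using integral_nonneg_eq_0_iff_AE[OF int] by (simp add: Z_def flat_exp_nonneg)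
  then have "AE x in lborel. x \<notin> ball (0 :: real^'d) e"
  proof eventually_elim
   case (elim x)
   then show ?case
   proof (rule contrapos_pn)
    assume "x \<in> ball 0 e"
    then have "norm x < e" by simp
    then have "(norm x)\<^sup>2 < e\<^sup>2" using e by (intro power_strict_mono) auto
    then show "?k x \<noteq> 0" by (simp add: flat_exp_def dot_square_norm)
   qed
  qed
  then have "emeasure lborel (ball (0 :: real^'d) e) = 0" by (subst (asm) AE_iff_measurable[OF _ refl]) (auto simp: ball_def)
  then show False using content_ball_pos[OF e, of "0 :: real^'d"] by (simp add: measure_def)
 qed
 ultimately have Z: "0 < Z" by simp
 show "bump 0 e (mollifier e :: real^'d => real)" using bump.scale[OF b, of "1 / Z"] by (simp only: m[abs_def])
 show "0 <= mollifier e (x :: real^'d)" using Z by (simp add: m flat_exp_nonneg)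
 have "(NN (x :: real^'d). ennreal (mollifier e x)) = ennreal (\<integral>(x :: real^'d). mollifier e x \<partial>lborel)"
  using Z int by (intro nn_integral_eq_integral) (auto simp: m flat_exp_nonneg)
 also have "(\<integral>(x :: real^'d). mollifier e x \<partial>lborel) = 1 / Z * Z"
  by (simp only: m[abs_def] integral_mult_right_zero Z_def)
 finally show "(NN (x :: real^'d). ennreal (mollifier e x)) = 1" using Z by simp
qed

lemma mollifier_commute: "mollifier e (x - y) = mollifier e (y - x)"
 by (simp add: mollifier_def dot_square_norm norm_minus_commute)

lemma mollifier_measurable [measurable]:
 assumes "0 < e" shows "mollifier e \<in> bm borel"
 by (rule bm_contI[OF bump_continuous[OF mollifier(1)[OF assms]]])

lemma mollifier_integral:
 assumes e: "0 < e"
 shows "(NN y. ennreal (mollifier e (x - y :: real^'d))) = 1"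
proof -
 have "(NN y. ennreal (mollifier e (x - y))) = (NN y. ennreal (mollifier e (- x + y)))"
  by (subst mollifier_commute) simp
 also have "\<dots> = (\<integral>\<^sup>+y. ennreal (mollifier e y) \<partial>distr lborel borel ((+) (- x)))"
  using e by (subst nn_integral_distr) auto
 also have "\<dots> = 1" using mollifier(3)[OF e] by (simp only: lborel_distr_plus)
 finally show ?thesis .
qed

lemma mollifier_lborel_integral:
 assumes e: "0 < e"
 shows "integrable lborel (%y. mollifier e (x - y :: real^'d))" "(\<integral>y. mollifier e (x - y :: real^'d) \<partial>lborel) = 1"
proof -
 have m: "(%y. mollifier e (x - y)) \<in> bm lborel" using e by measurable
 show i: "integrable lborel (%y. mollifier e (x - y :: real^'d))"
  by (rule integrableI_nonneg[OF m]) (use mollifier(2)[OF e] mollifier_integral[OF e, of x] in auto)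
 have "ennreal (\<integral>y. mollifier e (x - y) \<partial>lborel) = ennreal 1"
  using nn_integral_eq_integral[OF i] mollifier(2)[OF e] mollifier_integral[OF e, of x] by auto
 then show "(\<integral>y. mollifier e (x - y :: real^'d) \<partial>lborel) = 1"
  by (subst (asm) ennreal_inj) (simp_all add: Bochner_Integration.integral_nonneg mollifier(2)[OF e])
qed

lemma conv_close:
 assumes e: "0 < e" and f: "integrable lborel f" and \<eta>: "\<And>y. norm (y - x) < e ==> \<bar>f y - f x\<bar> <= \<eta>"
 shows "\<bar>conv (mollifier e) f x - f x\<bar> <= \<eta>"
proof -
 note i = mollifier_lborel_integral[OF e, of x] and c = integrable_conv[OF mollifier(1)[OF e] e f, of x]
 have "conv (mollifier e) f x - f x = (\<integral>y. f y * mollifier e (x - y) - f x * mollifier e (x - y) \<partial>lborel)"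
  using i c by (simp add: conv_def)
 also have "norm \<dots> <= (\<integral>y. \<eta> * mollifier e (x - y) \<partial>lborel)"
 proof (rule Bochner_Integration.integral_norm_bound_integral)
  show "integrable lborel (%y. f y * mollifier e (x - y) - f x * mollifier e (x - y))" using i c by simp
  show "integrable lborel (%y. \<eta> * mollifier e (x - y))" using i by simp
  fix y
  have m0: "0 <= mollifier e (x - y)" by (rule mollifier(2)[OF e])
  have "norm (f y * mollifier e (x - y) - f x * mollifier e (x - y)) = \<bar>f y - f x\<bar> * mollifier e (x - y)"
   using m0 by (simp add: left_diff_distrib[symmetric] abs_mult)
  also have "\<dots> <= \<eta> * mollifier e (x - y)"
  proof (cases "norm (y - x) < e")
   case True
   then show ?thesis by (intro mult_right_mono \<eta> m0)
  next
   case False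
   then have "mollifier e (x - y) = 0"
    using bump_support[OF mollifier(1)[OF e] e, of "x - y"] by (simp add: norm_minus_commute)
   then show ?thesis by simp
  qed
  finally show "norm (f y * mollifier e (x - y) - f x * mollifier e (x - y)) <= \<eta> * mollifier e (x - y)" .
 qed
 also have "\<dots> = \<eta>" using i by simp
 finally show ?thesis by simp
qed

text \<open>Jensen's inequality, obtained from Hoelder's by splitting the kernel into its powers
  with conjugate exponents, followed by Tonelli and the unit mass of the kernel in either
  variable.\<close>

lemma conv_Lp_le:
 fixes f :: "real^'d => real"
 assumes e: "0 < e" and p: "1 < p" and f: "integrable lborel f" and fin: "(NN y. ennreal (\<bar>f y\<bar> powr p)) < \<infinity>"
 shows "(NN x. ennreal (\<bar>conv (mollifier e) f x\<bar> powr p)) <= (NN y. ennreal (\<bar>f y\<bar> powr p))"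
proof -
 note [measurable] = mollifier_measurable[OF e]
 have [measurable]: "f \<in> bm borel" using borel_measurable_integrable[OF f] by simp
 have m0: "0 <= mollifier e z" for z :: "real^'d" by (rule mollifier(2)[OF e])
 obtain C where C: "0 <= C" "\<And>z :: real^'d. \<bar>mollifier e z\<bar> <= C" using bump_bounded[OF mollifier(1)[OF e] e] by blast
 have jensen: "ennreal (\<bar>conv (mollifier e) f x\<bar> powr p) <= (NN y. ennreal (mollifier e (x - y) * \<bar>f y\<bar> powr p))" for x
 proof -
  let ?B = "(NN y. ennreal (mollifier e (x - y) * \<bar>f y\<bar> powr p))"
  have "?B <= (NN y. ennreal C * ennreal (\<bar>f y\<bar> powr p))"
  proof (rule nn_integral_mono)
   fix y
   have "mollifier e (x - y) * \<bar>f y\<bar> powr p <= C * \<bar>f y\<bar> powr p"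
    using C(2)[of "x - y"] by (intro mult_right_mono) auto
   then show "ennreal (mollifier e (x - y) * \<bar>f y\<bar> powr p) <= ennreal C * ennreal (\<bar>f y\<bar> powr p)"
    using C by (simp add: ennreal_mult'[symmetric] ennreal_leI)
  qed
  also have "\<dots> = ennreal C * (NN y. ennreal (\<bar>f y\<bar> powr p))" by (rule nn_integral_cmult) measurable
  also have "\<dots> < \<infinity>" using fin by (simp add: ennreal_mult_less_top)
  finally obtain B where B: "?B = ennreal B" "0 <= B" by (cases ?B) auto
  have split: "(mollifier e (x - y) powr (1 / (p / (p - 1)))) * (mollifier e (x - y) powr (1 / p) * \<bar>f y\<bar>) = mollifier e (x - y) * \<bar>f y\<bar>" for y
  proof -
   have "1 / (p / (p - 1)) + 1 / p = 1" using p by (simp add: field_simps)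
   then have "mollifier e (x - y) powr (1 / (p / (p - 1))) * mollifier e (x - y) powr (1 / p) = mollifier e (x - y)"
    using m0[of "x - y"] by (simp only: powr_add[symmetric]) simp
   then show ?thesis by (simp only: mult.assoc[symmetric])
  qed
  have "(NN y. ennreal (mollifier e (x - y) powr (1 / (p / (p - 1))) * (mollifier e (x - y) powr (1 / p) * \<bar>f y\<bar>)))
    <= ennreal (1 powr (1 / (p / (p - 1))) * B powr (1 / p))"
  proof (rule Holder2)
   show "1 < p / (p - 1)" "1 < p" "1 / (p / (p - 1)) + 1 / p = 1" using p by (auto simp: field_simps)
   have "(mollifier e (x - y) powr (1 / (p / (p - 1)))) powr (p / (p - 1)) = mollifier e (x - y)" for y
    using p m0[of "x - y"] by (simp add: powr_powr)
   then show "(NN y. ennreal ((mollifier e (x - y) powr (1 / (p / (p - 1)))) powr (p / (p - 1)))) <= ennreal 1"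
    by (simp only: mollifier_integral[OF e]) simp
   have "(mollifier e (x - y) powr (1 / p) * \<bar>f y\<bar>) powr p = mollifier e (x - y) * \<bar>f y\<bar> powr p" for y
    using p m0[of "x - y"] by (simp add: powr_mult powr_powr)
   then show "(NN y. ennreal ((mollifier e (x - y) powr (1 / p) * \<bar>f y\<bar>) powr p)) <= ennreal B"
    by (simp only: B(1))
   show "(%y. mollifier e (x - y) powr (1 / (p / (p - 1)))) \<in> bm lborel"
    "(%y. mollifier e (x - y) powr (1 / p) * \<bar>f y\<bar>) \<in> bm lborel" by measurable
   show "0 <= mollifier e (x - y) powr (1 / p) * \<bar>f y\<bar>" for y by (intro mult_nonneg_nonneg) auto
  qed (use B in auto)
  then have h: "(NN y. ennreal (mollifier e (x - y) * \<bar>f y\<bar>)) <= ennreal (B powr (1 / p))"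
   by (simp only: split) simp
  have "ennreal \<bar>conv (mollifier e) f x\<bar> <= (NN y. ennreal (norm (f y * mollifier e (x - y))))"
   unfolding conv_def real_norm_def[symmetric] by (rule integral_norm_bound_ennreal) (rule integrable_conv[OF mollifier(1)[OF e] e f])
  also have "\<dots> = (NN y. ennreal (mollifier e (x - y) * \<bar>f y\<bar>))"
   using m0 by (simp add: abs_mult mult.commute)
  also note h
  finally have "\<bar>conv (mollifier e) f x\<bar> <= B powr (1 / p)" by (simp add: ennreal_le_iff)
  then have "\<bar>conv (mollifier e) f x\<bar> powr p <= (B powr (1 / p)) powr p" using p by (intro powr_mono2) auto
  also have "\<dots> = B" using p B by (simp add: powr_powr)
  finally show ?thesis unfolding B(1) by (rule ennreal_leI)
 qed
 have "(NN x. ennreal (\<bar>conv (mollifier e) f x\<bar> powr p)) <= (NN x. (NN y. ennreal (mollifier e (x - y) * \<bar>f y\<bar> powr p)))"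
  by (intro nn_integral_mono jensen)
 also have "\<dots> = (NN y. (NN x. ennreal (mollifier e (x - y) * \<bar>f y\<bar> powr p)))"
  by (rule lborel_pair.Fubini') simp
 also have "\<dots> = (NN y. ennreal (\<bar>f y\<bar> powr p))"
 proof (rule nn_integral_cong)
  fix y
  have "(NN x. ennreal (mollifier e (x - y) * \<bar>f y\<bar> powr p)) = (NN x. ennreal (mollifier e (y - x)) * ennreal (\<bar>f y\<bar> powr p))"
   using m0 by (intro nn_integral_cong) (simp add: ennreal_mult mollifier_commute[of e y])
  also have "\<dots> = ennreal (\<bar>f y\<bar> powr p)"
   by (subst nn_integral_multc) (simp_all add: mollifier_integral[OF e])
  finally show "(NN x. ennreal (mollifier e (x - y) * \<bar>f y\<bar> powr p)) = ennreal (\<bar>f y\<bar> powr p)" .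
 qed
 finally show ?thesis .
qed

lemma conv_diff:
 assumes "bump 0 e k" "0 < e" "integrable lborel f" "integrable lborel g"
 shows "conv k (%y. f y - g y) x = conv k f x - conv k g x"
 unfolding conv_def left_diff_distrib
 by (intro Bochner_Integration.integral_diff integrable_conv[OF assms(1,2)] assms)

lemma ennreal_tendsto_0I:
 fixes f :: "nat => ennreal"
 assumes "\<And>\<eta>. 0 < \<eta> ==> EV n. f n <= ennreal \<eta>"
 shows "f ---> 0"
proof (rule order_tendstoI)
 fix a :: ennreal assume "0 < a"
 then obtain z where z: "0 < z" "z < a" using dense by blast
 then obtain \<eta> where \<eta>: "z = ennreal \<eta>" "0 < \<eta>" by (cases z) auto
 from assms[OF \<eta>(2)] show "EV n. f n < a" by eventually_elim (use z \<eta> in auto)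
qed auto

lemma ennreal_tendsto_0D:
 fixes f :: "nat => ennreal"
 assumes "f ---> 0" "0 < \<eta>"
 shows "EV n. f n <= ennreal \<eta>"
proof -
 have "EV n. f n < ennreal \<eta>" using assms by (intro order_tendstoD) auto
 then show ?thesis by eventually_elim simp
qed

lemma integrable_compact_support:
 fixes g :: "real^'d => real"
 assumes gc: "cont g" and gR: "\<And>y. R <= norm y ==> g y = 0"
 shows "integrable lborel g"
proof -
 obtain B where B: "0 <= B" "\<And>y. norm (g y) <= B" using compact_support_bounded[OF gc gR] by blast
 have "integrable lborel (%y. indicator (cball (0 :: real^'d) R) y * B)"
  using emeasure_lborel_cball_finite[of "0 :: real^'d" R] by (intro integrable_mult_left integrable_real_indicator) auto
 then show ?thesis
 proof (rule Bochner_Integration.integrable_bound)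
  show "g \<in> bm lborel" using bm_contI[OF gc] by simp
  show "AE y in lborel. norm (g y) <= norm (indicator (cball 0 R) y * B)"
  proof (rule AE_I2)
   fix y
   show "norm (g y) <= norm (indicator (cball 0 R) y * B)"
    using B gR[of y] by (cases "norm y <= R") auto
  qed
 qed
qed

text \<open>f is replaced by a continuous g of compact support, for which mollification converges
  uniformly. The error h = f - g is controlled after mollification by \<open>conv_Lp_le\<close>,
  uniformly in n.\<close>

theorem mollify_Lp:
 fixes f :: "real^'d => real"
 assumes p: "1 < p" and f: "integrable lborel f" and fin: "(NN y. ennreal (\<bar>f y\<bar> powr p)) < \<infinity>"
 shows "(%n. (NN x. ennreal (\<bar>conv (mollifier (1 / real (Suc n))) f x - f x\<bar> powr p))) ---> 0"
proof (rule ennreal_tendsto_0I)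
 fix \<eta> :: real assume \<eta>: "0 < \<eta>"
 define C where "C = 2 powr p"
 \<comment> \<open>Solves C * (\<kappa> + C * (\<kappa> + \<kappa>)) = \<eta>, the cost of splitting
   into three terms with two applications of \<open>powr_sum_le_ennreal\<close>.\<close>
 define \<kappa> where "\<kappa> = \<eta> / (C * (1 + 2 * C))"
 have C: "0 < C" by (simp add: C_def)
 have \<kappa>: "0 < \<kappa>" using \<eta> C by (auto simp: \<kappa>_def intro!: divide_pos_pos mult_pos_pos add_pos_pos)
 have fm[measurable]: "f \<in> bm borel" using borel_measurable_integrable[OF f] by simp
 have fin': "(NN y. ennreal (norm (f y) powr p)) < \<infinity>" using fin by simp
 have p0: "0 < p" using p by simp
 obtain g R where gc: "cont g" and gR: "\<And>y. R <= norm y ==> g y = 0"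
  and gf: "(NN y. ennreal (norm (g y - f y) powr p)) <= ennreal \<kappa>"
  using Lp_approx[OF fm p0 fin' \<kappa>] by blast
 have [measurable]: "g \<in> bm borel" by (rule bm_contI[OF gc])
 have gi: "integrable lborel g" by (rule integrable_compact_support[OF gc gR])
 define V where "V = measure lborel (cball (0 :: real^'d) (R + 1))"
 \<comment> \<open>A uniform error \<omega> on a set of volume V contributes at most \<omega>^p * V
   <= \<kappa>.\<close>
 define \<omega> where "\<omega> = (\<kappa> / (V + 1)) powr (1 / p)"
 have V: "0 <= V" by (simp add: V_def)
 have \<omega>: "0 < \<omega>" using \<kappa> V by (simp add: \<omega>_def)
 obtain \<delta> where \<delta>: "0 < \<delta>" "\<And>y z. norm (z - y) < \<delta> ==> norm (g z - g y) < \<omega>"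
  using compact_support_uniform[OF gc gR \<omega>] by blast
 have "EV n. 1 / real (Suc n) < \<delta>"
  using order_tendstoD(2)[OF LIMSEQ_Suc[OF lim_1_over_n] \<delta>(1)] by simp
 then show "EV n. (NN x. ennreal (\<bar>conv (mollifier (1 / real (Suc n))) f x - f x\<bar> powr p)) <= ennreal \<eta>"
 proof eventually_elim
  case (elim n)
  define e where "e = 1 / real (Suc n)"
  have e: "0 < e" "e < \<delta>" "e <= 1" using elim by (auto simp: e_def)
  note me = mollifier(1)[OF e(1)]
  have [measurable]: "conv (mollifier e) h \<in> bm borel" if "integrable lborel h" for h :: "real^'d => real"
   by (rule bm_contI[OF conv_continuous[OF me e(1) that]])
  note [measurable] = this[OF f] this[OF gi]
  define h where "h = (%y. f y - g y)"
  have hi: "integrable lborel h" using f gi by (simp add: h_def)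
  have [measurable]: "h \<in> bm borel" by (simp add: h_def)
  note [measurable] = bm_contI[OF conv_continuous[OF me e(1) hi]]
  have h\<kappa>: "(NN y. ennreal (\<bar>h y\<bar> powr p)) <= ennreal \<kappa>"
   using gf by (simp add: h_def abs_minus_commute)
  have 1: "(NN y. ennreal (\<bar>conv (mollifier e) h y\<bar> powr p)) <= ennreal \<kappa>"
   by (rule order_trans[OF conv_Lp_le[OF e(1) p hi order_le_less_trans[OF h\<kappa>]] h\<kappa>]) simp
  have 2: "(NN y. ennreal (\<bar>conv (mollifier e) g y - g y\<bar> powr p)) <= ennreal \<kappa>"
  proof -
   have "(NN y. ennreal (\<bar>conv (mollifier e) g y - g y\<bar> powr p)) <= (NN y. ennreal (\<omega> powr p) * indicator (cball (0 :: real^'d) (R + 1)) y)"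
   proof (rule nn_integral_mono)
    fix y :: "real^'d"
    show "ennreal (\<bar>conv (mollifier e) g y - g y\<bar> powr p) <= ennreal (\<omega> powr p) * indicator (cball (0 :: real^'d) (R + 1)) y"
    proof (cases "norm y <= R + 1")
     case True
     have "\<bar>conv (mollifier e) g y - g y\<bar> <= \<omega>"
     proof (rule conv_close[OF e(1) gi])
      fix z assume "norm (z - y) < e"
      then show "\<bar>g z - g y\<bar> <= \<omega>" using \<delta>(2)[of z y] e by simp
     qed
     then have "\<bar>conv (mollifier e) g y - g y\<bar> powr p <= \<omega> powr p" using p by (intro powr_mono2) auto
     then show ?thesis using True by (simp add: ennreal_leI)
    next
     case False
     have "\<bar>conv (mollifier e) g y - g y\<bar> <= 0"
     proof (rule conv_close[OF e(1) gi])
      fix z assume "norm (z - y) < e"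
      then have "R <= norm z" using False e norm_triangle_ineq2[of y z] by (simp add: norm_minus_commute)
      then show "\<bar>g z - g y\<bar> <= 0" using gR[of z] gR[of y] False by simp
     qed
     then show ?thesis using p by simp
    qed
   qed
   also have "\<dots> = ennreal (\<omega> powr p) * emeasure lborel (cball (0 :: real^'d) (R + 1))" by (rule nn_integral_cmult_indicator) simp
   also have "emeasure lborel (cball (0 :: real^'d) (R + 1)) = ennreal V"
    unfolding V_def using emeasure_lborel_cball_finite[of "0 :: real^'d" "R + 1"] by (intro emeasure_eq_ennreal_measure) simp
   also have "ennreal (\<omega> powr p) * ennreal V = ennreal (\<omega> powr p * V)" by (rule ennreal_mult'[symmetric]) simp
   also have "\<dots> <= ennreal \<kappa>"
   proof (rule ennreal_leI)
    have "\<omega> powr p = \<kappa> / (V + 1)" using p \<kappa> V by (simp add: \<omega>_def powr_powr)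
    then have "\<omega> powr p * (V + 1) = \<kappa>" using V by simp
    moreover have "\<omega> powr p * V <= \<omega> powr p * (V + 1)" by (intro mult_left_mono) auto
    ultimately show "\<omega> powr p * V <= \<kappa>" by simp
   qed
   finally show ?thesis .
  qed
  have "(NN x. ennreal (\<bar>conv (mollifier e) f x - f x\<bar> powr p))
   <= (NN x. ennreal C * (ennreal (\<bar>conv (mollifier e) h x\<bar> powr p) + ennreal C * (ennreal (\<bar>conv (mollifier e) g x - g x\<bar> powr p) + ennreal (\<bar>h x\<bar> powr p))))"
  proof (rule nn_integral_mono)
   fix x
   have cd: "conv (mollifier e) h x = conv (mollifier e) f x - conv (mollifier e) g x"
    unfolding h_def by (rule conv_diff[OF me e(1) f gi])
   have "ennreal (\<bar>conv (mollifier e) f x - f x\<bar> powr p) <= ennreal C * (ennreal (\<bar>conv (mollifier e) h x\<bar> powr p) + ennreal ((\<bar>conv (mollifier e) g x - g x\<bar> + \<bar>h x\<bar>) powr p))"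
    unfolding C_def by (rule powr_sum_le_ennreal) (use p cd in \<open>auto simp: h_def\<close>)
   also have "\<dots> <= ennreal C * (ennreal (\<bar>conv (mollifier e) h x\<bar> powr p) + ennreal C * (ennreal (\<bar>conv (mollifier e) g x - g x\<bar> powr p) + ennreal (\<bar>h x\<bar> powr p)))"
    unfolding C_def by (intro mult_left_mono add_left_mono powr_sum_le_ennreal) (use p in auto)
   finally show "ennreal (\<bar>conv (mollifier e) f x - f x\<bar> powr p) <= ennreal C * (ennreal (\<bar>conv (mollifier e) h x\<bar> powr p) + ennreal C * (ennreal (\<bar>conv (mollifier e) g x - g x\<bar> powr p) + ennreal (\<bar>h x\<bar> powr p)))" .
  qed
  also have "\<dots> = ennreal C * ((NN x. ennreal (\<bar>conv (mollifier e) h x\<bar> powr p))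
    + ennreal C * ((NN x. ennreal (\<bar>conv (mollifier e) g x - g x\<bar> powr p)) + (NN x. ennreal (\<bar>h x\<bar> powr p))))"
   by (simp add: nn_integral_cmult nn_integral_add)
  also have "\<dots> <= ennreal C * (ennreal \<kappa> + ennreal C * (ennreal \<kappa> + ennreal \<kappa>))"
   by (intro mult_left_mono add_mono 1 2 h\<kappa>) auto
  also have "\<dots> = ennreal (C * (\<kappa> + C * (\<kappa> + \<kappa>)))"
   using C \<kappa> by (simp add: ennreal_mult'[symmetric] ennreal_plus[symmetric] del: ennreal_plus)
  also have "C * (\<kappa> + C * (\<kappa> + \<kappa>)) = \<kappa> * (C * (1 + 2 * C))" by (simp add: algebra_simps)
  also have "\<dots> = \<eta>"
  proof -
   have nz: "C * (1 + 2 * C) \<noteq> 0" using C by (metis add_pos_pos less_irrefl mult_pos_pos zero_less_numeral zero_less_one)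
   then show ?thesis unfolding \<kappa>_def by (simp only: times_divide_eq_left nonzero_mult_div_cancel_right[OF nz])
  qed
  finally show ?case unfolding e_def .
 qed
qed

section \<open>The maximum principle\<close>

lemma pos_power_deriv:
 "((%t. max 0 t ^ (n + 2)) has_real_derivative (real (n + 2) * max 0 t ^ (n + 1))) (at t)"
proof -
 consider "t < 0" | "t = 0" | "0 < t" by linarith
 then show ?thesis
 proof cases
  case 1
  have "\<forall>\<^sub>F s in nhds t. 0 = max 0 s ^ (n + 2)"
   using eventually_nhds_in_open[of "{..<0}" t] 1 by (auto elim!: eventually_mono)
  moreover have "((%t. 0 :: real) has_real_derivative 0) (at t)" by simp
  ultimately have "((%t. max 0 t ^ (n + 2)) has_real_derivative 0) (at t)" by (rule DERIV_transfer_ev)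
  then show ?thesis using 1 by simp
 next
  case 2
  have "((%h :: real. max 0 h ^ (n + 1)) \<longlongrightarrow> max 0 0 ^ (n + 1)) (at 0)"
   by (intro tendsto_intros tendsto_max tendsto_ident_at)
  then have "((%h :: real. max 0 h ^ (n + 1)) \<longlongrightarrow> 0) (at 0)" by simp
  moreover have "max 0 h ^ (n + 1) = (max 0 h ^ (n + 2) - max 0 0 ^ (n + 2)) / (h - 0)" for h :: real
   by (cases "h = 0") (auto simp: max_def)
  ultimately have "((%h :: real. (max 0 h ^ (n + 2) - max 0 0 ^ (n + 2)) / (h - 0)) \<longlongrightarrow> 0) (at 0)" by (simp only:)
  then show ?thesis using 2 by (simp add: has_field_derivative_iff)
 next
  case 3
  have "\<forall>\<^sub>F s in nhds t. s ^ (n + 2) = max 0 s ^ (n + 2)"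
   using eventually_nhds_in_open[of "{0<..}" t] 3 by (auto elim!: eventually_mono)
  moreover have "((%t. t ^ (n + 2)) has_real_derivative (real (n + 2) * t ^ (n + 1))) (at t)"
   using DERIV_pow[of "n + 2" t] by simp
  ultimately have "((%t. max 0 t ^ (n + 2)) has_real_derivative (real (n + 2) * t ^ (n + 1))) (at t)" by (rule DERIV_transfer_ev)
  then show ?thesis using 3 by simp
 qed
qed

lemma has_derivative_transfer_open:
 assumes "open U" "x \<in> U" "\<And>y. y \<in> U ==> f y = g y" "(f has_derivative f') (at x)"
 shows "(g has_derivative f') (at x)"
 using has_derivative_transform_within_open[OF assms(4,1,2)] assms(3) by blast

definition outer2 :: "real^'d => real^'d^'d" where
 "outer2 x = (\<chi> i j. x $ i * x $ j)"

lemma outer2_mult: "outer2 x *v h = (x \<bullet> h) *\<^sub>R x"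
 by (simp add: outer2_def vec_eq_iff matrix_vector_mult_def inner_vec_def sum_distrib_left mult_ac)

text \<open>The cube, unlike lower powers of the positive part, has continuous second derivatives.\<close>

lemma cube_test_fun:
 fixes v :: "real^'d => real"
 assumes v: "\<And>x. (v has_derivative (%h. Gv x \<bullet> h)) (at x)" "\<And>x. (Gv has_derivative (%h. Hv x *v h)) (at x)" "cont Hv"
  and A: "compact A" "open U" "A \<subseteq> U" "\<And>x. x \<in> U - A ==> v x <= 0"
 defines "\<phi> \<equiv> %x. if x \<in> A then max 0 (v x) ^ 3 else 0"
  and "g \<equiv> %x. if x \<in> A then (3 * max 0 (v x) ^ 2) *\<^sub>R Gv x else 0"
  and "H \<equiv> %x. if x \<in> A then (3 * max 0 (v x) ^ 2) *\<^sub>R Hv x + (6 * max 0 (v x)) *\<^sub>R outer2 (Gv x) else 0"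
 shows "test_fun \<phi> g H"
proof -
 \<comment> \<open>The open sets U and - A cover the space. On U the formula holds without the case
   distinction, since v <= 0 on U - A; on - A everything is 0. Derivatives can therefore be computed
   locally.\<close>
 have cover: "x \<in> U \<or> x \<in> - A" for x using A(3) by blast
 have oA: "open (- A)" using compact_imp_closed[OF A(1)] by (simp add: open_Compl)
 have U: "\<phi> x = max 0 (v x) ^ 3" "g x = (3 * max 0 (v x) ^ 2) *\<^sub>R Gv x"
  "H x = (3 * max 0 (v x) ^ 2) *\<^sub>R Hv x + (6 * max 0 (v x)) *\<^sub>R outer2 (Gv x)" if "x \<in> U" for x
  using A(4)[of x] that by (auto simp: \<phi>_def g_def H_def max_absorb1)
 have nA: "\<phi> x = 0" "g x = 0" "H x = 0" if "x \<in> - A" for x using that by (auto simp: \<phi>_def g_def H_def)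
 have vc: "cont v" "cont Gv"
  using v(1,2) by (auto simp: continuous_on_eq_continuous_at intro: has_derivative_continuous)
 show ?thesis unfolding test_fun_def
 proof (intro conjI allI)
  show "0 <= \<phi> x" for x by (simp add: \<phi>_def)
  fix x
  show "(\<phi> has_derivative (%h. g x \<bullet> h)) (at x)"
   using cover[of x]
  proof
   assume x: "x \<in> U"
   have "((%x. max 0 (v x) ^ (1 + 2)) has_derivative (%h. (real (1 + 2) * max 0 (v x) ^ (1 + 1)) * (Gv x \<bullet> h))) (at x)"
    by (rule has_derivative_compose[OF v(1) pos_power_deriv[of 1, unfolded has_field_derivative_def]])
   then have "((%x. max 0 (v x) ^ 3) has_derivative (%h. g x \<bullet> h)) (at x)"
    using U(2)[OF x] by (simp add: numeral_eq_Suc)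
   then show ?thesis by (rule has_derivative_transfer_open[OF A(2) x, rotated]) (simp add: U)
  next
   assume x: "x \<in> - A"
   have "((%x. 0 :: real) has_derivative (%h. g x \<bullet> h)) (at x)" using nA(2)[OF x] by simp
   then show ?thesis by (rule has_derivative_transfer_open[OF oA x, rotated]) (simp add: nA)
  qed
  show "(g has_derivative (%h. H x *v h)) (at x)"
   using cover[of x]
  proof
   assume x: "x \<in> U"
   have "((%x. max 0 (v x) ^ (0 + 2)) has_derivative (%h. (real (0 + 2) * max 0 (v x) ^ (0 + 1)) * (Gv x \<bullet> h))) (at x)"
    by (rule has_derivative_compose[OF v(1) pos_power_deriv[of 0, unfolded has_field_derivative_def]])
   then have "((%x. 3 * max 0 (v x) ^ 2) has_derivative (%h. 3 * ((2 * max 0 (v x)) * (Gv x \<bullet> h)))) (at x)"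
    by (intro has_derivative_mult_right) (simp add: numeral_eq_Suc)
   from has_derivative_scaleR[OF this v(2)]
   have "((%x. (3 * max 0 (v x) ^ 2) *\<^sub>R Gv x) has_derivative (%h. (3 * max 0 (v x) ^ 2) *\<^sub>R (Hv x *v h) + (3 * ((2 * max 0 (v x)) * (Gv x \<bullet> h))) *\<^sub>R Gv x)) (at x)" .
   moreover have "(3 * max 0 (v x) ^ 2) *\<^sub>R (Hv x *v h) + (3 * ((2 * max 0 (v x)) * (Gv x \<bullet> h))) *\<^sub>R Gv x = H x *v h" for h
    unfolding U(3)[OF x] matrix_vector_mult_add_rdistrib scaleR_matrix_vector_assoc[symmetric] outer2_mult by simp
   ultimately have "((%x. (3 * max 0 (v x) ^ 2) *\<^sub>R Gv x) has_derivative (%h. H x *v h)) (at x)" by (simp only:)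
   then show ?thesis by (rule has_derivative_transfer_open[OF A(2) x, rotated]) (simp add: U)
  next
   assume x: "x \<in> - A"
   have "((%x. 0 :: real^'d) has_derivative (%h. H x *v h)) (at x)" using nA(3)[OF x] by simp
   then show ?thesis by (rule has_derivative_transfer_open[OF oA x, rotated]) (simp add: nA)
  qed
 next
  have "continuous_on U (%x. (3 * max 0 (v x) ^ 2) *\<^sub>R Hv x + (6 * max 0 (v x)) *\<^sub>R outer2 (Gv x))"
  proof (rule continuous_on_subset[of UNIV])
   have "cont (%x. outer2 (Gv x))" unfolding outer2_def
    by (intro continuous_intros vc)
   then show "cont (%x. (3 * max 0 (v x) ^ 2) *\<^sub>R Hv x + (6 * max 0 (v x)) *\<^sub>R outer2 (Gv x))"
    by (intro continuous_on_add continuous_on_scaleR continuous_on_mult continuous_on_power continuous_on_max continuous_on_const vc v(3))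
  qed simp
  then have "continuous_on U H" by (rule continuous_on_eq) (simp add: U)
  moreover have "continuous_on (- A) H"
   by (rule continuous_on_eq[OF continuous_on_const[of _ 0]]) (simp add: nA)
  ultimately have "continuous_on (U \<union> - A) H" using A(2) oA by (intro continuous_on_open_Un)
  moreover have "U \<union> - A = UNIV" using A(3) by blast
  ultimately show "cont H" by simp
 qed
qed

text \<open>The constant depends on the diameter bound and not on A, U or the smoothness of v and
  the coefficients, so it survives the limits taken later.\<close>

theorem max_estimate:
 assumes d: "2 <= CARD('d::finite)" and \<delta>: "0 < \<delta>" "\<delta> < 1" and K: "0 <= K" and d0: "is_d0 TYPE('d) \<delta> K p" and \<rho>: "0 < \<rho>"
 shows "\<exists>C\<ge>0. \<forall>v Gv Hv a b A U (x :: real^'d). (\<forall>x. (v has_derivative (%h. Gv x \<bullet> h)) (at x)) \<and>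
  (\<forall>x. (Gv has_derivative (%h. Hv x *v h)) (at x)) \<and> cont Hv \<and>
  compact A \<and> open U \<and> A \<subseteq> U \<and> (\<forall>x\<in>U - A. v x <= 0) \<and> (\<forall>x\<in>A. \<forall>y\<in>A. norm (x - y) <= \<rho>) \<and>
  cont a \<and> (\<forall>y. a y \<in> S_mat \<delta>) \<and> smooth_drift K b \<and> x \<in> A \<longrightarrow>
  ennreal (max 0 (v x) powr p) <= ennreal C * (nnS A (%y. ennreal (max 0 (- gen_op a b Gv Hv y) powr p)))"
proof -
 let ?n = "CARD('d)"
 obtain N where N: "0 <= N" and key: "\<And>\<phi> g H (a :: real^'d => real^'d^'d) b x0 \<mu>. 0 < \<mu> ==> test_fun \<phi> g H ==>
   (\<forall>y. 1 / (2 * \<mu>) <= norm (y - x0) \<longrightarrow> \<phi> y = 0 \<and> g y = 0 \<and> H y = 0) ==>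
   cont a ==> (\<forall>y. a y \<in> S_mat \<delta>) ==> smooth_drift K b ==>
  ennreal (\<phi> x0 powr p) <= ennreal (N * \<mu> ^ ?n) * (NN y. ennreal (max 0 (\<phi> y - gen_op a b g H y / \<mu>\<^sup>2) powr p))"
  using key_estimate_scaled[OF d \<delta> K d0] by blast
 have p: "1 < p" using d d0 by (auto simp: is_d0_def)
 define \<omega> where "\<omega> = measure lborel (cball (0 :: real^'d) 1)"
 have \<omega>: "0 <= \<omega>" by (simp add: \<omega>_def)
 \<comment> \<open>With \<mu> = \<theta> / \<rho>, the bound 1/4 places A inside the ball of radius
   1 / (2 * \<mu>) about each of its points; the other bound makes the zeroth order term at most
   half of the left side (\<open>\<theta>s\<close>).\<close>
 define \<theta> where "\<theta> = min (1 / 4) (1 / (2 * (N * 2 powr p * \<omega> + 1)))"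
 have N\<omega>: "0 <= N * 2 powr p * \<omega>" using N \<omega> by simp
 have \<theta>: "0 < \<theta>" "\<theta> <= 1 / 4" "\<theta> <= 1 / (2 * (N * 2 powr p * \<omega> + 1))" using N\<omega> by (auto simp: \<theta>_def)
 have \<theta>s: "N * \<theta> ^ ?n * 2 powr p * \<omega> <= 1 / 2"
 proof -
  have "\<theta> ^ ?n <= \<theta> ^ 1" using \<theta> d by (intro power_decreasing) auto
  then have "(N * 2 powr p * \<omega>) * \<theta> ^ ?n <= (N * 2 powr p * \<omega>) * (1 / (2 * (N * 2 powr p * \<omega> + 1)))"
   using \<theta> N\<omega> by (intro mult_left_mono) auto
  also have "\<dots> <= 1 / 2" using N\<omega> by (simp add: field_simps)
  finally show ?thesis by (simp only: mult_ac)
 qed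
 define \<mu> where "\<mu> = \<theta> / \<rho>"
 have \<mu>: "0 < \<mu>" using \<theta> \<rho> by (simp add: \<mu>_def)
 define C where "C = 2 * (N * \<mu> ^ ?n) * 2 powr p * (3 / \<mu>\<^sup>2) powr p"
 have C: "0 <= C" using N \<mu> by (simp add: C_def)
 show ?thesis
 proof (intro exI[of _ C] conjI C allI impI)
  fix v :: "real^'d => real" and Gv b :: "real^'d => real^'d" and Hv a :: "real^'d => real^'d^'d" and A U :: "(real^'d) set" and x :: "real^'d"
  assume asm: "(\<forall>x. (v has_derivative (%h. Gv x \<bullet> h)) (at x)) \<and>
  (\<forall>x. (Gv has_derivative (%h. Hv x *v h)) (at x)) \<and> cont Hv \<and>
  compact A \<and> open U \<and> A \<subseteq> U \<and> (\<forall>x\<in>U - A. v x <= 0) \<and> (\<forall>x\<in>A. \<forall>y\<in>A. norm (x - y) <= \<rho>) \<and>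
  cont a \<and> (\<forall>y. a y \<in> S_mat \<delta>) \<and> smooth_drift K b \<and> x \<in> A"
  have v: "\<And>x. (v has_derivative (%h. Gv x \<bullet> h)) (at x)" "\<And>x. (Gv has_derivative (%h. Hv x *v h)) (at x)" "cont Hv"
   and A: "compact A" "open U" "A \<subseteq> U" "\<And>x. x \<in> U - A ==> v x <= 0" and diam: "\<And>x y. x \<in> A ==> y \<in> A ==> norm (x - y) <= \<rho>"
   and a: "cont a" "\<forall>y. a y \<in> S_mat \<delta>" and b: "smooth_drift K b" and x: "x \<in> A"
   using asm by blast+
  have vc: "cont v" "cont Gv"
   using v(1,2) by (auto simp: continuous_on_eq_continuous_at intro: has_derivative_continuous)
  \<comment> \<open>The estimate is applied at the maximum over A, because only there is the zeroth
    order term bounded by the left side itself.\<close>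
  obtain z where z: "z \<in> A" "\<And>y. y \<in> A ==> v y <= v z"
   using continuous_attains_sup[OF A(1) _ continuous_on_subset[OF vc(1)]] x by blast
  define M where "M = max 0 (v z)"
  define \<phi> where "\<phi> = (%x. if x \<in> A then max 0 (v x) ^ 3 else 0)"
  define g where "g = (%x. if x \<in> A then (3 * max 0 (v x) ^ 2) *\<^sub>R Gv x else 0)"
  define H where "H = (%x. if x \<in> A then (3 * max 0 (v x) ^ 2) *\<^sub>R Hv x + (6 * max 0 (v x)) *\<^sub>R outer2 (Gv x) else 0)"
  define l where "l = (%y. max 0 (- gen_op a b Gv Hv y))"
  have M0: "0 <= M" by (simp add: M_def)
  have l0: "0 <= l y" for y by (simp add: l_def)
  have bc: "cont b" using b by (simp add: smooth_drift_def)
  have [measurable]: "l \<in> bm borel" unfolding l_def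
   by (intro bm_contI continuous_on_max continuous_on_const continuous_on_minus gen_op_continuous a bc vc v(3))
  have Aset [measurable]: "A \<in> sets borel" using A(1) by (simp add: compact_imp_closed)
  have T: "test_fun \<phi> g H" unfolding \<phi>_def g_def H_def by (rule cube_test_fun[OF v A])
  have supp: "\<forall>y. 1 / (2 * \<mu>) <= norm (y - z) \<longrightarrow> \<phi> y = 0 \<and> g y = 0 \<and> H y = 0"
  proof (intro allI impI)
   fix y assume y: "1 / (2 * \<mu>) <= norm (y - z)"
   have "\<rho> < 1 / (2 * \<mu>)" using \<theta> \<rho> by (simp add: \<mu>_def field_simps)
   then have "y \<notin> A" using diam[of y z] z y by force
   then show "\<phi> y = 0 \<and> g y = 0 \<and> H y = 0" by (simp add: \<phi>_def g_def H_def)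
  qed
  \<comment> \<open>The operator applied to w^3 gives 3 w^2 times the operator on v plus 3 w times
    the form of a at the gradient. The last term is nonnegative and is dropped.\<close>
  have bound: "max 0 (\<phi> y - gen_op a b g H y / \<mu>\<^sup>2) <= (if y \<in> A then M ^ 3 + 3 * M\<^sup>2 / \<mu>\<^sup>2 * l y else 0)" for y
  proof (cases "y \<in> A")
   case False
   then show ?thesis by (simp add: \<phi>_def g_def H_def gen_op_def)
  next
   case True
   define w where "w = max 0 (v y)"
   have w: "0 <= w" "w <= M" using z(2)[OF True] by (auto simp: w_def M_def)
   have "gen_op a b g H y = 3 * w\<^sup>2 * gen_op a b Gv Hv y + 3 * w * (Gv y \<bullet> (a y *v Gv y))"
   proof -
    have "(\<Sum>i\<in>UNIV. \<Sum>j\<in>UNIV. a y $ i $ j * H y $ i $ j) = (\<Sum>i\<in>UNIV. \<Sum>j\<in>UNIV. (3 * w\<^sup>2) * (a y $ i $ j * Hv y $ i $ j) + (6 * w) * (a y $ i $ j * Gv y $ i * Gv y $ j))"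
     using True by (intro sum.cong refl) (simp add: H_def outer2_def w_def algebra_simps)
    also have "\<dots> = (3 * w\<^sup>2) * (\<Sum>i\<in>UNIV. \<Sum>j\<in>UNIV. a y $ i $ j * Hv y $ i $ j) + (6 * w) * (Gv y \<bullet> (a y *v Gv y))"
     unfolding quadratic_form_eq by (simp only: sum.distrib sum_distrib_left)
    finally have s: "(\<Sum>i\<in>UNIV. \<Sum>j\<in>UNIV. a y $ i $ j * H y $ i $ j) = (3 * w\<^sup>2) * (\<Sum>i\<in>UNIV. \<Sum>j\<in>UNIV. a y $ i $ j * Hv y $ i $ j) + (6 * w) * (Gv y \<bullet> (a y *v Gv y))" .
    have g: "g y \<bullet> b y = 3 * w\<^sup>2 * (Gv y \<bullet> b y)" using True by (simp add: g_def w_def)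
    show ?thesis unfolding gen_op_def s g by (simp add: algebra_simps)
   qed
   moreover have "0 <= 3 * w * (Gv y \<bullet> (a y *v Gv y))"
   proof -
    have "0 <= \<delta> * (Gv y \<bullet> Gv y)" using \<delta> by simp
    also have "\<dots> <= Gv y \<bullet> (a y *v Gv y)" using a(2) unfolding S_mat_iff by blast
    finally show ?thesis using w by simp
   qed
   moreover have "- gen_op a b Gv Hv y <= l y" by (simp add: l_def)
   then have "3 * w\<^sup>2 * (- gen_op a b Gv Hv y) <= 3 * w\<^sup>2 * l y" by (intro mult_left_mono) auto
   moreover have "3 * w\<^sup>2 * l y <= 3 * M\<^sup>2 * l y" using w l0[of y] by (intro mult_right_mono mult_left_mono power_mono) auto
   ultimately have "- gen_op a b g H y <= 3 * M\<^sup>2 * l y" by linarith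
   then have "(- gen_op a b g H y) / \<mu>\<^sup>2 <= 3 * M\<^sup>2 * l y / \<mu>\<^sup>2" by (rule divide_right_mono) simp
   moreover have "\<phi> y <= M ^ 3" using True w by (simp add: \<phi>_def w_def[symmetric] power_mono)
   moreover have "0 <= M ^ 3 + 3 * M\<^sup>2 / \<mu>\<^sup>2 * l y" using M0 l0[of y] by simp
   ultimately show ?thesis using True by simp
  qed
  define I where "I = (nnS A (%y. ennreal (l y powr p)))"
  have vol: "emeasure lborel A <= ennreal (\<omega> * \<rho> ^ ?n)"
  proof -
   have "A \<subseteq> cball z \<rho>" using diam z(1) by (auto simp: dist_norm)
   then have "emeasure lborel A <= emeasure lborel (cball z \<rho>)" by (intro emeasure_mono) auto
   also have "\<dots> = ennreal (measure lborel (cball z \<rho>))"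
    using emeasure_lborel_cball_finite[of z \<rho>] by (intro emeasure_eq_ennreal_measure) simp
   also have "measure lborel (cball z \<rho>) = \<omega> * \<rho> ^ ?n"
    using \<rho> by (simp add: \<omega>_def content_cball)
   finally show ?thesis .
  qed
  have "ennreal (\<phi> z powr p) <= ennreal (N * \<mu> ^ ?n) * (NN y. ennreal (max 0 (\<phi> y - gen_op a b g H y / \<mu>\<^sup>2) powr p))"
   by (rule key[OF \<mu> T supp a b])
  also have "(NN y. ennreal (max 0 (\<phi> y - gen_op a b g H y / \<mu>\<^sup>2) powr p))
   <= (NN y. ennreal (2 powr p) * (ennreal ((M ^ 3) powr p) * indicator A y + ennreal ((3 * M\<^sup>2 / \<mu>\<^sup>2) powr p) * (ennreal (l y powr p) * indicator A y)))"
  proof (rule nn_integral_mono)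
   fix y
   show "ennreal (max 0 (\<phi> y - gen_op a b g H y / \<mu>\<^sup>2) powr p) <= ennreal (2 powr p) * (ennreal ((M ^ 3) powr p) * indicator A y + ennreal ((3 * M\<^sup>2 / \<mu>\<^sup>2) powr p) * (ennreal (l y powr p) * indicator A y))"
   proof (cases "y \<in> A")
    case False
    then have "max 0 (\<phi> y - gen_op a b g H y / \<mu>\<^sup>2) = 0" using bound[of y] by simp
    then show ?thesis using p by simp
   next
    case True
    have "ennreal (max 0 (\<phi> y - gen_op a b g H y / \<mu>\<^sup>2) powr p) <= ennreal (2 powr p) * (ennreal ((M ^ 3) powr p) + ennreal ((3 * M\<^sup>2 / \<mu>\<^sup>2 * l y) powr p))"
     by (rule powr_sum_le_ennreal) (use bound[of y] True M0 l0[of y] p in auto)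
    also have "(3 * M\<^sup>2 / \<mu>\<^sup>2 * l y) powr p = (3 * M\<^sup>2 / \<mu>\<^sup>2) powr p * l y powr p" by (rule powr_mult)
    also have "ennreal ((3 * M\<^sup>2 / \<mu>\<^sup>2) powr p * l y powr p) = ennreal ((3 * M\<^sup>2 / \<mu>\<^sup>2) powr p) * ennreal (l y powr p)" by (rule ennreal_mult') simp
    finally show ?thesis using True by simp
   qed
  qed
  also have "\<dots> = ennreal (2 powr p) * (ennreal ((M ^ 3) powr p) * emeasure lborel A + ennreal ((3 * M\<^sup>2 / \<mu>\<^sup>2) powr p) * I)"
   unfolding I_def by (simp add: nn_integral_cmult nn_integral_add nn_integral_cmult_indicator)
  also have "\<dots> <= ennreal (2 powr p) * (ennreal ((M ^ 3) powr p) * ennreal (\<omega> * \<rho> ^ ?n) + ennreal ((3 * M\<^sup>2 / \<mu>\<^sup>2) powr p) * I)"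
   by (intro mult_left_mono add_right_mono vol) auto
  finally have est: "ennreal (\<phi> z powr p) <= ennreal (N * \<mu> ^ ?n) * (ennreal (2 powr p) * (ennreal ((M ^ 3) powr p) * ennreal (\<omega> * \<rho> ^ ?n) + ennreal ((3 * M\<^sup>2 / \<mu>\<^sup>2) powr p) * I))"
   by (simp add: mult_left_mono)
  have "ennreal (M powr p) <= ennreal C * I"
  \<comment> \<open>In \<open>ennreal\<close> the product of 0 and \<infinity> is 0, so an infinite
    I makes the bound trivial only if 0 < C. C = 0 forces N = 0, which contradicts M > 0.\<close>
  proof (cases "M = 0 \<or> I = \<infinity> \<and> 0 < C")
   case True
   then show ?thesis using p by (auto simp: ennreal_mult_top)
  next
   case False
   then have Mp: "0 < M" using M0 by auto
   show ?thesis
   proof (cases "I = \<infinity>")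
    case True
    then have "C = 0" using False C by auto
    then have "N = 0" using \<mu> by (simp add: C_def)
    then have "ennreal (\<phi> z powr p) = 0" using est by simp
    moreover have "\<phi> z = M ^ 3" using z by (simp add: \<phi>_def M_def)
    ultimately show ?thesis using Mp by (simp add: ennreal_eq_0_iff)
   next
    case False
    then obtain J where J: "I = ennreal J" "0 <= J" by (cases I) auto
    define X where "X = (M ^ 3) powr p"
    define Y where "Y = (3 / \<mu>\<^sup>2) powr p"
    \<comment> \<open>Both sides carry the factor (M^2)^p from the cube; cancelling it leaves an
      estimate for M^p.\<close>
    have X: "X = (M\<^sup>2) powr p * M powr p"
     by (simp add: X_def powr_mult[symmetric] power3_eq_cube power2_eq_square)
    have Y: "(3 * M\<^sup>2 / \<mu>\<^sup>2) powr p = Y * (M\<^sup>2) powr p"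
     by (simp add: Y_def powr_mult[symmetric])
    have "ennreal X <= ennreal ((N * \<mu> ^ ?n) * (2 powr p * (X * (\<omega> * \<rho> ^ ?n) + Y * (M\<^sup>2) powr p * J)))"
    proof -
     have \<phi>z: "\<phi> z = M ^ 3" using z by (simp add: \<phi>_def M_def)
     have "ennreal X <= ennreal (N * \<mu> ^ ?n) * (ennreal (2 powr p) * (ennreal X * ennreal (\<omega> * \<rho> ^ ?n) + ennreal (Y * (M\<^sup>2) powr p) * ennreal J))"
      using est unfolding \<phi>z X_def[symmetric] Y J(1) .
     also have "\<dots> = ennreal ((N * \<mu> ^ ?n) * (2 powr p * (X * (\<omega> * \<rho> ^ ?n) + Y * (M\<^sup>2) powr p * J)))"
     proof -
      have nn: "0 <= X" "0 <= \<omega> * \<rho> ^ ?n" "0 <= Y * (M\<^sup>2) powr p" "0 <= N * \<mu> ^ ?n" using \<omega> \<rho> N \<mu> by (auto simp: X_def Y_def)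
      have e1: "ennreal X * ennreal (\<omega> * \<rho> ^ ?n) = ennreal (X * (\<omega> * \<rho> ^ ?n))" using nn by (intro ennreal_mult'[symmetric])
      have e2: "ennreal (Y * (M\<^sup>2) powr p) * ennreal J = ennreal (Y * (M\<^sup>2) powr p * J)" using nn by (intro ennreal_mult'[symmetric])
      have e3: "ennreal (X * (\<omega> * \<rho> ^ ?n)) + ennreal (Y * (M\<^sup>2) powr p * J) = ennreal (X * (\<omega> * \<rho> ^ ?n) + Y * (M\<^sup>2) powr p * J)"
       by (rule ennreal_plus[symmetric]; rule mult_nonneg_nonneg; fact)
      show ?thesis unfolding e1 e2 e3 using nn by (simp only: ennreal_mult'[symmetric] powr_ge_zero)
     qed
     finally show ?thesis .
    qed
    then have "X <= (N * \<mu> ^ ?n) * (2 powr p * (X * (\<omega> * \<rho> ^ ?n) + Y * (M\<^sup>2) powr p * J))"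
    proof (subst (asm) ennreal_le_iff)
     show "0 <= (N * \<mu> ^ ?n) * (2 powr p * (X * (\<omega> * \<rho> ^ ?n) + Y * (M\<^sup>2) powr p * J))"
      using N \<mu> \<omega> \<rho> J by (intro mult_nonneg_nonneg add_nonneg_nonneg) (auto simp: X_def Y_def)
    qed
    also have "\<dots> = X * (N * (\<mu> ^ ?n * \<rho> ^ ?n) * 2 powr p * \<omega>) + (N * \<mu> ^ ?n) * 2 powr p * Y * (M\<^sup>2) powr p * J"
     by (simp add: algebra_simps)
    also have "\<mu> ^ ?n * \<rho> ^ ?n = \<theta> ^ ?n" using \<rho> by (simp add: \<mu>_def power_mult_distrib[symmetric])
    \<comment> \<open>The zeroth order term is absorbed into the left side.\<close>
    also have "X * (N * \<theta> ^ ?n * 2 powr p * \<omega>) <= X * (1 / 2)" by (intro mult_left_mono \<theta>s) (simp add: X_def)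
    finally have "X <= 2 * ((N * \<mu> ^ ?n) * 2 powr p * Y * (M\<^sup>2) powr p * J)" by simp
    then have "(M\<^sup>2) powr p * M powr p <= (M\<^sup>2) powr p * (C * J)"
     unfolding X C_def Y_def by (simp only: mult_ac)
    then have "M powr p <= C * J" using Mp by simp
    then show ?thesis unfolding J(1) using C by (simp add: ennreal_mult'[symmetric] ennreal_leI)
   qed
  qed
  moreover have "max 0 (v x) powr p <= M powr p" using z(2)[OF x] p by (intro powr_mono2) (auto simp: M_def)
  ultimately show "ennreal (max 0 (v x) powr p) <= ennreal C * (nnS A (%y. ennreal (max 0 (- gen_op a b Gv Hv y) powr p)))"
   unfolding I_def l_def by (meson ennreal_leI order_trans)
 qed
qed

section \<open>Borel representatives and mollified weak derivatives\<close>

definition borel_rep :: "real => (real^'d) set => (real^'d => real) => (real^'d => real) => bool" where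
 "borel_rep p C v f \<longleftrightarrow> f \<in> bm borel \<and> (\<forall>x. x \<notin> C \<longrightarrow> f x = 0) \<and>
  (AE x in lborel. x \<in> C \<longrightarrow> f x = v x) \<and> integrable lborel f \<and>
  (NN x. ennreal (\<bar>f x\<bar> powr p)) < \<infinity>"

text \<open>On the bounded set C one has |f| <= 1 + |f|^p.\<close>

lemma integrable_bounded_Lp:
 fixes f :: "real^'d => real"
 assumes [measurable]: "f \<in> bm borel" and C: "bounded C" "C \<in> sets borel" "\<And>x. x \<notin> C ==> f x = 0" and p: "1 <= p"
  and fin: "(NN x. ennreal (\<bar>f x\<bar> powr p)) < \<infinity>"
 shows "integrable lborel f"
proof (rule integrableI_bounded)
 note [measurable] = C(2)
 have "(NN x. ennreal (norm (f x))) <= (NN x. indicator C x + ennreal (\<bar>f x\<bar> powr p))"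
 proof (rule nn_integral_mono)
  fix x
  consider "x \<notin> C" | "x \<in> C" "\<bar>f x\<bar> <= 1" | "1 < \<bar>f x\<bar>" by linarith
  then show "ennreal (norm (f x)) <= indicator C x + ennreal (\<bar>f x\<bar> powr p)"
  proof cases
   case 2
   have "ennreal (norm (f x)) <= 1" using 2 ennreal_leI[of "norm (f x)" 1] by simp
   then have "ennreal (norm (f x)) + 0 <= 1 + ennreal (\<bar>f x\<bar> powr p)" by (intro add_mono) auto
   then show ?thesis using 2 by simp
  next
   case 3
   have "\<bar>f x\<bar> powr 1 <= \<bar>f x\<bar> powr p" using 3 p by (intro powr_mono) auto
   then have "ennreal (norm (f x)) <= ennreal (\<bar>f x\<bar> powr p)" by (intro ennreal_leI) simp
   then show ?thesis by (rule order_trans) (simp add: le_iff_add add.commute)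
  qed (use C in auto)
 qed
 also have "\<dots> = emeasure lborel C + (NN x. ennreal (\<bar>f x\<bar> powr p))"
  by (simp add: nn_integral_add)
 also have "\<dots> < \<infinity>" using fin emeasure_bounded_finite[OF C(1)] by simp
 finally show "(NN x. ennreal (norm (f x))) < \<infinity>" .
qed simp

lemma borel_rep_exists:
 fixes D :: "(real^'d) set"
 assumes D: "open D" and v: "v \<in> Lp_loc p D" and C: "compact C" "C \<subseteq> D" and p: "1 <= p"
 shows "\<exists>f. borel_rep p C v f"
proof -
 have Cs [measurable]: "C \<in> sets borel" using C(1) by (simp add: compact_imp_closed)
 have vm: "v \<in> bm (lebesgue_on D)" and fin: "Lp_norm p C v < \<infinity>"
  using v C by (auto simp: Lp_loc_def)
 have Dl: "D \<in> sets lebesgue" using D by simp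
 have "(%x. indicator D x *\<^sub>R v x) \<in> bm lebesgue"
  using vm Dl by (subst (asm) borel_measurable_restrict_space_iff) auto
 then have "(%x. indicator C x * (indicator D x *\<^sub>R v x)) \<in> bm lebesgue"
  using Cs by (intro borel_measurable_times borel_measurable_indicator) auto
 then obtain f0 where f0[measurable]: "f0 \<in> bm lborel" and f0v: "AE x in lborel. indicator C x * (indicator D x *\<^sub>R v x) = f0 x"
  using completion_ex_borel_measurable_real by blast
 define f where "f = (%x. indicator C x * f0 x)"
 have fm [measurable]: "f \<in> bm borel" using f0 unfolding f_def by simp
 have fC: "f x = 0" if "x \<notin> C" for x using that by (simp add: f_def)
 have fv: "AE x in lborel. x \<in> C \<longrightarrow> f x = v x"
  using f0v
 proof eventually_elim
  case (elim x)
  then show ?case using C(2) by (auto simp: f_def split: split_indicator_asm)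
 qed
 have "(NN x. ennreal (\<bar>f x\<bar> powr p)) = (\<integral>\<^sup>+x. ennreal (\<bar>f x\<bar> powr p) \<partial>lebesgue)"
  by (rule nn_integral_lebesgue_eq[symmetric]) simp
 also have "\<dots> = (\<integral>\<^sup>+x\<in>C. ennreal (norm (v x) powr p) \<partial>lebesgue)"
 proof (rule nn_integral_cong_AE)
  have "AE x in lebesgue. x \<in> C \<longrightarrow> f x = v x" using fv by (rule AE_completion)
  then show "AE x in lebesgue. ennreal (\<bar>f x\<bar> powr p) = ennreal (norm (v x) powr p) * indicator C x"
  proof eventually_elim
   case (elim x)
   then show ?case using fC[of x] p by (auto split: split_indicator)
  qed
 qed
 also have "\<dots> < \<infinity>" using fin by (auto simp: Lp_norm_def Let_def less_top split: if_splits)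
 finally have ff: "(NN x. ennreal (\<bar>f x\<bar> powr p)) < \<infinity>" .
 have "integrable lborel f"
  by (rule integrable_bounded_Lp[OF fm compact_imp_bounded[OF C(1)] Cs fC p ff])
 then show ?thesis using fm fC fv ff unfolding borel_rep_def by blast
qed

text \<open>The kernel centred at x is supported in a ball inside C, so the integral over D sees v
  only where the Borel representative agrees with it almost everywhere.\<close>

lemma lebesgue_integral_rep:
 fixes D :: "(real^'d) set"
 assumes D: "open D" and v: "v \<in> bm (lebesgue_on D)" and C: "cball x e \<subseteq> C" "C \<subseteq> D" and f: "borel_rep p C v f"
  and h: "bump 0 e h" "0 < e"
 shows "(LINT y:D|lebesgue. v y * h (x - y)) = conv h f x"
proof -
 have hc: "cont h" by (rule bump_continuous[OF h(1)])
 have hm: "h \<in> bm borel" by (rule bm_contI[OF hc])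
 have hx: "(%y. h (x - y)) \<in> bm borel" using hm by measurable
 have fm: "f \<in> bm borel" and fv: "AE y in lborel. y \<in> C \<longrightarrow> f y = v y" using f by (auto simp: borel_rep_def)
 have Dl: "D \<in> sets lebesgue" using D by simp
 have vm: "(%y. indicator D y *\<^sub>R v y) \<in> bm lebesgue"
  using v Dl by (subst (asm) borel_measurable_restrict_space_iff) auto
 have "(LINT y:D|lebesgue. v y * h (x - y)) = (\<integral>y. f y * h (x - y) \<partial>lebesgue)"
  unfolding set_lebesgue_integral_def
 proof (rule integral_cong_AE)
  have "(%y. (indicator D y *\<^sub>R v y) * h (x - y)) \<in> bm lebesgue"
   by (intro borel_measurable_times vm measurable_completion) (use hx in simp)
  then show "(%y. indicator D y *\<^sub>R (v y * h (x - y))) \<in> bm lebesgue" by (simp add: mult.assoc)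
  show "(%y. f y * h (x - y)) \<in> bm lebesgue"
   by (intro measurable_completion borel_measurable_times) (use fm hx in simp_all)
  have "AE y in lebesgue. y \<in> C \<longrightarrow> f y = v y" using fv by (rule AE_completion)
  then show "AE y in lebesgue. indicator D y *\<^sub>R (v y * h (x - y)) = f y * h (x - y)"
  proof eventually_elim
   case (elim y)
   show ?case
   proof (cases "y \<in> cball x e")
    case True
    then have "y \<in> C" "y \<in> D" using C by blast+
    then show ?thesis using elim by simp
   next
    case False
    then have "h (x - y) = 0" using bump_support[OF h, of "x - y"] by (simp add: dist_norm)
    then show ?thesis by simp
   qed
  qed
 qed
 also have "\<dots> = (\<integral>y. f y * h (x - y) \<partial>lborel)"
  by (rule integral_completion) (use fm hx in simp)
 finally show ?thesis by (simp add: conv_def)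
qed

text \<open>The reflected kernel is an admissible test function; the sign from the reflection
  cancels the sign in the definition of the weak derivative.\<close>

lemma conv_weak_partial:
 fixes D :: "(real^'d) set"
 assumes D: "open D" and uv: "is_weak_partial D i u v" and C: "cball x e \<subseteq> C" "C \<subseteq> D"
  and f: "borel_rep p C u f" and g: "borel_rep p C v g" and k: "bump 0 e k" "0 < e"
 shows "conv (partial i k) f x = conv k g x"
proof -
 have um: "u \<in> bm (lebesgue_on D)" and vm: "v \<in> bm (lebesgue_on D)"
  using uv by (auto simp: is_weak_partial_def Lp_loc_def)
 have t: "(%y. k (x - y)) \<in> test_functions D"
  using C by (intro bump_test_function[OF bump_reflect[OF k(1)] k(2)]) auto
 have "(LINT y:D|lebesgue. u y * partial i (%y. k (x - y)) y) = - (LINT y:D|lebesgue. v y * k (x - y))"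
  using uv t unfolding is_weak_partial_def by blast
 moreover have "(LINT y:D|lebesgue. u y * partial i (%y. k (x - y)) y) = - (LINT y:D|lebesgue. u y * partial i k (x - y))"
  by (simp add: partial_reflect[OF k(1)] set_lebesgue_integral_def)
 ultimately show ?thesis
  by (simp add: lebesgue_integral_rep[OF D um C f bump_partial(2)[OF k(1)] k(2)] lebesgue_integral_rep[OF D vm C g k])
qed

lemma is_weak_partial_weak_D: "\<exists>v. is_weak_partial D i u v ==> is_weak_partial D i u (weak_D D i u)"
 unfolding weak_D_def using someI_ex[of "is_weak_partial D i u"] by blast

definition moll_grad :: "real => (real^'d => real) => real^'d => real^'d" where
 "moll_grad e f x = (\<chi> i. conv (partial i (mollifier e)) f x)"

text \<open>Row i is the gradient of component i of \<open>moll_grad\<close>. Putting all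
  derivatives on the kernel gives true derivatives on the whole space, also near the boundary of
  D.\<close>

definition moll_hess :: "real => (real^'d => real) => real^'d => real^'d^'d" where
 "moll_hess e f x = (\<chi> i j. conv (partial j (partial i (mollifier e))) f x)"

lemma moll_derivatives:
 fixes f :: "real^'d => real"
 assumes e: "0 < e" and f: "integrable lborel f"
 shows "(conv (mollifier e) f has_derivative (%h. moll_grad e f x \<bullet> h)) (at x)"
  and "(moll_grad e f has_derivative (%h. moll_hess e f x *v h)) (at x)"
  and "cont (moll_hess e f)"
proof -
 note b = mollifier(1)[OF e, where 'd='d]
 note b1 = bump_partial(2)[OF b] and b2 = bump_partial(2)[OF bump_partial(2)[OF b]]
 show "(conv (mollifier e) f has_derivative (%h. moll_grad e f x \<bullet> h)) (at x)"
  using conv_has_derivative[OF b e f, of x] by (simp add: moll_grad_def inner_vec_def mult.commute)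
 show "(moll_grad e f has_derivative (%h. moll_hess e f x *v h)) (at x)"
 proof (rule has_derivative_componentwise_within[THEN iffD2], rule ballI)
  fix c :: "real^'d" assume "c \<in> Basis"
  then obtain i where c: "c = axis i 1" by (auto simp: Basis_vec_def)
  have "((%x. moll_grad e f x \<bullet> c)) = conv (partial i (mollifier e)) f"
   by (rule ext) (simp add: c moll_grad_def inner_axis)
  moreover have "(%h. (moll_hess e f x *v h) \<bullet> c) = (%h. \<Sum>j\<in>UNIV. h $ j * conv (partial j (partial i (mollifier e))) f x)"
   by (rule ext) (simp add: c moll_hess_def inner_axis matrix_vector_mult_def mult.commute)
  ultimately show "((%x. moll_grad e f x \<bullet> c) has_derivative (%h. (moll_hess e f x *v h) \<bullet> c)) (at x)"
   using conv_has_derivative[OF b1 e f, of i x] by simp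
 qed
 show "cont (moll_hess e f)" unfolding moll_hess_def
  by (intro continuous_intros conv_continuous[OF b2 e f])
qed

text \<open>The derivatives are moved from the kernel to u one at a time, first j and then i, which
  produces exactly the iterated weak derivative that occurs in \<open>apply_op\<close>.\<close>

lemma moll_weak:
 fixes D :: "(real^'d) set"
 assumes D: "open D" and u: "u \<in> W2_loc p D" and C: "cball x e \<subseteq> C" "C \<subseteq> D" and e: "0 < e"
  and f0: "borel_rep p C u f0" and f1: "\<And>i. borel_rep p C (weak_D D i u) (f1 i)"
  and f2: "\<And>i j. borel_rep p C (weak_D D i (weak_D D j u)) (f2 i j)"
 shows "moll_grad e f0 x $ i = conv (mollifier e) (f1 i) x"
  and "moll_hess e f0 x $ i $ j = conv (mollifier e) (f2 i j) x"
proof -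
 note b = mollifier(1)[OF e, where 'd='d]
 note b1 = bump_partial(2)[OF b]
 have w1: "is_weak_partial D i u (weak_D D i u)" for i
  using u by (intro is_weak_partial_weak_D) (auto simp: W2_loc_def)
 have w2: "is_weak_partial D i (weak_D D j u) (weak_D D i (weak_D D j u))" for i j
  using u by (intro is_weak_partial_weak_D) (auto simp: W2_loc_def)
 show "moll_grad e f0 x $ i = conv (mollifier e) (f1 i) x"
  using conv_weak_partial[OF D w1 C f0 f1 b e] by (simp add: moll_grad_def)
 have "conv (partial j (partial i (mollifier e))) f0 x = conv (partial i (mollifier e)) (f1 j) x"
  by (rule conv_weak_partial[OF D w1 C f0 f1 b1 e])
 also have "\<dots> = conv (mollifier e) (f2 i j) x"
  by (rule conv_weak_partial[OF D w2 C f1 f2 b e])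
 finally show "moll_hess e f0 x $ i $ j = conv (mollifier e) (f2 i j) x" by (simp add: moll_hess_def)
qed

section \<open>Null sequences in L_p\<close>

definition Lnull :: "real => (real^'d) set => (nat => real^'d => real) => bool" where
 "Lnull p S f \<longleftrightarrow> (\<forall>n. f n \<in> bm borel) \<and>
  (%n. (nnS S (%x. ennreal (\<bar>f n x\<bar> powr p)))) ---> 0"

lemma ennreal_tendsto_0_cmult:
 fixes f g :: "nat => ennreal"
 assumes "f ---> 0" "EV n. g n <= ennreal c * f n"
 shows "g ---> 0"
proof (rule ennreal_tendsto_0I)
 fix \<eta> :: real assume \<eta>: "0 < \<eta>"
 define c' where "c' = max 0 c + 1"
 have c': "0 < c'" by (simp add: c'_def)
 have "EV n. f n <= ennreal (\<eta> / c')"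
  using \<eta> c' by (intro ennreal_tendsto_0D assms) simp
 with assms(2) show "EV n. g n <= ennreal \<eta>"
 proof eventually_elim
  case (elim n)
  have "g n <= ennreal c' * ennreal (\<eta> / c')"
   by (rule order_trans[OF elim(1)], rule mult_mono) (use elim in \<open>auto simp: c'_def intro!: ennreal_leI\<close>)
  also have "\<dots> = ennreal (c' * (\<eta> / c'))" using c' by (intro ennreal_mult'[symmetric]) simp
  also have "c' * (\<eta> / c') = \<eta>" using c' by simp
  finally show ?case .
 qed
qed

lemma Lnull_dominated:
 assumes g: "Lnull p S g" and S: "S \<in> sets borel" and p: "0 < p" and m: "\<And>n. f n \<in> bm borel"
  and le: "EV n. \<forall>x\<in>S. \<bar>f n x\<bar> <= c * \<bar>g n x\<bar>"
 shows "Lnull p S f"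
 unfolding Lnull_def
proof (intro conjI allI m)
 note [measurable] = S
 have gm [measurable]: "g n \<in> bm borel" for n using g by (simp add: Lnull_def)
 have g0: "(%n. (nnS S (%x. ennreal (\<bar>g n x\<bar> powr p)))) ---> 0" using g by (simp add: Lnull_def)
 show "(%n. (nnS S (%x. ennreal (\<bar>f n x\<bar> powr p)))) ---> 0"
 proof (rule ennreal_tendsto_0_cmult[OF g0, of _ "\<bar>c\<bar> powr p"])
  show "EV n. (nnS S (%x. ennreal (\<bar>f n x\<bar> powr p))) <= ennreal (\<bar>c\<bar> powr p) * (nnS S (%x. ennreal (\<bar>g n x\<bar> powr p)))"
   using le
  proof eventually_elim
   case (elim n)
   have "(nnS S (%x. ennreal (\<bar>f n x\<bar> powr p))) <= (NN x. ennreal (\<bar>c\<bar> powr p) * (ennreal (\<bar>g n x\<bar> powr p) * indicator S x))"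
   proof (rule nn_integral_mono)
    fix x
    show "ennreal (\<bar>f n x\<bar> powr p) * indicator S x <= ennreal (\<bar>c\<bar> powr p) * (ennreal (\<bar>g n x\<bar> powr p) * indicator S x)"
    proof (cases "x \<in> S")
     case True
     have "\<bar>f n x\<bar> <= c * \<bar>g n x\<bar>" using elim True by blast
     also have "\<dots> <= \<bar>c\<bar> * \<bar>g n x\<bar>" by (intro mult_right_mono) auto
     finally have "\<bar>f n x\<bar> powr p <= (\<bar>c\<bar> * \<bar>g n x\<bar>) powr p" using p by (intro powr_mono2) auto
     then have "ennreal (\<bar>f n x\<bar> powr p) <= ennreal (\<bar>c\<bar> powr p * \<bar>g n x\<bar> powr p)" by (intro ennreal_leI) (simp add: powr_mult)
     also have "\<dots> = ennreal (\<bar>c\<bar> powr p) * ennreal (\<bar>g n x\<bar> powr p)" by (rule ennreal_mult') simp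
     finally show ?thesis using True by simp
    qed simp
   qed
   also have "\<dots> = ennreal (\<bar>c\<bar> powr p) * (nnS S (%x. ennreal (\<bar>g n x\<bar> powr p)))"
    by (rule nn_integral_cmult) simp
   finally show ?case .
  qed
 qed
qed

lemma nn_integral_powr_sum_le:
 fixes f g h :: "real^'d => real"
 assumes [measurable]: "f \<in> bm borel" "g \<in> bm borel" and S: "S \<in> sets borel" and p: "0 < p"
  and le: "\<And>x. x \<in> S ==> \<bar>h x\<bar> <= \<bar>f x\<bar> + \<bar>g x\<bar>"
 shows "(nnS S (%x. ennreal (\<bar>h x\<bar> powr p)))
  <= ennreal (2 powr p) * ((nnS S (%x. ennreal (\<bar>f x\<bar> powr p))) + (nnS S (%x. ennreal (\<bar>g x\<bar> powr p))))"
proof -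
 note [measurable] = S
 have "(nnS S (%x. ennreal (\<bar>h x\<bar> powr p)))
  <= (NN x. ennreal (2 powr p) * (ennreal (\<bar>f x\<bar> powr p) * indicator S x + ennreal (\<bar>g x\<bar> powr p) * indicator S x))"
 proof (rule nn_integral_mono)
  fix x
  show "ennreal (\<bar>h x\<bar> powr p) * indicator S x <= ennreal (2 powr p) * (ennreal (\<bar>f x\<bar> powr p) * indicator S x + ennreal (\<bar>g x\<bar> powr p) * indicator S x)"
  proof (cases "x \<in> S")
   case True
   have "ennreal (\<bar>h x\<bar> powr p) <= ennreal (2 powr p) * (ennreal (\<bar>f x\<bar> powr p) + ennreal (\<bar>g x\<bar> powr p))"
    by (rule powr_sum_le_ennreal) (use le[OF True] p in auto)
   then show ?thesis using True by simp
  qed simp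
 qed
 also have "\<dots> = ennreal (2 powr p) * ((nnS S (%x. ennreal (\<bar>f x\<bar> powr p))) + (nnS S (%x. ennreal (\<bar>g x\<bar> powr p))))"
  by (simp add: nn_integral_cmult nn_integral_add)
 finally show ?thesis .
qed

lemma Lnull_add:
 assumes f: "Lnull p S f" and g: "Lnull p S g" and S: "S \<in> sets borel" and p: "0 < p"
 shows "Lnull p S (%n x. f n x + g n x)"
 unfolding Lnull_def
proof (intro conjI allI)
 have fm: "f n \<in> bm borel" and gm: "g n \<in> bm borel" for n using f g by (auto simp: Lnull_def)
 show "(%x. f n x + g n x) \<in> bm borel" for n using fm gm by simp
 have "(%n. (nnS S (%x. ennreal (\<bar>f n x\<bar> powr p))) + (nnS S (%x. ennreal (\<bar>g n x\<bar> powr p)))) ---> 0"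
  using tendsto_add[of "%n. (nnS S (%x. ennreal (\<bar>f n x\<bar> powr p)))" 0 sequentially "%n. (nnS S (%x. ennreal (\<bar>g n x\<bar> powr p)))" 0] f g
  by (simp add: Lnull_def)
 then show "(%n. (nnS S (%x. ennreal (\<bar>f n x + g n x\<bar> powr p)))) ---> 0"
  by (rule ennreal_tendsto_0_cmult[of _ _ "2 powr p"]) (intro always_eventually allI nn_integral_powr_sum_le fm gm S p abs_triangle_ineq)
qed

lemma Lnull_zero: "0 < p ==> Lnull p S (%n x. 0)"
 by (simp add: Lnull_def)

lemma Lnull_sum:
 assumes "finite I" "\<And>i. i \<in> I ==> Lnull p S (f i)" "S \<in> sets borel" "0 < p"
 shows "Lnull p S (%n x. \<Sum>i\<in>I. f i n x)"
 using assms(1,2)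
proof (induction I rule: finite_induct)
 case empty
 then show ?case using Lnull_zero[OF assms(4)] by simp
next
 case (insert i I)
 then show ?case using Lnull_add[OF _ _ assms(3,4), of "f i" "%n x. \<Sum>i\<in>I. f i n x"] by simp
qed

lemma Lnull_subset:
 assumes "Lnull p S f" "A \<subseteq> S"
 shows "Lnull p A f"
proof -
 have "(nnS A (%x. ennreal (\<bar>f n x\<bar> powr p))) <= ennreal 1 * (nnS S (%x. ennreal (\<bar>f n x\<bar> powr p)))" for n
  using assms(2) by (auto intro!: nn_integral_mono split: split_indicator)
 then have ev: "EV n. (nnS A (%x. ennreal (\<bar>f n x\<bar> powr p))) <= ennreal 1 * (nnS S (%x. ennreal (\<bar>f n x\<bar> powr p)))"
  by (intro always_eventually allI)
 have "(%n. (nnS S (%x. ennreal (\<bar>f n x\<bar> powr p)))) ---> 0" using assms(1) by (simp add: Lnull_def)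
 from ennreal_tendsto_0_cmult[OF this ev]
 have "(%n. (nnS A (%x. ennreal (\<bar>f n x\<bar> powr p)))) ---> 0" .
 then show ?thesis using assms(1) by (simp add: Lnull_def)
qed

section \<open>Approximation of the coefficients and of the operator\<close>

lemma borel_measurable_vec_lambda:
 fixes f :: "'d::finite => 'a => real"
 assumes "\<And>i. f i \<in> bm M"
 shows "(%x. \<chi> i. f i x) \<in> bm M"
proof (subst borel_measurable_euclidean_space, rule ballI)
 fix c :: "real^'d" assume "c \<in> Basis"
 then obtain i where "c = axis i 1" by (auto simp: Basis_vec_def)
 then have "(%x. (\<chi> i. f i x) \<bullet> c) = f i" by (simp add: inner_axis)
 then show "(%x. (\<chi> i. f i x) \<bullet> c) \<in> bm M" using assms by simp
qed

lemma S_mat_entry_le: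
 assumes \<delta>: "0 < \<delta>" and A: "A \<in> S_mat \<delta>"
 shows "\<bar>A $ i $ j\<bar> <= 1 / \<delta>"
proof -
 have e: "axis i 1 \<bullet> (A *v axis j 1) = A $ i $ j" for i j
  by (simp add: inner_axis' matrix_vector_mult_basis column_def)
 have "psd A" by (rule S_mat_psd[OF \<delta> A])
 then have nn: "0 <= A $ i $ i" for i unfolding psd_def using e[of i i] by metis
 have "(A $ i $ j)\<^sup>2 <= A $ i $ i * A $ j $ j"
  using psd_cauchy[OF \<open>psd A\<close>, of "axis i 1" "axis j 1"] by (simp only: e)
 also have "\<dots> <= 1 / \<delta> * (1 / \<delta>)" by (intro mult_mono S_mat_diag_le[OF A] nn) (use \<delta> in simp)
 finally have "(A $ i $ j)\<^sup>2 <= (1 / \<delta>)\<^sup>2" by (simp only: power2_eq_square)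
 then show ?thesis using \<delta> by (simp add: abs_le_square_iff[symmetric])
qed

text \<open>Continuous approximations are projected onto the closed convex set
  \<open>S_mat \<delta>\<close>. The projection is continuous and fixes the limit, so convergence is
  kept.\<close>

lemma diffusion_approx:
 fixes a :: "real^'d => real^'d^'d"
 assumes \<delta>: "0 < \<delta>" "\<delta> < 1" and a: "a \<in> bm borel" "\<And>x. a x \<in> S_mat \<delta>"
 obtains A where "\<And>n. cont (A n)" "\<And>n x. A n x \<in> S_mat \<delta>" "AE x in lborel. (%n. A n x) ---> a x"
proof -
 obtain g where g: "\<And>n. cont (g n)" "AE x in lborel. (%n. g n x) ---> a x"
  using AE_continuous_approx[OF a(1)] by blast
 have ne: "(S_mat \<delta> :: (real^'d^'d) set) \<noteq> {}" using a(2) by blast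
 note cp = continuous_on_closest_point[OF convex_S_mat closed_S_mat ne, of UNIV]
 show thesis
 proof (rule that[of "%n x. closest_point (S_mat \<delta>) (g n x)"])
  show "cont (%x. closest_point (S_mat \<delta>) (g n x))" for n
   by (rule continuous_on_compose2[OF cp g(1)]) simp
  show "closest_point (S_mat \<delta>) (g n x) \<in> S_mat \<delta>" for n x
   by (rule closest_point_in_set[OF closed_S_mat ne])
  show "AE x in lborel. (%n. closest_point (S_mat \<delta>) (g n x)) ---> a x"
   using g(2)
  proof eventually_elim
   case (elim x)
   have "(%n. closest_point (S_mat \<delta>) (g n x)) ---> closest_point (S_mat \<delta>) (a x)"
    by (rule continuous_on_tendsto_compose[OF cp elim]) auto
   then show ?case by (simp add: closest_point_self[OF a(2)])
  qed
 qed
qed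

text \<open>The factor \<theta> < 1 puts the limit norm strictly below K, so the norms of the
  approximations are eventually below K too, and the index is shifted past the exceptions. For K = 0
  the drift vanishes almost everywhere and zero approximations serve.\<close>

lemma drift_approx:
 fixes b :: "real^'d => real^'d"
 assumes b [measurable]: "b \<in> bm borel" and K: "0 <= K"
  and norm_b: "(NN x. ennreal (norm (b x) powr real CARD('d))) <= ennreal (K powr real CARD('d))"
  and c: "0 < c" and \<theta>: "0 <= \<theta>" "\<theta> < 1"
 defines "b' \<equiv> %x. if norm (b x) <= c \<and> norm x <= c then \<theta> *\<^sub>R b x else 0"
 shows "\<exists>\<beta>. (\<forall>n :: nat. smooth_drift K (\<beta> n)) \<and> (\<forall>n x. norm (\<beta> n x) <= c) \<and> (AE x in lborel. (%n. \<beta> n x) ---> b' x)"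
proof -
 let ?d = "real CARD('d)"
 have b'm [measurable]: "b' \<in> bm borel" unfolding b'_def by measurable
 have b'b: "norm (b' x) <= \<theta> * norm (b x)" for x using \<theta> by (simp add: b'_def)
 have b'c: "norm (b' x) <= c" for x
  using \<theta> c mult_left_le_one_le[of "norm (b x)" \<theta>] by (auto simp: b'_def)
 show ?thesis
 proof (cases "K = 0")
  case True
  then have "(NN x. ennreal (norm (b x) powr ?d)) = 0" using norm_b by simp
  then have "AE x in lborel. b x = 0" by (simp add: nn_integral_0_iff_AE ennreal_eq_0_iff)
  then have "AE x in lborel. (%n. 0) ---> b' x" by eventually_elim (simp add: b'_def)
  then show ?thesis using c by (intro exI[of _ "%n x. 0"]) (simp add: smooth_drift_def)
 next
  case False
  then have Kp: "0 < K" using K by simp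
  have pw: "x powr ?d = x ^ CARD('d)" if "0 <= x" for x :: real
   using that by (cases "x = 0") (simp_all add: powr_realpow)
  obtain T where Tc: "\<And>n. cont (T n)" and Tn: "\<And>n x. norm (T n x) <= c" and T0: "\<And>n x. c + 1 <= norm x ==> T n x = 0"
   and Tt: "AE x in lborel. (%n. T n x) ---> b' x"
   using bounded_approx[OF b'm c b'c] unfolding b'_def by auto
  have "(%n. (NN x. ennreal (norm (T n x) powr ?d))) ---> (NN x. ennreal (norm (b' x) powr ?d))"
   by (rule bounded_approx_Lp[OF bm_contI[OF Tc] b'm _ Tn T0 Tt]) simp
  moreover have "(NN x. ennreal (norm (b' x) powr ?d)) < ennreal (K powr ?d)"
  proof -
   have "(NN x. ennreal (norm (b' x) powr ?d)) <= (NN x. ennreal (\<theta> powr ?d) * ennreal (norm (b x) powr ?d))"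
   proof (rule nn_integral_mono)
    fix x
    have "norm (b' x) powr ?d <= (\<theta> * norm (b x)) powr ?d" by (intro powr_mono2 b'b) auto
    also have "\<dots> = \<theta> powr ?d * norm (b x) powr ?d" by (rule powr_mult)
    finally show "ennreal (norm (b' x) powr ?d) <= ennreal (\<theta> powr ?d) * ennreal (norm (b x) powr ?d)"
     by (simp add: ennreal_mult'[symmetric] ennreal_leI)
   qed
   also have "\<dots> = ennreal (\<theta> powr ?d) * (NN x. ennreal (norm (b x) powr ?d))" by (rule nn_integral_cmult) simp
   also have "\<dots> <= ennreal (\<theta> powr ?d) * ennreal (K powr ?d)" by (intro mult_left_mono norm_b) simp
   also have "\<dots> = ennreal ((\<theta> * K) powr ?d)" by (simp add: ennreal_mult'[symmetric] powr_mult)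
   also have "\<dots> < ennreal (K powr ?d)" using \<theta> Kp by (intro ennreal_lessI powr_less_mono2) auto
   finally show ?thesis .
  qed
  ultimately have "EV n. (NN x. ennreal (norm (T n x) powr ?d)) < ennreal (K powr ?d)"
   by (rule order_tendstoD)
  then obtain N where N: "\<And>n. N <= n ==> (NN x. ennreal (norm (T n x) powr ?d)) < ennreal (K powr ?d)"
   unfolding eventually_sequentially by blast
  have "smooth_drift K (T (n + N))" for n
   unfolding smooth_drift_def using Tc T0 N[of "n + N"] Kp pw by auto
  moreover have "AE x in lborel. (%n. T (n + N) x) ---> b' x"
   using Tt by eventually_elim (rule LIMSEQ_ignore_initial_segment)
  ultimately show ?thesis using Tn by (intro exI[of _ "%n. T (n + N)"] conjI allI)
 qed
qed

lemma Lnull_dominated_convergence: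
 assumes S: "S \<in> sets borel" and p: "0 < p" and m: "\<And>n. h n \<in> bm borel" and f: "f \<in> bm borel"
  and fin: "(nnS S (%x. ennreal (\<bar>f x\<bar> powr p))) < \<infinity>" and hb: "\<And>n x. \<bar>h n x\<bar> <= c" and h0: "AE x in lborel. (%n. h n x) ---> 0"
 shows "Lnull p S (%n x. h n x * f x)"
 unfolding Lnull_def
proof (intro conjI allI)
 note [measurable] = S m f
 show "(%x. h n x * f x) \<in> bm borel" for n by measurable
 have "(%n. (nnS S (%x. ennreal (\<bar>h n x * f x\<bar> powr p)))) ---> (NN (x :: real^'a). 0)"
 proof (rule nn_integral_dominated_convergence[where w="%x. ennreal (c powr p) * (ennreal (\<bar>f x\<bar> powr p) * indicator S x)"])
  have "(NN x. ennreal (c powr p) * (ennreal (\<bar>f x\<bar> powr p) * indicator S x)) = ennreal (c powr p) * (nnS S (%x. ennreal (\<bar>f x\<bar> powr p)))"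
   by (rule nn_integral_cmult) simp
  also have "\<dots> < \<infinity>" using fin by (simp add: ennreal_mult_less_top)
  finally show "(NN x. ennreal (c powr p) * (ennreal (\<bar>f x\<bar> powr p) * indicator S x)) < \<infinity>" .
  show "AE x in lborel. ennreal (\<bar>h j x * f x\<bar> powr p) * indicator S x <= ennreal (c powr p) * (ennreal (\<bar>f x\<bar> powr p) * indicator S x)" for j
  proof (rule AE_I2)
   fix x
   have "\<bar>h j x * f x\<bar> powr p <= (c * \<bar>f x\<bar>) powr p" using p hb[of j x] by (intro powr_mono2) (auto simp: abs_mult mult_right_mono)
   also have "\<dots> = c powr p * \<bar>f x\<bar> powr p" by (rule powr_mult)
   finally have "ennreal (\<bar>h j x * f x\<bar> powr p) <= ennreal (c powr p) * ennreal (\<bar>f x\<bar> powr p)"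
    by (simp add: ennreal_mult'[symmetric] ennreal_leI)
   then show "ennreal (\<bar>h j x * f x\<bar> powr p) * indicator S x <= ennreal (c powr p) * (ennreal (\<bar>f x\<bar> powr p) * indicator S x)"
    by (auto split: split_indicator)
  qed
  show "AE x in lborel. (%i. ennreal (\<bar>h i x * f x\<bar> powr p) * indicator S x) ---> 0"
   using h0
  proof eventually_elim
   case (elim x)
   have "(%i. \<bar>h i x * f x\<bar> powr p) ---> 0 powr p"
    using p by (intro tendsto_powr' tendsto_rabs_zero tendsto_mult_left_zero elim tendsto_const) auto
   then have "(%i. ennreal (\<bar>h i x * f x\<bar> powr p)) ---> ennreal 0" using p by (intro tendsto_ennrealI) simp
   then show ?case by (simp split: split_indicator)
  qed
 qed simp_all
 then show "(%n. (nnS S (%x. ennreal (\<bar>h n x * f x\<bar> powr p)))) ---> 0" by simp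
qed

lemma Lp_sum_finite:
 fixes f :: "'i => real^'d => real"
 assumes I: "finite I" and m: "\<And>j. f j \<in> bm borel" and fin: "\<And>j. (nnS S (%x. ennreal (\<bar>f j x\<bar> powr p))) < \<infinity>"
  and S: "S \<in> sets borel" and p: "0 < p"
 shows "(nnS S (%x. ennreal (\<bar>\<Sum>j\<in>I. \<bar>f j x\<bar>\<bar> powr p))) < \<infinity>"
 using I
proof (induction I rule: finite_induct)
 case (insert i I)
 note [measurable] = m
 have "(nnS S (%x. ennreal (\<bar>\<Sum>j\<in>insert i I. \<bar>f j x\<bar>\<bar> powr p)))
  <= ennreal (2 powr p) * ((nnS S (%x. ennreal (\<bar>f i x\<bar> powr p))) + (nnS S (%x. ennreal (\<bar>\<Sum>j\<in>I. \<bar>f j x\<bar>\<bar> powr p))))"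
  by (rule nn_integral_powr_sum_le[OF _ _ S p]) (use insert.hyps in \<open>auto simp: sum_nonneg\<close>)
 also have "\<dots> < \<infinity>" using insert.IH fin by (simp add: ennreal_mult_less_top)
 finally show ?case .
qed (use p in simp)

text \<open>Telescoped so that each product has one factor tending to 0: bounded coefficients meet
  differences of derivatives, and differences of coefficients meet the fixed L_p functions f1 and
  f2.\<close>

lemma gen_op_diff:
 fixes a a' :: "real^'d => real^'d^'d" and b b' G :: "real^'d => real^'d"
 shows "gen_op a' b' G H x - gen_op a b (%x. \<chi> i. f1 i x) (%x. \<chi> i j. f2 i j x) x
  = (\<Sum>i\<in>UNIV. \<Sum>j\<in>UNIV. a' x $ i $ j * (H x $ i $ j - f2 i j x)) / 2 + (\<Sum>i\<in>UNIV. \<Sum>j\<in>UNIV. (a' x $ i $ j - a x $ i $ j) * f2 i j x) / 2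
   + (\<Sum>i\<in>UNIV. b' x $ i * (G x $ i - f1 i x)) + (\<Sum>i\<in>UNIV. (b' x $ i - b x $ i) * f1 i x)"
 unfolding gen_op_def inner_vec_def
 by (simp add: algebra_simps sum.distrib sum_subtractf diff_divide_distrib)

theorem operator_convergence:
 fixes A :: "(real^'d) set" and G :: "nat => real^'d => real^'d" and H :: "nat => real^'d => real^'d^'d"
 assumes p: "0 < p" and As: "A \<in> sets borel" and \<delta>: "0 < \<delta>"
  and a: "a \<in> bm borel" "\<And>x. a x \<in> S_mat \<delta>" and b: "b \<in> bm borel" "\<And>x. norm (b x) <= c"
  and \<alpha>: "\<And>n. cont (\<alpha> n)" "\<And>n x. \<alpha> n x \<in> S_mat \<delta>" "AE x in lborel. (%n. \<alpha> n x) ---> a x"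
  and \<beta>: "\<And>n. cont (\<beta> n)" "\<And>n x. norm (\<beta> n x) <= c" "AE x in lborel. (%n. \<beta> n x) ---> b x"
  and GH: "\<And>n. cont (G n)" "\<And>n. cont (H n)"
  and f1: "\<And>i. f1 i \<in> bm borel" "\<And>i. (nnS A (%x. ennreal (\<bar>f1 i x\<bar> powr p))) < \<infinity>" "\<And>i. Lnull p A (%n x. G n x $ i - f1 i x)"
  and f2: "\<And>i j. f2 i j \<in> bm borel" "\<And>i j. (nnS A (%x. ennreal (\<bar>f2 i j x\<bar> powr p))) < \<infinity>" "\<And>i j. Lnull p A (%n x. H n x $ i $ j - f2 i j x)"
 shows "Lnull p A (%n x. gen_op (\<alpha> n) (\<beta> n) (G n) (H n) x - gen_op a b (%x. \<chi> i. f1 i x) (%x. \<chi> i j. f2 i j x) x)"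
proof -
 note [measurable] = a(1) b(1) f1(1) f2(1)
 have comp1: "(%v :: real^'d. v $ i) \<in> bm borel" for i
  by (intro bm_contI continuous_intros)
 have comp2: "(%M :: real^'d^'d. M $ i $ j) \<in> bm borel" for i j
  by (intro bm_contI continuous_intros)
 have cont: "f n \<in> bm borel" if "\<And>n. cont (f n)" for n and f :: "nat => real^'d => 'b::topological_space"
  by (rule bm_contI[OF that])
 have [measurable]: "(%x. \<alpha> n x $ i $ j) \<in> bm borel" "(%x. a x $ i $ j) \<in> bm borel"
  "(%x. H n x $ i $ j) \<in> bm borel" "(%x. G n x $ i) \<in> bm borel"
  "(%x. \<beta> n x $ i) \<in> bm borel" "(%x. b x $ i) \<in> bm borel" for n i j
  by (rule measurable_compose[OF _ comp2], rule cont[OF \<alpha>(1)] a cont[OF GH(2)])+ (rule measurable_compose[OF _ comp1], rule cont[OF GH(1)] cont[OF \<beta>(1)] b)+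
 have bnd: "Lnull p A (%n x. h n x * f n x)" if "Lnull p A f" "\<And>n x. \<bar>h n x\<bar> <= c'" and [measurable]: "\<And>n. h n \<in> bm borel" for h f c'
 proof (rule Lnull_dominated[OF that(1) As p, where c=c'])
  have [measurable]: "f n \<in> bm borel" for n using that(1) by (simp add: Lnull_def)
  show "(%x. h n x * f n x) \<in> bm borel" for n by measurable
  show "EV n. \<forall>x\<in>A. \<bar>h n x * f n x\<bar> <= c' * \<bar>f n x\<bar>"
   unfolding abs_mult by (intro always_eventually allI ballI mult_right_mono that(2) abs_ge_zero)
 qed
 have nb: "\<bar>v $ i\<bar> <= c" if "norm v <= c" for v :: "real^'d" and i
  by (rule order_trans[OF component_le_norm_cart that])
 have t1: "Lnull p A (%n x. \<alpha> n x $ i $ j * (H n x $ i $ j - f2 i j x))" for i j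
  by (rule bnd[OF f2(3) S_mat_entry_le[OF \<delta> \<alpha>(2)]]) measurable
 have t2: "Lnull p A (%n x. (\<alpha> n x $ i $ j - a x $ i $ j) * f2 i j x)" for i j
 proof (rule Lnull_dominated_convergence[where h="%n x. \<alpha> n x $ i $ j - a x $ i $ j" and f="f2 i j" and c="1 / \<delta> + 1 / \<delta>", OF As p _ f2(1) f2(2)])
  show "\<bar>\<alpha> n x $ i $ j - a x $ i $ j\<bar> <= 1 / \<delta> + 1 / \<delta>" for n x
   by (rule order_trans[OF abs_triangle_ineq4 add_mono[OF S_mat_entry_le[OF \<delta> \<alpha>(2)] S_mat_entry_le[OF \<delta> a(2)]]])
  show "AE x in lborel. (%n. \<alpha> n x $ i $ j - a x $ i $ j) ---> 0"
   using \<alpha>(3) by eventually_elim (rule LIM_zero[OF tendsto_vec_nth[OF tendsto_vec_nth]])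
 qed simp
 have t3: "Lnull p A (%n x. \<beta> n x $ i * (G n x $ i - f1 i x))" for i
  by (rule bnd[OF f1(3) nb[OF \<beta>(2)]]) measurable
 have t4: "Lnull p A (%n x. (\<beta> n x $ i - b x $ i) * f1 i x)" for i
 proof (rule Lnull_dominated_convergence[where h="%n x. \<beta> n x $ i - b x $ i" and f="f1 i" and c="c + c", OF As p _ f1(1) f1(2)])
  show "\<bar>\<beta> n x $ i - b x $ i\<bar> <= c + c" for n x
   by (rule order_trans[OF abs_triangle_ineq4 add_mono[OF nb[OF \<beta>(2)] nb[OF b(2)]]])
  show "AE x in lborel. (%n. \<beta> n x $ i - b x $ i) ---> 0"
   using \<beta>(3) by eventually_elim (rule LIM_zero[OF tendsto_vec_nth])
 qed simp
 have half: "Lnull p A (%n x. f n x / 2)" if "Lnull p A f" for f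
  using bnd[OF that, of "%_ _. 1 / 2" "1 / 2"] by simp
 show ?thesis
  unfolding gen_op_diff
 proof (rule Lnull_add[OF Lnull_add[OF Lnull_add[OF half half As p] _ As p] _ As p])
  show "Lnull p A (%n x. \<Sum>i\<in>UNIV. \<Sum>j\<in>UNIV. \<alpha> n x $ i $ j * (H n x $ i $ j - f2 i j x))"
   by (rule Lnull_sum[OF finite Lnull_sum[OF finite t1 As p] As p])
  show "Lnull p A (%n x. \<Sum>i\<in>UNIV. \<Sum>j\<in>UNIV. (\<alpha> n x $ i $ j - a x $ i $ j) * f2 i j x)"
   by (rule Lnull_sum[OF finite Lnull_sum[OF finite t2 As p] As p])
  show "Lnull p A (%n x. \<Sum>i\<in>UNIV. \<beta> n x $ i * (G n x $ i - f1 i x))"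
   by (rule Lnull_sum[OF finite t3 As p])
  show "Lnull p A (%n x. \<Sum>i\<in>UNIV. (\<beta> n x $ i - b x $ i) * f1 i x)"
   by (rule Lnull_sum[OF finite t4 As p])
 qed
qed

section \<open>The interior estimate\<close>

lemma compact_neighbourhood:
 fixes A :: "(real^'d) set"
 assumes A: "compact A" "A \<noteq> {}" and D: "open D" "A \<subseteq> D"
 obtains r where "0 < r" "compact {x. infdist x A <= 2 * r}" "{x. infdist x A <= 2 * r} \<subseteq> D"
  "\<And>x. infdist x A <= r ==> cball x r \<subseteq> {x. infdist x A <= 2 * r}"
proof -
 obtain e where e: "0 < e" "(\<Union>x\<in>A. cball x e) \<subseteq> D"
  using compact_subset_open_imp_cball_epsilon_subset[OF A(1) D] by blast
 show thesis
 proof (rule that[of "e / 2"])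
  show "0 < e / 2" using e by simp
  show "compact {x. infdist x A <= 2 * (e / 2)}" using A e by (intro compact_infdist_le) auto
  show "{x. infdist x A <= 2 * (e / 2)} \<subseteq> D"
  proof
   fix x assume "x \<in> {x. infdist x A <= 2 * (e / 2)}"
   moreover obtain y where "y \<in> A" "infdist x A = dist x y"
    using infdist_attains_inf[OF compact_imp_closed[OF A(1)] A(2)] by blast
   ultimately have "x \<in> (\<Union>x\<in>A. cball x e)" by (auto simp: dist_commute)
   then show "x \<in> D" using e by blast
  qed
  show "cball x (e / 2) \<subseteq> {x. infdist x A <= 2 * (e / 2)}" if "infdist x A <= e / 2" for x
  proof
   fix y assume "y \<in> cball x (e / 2)"
   then show "y \<in> {x. infdist x A <= 2 * (e / 2)}" using infdist_triangle[of y A x] that by (simp add: dist_commute)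
  qed
 qed
qed

lemma borel_rep_continuous:
 fixes u :: "real^'d => real"
 assumes C: "compact C" and u: "continuous_on C u" and p: "1 <= p"
 shows "borel_rep p C u (%x. indicator C x * u x)"
proof -
 have Cs [measurable]: "C \<in> sets borel" using C by (simp add: compact_imp_closed)
 have m [measurable]: "(%x. indicator C x * u x) \<in> bm borel"
  using borel_measurable_continuous_on_indicator[OF Cs u] by simp
 obtain B where B: "\<And>x. x \<in> C ==> \<bar>u x\<bar> <= B"
  using compact_imp_bounded[OF compact_continuous_image[OF u C]] by (auto simp: bounded_iff)
 have "(NN x. ennreal (\<bar>indicator C x * u x\<bar> powr p)) <= (NN x. ennreal (\<bar>B\<bar> powr p) * indicator C x)"
 proof (rule nn_integral_mono)
  fix x
  show "ennreal (\<bar>indicator C x * u x\<bar> powr p) <= ennreal (\<bar>B\<bar> powr p) * indicator C x"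
  proof (cases "x \<in> C")
   case True
   have "\<bar>u x\<bar> powr p <= \<bar>B\<bar> powr p" using B[OF True] p by (intro powr_mono2) auto
   then show ?thesis using True by (simp add: ennreal_leI)
  qed (use p in simp)
 qed
 also have "\<dots> = ennreal (\<bar>B\<bar> powr p) * emeasure lborel C" by (rule nn_integral_cmult_indicator) (use Cs in simp)
 also have "\<dots> < \<infinity>" using emeasure_bounded_finite[OF compact_imp_bounded[OF C]] by (simp add: ennreal_mult_less_top)
 finally have f: "(NN x. ennreal (\<bar>indicator C x * u x\<bar> powr p)) < \<infinity>" .
 have "integrable lborel (%x. indicator C x * u x)"
  by (rule integrable_bounded_Lp[OF m compact_imp_bounded[OF C] Cs _ p f]) simp
 then show ?thesis unfolding borel_rep_def using m f by (auto intro!: AE_I2)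
qed

lemma mollify_uniform:
 fixes u :: "real^'d => real"
 assumes C: "compact C" and u: "continuous_on C u" and r: "0 < r" and S: "\<And>x. x \<in> S ==> cball x r \<subseteq> C" and \<eta>: "0 < \<eta>"
 shows "EV n. \<forall>x\<in>S. \<bar>conv (mollifier (1 / real (Suc n))) (%x. indicator C x * u x) x - u x\<bar> <= \<eta>"
proof -
 have int: "integrable lborel (%x. indicator C x * u x)"
  using borel_rep_continuous[OF C u, of 1] by (simp add: borel_rep_def)
 obtain \<delta> where \<delta>: "0 < \<delta>" "\<And>x x'. x \<in> C ==> x' \<in> C ==> dist x' x < \<delta> ==> dist (u x') (u x) < \<eta>"
  using uniformly_continuous_onE[OF compact_uniformly_continuous[OF u C] \<eta>] by blast
 have "EV n. 1 / real (Suc n) < min \<delta> r"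
  using order_tendstoD(2)[OF LIMSEQ_Suc[OF lim_1_over_n], of "min \<delta> r"] \<delta>(1) r by simp
 then show ?thesis
 proof eventually_elim
  case (elim n)
  show ?case
  proof
   fix x assume x: "x \<in> S"
   have xC: "x \<in> C" using S[OF x] r by auto
   have "\<bar>conv (mollifier (1 / real (Suc n))) (%x. indicator C x * u x) x - indicator C x * u x\<bar> <= \<eta>"
   proof (rule conv_close[OF _ int])
    fix y assume y: "norm (y - x) < 1 / real (Suc n)"
    then have "norm (y - x) < \<delta>" "norm (y - x) < r" using elim by auto
    then have "y \<in> C" using S[OF x] by (auto simp: dist_norm norm_minus_commute)
    then have "dist (u y) (u x) < \<eta>" using \<open>norm (y - x) < \<delta>\<close> by (intro \<delta>(2) xC) (auto simp: dist_norm)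
    then show "\<bar>indicator C y * u y - indicator C x * u x\<bar> <= \<eta>" using xC \<open>y \<in> C\<close> by (simp add: dist_real_def)
   qed simp
   then show "\<bar>conv (mollifier (1 / real (Suc n))) (%x. indicator C x * u x) x - u x\<bar> <= \<eta>" using xC by simp
  qed
 qed
qed

lemma Lnull_mollify:
 fixes f :: "real^'d => real"
 assumes p: "1 < p" and f: "borel_rep p C v f" and S: "S \<in> sets borel" and r: "0 < r" "\<And>x. x \<in> S ==> cball x r \<subseteq> C"
  and w: "\<And>n. w n \<in> bm borel"
  and eq: "\<And>n x. cball x (1 / real (Suc n)) \<subseteq> C ==> w n x = conv (mollifier (1 / real (Suc n))) f x"
 shows "Lnull p S (%n x. w n x - f x)"
proof -
 have fi: "integrable lborel f" and fm: "f \<in> bm borel" and ff: "(NN x. ennreal (\<bar>f x\<bar> powr p)) < \<infinity>"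
  using f by (auto simp: borel_rep_def)
 have p0: "0 < p" using p by simp
 have cm: "conv (mollifier (1 / real (Suc n))) f \<in> bm borel" for n
  by (intro bm_contI conv_continuous[OF mollifier(1) _ fi]) auto
 have "Lnull p UNIV (%n x. conv (mollifier (1 / real (Suc n))) f x - f x)"
  unfolding Lnull_def using mollify_Lp[OF p fi ff] cm fm by (auto intro: borel_measurable_diff)
 then have "Lnull p S (%n x. conv (mollifier (1 / real (Suc n))) f x - f x)" by (rule Lnull_subset) simp
 then show ?thesis
 proof (rule Lnull_dominated[OF _ S p0, where c=1])
  show "(%x. w n x - f x) \<in> bm borel" for n using w fm by (rule borel_measurable_diff)
  have "EV n. 1 / real (Suc n) < r"
   using order_tendstoD(2)[OF LIMSEQ_Suc[OF lim_1_over_n], of r] r(1) by simp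
  then show "EV n. \<forall>x\<in>S. \<bar>w n x - f x\<bar> <= 1 * \<bar>conv (mollifier (1 / real (Suc n))) f x - f x\<bar>"
  proof eventually_elim
   case (elim n)
   show ?case
   proof
    fix x assume "x \<in> S"
    then have "cball x (1 / real (Suc n)) \<subseteq> C" using r(2)[of x] subset_cball[of "1 / real (Suc n)" r x] elim by (meson less_imp_le order_trans)
    then show "\<bar>w n x - f x\<bar> <= 1 * \<bar>conv (mollifier (1 / real (Suc n))) f x - f x\<bar>" by (simp only: eq) simp
   qed
  qed
 qed
qed

text \<open>Two limits in this order: with m fixed and the drift bounded, n -> infinity removes
  mollification and smoothing of the coefficients; then m -> infinity restores the drift. Each limit
  costs a factor 2^p from adding its error, whence \<open>C1\<close>.\<close>

theorem interior_estimate: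
 assumes d: "2 <= CARD('d::finite)" and \<delta>: "0 < \<delta>" "\<delta> < 1" and K: "0 <= K" and d0: "is_d0 TYPE('d) \<delta> K p" and \<rho>: "0 < \<rho>"
 shows "\<exists>C\<ge>0. \<forall>(D :: (real^'d) set) u a b s \<epsilon> x. open D \<and> bounded D \<and> diameter D = \<rho> \<and> u \<in> W2_loc p D \<and> continuous_on (closure D) u \<and>
  (a, b) \<in> op_class \<delta> K \<and> (\<forall>y\<in>frontier D. u y <= s) \<and> 0 < \<epsilon> \<and> x \<in> D \<and> s + \<epsilon> <= u x \<longrightarrow>
  ennreal (max 0 (u x - s - 2 * \<epsilon>) powr p) <= ennreal C * (\<integral>\<^sup>+y\<in>{y\<in>D. s + \<epsilon> <= u y}. ennreal (neg_part (apply_op D (a, b) u y) powr p) \<partial>lebesgue)"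
proof -
 have p: "1 < p" "p < real CARD('d)" using d d0 by (auto simp: is_d0_def)
 have p0: "0 < p" "1 <= p" using p by auto
 obtain C0 where C0: "0 <= C0" and max: "\<And>v Gv Hv a b A U (x :: real^'d). (\<forall>x. (v has_derivative (%h. Gv x \<bullet> h)) (at x)) \<and>
  (\<forall>x. (Gv has_derivative (%h. Hv x *v h)) (at x)) \<and> cont Hv \<and>
  compact A \<and> open U \<and> A \<subseteq> U \<and> (\<forall>x\<in>U - A. v x <= 0) \<and> (\<forall>x\<in>A. \<forall>y\<in>A. norm (x - y) <= \<rho>) \<and>
  cont a \<and> (\<forall>y. a y \<in> S_mat \<delta>) \<and> smooth_drift K b \<and> x \<in> A ==>
  ennreal (max 0 (v x) powr p) <= ennreal C0 * (nnS A (%y. ennreal (max 0 (- gen_op a b Gv Hv y) powr p)))"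
  using max_estimate[OF d \<delta> K d0 \<rho>] by blast
 define C1 where "C1 = C0 * (2 powr p * 2 powr p)"
 have C1: "0 <= C1" using C0 by (simp add: C1_def)
 show ?thesis
 proof (intro exI[of _ C1] conjI C1 allI impI, elim conjE)
  fix D :: "(real^'d) set" and u :: "real^'d => real" and a :: "real^'d => real^'d^'d" and b :: "real^'d => real^'d" and s \<epsilon> :: real and x :: "real^'d"
  assume D: "open D" "bounded D" "diameter D = \<rho>" and u: "u \<in> W2_loc p D" "continuous_on (closure D) u"
   and ab: "(a, b) \<in> op_class \<delta> K" and s: "\<forall>y\<in>frontier D. u y <= s" and \<epsilon>: "0 < \<epsilon>" and x: "x \<in> D" "s + \<epsilon> <= u x"
  define A where "A = {y\<in>D. s + \<epsilon> <= u y}"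
  \<comment> \<open>On the frontier u <= s < s + \<epsilon>, so this set is closed although D is
    open.\<close>
  have A_eq: "A = closure D \<inter> u -` {s + \<epsilon>..}"
  proof
   show "A \<subseteq> closure D \<inter> u -` {s + \<epsilon>..}" using closure_subset by (auto simp: A_def)
   show "closure D \<inter> u -` {s + \<epsilon>..} \<subseteq> A"
   proof
    fix y assume y: "y \<in> closure D \<inter> u -` {s + \<epsilon>..}"
    have "y \<in> D"
    proof (rule ccontr)
     assume "y \<notin> D"
     then have "y \<in> frontier D" using y D(1) by (simp add: frontier_def interior_open)
     then show False using s y \<epsilon> by force
    qed
    then show "y \<in> A" using y by (simp add: A_def)
   qed
  qed
  have "closed A" unfolding A_eq by (rule continuous_closed_preimage[OF u(2)]) auto
  then have A: "compact A" "A \<noteq> {}" "A \<subseteq> D"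
   using bounded_subset[OF D(2), of A] x by (auto simp: A_def compact_eq_bounded_closed)
  have As: "A \<in> sets borel" using \<open>closed A\<close> by simp
  obtain r where r: "0 < r" and cC: "compact {x. infdist x A <= 2 * r}" "{x. infdist x A <= 2 * r} \<subseteq> D"
   and bC: "\<And>x. infdist x A <= r ==> cball x r \<subseteq> {x. infdist x A <= 2 * r}"
   using compact_neighbourhood[OF A(1,2) D(1) A(3)] by blast
  \<comment> \<open>The representatives live on the outer neighbourhood C of A. About points of the
    inner one, S, balls of radius r stay in C, so mollification with a smaller radius sees the true
    values of u.\<close>
  define C where "C = {x. infdist x A <= 2 * r}"
  define S where "S = {x. infdist x A <= r}"
  note cC = cC[folded C_def]
  have bS: "\<And>x. x \<in> S ==> cball x r \<subseteq> C" using bC unfolding S_def C_def by blast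
  have cS: "compact S" unfolding S_def using A r by (intro compact_infdist_le) auto
  have Ss: "S \<in> sets borel" using cS by (simp add: compact_imp_closed)
  have uC: "continuous_on C u" using u(2) cC(2) closure_subset by (meson continuous_on_subset order_trans)
  define f0 where "f0 = (%x. indicator C x * u x)"
  have f0: "borel_rep p C u f0" unfolding f0_def by (rule borel_rep_continuous[OF cC(1) uC p0(2)])
  have f0i: "integrable lborel f0" using f0 by (simp add: borel_rep_def)
  have "\<forall>i. \<exists>f. borel_rep p C (weak_D D i u) f"
   using u(1) by (intro allI borel_rep_exists[OF D(1) _ cC p0(2)]) (simp add: W2_loc_def)
  from choice[OF this] obtain f1 where "\<forall>i. borel_rep p C (weak_D D i u) (f1 i)" ..
  then have f1: "borel_rep p C (weak_D D i u) (f1 i)" for i by (rule spec)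
  have "\<forall>i. \<exists>f. \<forall>j. borel_rep p C (weak_D D i (weak_D D j u)) (f j)"
   using u(1) by (intro allI choice borel_rep_exists[OF D(1) _ cC p0(2)]) (simp add: W2_loc_def)
  from choice[OF this] obtain f2 where f2': "\<forall>i j. borel_rep p C (weak_D D i (weak_D D j u)) (f2 i j)" ..
  have f2: "borel_rep p C (weak_D D i (weak_D D j u)) (f2 i j)" for i j by (rule f2'[rule_format])
  define e where "e = (%n. 1 / real (Suc n))"
  have e: "0 < e n" for n by (simp add: e_def)
  define G where "G = (%n. moll_grad (e n) f0)"
  define H where "H = (%n. moll_hess (e n) f0)"
  have der: "(conv (mollifier (e n)) f0 has_derivative (%h. G n x \<bullet> h)) (at x)"
   "(G n has_derivative (%h. H n x *v h)) (at x)" "cont (H n)" for n x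
   unfolding G_def H_def by (rule moll_derivatives[OF e f0i])+
  have Gc: "cont (G n)" for n using der(2) by (auto simp: continuous_on_eq_continuous_at intro: has_derivative_continuous)
  have Gm: "(%x. G n x $ i) \<in> bm borel" for n i
   by (intro bm_contI continuous_intros Gc)
  have Hm: "(%x. H n x $ i $ j) \<in> bm borel" for n i j
   by (intro bm_contI continuous_intros der(3))
  have bA: "\<And>x. x \<in> A ==> cball x r \<subseteq> C" using bS r by (auto simp: S_def)
  have L1: "Lnull p A (%n x. G n x $ i - f1 i x)" for i
  proof (rule Lnull_mollify[OF p(1) f1 As r bA Gm])
   fix n x assume "cball x (1 / real (Suc n)) \<subseteq> C"
   then show "G n x $ i = conv (mollifier (1 / real (Suc n))) (f1 i) x"
    using moll_weak(1)[OF D(1) u(1) _ cC(2) e f0 f1 f2] by (simp only: G_def e_def)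
  qed
  have L2: "Lnull p A (%n x. H n x $ i $ j - f2 i j x)" for i j
  proof (rule Lnull_mollify[OF p(1) f2 As r bA Hm])
   fix n x assume "cball x (1 / real (Suc n)) \<subseteq> C"
   then show "H n x $ i $ j = conv (mollifier (1 / real (Suc n))) (f2 i j) x"
    using moll_weak(2)[OF D(1) u(1) _ cC(2) e f0 f1 f2] by (simp only: H_def e_def)
  qed
  have fin: "(nnS A (%x. ennreal (\<bar>f x\<bar> powr p))) < \<infinity>" if "borel_rep p C v f" for v f
  proof -
   have "(nnS A (%x. ennreal (\<bar>f x\<bar> powr p))) <= (NN x. ennreal (\<bar>f x\<bar> powr p))"
    by (intro nn_integral_mono) (simp split: split_indicator)
   also have "\<dots> < \<infinity>" using that by (simp add: borel_rep_def)
   finally show ?thesis .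
  qed
  have am: "a \<in> bm borel" and aS: "\<And>x. a x \<in> S_mat \<delta>" and bm: "b \<in> bm borel"
   and bK: "(NN x. ennreal (norm (b x) powr real CARD('d))) <= ennreal (K powr real CARD('d))"
  proof -
   show "a \<in> bm borel" "\<And>x. a x \<in> S_mat \<delta>" and bm: "b \<in> bm borel" using ab by (auto simp: op_class_def)
   have "Lp_norm (real CARD('d)) UNIV b <= ennreal K" using ab by (simp add: op_class_def)
   then have "(\<integral>\<^sup>+x. ennreal (norm (b x) powr real CARD('d)) \<partial>lebesgue) <= ennreal (K powr real CARD('d))"
    using Lp_norm_le_iff[of "real CARD('d)" K UNIV b] K by simp
   then show "(NN x. ennreal (norm (b x) powr real CARD('d))) <= ennreal (K powr real CARD('d))"
    using bm by (subst (asm) nn_integral_lebesgue_eq) simp_all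
  qed
  have f1m: "f1 i \<in> bm borel" and f2m: "f2 i j \<in> bm borel" for i j
   using f1[of i] f2[of i j] by (auto simp: borel_rep_def)
  define F where "F = (%b. gen_op a b (%x. \<chi> i. f1 i x) (%x. \<chi> i j. f2 i j x))"
  define \<theta> where "\<theta> = (%m. 1 - 1 / real (Suc m))"
  \<comment> \<open>The truncation makes the drift bounded, so that it multiplies first derivatives
    that are only known to lie in L_p; the factor below 1 gives the strict inequality of
    \<open>smooth_drift\<close>.\<close>
  define bt where "bt = (%m x. if norm (b x) <= real (Suc m) \<and> norm x <= real (Suc m) then \<theta> m *\<^sub>R b x else 0)"
  have \<theta>: "0 <= \<theta> m" "\<theta> m < 1" for m by (auto simp: \<theta>_def)
  have btm: "bt m \<in> bm borel" for m using bm unfolding bt_def by measurable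
  have btb: "norm (bt m x) <= real (Suc m)" for m x
   using \<theta>[of m] mult_left_le_one_le[of "norm (b x)" "\<theta> m"] by (auto simp: bt_def simp del: of_nat_Suc)
  obtain \<alpha> where \<alpha>: "\<And>n. cont (\<alpha> n)" "\<And>n x. \<alpha> n x \<in> S_mat \<delta>" "AE x in lborel. (%n. \<alpha> n x) ---> a x"
   using diffusion_approx[OF \<delta> am aS] by blast
  have "\<exists>\<beta>. (\<forall>n. smooth_drift K (\<beta> n)) \<and> Lnull p A (%n x. gen_op (\<alpha> n) (\<beta> n) (G n) (H n) x - F (bt m) x)" for m
  proof -
   obtain \<beta> where \<beta>: "\<forall>n. smooth_drift K (\<beta> n)" "\<forall>n x. norm (\<beta> n x) <= real (Suc m)" "AE x in lborel. (%n. \<beta> n x) ---> bt m x"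
    using drift_approx[OF bm K bK _ \<theta>, of "real (Suc m)" m] unfolding bt_def by auto
   have \<beta>c: "cont (\<beta> n)" for n using \<beta>(1) by (simp add: smooth_drift_def)
   have "Lnull p A (%n x. gen_op (\<alpha> n) (\<beta> n) (G n) (H n) x - F (bt m) x)"
    unfolding F_def by (rule operator_convergence[OF p0(1) As \<delta>(1) am aS btm btb \<alpha> \<beta>c \<beta>(2)[rule_format] \<beta>(3) Gc der(3) f1m fin[OF f1] L1 f2m fin[OF f2] L2])
   then show ?thesis using \<beta>(1) by blast
  qed
  note approx = this
  show "ennreal (max 0 (u x - s - 2 * \<epsilon>) powr p) <= ennreal C1 * (\<integral>\<^sup>+y\<in>{y\<in>D. s + \<epsilon> <= u y}. ennreal (neg_part (apply_op D (a, b) u y) powr p) \<partial>lebesgue)"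
  proof -
   have AC: "A \<subseteq> C" using r by (auto simp: C_def)
   have AS: "A \<subseteq> S" using r by (auto simp: S_def)
   have vm: "(%x. \<chi> i. f1 i x) \<in> bm borel" by (rule borel_measurable_vec_lambda[OF f1m])
   have Fm: "F b \<in> bm borel" if bm: "b \<in> bm borel" for b
   proof -
    have aij: "(%x. a x $ i $ j) \<in> bm borel" for i j
     by (rule measurable_compose[OF am]) (intro bm_contI continuous_intros)
    have "(%x. (\<Sum>i\<in>UNIV. \<Sum>j\<in>UNIV. a x $ i $ j * f2 i j x) / 2 + (\<chi> i. f1 i x) \<bullet> b x) \<in> bm borel"
     by (intro borel_measurable_add borel_measurable_divide borel_measurable_sum borel_measurable_times borel_measurable_inner aij f2m vm bm) simp
    then show ?thesis unfolding F_def gen_op_def[abs_def] vec_lambda_beta .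
   qed
   have F_eq: "AE y in lborel. y \<in> A \<longrightarrow> F b y = apply_op D (a, b) u y"
   proof -
    have "AE y in lborel. \<forall>i\<in>UNIV. y \<in> C \<longrightarrow> f1 i y = weak_D D i u y"
     by (rule AE_finite_allI[OF finite]) (use f1 in \<open>auto simp: borel_rep_def\<close>)
    moreover have "AE y in lborel. \<forall>k\<in>UNIV. y \<in> C \<longrightarrow> f2 (fst k) (snd k) y = weak_D D (fst k) (weak_D D (snd k) u) y"
     by (rule AE_finite_allI[OF finite]) (use f2 in \<open>auto simp: borel_rep_def\<close>)
    ultimately show ?thesis
    proof eventually_elim
     case (elim y)
     then show ?case using AC by (auto simp: F_def gen_op_def apply_op_def inner_vec_def mult.commute)
    qed
   qed
   define I where "I = (nnS A (%y. ennreal (\<bar>max 0 (- F b y)\<bar> powr p)))"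
   have I_eq: "I = (\<integral>\<^sup>+y\<in>{y\<in>D. s + \<epsilon> <= u y}. ennreal (neg_part (apply_op D (a, b) u y) powr p) \<partial>lebesgue)"
   proof -
    note [measurable] = Fm[OF bm] As
    have "I = (\<integral>\<^sup>+y\<in>A. ennreal (\<bar>max 0 (- F b y)\<bar> powr p) \<partial>lebesgue)"
     unfolding I_def by (rule nn_integral_lebesgue_eq[symmetric]) simp
    also have "\<dots> = (\<integral>\<^sup>+y\<in>A. ennreal (neg_part (apply_op D (a, b) u y) powr p) \<partial>lebesgue)"
    proof (rule nn_integral_cong_AE)
     have "AE y in lebesgue. y \<in> A \<longrightarrow> F b y = apply_op D (a, b) u y" using F_eq by (rule AE_completion)
     then show "AE y in lebesgue. ennreal (\<bar>max 0 (- F b y)\<bar> powr p) * indicator A y = ennreal (neg_part (apply_op D (a, b) u y) powr p) * indicator A y"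
     proof eventually_elim
      case (elim y)
      have "\<bar>max 0 (- t)\<bar> = neg_part t" for t :: real by (simp add: neg_part_def)
      moreover have "0 <= neg_part t" for t by (simp add: neg_part_def)
      ultimately show ?case using elim by (simp split: split_indicator)
     qed
    qed
    finally show ?thesis unfolding A_def .
   qed
   \<comment> \<open>The level is s + 2 * \<epsilon>: near A but outside it u < s + \<epsilon>, and
     mollification changes u by at most \<epsilon> for large n, so v <= 0 there.\<close>
   define v where "v = (%n x. conv (mollifier (e n)) f0 x - s - 2 * \<epsilon>)"
   have unif: "EV n. \<forall>x\<in>S. \<bar>conv (mollifier (e n)) f0 x - u x\<bar> <= \<eta>" if "0 < \<eta>" for \<eta>
    unfolding e_def f0_def by (rule mollify_uniform[OF cC(1) uC r bS that])
   have xA: "x \<in> A" using x by (simp add: A_def)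
   have xS: "x \<in> S" using xA AS by blast
   have "(%n. v n x) ---> u x - s - 2 * \<epsilon>"
   proof -
    have "(%n. conv (mollifier (e n)) f0 x) ---> u x"
    proof (rule LIMSEQ_I)
     fix \<eta> :: real assume "0 < \<eta>"
     then have "EV n. \<forall>x\<in>S. \<bar>conv (mollifier (e n)) f0 x - u x\<bar> <= \<eta> / 2" by (intro unif) simp
     then have "EV n. norm (conv (mollifier (e n)) f0 x - u x) < \<eta>"
     proof eventually_elim
      case (elim n)
      then have "\<bar>conv (mollifier (e n)) f0 x - u x\<bar> <= \<eta> / 2" using xS by blast
      then show ?case using \<open>0 < \<eta>\<close> by simp
     qed
     then show "\<exists>N. \<forall>n\<ge>N. norm (conv (mollifier (e n)) f0 x - u x) < \<eta>" by (simp add: eventually_sequentially)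
    qed
    then show ?thesis unfolding v_def by (intro tendsto_intros)
   qed
   then have lim1: "(%n. ennreal (max 0 (v n x) powr p)) ---> ennreal (max 0 (u x - s - 2 * \<epsilon>) powr p)"
    using p0 by (intro tendsto_ennrealI tendsto_powr' tendsto_max tendsto_const) auto
   define J where "J = (%m. (nnS A (%y. ennreal (\<bar>max 0 (- F (bt m) y)\<bar> powr p))))"
   have mJ: "ennreal (max 0 (u x - s - 2 * \<epsilon>) powr p) <= ennreal C0 * (ennreal (2 powr p) * J m)" for m
   proof -
    obtain \<beta> where \<beta>: "\<forall>n. smooth_drift K (\<beta> n)" and LF: "Lnull p A (%n x. gen_op (\<alpha> n) (\<beta> n) (G n) (H n) x - F (bt m) x)"
     using approx by blast
    define E where "E = (%n. (nnS A (%y. ennreal (\<bar>gen_op (\<alpha> n) (\<beta> n) (G n) (H n) y - F (bt m) y\<bar> powr p))))"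
    have E0: "E ---> 0" using LF by (simp add: Lnull_def E_def)
    have est: "EV n. ennreal (max 0 (v n x) powr p) <= ennreal C0 * (ennreal (2 powr p) * (J m + E n))"
     using unif[OF \<epsilon>]
    proof eventually_elim
     case (elim n)
     let ?L = "gen_op (\<alpha> n) (\<beta> n) (G n) (H n)"
     have "ennreal (max 0 (v n x) powr p) <= ennreal C0 * (nnS A (%y. ennreal (max 0 (- ?L y) powr p)))"
     \<comment> \<open>The open neighbourhood of A lies in S, where the uniform estimate for the
       mollification is available.\<close>
     proof (rule max[where U="{x. infdist x A < r}"], intro conjI allI ballI)
      show "(v n has_derivative (%h. G n y \<bullet> h)) (at y)" for y
       using has_derivative_diff[OF der(1)[of n y] has_derivative_const[of "s + 2 * \<epsilon>"]] by (simp add: v_def diff_diff_eq)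
      show "open {x. infdist x A < r}"
       by (intro open_Collect_less continuous_on_infdist continuous_on_id continuous_on_const)
      show "A \<subseteq> {x. infdist x A < r}" using r by auto
      show "v n y <= 0" if y: "y \<in> {x. infdist x A < r} - A" for y
      proof -
       have yS: "y \<in> S" using y by (simp add: S_def)
       then have "y \<in> D" using bS[of y] cC(2) r by (meson centre_in_cball less_imp_le subsetD)
       then have "u y < s + \<epsilon>" using y by (auto simp: A_def)
       moreover have "\<bar>conv (mollifier (e n)) f0 y - u y\<bar> <= \<epsilon>" using elim yS by blast
       ultimately show ?thesis unfolding v_def by linarith
      qed
      show "norm (y - z) <= \<rho>" if "y \<in> A" "z \<in> A" for y z
       using diameter_bounded_bound[OF D(2), of y z] that A(3) D(3) by (auto simp: dist_norm)
     qed (use der(2,3) \<alpha>(1,2) \<beta> A xA in simp_all)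
     also have "(nnS A (%y. ennreal (max 0 (- ?L y) powr p))) = (nnS A (%y. ennreal (\<bar>max 0 (- ?L y)\<bar> powr p)))" by simp
     also have "\<dots> <= ennreal (2 powr p) * (J m + E n)" unfolding J_def E_def
     proof (rule nn_integral_powr_sum_le)
      show "(%y. max 0 (- F (bt m) y)) \<in> bm borel" using Fm[OF btm] by measurable
      show "(%y. ?L y - F (bt m) y) \<in> bm borel" using LF by (simp add: Lnull_def)
      show "\<bar>max 0 (- ?L y)\<bar> <= \<bar>max 0 (- F (bt m) y)\<bar> + \<bar>?L y - F (bt m) y\<bar>" for y by linarith
     qed (rule As, rule p0)
     finally show ?case by (simp add: mult_left_mono)
    qed
    have "(%n. ennreal C0 * (ennreal (2 powr p) * (J m + E n))) ---> ennreal C0 * (ennreal (2 powr p) * (J m + 0))"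
     by (intro ennreal_tendsto_cmult tendsto_add tendsto_const E0) auto
    from tendsto_le[OF sequentially_bot this lim1 est] show ?thesis by simp
   qed
   \<comment> \<open>The error weight of the modified drift: 1 minus the factor \<theta> m where the
     drift is kept, and 1 where it was dropped. It tends to 0 pointwise.\<close>
   define h where "h = (%m x. if norm (b x) <= real (Suc m) \<and> norm x <= real (Suc m) then 1 / real (Suc m) else 1)"
   define X where "X = (%x. \<Sum>i\<in>UNIV. \<bar>\<Sum>j\<in>UNIV. \<bar>f2 i j x\<bar>\<bar>)"
   have Xm: "X \<in> bm borel" unfolding X_def using f2m by measurable
   have X0: "0 <= X y" for y unfolding X_def by (intro sum_nonneg) simp
   have Xfin: "(nnS A (%x. ennreal (\<bar>X x\<bar> powr p))) < \<infinity>"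
    unfolding X_def
   proof (rule Lp_sum_finite[OF finite _ _ As p0(1)])
    show "(%x. \<Sum>j\<in>UNIV. \<bar>f2 i j x\<bar>) \<in> bm borel" for i using f2m by measurable
    show "(nnS A (%x. ennreal (\<bar>\<Sum>j\<in>UNIV. \<bar>f2 i j x\<bar>\<bar> powr p))) < \<infinity>" for i
     by (rule Lp_sum_finite[OF finite f2m fin[OF f2] As p0(1)])
   qed
   have hm: "h m \<in> bm borel" for m using bm unfolding h_def by measurable
   have "Lnull p A (%m x. h m x * (X x / \<delta>))"
   proof -
    have "Lnull p A (%m x. h m x * X x)"
    proof (rule Lnull_dominated_convergence[OF As p0(1) hm Xm Xfin, where c=1])
     show "\<bar>h m y\<bar> <= 1" for m y by (simp add: h_def)
     show "AE y in lborel. (%m. h m y) ---> 0"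
     proof (rule AE_I2)
      fix y
      obtain m0 :: nat where m0: "max (norm (b y)) (norm y) <= real m0" using real_arch_simple by blast
      have "EV m. 1 / real (Suc m) = h m y"
       unfolding eventually_sequentially
      proof (intro exI[of _ m0] allI impI)
       fix m assume "m0 <= m"
       then have "norm (b y) <= real (Suc m)" "norm y <= real (Suc m)" using m0 by auto
       then show "1 / real (Suc m) = h m y" by (simp add: h_def)
      qed
      then show "(%m. h m y) ---> 0"
       by (rule Lim_transform_eventually[OF LIMSEQ_Suc[OF lim_1_over_n]])
     qed
    qed
    then show ?thesis
    proof (rule Lnull_dominated[OF _ As p0(1), where c="1 / \<delta>"])
     show "(%x. h m x * (X x / \<delta>)) \<in> bm borel" for m using hm Xm by measurable
     show "EV m. \<forall>x\<in>A. \<bar>h m x * (X x / \<delta>)\<bar> <= 1 / \<delta> * \<bar>h m x * X x\<bar>"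
      using \<delta>(1) by (intro always_eventually allI ballI) (simp add: abs_mult)
    qed
   qed
   then have Z0: "(%m. (nnS A (%y. ennreal (\<bar>h m y * (X y / \<delta>)\<bar> powr p)))) ---> 0" (is "?Z ---> 0") by (simp add: Lnull_def)
   have JZ: "J m <= ennreal (2 powr p) * (I + ?Z m)" for m
    unfolding J_def I_def
   proof (rule nn_integral_powr_sum_le[OF _ _ As p0(1)])
    show "(%y. max 0 (- F b y)) \<in> bm borel" using Fm[OF bm] by measurable
    show "(%y. h m y * (X y / \<delta>)) \<in> bm borel" using hm Xm by measurable
    fix y
    \<comment> \<open>The second order part. Where the drift is kept, the operator with drift
      \<open>bt m\<close> is \<theta> m times the full operator plus h m times P; where it was
      dropped, the operator is P alone. So the error involves second derivatives only, never the
      possibly non-integrable product of b with the gradient.\<close>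
    define P where "P = (\<Sum>i\<in>UNIV. \<Sum>j\<in>UNIV. a y $ i $ j * f2 i j y) / 2"
    have FP: "F b' y = P + (\<chi> i. f1 i y) \<bullet> b' y" for b' by (simp add: F_def gen_op_def P_def)
    have "\<bar>\<Sum>i\<in>UNIV. \<Sum>j\<in>UNIV. a y $ i $ j * f2 i j y\<bar> <= (\<Sum>i\<in>UNIV. \<Sum>j\<in>UNIV. 1 / \<delta> * \<bar>f2 i j y\<bar>)"
     by (intro order_trans[OF sum_abs] sum_mono) (simp only: abs_mult mult_right_mono[OF S_mat_entry_le[OF \<delta>(1) aS] abs_ge_zero])
    also have "\<dots> = X y / \<delta>" by (simp add: X_def sum_nonneg sum_divide_distrib)
    finally have PX: "\<bar>P\<bar> <= X y / \<delta>" by (rule order_trans[rotated]) (simp add: P_def)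
    show "\<bar>max 0 (- F (bt m) y)\<bar> <= \<bar>max 0 (- F b y)\<bar> + \<bar>h m y * (X y / \<delta>)\<bar>"
    proof (cases "norm (b y) <= real (Suc m) \<and> norm y <= real (Suc m)")
     case True
     then have "F (bt m) y = \<theta> m * F b y + h m y * P" by (simp add: FP bt_def h_def \<theta>_def algebra_simps)
     moreover have "- (\<theta> m * F b y) <= max 0 (- F b y)"
      using \<theta>[of m] mult_left_le_one_le[of "- F b y" "\<theta> m"] mult_nonneg_nonneg[of "\<theta> m" "F b y"] by (cases "0 <= F b y") auto
     moreover have "- (h m y * P) <= \<bar>h m y * (X y / \<delta>)\<bar>"
     proof -
      have "\<bar>h m y * P\<bar> <= \<bar>h m y\<bar> * (X y / \<delta>)" unfolding abs_mult by (intro mult_left_mono PX) simp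
      also have "\<dots> <= \<bar>h m y * (X y / \<delta>)\<bar>" unfolding abs_mult by (intro mult_left_mono abs_ge_self) simp
      finally show ?thesis by linarith
     qed
     ultimately show ?thesis by linarith
    next
     case False
     then have "bt m y = 0" "h m y = 1" by (simp_all only: bt_def h_def if_False)
     then have "F (bt m) y = P" "h m y * (X y / \<delta>) = X y / \<delta>" by (simp_all add: FP)
     then show ?thesis using PX by linarith
    qed
   qed
   have est: "EV m. ennreal (max 0 (u x - s - 2 * \<epsilon>) powr p) <= ennreal C0 * (ennreal (2 powr p) * (ennreal (2 powr p) * (I + ?Z m)))"
   proof (intro always_eventually allI)
    fix m
    show "ennreal (max 0 (u x - s - 2 * \<epsilon>) powr p) <= ennreal C0 * (ennreal (2 powr p) * (ennreal (2 powr p) * (I + ?Z m)))"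
     by (rule order_trans[OF mJ[of m]], rule mult_left_mono, rule mult_left_mono, rule JZ) simp_all
   qed
   have "(%m. ennreal C0 * (ennreal (2 powr p) * (ennreal (2 powr p) * (I + ?Z m)))) ---> ennreal C0 * (ennreal (2 powr p) * (ennreal (2 powr p) * (I + 0)))"
    by (intro ennreal_tendsto_cmult tendsto_add tendsto_const Z0) auto
   from tendsto_le[OF sequentially_bot this tendsto_const est]
   have "ennreal (max 0 (u x - s - 2 * \<epsilon>) powr p) <= ennreal C0 * (ennreal (2 powr p) * (ennreal (2 powr p) * I))" by simp
   also have "\<dots> = ennreal C1 * I" using C0 by (simp add: C1_def ennreal_mult' mult.assoc)
   finally show ?thesis unfolding I_eq .
  qed
 qed
qed

section \<open>Larger exponents and the zeroth order coefficient\<close>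

lemma powr_young:
 fixes h l p q :: real
 assumes "0 <= h" "0 < l" "0 < q" "q <= p"
 shows "h powr q <= l powr q + l powr (q - p) * h powr p"
proof (cases "h <= l")
 case True
 then have "h powr q <= l powr q" using assms by (intro powr_mono2) auto
 then show ?thesis by (simp add: add_increasing2)
next
 case False
 then have h: "l < h" "0 < h" using assms by auto
 have "h powr q = h powr (q - p) * h powr p" by (simp add: powr_add[symmetric])
 also have "\<dots> <= l powr (q - p) * h powr p"
  using assms h by (intro mult_right_mono powr_mono2') auto
 finally show ?thesis by (simp add: add_increasing)
qed

text \<open>On a compact set |f|^q <= 1 + |f|^p, and the volume is finite.\<close>

lemma Lp_loc_mono:
 fixes D :: "(real^'d) set"
 assumes "0 < q" "q <= p"
 shows "Lp_loc p D \<subseteq> Lp_loc q D"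
proof
 fix f assume f: "f \<in> Lp_loc p D"
 have "Lp_norm q C f < \<infinity>" if C: "compact C" "C \<subseteq> D" for C
 proof -
  let ?J = "%q. \<integral>\<^sup>+x\<in>C. ennreal (norm (f x) powr q) \<partial>lebesgue"
  have fin: "?J p < \<infinity>" using f C by (auto simp: Lp_loc_def Lp_norm_def Let_def less_top split: if_splits)
  have Cl: "C \<in> sets lborel" using compact_imp_closed[OF C(1)] by simp
  then have Cl': "C \<in> sets lebesgue" by (rule sets_completionI_sets)
  have fC: "f \<in> bm (lebesgue_on C)"
   using f C(2) by (auto simp: Lp_loc_def intro: measurable_restrict_mono)
  then have "(%x. indicator C x *\<^sub>R f x) \<in> bm lebesgue"
   using Cl' by (subst (asm) borel_measurable_restrict_space_iff) auto
  then have m: "(%x. ennreal (norm (indicator C x *\<^sub>R f x) powr p)) \<in> bm lebesgue" by measurable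
  have "?J q <= (\<integral>\<^sup>+x. indicator C x + ennreal (norm (indicator C x *\<^sub>R f x) powr p) \<partial>lebesgue)"
  proof (rule nn_integral_mono)
   fix x
   show "ennreal (norm (f x) powr q) * indicator C x <= indicator C x + ennreal (norm (indicator C x *\<^sub>R f x) powr p)"
   proof (cases "x \<in> C")
    case True
    have "norm (f x) powr q <= 1 + norm (f x) powr p"
     using powr_young[of "norm (f x)" 1 q p] assms by simp
    then have "ennreal (norm (f x) powr q) <= ennreal (1 + norm (f x) powr p)" by (rule ennreal_leI)
    also have "\<dots> = 1 + ennreal (norm (f x) powr p)" by (subst ennreal_plus) auto
    finally show ?thesis using True by simp
   qed simp
  qed
  also have "\<dots> = emeasure lebesgue C + (\<integral>\<^sup>+x. ennreal (norm (indicator C x *\<^sub>R f x) powr p) \<partial>lebesgue)"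
   using Cl' m by (simp add: nn_integral_add)
  also have "(\<integral>\<^sup>+x. ennreal (norm (indicator C x *\<^sub>R f x) powr p) \<partial>lebesgue) = ?J p"
   using assms by (intro nn_integral_cong) (simp split: split_indicator)
  also have "emeasure lebesgue C + ?J p < \<infinity>"
   using fin emeasure_bounded_finite[OF compact_imp_bounded[OF C(1)]] Cl by (simp add: emeasure_completion)
  finally show ?thesis by (auto simp: Lp_norm_def Let_def)
 qed
 then show "f \<in> Lp_loc q D" using f by (simp add: Lp_loc_def)
qed

lemma W2_loc_mono:
 assumes "0 < q" "q <= p"
 shows "W2_loc p D \<subseteq> W2_loc q D"
 using Lp_loc_mono[OF assms, of D] unfolding W2_loc_def by blast

lemma apply_op_measurable:
 fixes D :: "(real^'d) set"
 assumes u: "u \<in> W2_loc p D" and a: "fst L \<in> bm borel" and b: "snd L \<in> bm borel"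
 shows "apply_op D L u \<in> bm (lebesgue_on D)"
proof -
 have r: "f \<in> bm (lebesgue_on D)" if "f \<in> bm borel" for f :: "real^'d => real"
  by (rule measurable_restrict_space1[OF measurable_completion]) (use that in simp)
 have aij: "(%x. fst L x $ i $ j) \<in> bm (lebesgue_on D)" for i j
  by (rule r, rule measurable_compose[OF a]) (intro bm_contI continuous_intros)
 have bi: "(%x. snd L x $ i) \<in> bm (lebesgue_on D)" for i
  by (rule r, rule measurable_compose[OF b]) (intro bm_contI continuous_intros)
 have w1: "weak_D D i u \<in> bm (lebesgue_on D)" and w2: "weak_D D i (weak_D D j u) \<in> bm (lebesgue_on D)" for i j
  using u by (auto simp: W2_loc_def Lp_loc_def)
 show ?thesis unfolding apply_op_def[abs_def]
  by (intro borel_measurable_add borel_measurable_times borel_measurable_sum borel_measurable_const aij bi w1 w2)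
qed

text \<open>\<open>powr_young\<close> with the norm bound l itself as threshold: both terms are then
  multiples of l^q, as Hoelder's inequality would give.\<close>

lemma Lp_integral_bound:
 fixes h :: "real^'d => real"
 assumes D: "D \<in> sets lebesgue" and h: "h \<in> bm (lebesgue_on D)" "\<And>x. 0 <= h x" and q: "0 < q" "q <= p" and l: "0 < l"
  and n: "Lp_norm p D h <= ennreal l" and V: "0 <= V" "emeasure lebesgue D <= ennreal V"
 shows "(\<integral>\<^sup>+x\<in>D. ennreal (h x powr q) \<partial>lebesgue) <= ennreal ((V + 1) * l powr q)"
proof -
 have J: "(\<integral>\<^sup>+x\<in>D. ennreal (h x powr p) \<partial>lebesgue) <= ennreal (l powr p)"
  using n Lp_norm_le_iff[of p l D h] q l h(2) by simp
 have hm: "(%x. indicator D x *\<^sub>R h x) \<in> bm lebesgue"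
  using h(1) D by (subst (asm) borel_measurable_restrict_space_iff) auto
 then have m: "(%x. ennreal ((indicator D x *\<^sub>R h x) powr p)) \<in> bm lebesgue" by measurable
 have "(\<integral>\<^sup>+x\<in>D. ennreal (h x powr q) \<partial>lebesgue) <= (\<integral>\<^sup>+x. ennreal (l powr q) * indicator D x + ennreal (l powr (q - p)) * ennreal ((indicator D x *\<^sub>R h x) powr p) \<partial>lebesgue)"
 proof (rule nn_integral_mono)
  fix x
  show "ennreal (h x powr q) * indicator D x <= ennreal (l powr q) * indicator D x + ennreal (l powr (q - p)) * ennreal ((indicator D x *\<^sub>R h x) powr p)"
  proof (cases "x \<in> D")
   case True
   have "ennreal (h x powr q) <= ennreal (l powr q + l powr (q - p) * h x powr p)"
    using powr_young[OF h(2)[of x] l q] by (rule ennreal_leI)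
   also have "\<dots> = ennreal (l powr q) + ennreal (l powr (q - p)) * ennreal (h x powr p)"
    by (simp add: ennreal_mult')
   finally show ?thesis using True by simp
  qed simp
 qed
 also have "\<dots> = ennreal (l powr q) * emeasure lebesgue D + ennreal (l powr (q - p)) * (\<integral>\<^sup>+x. ennreal ((indicator D x *\<^sub>R h x) powr p) \<partial>lebesgue)"
  using D m by (simp add: nn_integral_add nn_integral_cmult nn_integral_cmult_indicator)
 also have "(\<integral>\<^sup>+x. ennreal ((indicator D x *\<^sub>R h x) powr p) \<partial>lebesgue) = (\<integral>\<^sup>+x\<in>D. ennreal (h x powr p) \<partial>lebesgue)"
  using q by (intro nn_integral_cong) (simp split: split_indicator)
 also have "ennreal (l powr q) * emeasure lebesgue D + ennreal (l powr (q - p)) * (\<integral>\<^sup>+x\<in>D. ennreal (h x powr p) \<partial>lebesgue)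
  <= ennreal (l powr q) * ennreal V + ennreal (l powr (q - p)) * ennreal (l powr p)"
  by (intro add_mono mult_left_mono V J) auto
 also have "\<dots> = ennreal (l powr q * V + l powr (q - p) * l powr p)"
  using V by (simp add: ennreal_mult'[symmetric] ennreal_plus[symmetric] del: ennreal_plus)
 also have "l powr q * V + l powr (q - p) * l powr p = (V + 1) * l powr q"
  by (simp add: powr_add[symmetric] algebra_simps)
 finally show ?thesis .
qed

lemma diameter_open_pos:
 fixes D :: "(real^'d) set"
 assumes "open D" "D \<noteq> {}" "bounded D"
 shows "0 < diameter D"
proof -
 obtain x e where e: "0 < e" "cball x e \<subseteq> D"
  using assms(1,2) open_contains_cball by blast
 have "x + e *\<^sub>R axis i 1 \<in> cball x e" for i using e by (simp add: dist_norm)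
 then have "dist x (x + e *\<^sub>R axis undefined 1) <= diameter D"
  using e by (intro diameter_bounded_bound[OF assms(3)]) (auto intro: subsetD[OF e(2)])
 then show ?thesis using e by (simp add: dist_norm)
qed

lemma emeasure_le_diameter:
 fixes D :: "(real^'d) set"
 assumes "open D" "bounded D" "diameter D = \<rho>" "x \<in> D"
 shows "emeasure lebesgue D <= ennreal (measure lborel (cball (0 :: real^'d) \<rho>))"
proof -
 have "D \<subseteq> cball x \<rho>" using diameter_bounded_bound[OF assms(2,4)] assms(3) by auto
 then have "emeasure lborel D <= emeasure lborel (cball x \<rho>)" using assms(1) by (intro emeasure_mono) auto
 also have "\<dots> = ennreal (measure lborel (cball x \<rho>))"
  using emeasure_lborel_cball_finite[of x \<rho>] by (intro emeasure_eq_ennreal_measure) simp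
 also have "measure lborel (cball x \<rho>) = measure lborel (cball (0 :: real^'d) \<rho>)"
 proof -
  have "0 <= \<rho>" using diameter_ge_0[OF assms(2)] assms(3) by simp
  then show ?thesis by (simp add: content_cball)
 qed
 finally show ?thesis using assms(1) by (simp add: emeasure_completion)
qed

theorem corollary3p1:
  fixes \<delta> K d0 p \<rho> :: real
  assumes "2 \<le> CARD('d::finite)"
    and "0 < \<delta>" and "\<delta> < 1"
    and "0 \<le> K"
    and "is_d0 TYPE('d) \<delta> K d0"
    and "d0 \<le> p"
  shows "\<exists>N::real. 0 \<le> N \<and>
    (\<forall>(D :: (real^'d) set) u c L.
       open D \<and> connected D \<and> D \<noteq> {} \<and> bounded D \<and> diameter D = \<rho> \<and>
       u \<in> W2_loc p D \<and> continuous_on (closure D) u \<and>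
       c \<in> borel_measurable (lebesgue_on D) \<and> (\<forall>x\<in>D. 0 \<le> c x) \<and>
       L \<in> op_class \<delta> K \<longrightarrow>
       (\<forall>x\<in>D. ereal (u x) \<le>
          ereal N * enn2ereal (Lp_norm p D (\<lambda>y. neg_part (apply_op D L u y - c y * u y)))
          + ereal (SUP y\<in>frontier D. pos_part (u y))))"
proof (cases "0 < \<rho>")
 \<comment> \<open>A nonempty bounded open set has positive diameter, so no domain is left.\<close>
 case False
 then show ?thesis using diameter_open_pos by (intro exI[of _ 0]) auto
next
 case True
 have d0: "1 < d0" using assms(1,5) by (auto simp: is_d0_def)
 obtain C where C: "0 <= C" and interior: "\<And>(D :: (real^'d) set) u a b s \<epsilon> x. open D \<and> bounded D \<and> diameter D = \<rho> \<and> u \<in> W2_loc d0 D \<and> continuous_on (closure D) u \<and>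
  (a, b) \<in> op_class \<delta> K \<and> (\<forall>y\<in>frontier D. u y <= s) \<and> 0 < \<epsilon> \<and> x \<in> D \<and> s + \<epsilon> <= u x ==>
  ennreal (max 0 (u x - s - 2 * \<epsilon>) powr d0) <= ennreal C * (\<integral>\<^sup>+y\<in>{y\<in>D. s + \<epsilon> <= u y}. ennreal (neg_part (apply_op D (a, b) u y) powr d0) \<partial>lebesgue)"
  using interior_estimate[OF assms(1-5) True] by blast
 define V where "V = measure lborel (cball (0 :: real^'d) \<rho>)"
 have V: "0 <= V" by (simp add: V_def)
 \<comment> \<open>The added 1 makes N positive: then N times an infinite norm is infinite, and
   division by N is possible.\<close>
 define N where "N = (C * (V + 1)) powr (1 / d0) + 1"
 have N: "0 < N" "(C * (V + 1)) powr (1 / d0) <= N" by (auto simp: N_def add_nonneg_pos)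
 show ?thesis
 proof (intro exI[of _ N] conjI allI impI ballI)
  show "0 <= N" using N by simp
  fix D :: "(real^'d) set" and u c :: "real^'d => real" and L :: "(real^'d => real^'d^'d) \<times> (real^'d => real^'d)" and x :: "real^'d"
  assume asm: "open D \<and> connected D \<and> D \<noteq> {} \<and> bounded D \<and> diameter D = \<rho> \<and>
   u \<in> W2_loc p D \<and> continuous_on (closure D) u \<and>
   c \<in> bm (lebesgue_on D) \<and> (\<forall>x\<in>D. 0 <= c x) \<and> L \<in> op_class \<delta> K" and x: "x \<in> D"
  then have D: "open D" "D \<noteq> {}" "bounded D" "diameter D = \<rho>" and u: "u \<in> W2_loc p D" "continuous_on (closure D) u"
   and c: "c \<in> bm (lebesgue_on D)" "\<And>x. x \<in> D ==> 0 <= c x" and L: "L \<in> op_class \<delta> K" by auto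
  obtain a b where ab: "L = (a, b)" by (cases L)
  define h where "h = (%y. neg_part (apply_op D L u y - c y * u y))"
  define s where "s = (SUP y\<in>frontier D. pos_part (u y))"
  have h0: "0 <= h y" for y by (simp add: h_def neg_part_def)
  have s: "pos_part (u y) <= s" if "y \<in> frontier D" for y
  proof -
   have "frontier D \<subseteq> closure D" by (simp add: frontier_def)
   then have "continuous_on (frontier D) (%y. pos_part (u y))" unfolding pos_part_def
    by (intro continuous_intros continuous_on_subset[OF u(2)]) auto
   then have "compact ((%y. pos_part (u y)) ` frontier D)"
    using compact_frontier_bounded[OF D(3)] by (intro compact_continuous_image)
   then show ?thesis unfolding s_def
    using that by (intro cSUP_upper bounded_imp_bdd_above compact_imp_bounded)
  qed
  have us: "\<forall>y\<in>frontier D. u y <= s"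
  proof
   fix y assume "y \<in> frontier D"
   moreover have "u y <= pos_part (u y)" by (simp add: pos_part_def)
   ultimately show "u y <= s" using s[of y] by linarith
  qed
  \<comment> \<open>A nonempty bounded set has a nonempty frontier, so the supremum is over a
    nonempty set and is nonnegative.\<close>
  have s0: "0 <= s"
  proof -
   have "D \<noteq> UNIV" using D(3) not_bounded_UNIV by blast
   then obtain y where "y \<in> frontier D" using D(2) frontier_eq_empty[of D] by blast
   moreover have "0 <= pos_part (u y)" by (simp add: pos_part_def)
   ultimately show ?thesis using s[of y] by linarith
  qed
  have Dl: "D \<in> sets lebesgue" using D(1) by simp
  have um: "u \<in> bm (lebesgue_on D)" using u(1) by (simp add: W2_loc_def Lp_loc_def)
  have hm: "h \<in> bm (lebesgue_on D)"
  proof -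
   have "apply_op D L u \<in> bm (lebesgue_on D)"
    by (rule apply_op_measurable[OF u(1)]) (use L in \<open>auto simp: ab op_class_def\<close>)
   then show ?thesis unfolding h_def neg_part_def using c(1) um by measurable
  qed
  \<comment> \<open>A strictly positive bound l is required, since it serves as the threshold in
    \<open>Lp_integral_bound\<close>; the norm itself may be 0.\<close>
  have main: "u x <= s + N * l" if l: "0 < l" "Lp_norm p D h <= ennreal l" for l
  proof (rule field_le_epsilon)
   fix \<eta> :: real assume \<eta>: "0 < \<eta>"
   define \<epsilon> where "\<epsilon> = \<eta> / 2"
   have \<epsilon>: "0 < \<epsilon>" using \<eta> by (simp add: \<epsilon>_def)
   have Nl: "0 <= N * l" using N l by simp
   show "u x <= s + N * l + \<eta>"
   proof (cases "s + \<epsilon> <= u x")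
    case False
    then show ?thesis using Nl \<eta> by (simp add: \<epsilon>_def)
   next
    case True
    have "ennreal (max 0 (u x - s - 2 * \<epsilon>) powr d0) <= ennreal C * (\<integral>\<^sup>+y\<in>{y\<in>D. s + \<epsilon> <= u y}. ennreal (neg_part (apply_op D (a, b) u y) powr d0) \<partial>lebesgue)"
    proof (intro interior conjI)
     show "u \<in> W2_loc d0 D" using W2_loc_mono[of d0 p D] d0 assms(6) u(1) by auto
     show "(a, b) \<in> op_class \<delta> K" using L ab by simp
    qed (fact D u us \<epsilon> x True)+
    also have "\<dots> <= ennreal C * (\<integral>\<^sup>+y\<in>D. ennreal (h y powr d0) \<partial>lebesgue)"
    proof (intro mult_left_mono nn_integral_mono)
     fix y
     show "ennreal (neg_part (apply_op D (a, b) u y) powr d0) * indicator {y\<in>D. s + \<epsilon> <= u y} y <= ennreal (h y powr d0) * indicator D y"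
     proof (cases "y \<in> D \<and> s + \<epsilon> <= u y")
      case True
      \<comment> \<open>On this set u >= s + \<epsilon> > 0, so c u >= 0 and subtracting it can only
        increase the negative part.\<close>
      then have "0 <= c y * u y" using c(2)[of y] s0 \<epsilon> by (intro mult_nonneg_nonneg) auto
      moreover have "neg_part t <= neg_part (t - e)" if "0 <= e" for t e
       using that unfolding neg_part_def by (simp add: abs_if)
      ultimately have "neg_part (apply_op D (a, b) u y) <= h y" unfolding h_def ab by blast
      then have "neg_part (apply_op D (a, b) u y) powr d0 <= h y powr d0"
       using d0 by (intro powr_mono2) (auto simp: neg_part_def)
      then show ?thesis using True by (simp add: ennreal_leI)
     qed auto
    qed simp
    also have "\<dots> <= ennreal C * ennreal ((V + 1) * l powr d0)"
    proof (intro mult_left_mono Lp_integral_bound[OF Dl hm h0 _ assms(6) l V])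
     show "emeasure lebesgue D <= ennreal V" unfolding V_def by (rule emeasure_le_diameter[OF D(1,3,4) x])
    qed (use d0 in auto)
    also have "\<dots> = ennreal (C * (V + 1) * l powr d0)" using C by (simp add: ennreal_mult'[symmetric] mult.assoc)
    finally have "max 0 (u x - s - 2 * \<epsilon>) powr d0 <= C * (V + 1) * l powr d0"
     using C V by (subst (asm) ennreal_le_iff) (auto intro!: mult_nonneg_nonneg)
    then have "(max 0 (u x - s - 2 * \<epsilon>) powr d0) powr (1 / d0) <= (C * (V + 1) * l powr d0) powr (1 / d0)"
     using d0 by (intro powr_mono2) auto
    also have "\<dots> = (C * (V + 1)) powr (1 / d0) * l" using d0 l by (simp add: powr_mult powr_powr)
    also have "\<dots> <= N * l" using N l by (intro mult_right_mono) auto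
    also have "(max 0 (u x - s - 2 * \<epsilon>) powr d0) powr (1 / d0) = max 0 (u x - s - 2 * \<epsilon>)"
     using d0 by (simp add: powr_powr)
    finally show ?thesis by (simp add: \<epsilon>_def)
   qed
  qed
  have "ereal (u x) <= ereal N * enn2ereal (Lp_norm p D h) + ereal s"
  proof (cases "Lp_norm p D h = \<infinity>")
   case True
   then show ?thesis using N(1) by simp
  next
   case False
   then obtain l where l: "Lp_norm p D h = ennreal l" "0 <= l" by (cases "Lp_norm p D h") auto
   have "u x <= s + N * l"
   proof (rule field_le_epsilon)
    fix \<eta> :: real assume \<eta>: "0 < \<eta>"
    \<comment> \<open>The norm is enlarged by \<eta> / N to make it positive; after multiplication
      by N this costs exactly \<eta>.\<close>
    have "u x <= s + N * (l + \<eta> / N)"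
     using l \<eta> N(1) by (intro main) (auto intro!: ennreal_leI add_nonneg_pos)
    then show "u x <= s + N * l + \<eta>" using N(1) by (simp add: distrib_left)
   qed
   then show ?thesis using l by (simp add: add.commute)
  qed
  then show "ereal (u x) <= ereal N * enn2ereal (Lp_norm p D (%y. neg_part (apply_op D L u y - c y * u y)))
     + ereal (SUP y\<in>frontier D. pos_part (u y))"
   unfolding h_def s_def .
 qed
qed

end
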